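(* There exists a deterministic algorithm in the CONGEST model (local wakeup model) that maintains a maximal independent set of a graph $G=(V,E)$, starting from the empty graph on $n$ vertices, under edge insertions and deletions, using $O(\log^2 n)$ amortized rounds and $O(m_{max}^{2/3}\log^2 n)$ amortized messages per update, where $m_{max}$ is the maximum number of edges present in the graph at any time during the update sequence.
   Context: A maximal independent set (MIS) of a graph is an independent set not contained in any larger independent set. In the CONGEST model computation proceeds in synchronous rounds in which each vertex may send an $O(\log n)$-bit message to each neighbor; vertices know their neighbors' IDs. Local wakeup model: the graph starts empty; after an update of edge $(u,v)$ only $u$ and $v$ wake up, and other vertices act only after receiving a message; messages are unicast. After each update the maintained set must be an MIS of the current graph. Amortized round (resp. message) complexity is the average, over a worst-case update sequence, of the number of rounds (resp. messages) per update. *)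

theory Defs
  imports Complex_Main
begin

section \<open>Dynamic graphs and maximal independent sets\<close>

text \<open>A vertex is identified with its ID. Graphs are simple and undirected on a fixed vertex set;
  the edge set consists of two-element sets of vertices.\<close>

type_synonym vertex = nat
type_synonym edges = "vertex set set"

definition nbrs :: "edges \<Rightarrow> vertex \<Rightarrow> vertex set" where
  "nbrs E v = {w. {v, w} \<in> E}"

definition independent :: "edges \<Rightarrow> vertex set \<Rightarrow> bool" where
  "independent E S \<longleftrightarrow> (\<forall>u\<in>S. \<forall>v\<in>S. {u, v} \<notin> E)"

definition is_MIS :: "vertex set \<Rightarrow> edges \<Rightarrow> vertex set \<Rightarrow> bool" where
  "is_MIS V E S \<longleftrightarrow> S \<subseteq> V \<and> independent E S \<and>
     \<not> (\<exists>T. T \<subseteq> V \<and> independent E T \<and> S \<subset> T)"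

datatype edge_update = Insert vertex vertex | Delete vertex vertex

fun endpoints :: "edge_update \<Rightarrow> vertex set" where
  "endpoints (Insert u v) = {u, v}"
| "endpoints (Delete u v) = {u, v}"

fun apply_update :: "edge_update \<Rightarrow> edges \<Rightarrow> edges" where
  "apply_update (Insert u v) E = insert {u, v} E"
| "apply_update (Delete u v) E = E - {{u, v}}"

fun valid_update :: "vertex set \<Rightarrow> edges \<Rightarrow> edge_update \<Rightarrow> bool" where
  "valid_update V E (Insert u v) \<longleftrightarrow> u \<in> V \<and> v \<in> V \<and> u \<noteq> v \<and> {u, v} \<notin> E"
| "valid_update V E (Delete u v) \<longleftrightarrow> {u, v} \<in> E"

definition graph_after :: "edge_update list \<Rightarrow> nat \<Rightarrow> edges" where
  "graph_after us i = fold apply_update (take i us) {}"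

definition valid_updates :: "vertex set \<Rightarrow> edge_update list \<Rightarrow> bool" where
  "valid_updates V us \<longleftrightarrow> (\<forall>i<length us. valid_update V (graph_after us i) (us ! i))"

definition max_edges :: "edge_update list \<Rightarrow> nat" where
  "max_edges us = Max ((\<lambda>i. card (graph_after us i)) ` {..length us})"

section \<open>Deterministic algorithms in the CONGEST model with local wakeup\<close>

text \<open>Messages are bit strings. An outbox assigns to each potential receiver at most one message
  (unicast: different neighbours may get different messages); an inbox does so for each potential
  sender. The local memory of a vertex is unbounded; since everything a vertex ever observes is
  finite data, coding its memory by a natural number is no restriction.\<close>

type_synonym message = "bool list"
type_synonym mailbox = "vertex \<Rightarrow> message option"
type_synonym memory = nat

datatype local_event = Gained vertex | Lost vertex

fun event_at :: "vertex \<Rightarrow> edge_update \<Rightarrow> local_event" where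
  "event_at w (Insert u v) = Gained (if w = u then v else u)"
| "event_at w (Delete u v) = Lost (if w = u then v else u)"

text \<open>The result of one local step: the new memory, the outbox, and whether the vertex stays awake
  for the next round even if it receives no message.\<close>

type_synonym action = "memory \<times> mailbox \<times> bool"

text \<open>The first two arguments of the first three fields are the number of vertices and the vertex's
  own ID; the set of IDs passed to a step contains the current neighbours. An endpoint of the updated
  edge takes the step \<open>on_update\<close> in the first round after the update, when no messages are in
  transit; all other steps are \<open>on_round\<close>, which also gets the messages sent to the vertex in the
  previous round.\<close>

record algorithm =
  start_memory :: "nat \<Rightarrow> vertex \<Rightarrow> memory"
  on_update :: "nat \<Rightarrow> vertex \<Rightarrow> vertex set \<Rightarrow> local_event \<Rightarrow> memory \<Rightarrow> action"
  on_round :: "nat \<Rightarrow> vertex \<Rightarrow> vertex set \<Rightarrow> mailbox \<Rightarrow> memory \<Rightarrow> action"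
  in_MIS :: "memory \<Rightarrow> bool"

text \<open>The global configuration at the end of a round; \<open>transit c u w\<close> is the message sent from \<open>u\<close>
  to \<open>w\<close> in that round.\<close>

record config =
  memories :: "vertex \<Rightarrow> memory"
  transit :: "vertex \<Rightarrow> mailbox"
  awake :: "vertex set"

text \<open>The vertices acting in the next round: those that stayed awake and those receiving a
  message. A sleeping vertex that receives nothing does nothing.\<close>

definition active :: "config \<Rightarrow> vertex set" where
  "active c = awake c \<union> {w. \<exists>u. transit c u w \<noteq> None}"

text \<open>One synchronous round on the graph \<open>E\<close> in which the vertices of \<open>W\<close> take the steps \<open>act\<close>.
  Only messages along edges of \<open>E\<close> are sent; other outbox entries are ignored.\<close>

definition perform ::
  "edges \<Rightarrow> vertex set \<Rightarrow> (vertex \<Rightarrow> action) \<Rightarrow> (vertex \<Rightarrow> memory) \<Rightarrow> config" where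
  "perform E W act \<sigma> =
    \<lparr>memories = (\<lambda>v. if v \<in> W then fst (act v) else \<sigma> v),
     transit = (\<lambda>u w. if u \<in> W \<and> w \<in> nbrs E u then fst (snd (act u)) w else None),
     awake = {v \<in> W. snd (snd (act v))}\<rparr>"

definition first_round ::
  "algorithm \<Rightarrow> nat \<Rightarrow> edges \<Rightarrow> edge_update \<Rightarrow> (vertex \<Rightarrow> memory) \<Rightarrow> config" where
  "first_round A n E x \<sigma> =
    perform E (endpoints x) (\<lambda>v. on_update A n v (nbrs E v) (event_at v x) (\<sigma> v)) \<sigma>"

definition next_round :: "algorithm \<Rightarrow> nat \<Rightarrow> edges \<Rightarrow> config \<Rightarrow> config" where
  "next_round A n E c =
    perform E (active c)
      (\<lambda>v. on_round A n v (nbrs E v) (\<lambda>u. transit c u v) (memories c v)) (memories c)"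

text \<open>Here \<open>E\<close> is the graph after the update \<open>x\<close>, and \<open>config_at A n E x \<sigma> k\<close> is the configuration
  at the end of round \<open>k + 1\<close> of the recovery from \<open>x\<close>. The recovery ends with the first round after
  which all vertices sleep and no message is in transit; the next update happens only then.\<close>

definition config_at ::
  "algorithm \<Rightarrow> nat \<Rightarrow> edges \<Rightarrow> edge_update \<Rightarrow> (vertex \<Rightarrow> memory) \<Rightarrow> nat \<Rightarrow> config" where
  "config_at A n E x \<sigma> k = (next_round A n E ^^ k) (first_round A n E x \<sigma>)"

definition recovers ::
  "algorithm \<Rightarrow> nat \<Rightarrow> edges \<Rightarrow> edge_update \<Rightarrow> (vertex \<Rightarrow> memory) \<Rightarrow> bool" where
  "recovers A n E x \<sigma> \<longleftrightarrow> (\<exists>k. active (config_at A n E x \<sigma> k) = {})"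

definition last_index ::
  "algorithm \<Rightarrow> nat \<Rightarrow> edges \<Rightarrow> edge_update \<Rightarrow> (vertex \<Rightarrow> memory) \<Rightarrow> nat" where
  "last_index A n E x \<sigma> = (LEAST k. active (config_at A n E x \<sigma> k) = {})"

definition rounds ::
  "algorithm \<Rightarrow> nat \<Rightarrow> edges \<Rightarrow> edge_update \<Rightarrow> (vertex \<Rightarrow> memory) \<Rightarrow> nat" where
  "rounds A n E x \<sigma> = Suc (last_index A n E x \<sigma>)"

definition messages ::
  "algorithm \<Rightarrow> nat \<Rightarrow> edges \<Rightarrow> edge_update \<Rightarrow> (vertex \<Rightarrow> memory) \<Rightarrow> nat" where
  "messages A n E x \<sigma> =
    (\<Sum>k\<le>last_index A n E x \<sigma>. card {(u, w). transit (config_at A n E x \<sigma> k) u w \<noteq> None})"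

section \<open>Executions over update sequences\<close>

primrec memories_after ::
  "algorithm \<Rightarrow> nat \<Rightarrow> edge_update list \<Rightarrow> nat \<Rightarrow> vertex \<Rightarrow> memory" where
  "memories_after A n us 0 = start_memory A n"
| "memories_after A n us (Suc i) =
    (let E = graph_after us (Suc i); x = us ! i; \<sigma> = memories_after A n us i
     in memories (config_at A n E x \<sigma> (last_index A n E x \<sigma>)))"

definition maintains_MIS :: "algorithm \<Rightarrow> nat \<Rightarrow> vertex set \<Rightarrow> edge_update list \<Rightarrow> bool" where
  "maintains_MIS A n V us \<longleftrightarrow>
    (\<forall>i<length us. recovers A n (graph_after us (Suc i)) (us ! i) (memories_after A n us i)) \<and>
    (\<forall>i\<le>length us. is_MIS V (graph_after us i) {v \<in> V. in_MIS A (memories_after A n us i v)})"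

definition message_size_bounded ::
  "algorithm \<Rightarrow> nat \<Rightarrow> edge_update list \<Rightarrow> real \<Rightarrow> bool" where
  "message_size_bounded A n us b \<longleftrightarrow>
    (\<forall>i<length us. \<forall>k u w msg.
       transit (config_at A n (graph_after us (Suc i)) (us ! i) (memories_after A n us i) k) u w
         = Some msg \<longrightarrow> real (length msg) \<le> b)"

definition amortized_rounds :: "algorithm \<Rightarrow> nat \<Rightarrow> edge_update list \<Rightarrow> real" where
  "amortized_rounds A n us =
    (\<Sum>i<length us. real (rounds A n (graph_after us (Suc i)) (us ! i) (memories_after A n us i)))
      / real (length us)"

definition amortized_messages :: "algorithm \<Rightarrow> nat \<Rightarrow> edge_update list \<Rightarrow> real" where
  "amortized_messages A n us =
    (\<Sum>i<length us. real (messages A n (graph_after us (Suc i)) (us ! i) (memories_after A n us i)))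
      / real (length us)"

end

theory Submission
  imports Defs "HOL-Library.Countable" "HOL-Library.Product_Plus"
begin

text \<open>Every vertex is light or heavy. Light vertices have degree \<open>O(m powr (2 / 3))\<close> and tell all neighbours about each
  change of their status, heavy vertices tell only heavy ones; the maintained set is an MIS of the
  light part together with an MIS of the heavy vertices that it leaves uncovered. An insertion makes
  both endpoints heavy. After a deletion at most one endpoint lacks a cover. The repair is run by a hub
  with a level \<open>K\<close>. If a vertex within distance two has a heavy neighbour of degree at most \<open>4 ^ K\<close>,
  or is light and uncovered, that vertex turns light and becomes a hub itself; if some vertex has more
  than \<open>2 ^ K\<close> heavy neighbours, or more than \<open>2 ^ K\<close> vertices are uncovered, the level is raised.
  Otherwise the ball of radius two contains only \<open>O(4 ^ K)\<close> relevant edges, and Luby's algorithm,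
  derandomised bit by bit with a pairwise independent hash family, covers the uncovered vertices in
  \<open>O(log n)\<close> phases of \<open>O(log n)\<close> rounds. Since light vertices never turn heavy except by an insertion,
  the number of hubs is \<open>O(1)\<close> per update on average, and the level stays below \<open>log (4 m) / 3 + 1\<close>.\<close>

text \<open>The vertices do not know the number of edges, so no fixed degree threshold can separate
  light from heavy. The level is raised only on evidence: \<open>2 ^ K\<close> heavy vertices of
  degree about \<open>4 ^ K\<close> certify that there are of order \<open>8 ^ K\<close> edges,
  while a hub at level \<open>K\<close> spends about \<open>4 ^ K\<close> messages on one broadcast.
  This balance is the origin of the exponent \<open>2 / 3\<close>. The obstacle is recursion: a
  vertex that turns light may eject heavy neighbours from the set, so that new damage arises while
  older hubs are still waiting. It is kept under control by confining all damage to the surroundings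
  of the hubs on the recursion stack; a hub that finds its own surroundings in order can then be
  removed without harm to the others. Costs are amortised with two potentials: \<open>Phi\<close>
  pays for the hubs, \<open>Psi\<close> for the occasional broadcasts by which heavy vertices
  publish their degrees. Level tests need degrees only up to a constant factor, so a published value
  may be off by a factor of two.\<close>

section \<open>Encodings\<close>

instance local_event :: countable by countable_datatype

fun bits :: "nat \<Rightarrow> bool list" where
  "bits k = (if k = 0 then [] else odd k # bits (k div 2))"

declare bits.simps [simp del]

text \<open>A prefix-free code: every binary digit is announced by \<open>True\<close>, and
  \<open>False\<close> marks the end. Numbers can thus be concatenated without separators at the
  price of doubling the length.\<close>

definition enc_nat :: "nat \<Rightarrow> bool list" where
  "enc_nat k = concat (map (\<lambda>b. [True, b]) (bits k)) @ [False]"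

definition enc_nats :: "nat list \<Rightarrow> bool list" where
  "enc_nats ks = concat (map enc_nat ks)"

lemma bits_inj: "bits k = bits l \<Longrightarrow> k = l"
proof (induction k arbitrary: l rule: less_induct)
  case (less k)
  show ?case
  proof (cases "k = 0 \<or> l = 0")
    case True
    then show ?thesis using less.prems by (auto simp: bits.simps[of k] bits.simps[of l] split: if_splits)
  next
    case False
    then have "odd k = odd l" "bits (k div 2) = bits (l div 2)"
      using less.prems by (auto simp: bits.simps[of k] bits.simps[of l])
    moreover have "k div 2 = l div 2" using less.IH[of "k div 2" "l div 2"] False calculation by auto
    ultimately show ?thesis
      by (metis dvd_mult_div_cancel odd_two_times_div_two_succ)
  qed
qed

lemma length_bits: "k < 2 ^ t \<Longrightarrow> length (bits k) \<le> t"
proof (induction t arbitrary: k)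
  case 0
  then show ?case by (simp add: bits.simps)
next
  case (Suc t)
  then have "length (bits (k div 2)) \<le> t" by auto
  then show ?case by (simp add: bits.simps[of k])
qed

lemma marked_inj:
  "concat (map (\<lambda>b. [True, b]) xs) @ False # r = concat (map (\<lambda>b. [True, b]) ys) @ False # s
    \<Longrightarrow> xs = ys \<and> r = s"
proof (induction xs arbitrary: ys)
  case Nil
  then show ?case by (cases ys) auto
next
  case (Cons x xs)
  then show ?case by (cases ys) auto
qed

lemma enc_nat_inj: "enc_nat k @ r = enc_nat l @ s \<Longrightarrow> k = l \<and> r = s"
  unfolding enc_nat_def using marked_inj[of "bits k" r "bits l" s] bits_inj by auto

lemma enc_nat_nonempty: "enc_nat k \<noteq> []"
  by (simp add: enc_nat_def)

lemma inj_enc_nats: "inj enc_nats"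
proof (rule injI)
  fix xs ys assume "enc_nats xs = enc_nats ys"
  then show "xs = ys"
  proof (induction xs arbitrary: ys)
    case Nil
    then show ?case by (cases ys) (auto simp: enc_nats_def enc_nat_nonempty)
  next
    case (Cons x xs)
    show ?case
    proof (cases ys)
      case Nil
      then show ?thesis using Cons.prems by (auto simp: enc_nats_def enc_nat_nonempty)
    next
      case (Cons y ys')
      then have "enc_nat x @ enc_nats xs = enc_nat y @ enc_nats ys'"
        using Cons.prems by (simp add: enc_nats_def)
      then show ?thesis using enc_nat_inj Cons.IH Cons by blast
    qed
  qed
qed

lemma length_enc_nats:
  assumes "\<And>k. k \<in> set ks \<Longrightarrow> k < 2 ^ t"
  shows "length (enc_nats ks) \<le> length ks * (2 * t + 1)"
  using assms
proof (induction ks)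
  case (Cons k ks)
  have "length (concat (map (\<lambda>b. [True, b]) xs)) = 2 * length xs" for xs
    by (induction xs) auto
  then have "length (enc_nat k) \<le> 2 * t + 1"
    using length_bits[of k t] Cons.prems by (simp add: enc_nat_def)
  moreover have "length (enc_nats ks) \<le> length ks * (2 * t + 1)" using Cons by auto
  ultimately show ?case by (simp add: enc_nats_def)
qed (simp add: enc_nats_def)

section \<open>Realising abstract automata\<close>

text \<open>The memory of a vertex is its finite history of observations, from which the abstract state
  is recomputed in every step; so abstract states may have any type.\<close>

type_synonym observation = "vertex list \<times> (local_event + (vertex \<times> message) list)"

text \<open>The assumption \<open>idle\<close> bridges two notions of a round: the model lets only
  active vertices act, whereas in \<open>a_next\<close> all vertices step simultaneously. For a
  sleeping vertex without mail the extra step is the identity.\<close>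

locale automaton =
  fixes ini :: "'s"
    and upd :: "nat \<Rightarrow> vertex \<Rightarrow> vertex set \<Rightarrow> local_event \<Rightarrow> 's \<Rightarrow> 's \<times> (vertex \<Rightarrow> 'm option)"
    and stp :: "nat \<Rightarrow> vertex \<Rightarrow> vertex set \<Rightarrow> (vertex \<Rightarrow> 'm option) \<Rightarrow> 's \<Rightarrow> 's \<times> (vertex \<Rightarrow> 'm option)"
    and awk :: "'s \<Rightarrow> bool"
    and outp :: "'s \<Rightarrow> bool"
    and enc :: "'m \<Rightarrow> bool list"
  assumes inj_enc: "inj enc"
    and idle: "\<not> awk s \<Longrightarrow> stp n v N (\<lambda>_. None) s = (s, \<lambda>_. None)"
begin

definition obs_step :: "nat \<Rightarrow> vertex \<Rightarrow> observation \<Rightarrow> 's \<Rightarrow> 's" where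
  "obs_step n v ob s = (case ob of
     (N, Inl ev) \<Rightarrow> fst (upd n v (set N) ev s)
   | (N, Inr bx) \<Rightarrow> fst (stp n v (set N) (\<lambda>u. map_option (inv enc) (map_of bx u)) s))"

definition state_of :: "memory \<Rightarrow> 's" where
  "state_of mm = (case from_nat mm :: nat \<times> vertex \<times> observation list of
     (n, v, h) \<Rightarrow> fold (obs_step n v) h ini)"

definition extend :: "memory \<Rightarrow> observation \<Rightarrow> memory" where
  "extend mm ob = (case from_nat mm :: nat \<times> vertex \<times> observation list of
     (n, v, h) \<Rightarrow> to_nat (n, v, h @ [ob]))"

text \<open>An inbox is a function and not a finite object. Since only neighbours can send,
  tabulating it on the sorted neighbours loses nothing.\<close>

definition box_list :: "vertex set \<Rightarrow> mailbox \<Rightarrow> (vertex \<times> message) list" where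
  "box_list N bx = map (\<lambda>u. (u, the (bx u))) (filter (\<lambda>u. bx u \<noteq> None) (sorted_list_of_set N))"

definition realise :: "memory \<Rightarrow> 's \<times> (vertex \<Rightarrow> 'm option) \<Rightarrow> action" where
  "realise mm r = (mm, (\<lambda>u. map_option enc (snd r u)), awk (fst r))"

definition alg :: algorithm where
  "alg = \<lparr>start_memory = (\<lambda>n v. to_nat (n, v, [] :: observation list)),
     on_update = (\<lambda>n v N ev mm. realise (extend mm (sorted_list_of_set N, Inl ev))
        (upd n v N ev (state_of mm))),
     on_round = (\<lambda>n v N bx mm. realise (extend mm (sorted_list_of_set N, Inr (box_list N bx)))
        (stp n v N (\<lambda>u. map_option (inv enc) (bx u)) (state_of mm))),
     in_MIS = (\<lambda>mm. outp (state_of mm))\<rparr>"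

text \<open>Besides the decoded state, the memory must still carry the parameters \<open>n\<close>
  and \<open>v\<close>, because replaying the history uses them.\<close>

definition codes :: "nat \<Rightarrow> (vertex \<Rightarrow> memory) \<Rightarrow> (vertex \<Rightarrow> 's) \<Rightarrow> bool" where
  "codes n ms \<sigma> \<longleftrightarrow> (\<forall>v. state_of (ms v) = \<sigma> v \<and>
     (\<exists>h. from_nat (ms v) = (n, v, h :: observation list)))"

definition a_first :: "nat \<Rightarrow> edges \<Rightarrow> edge_update \<Rightarrow> (vertex \<Rightarrow> 's) \<Rightarrow>
    (vertex \<Rightarrow> 's) \<times> (vertex \<Rightarrow> vertex \<Rightarrow> 'm option)" where
  "a_first n E x \<sigma> =
    ((\<lambda>v. if v \<in> endpoints x then fst (upd n v (nbrs E v) (event_at v x) (\<sigma> v)) else \<sigma> v),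
     (\<lambda>u w. if u \<in> endpoints x \<and> w \<in> nbrs E u
        then snd (upd n u (nbrs E u) (event_at u x) (\<sigma> u)) w else None))"

definition a_next :: "nat \<Rightarrow> edges \<Rightarrow> (vertex \<Rightarrow> 's) \<times> (vertex \<Rightarrow> vertex \<Rightarrow> 'm option) \<Rightarrow>
    (vertex \<Rightarrow> 's) \<times> (vertex \<Rightarrow> vertex \<Rightarrow> 'm option)" where
  "a_next n E c =
    ((\<lambda>v. fst (stp n v (nbrs E v) (\<lambda>u. snd c u v) (fst c v))),
     (\<lambda>u w. if w \<in> nbrs E u then snd (stp n u (nbrs E u) (\<lambda>x. snd c x u) (fst c u)) w else None))"

definition live :: "(vertex \<Rightarrow> 's) \<times> (vertex \<Rightarrow> vertex \<Rightarrow> 'm option) \<Rightarrow> bool" where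
  "live c \<longleftrightarrow> (\<exists>v. awk (fst c v)) \<or> (\<exists>u w. snd c u w \<noteq> None)"

definition represents where
  "represents n E cc c \<longleftrightarrow> codes n (memories cc) (fst c) \<and>
     (\<forall>u w. transit cc u w = map_option enc (snd c u w)) \<and>
     awake cc = {v. awk (fst c v)} \<and> (\<forall>u w. snd c u w \<noteq> None \<longrightarrow> w \<in> nbrs E u)"

lemma dec_enc [simp]: "inv enc (enc m) = m"
  using inj_enc by simp

lemma nbrs_sym: "w \<in> nbrs E u \<longleftrightarrow> u \<in> nbrs E w"
  by (simp add: nbrs_def insert_commute)

lemma map_of_box_list:
  assumes "finite N" "\<And>u. bx u \<noteq> None \<Longrightarrow> u \<in> N"
  shows "map_of (box_list N bx) = bx"
proof
  fix u
  have *: "map_of (map (\<lambda>u. (u, the (bx u))) (filter (\<lambda>u. bx u \<noteq> None) xs)) u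
      = (if u \<in> set xs then bx u else None)" for xs
    by (induction xs) auto
  show "map_of (box_list N bx) u = bx u"
    unfolding box_list_def * using assms(1) assms(2)[of u] by (cases "bx u") auto
qed

lemma codes_start: "codes n (start_memory alg n) (\<lambda>_. ini)"
  by (simp add: codes_def alg_def state_of_def)

text \<open>All vertices have to be asleep before the update: the first round sets awake flags at
  the endpoints only, so a flag left over elsewhere would be lost.\<close>

lemma first_represents:
  assumes "codes n ms \<sigma>" "\<And>v. finite (nbrs E v)" "\<And>v. \<not> awk (\<sigma> v)"
  shows "represents n E (first_round alg n E x ms) (a_first n E x \<sigma>)"
proof -
  have "state_of (extend (ms v) (sorted_list_of_set (nbrs E v), Inl (event_at v x)))
      = fst (upd n v (nbrs E v) (event_at v x) (\<sigma> v)) \<and>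
    (\<exists>h. from_nat (extend (ms v) (sorted_list_of_set (nbrs E v), Inl (event_at v x))) = (n, v, h :: observation list))" for v
  proof -
    obtain h where h: "from_nat (ms v) = (n, v, h :: observation list)" "state_of (ms v) = \<sigma> v"
      using assms(1) unfolding codes_def by meson
    then show ?thesis using assms(2)[of v]
      by (simp add: extend_def state_of_def obs_step_def)
  qed
  then show ?thesis using assms
    by (auto simp: represents_def codes_def first_round_def a_first_def perform_def alg_def realise_def)
qed

text \<open>Active vertices append the current observation to their history, and replaying it
  performs exactly the abstract step. Inactive ones keep their memory, which agrees with the
  abstract step by \<open>idle\<close>.\<close>

lemma next_represents:
  assumes r: "represents n E cc c" and fin: "\<And>v. finite (nbrs E v)"
  shows "represents n E (next_round alg n E cc) (a_next n E c)"
proof -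
  obtain \<sigma> tr where c: "c = (\<sigma>, tr)" by force
  have tr: "transit cc u w = map_option enc (tr u w)" and aw: "awake cc = {v. awk (\<sigma> v)}"
    and nb: "tr u w \<noteq> None \<Longrightarrow> w \<in> nbrs E u" and cd: "codes n (memories cc) \<sigma>" for u w
    using r by (auto simp: represents_def c)
  have box: "(\<lambda>u. map_option (inv enc) (transit cc u v)) = (\<lambda>u. tr u v)" for v
    by (rule ext) (simp add: tr option.map_comp comp_def option.map_ident)
  have act: "active cc = {v. awk (\<sigma> v) \<or> (\<exists>u. tr u v \<noteq> None)}"
    by (auto simp: active_def aw tr)
  have idl: "stp n v (nbrs E v) (\<lambda>u. tr u v) (\<sigma> v) = (\<sigma> v, \<lambda>_. None)" if "v \<notin> active cc" for v
  proof -
    have "(\<lambda>u. tr u v) = (\<lambda>_. None)" using that by (auto simp: act)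
    then show ?thesis using idle that by (simp add: act)
  qed
  have st: "state_of (memories cc v) = \<sigma> v" for v using cd by (simp add: codes_def)
  have ext: "state_of (extend (memories cc v) (sorted_list_of_set (nbrs E v), Inr (box_list (nbrs E v) (\<lambda>u. transit cc u v))))
      = fst (stp n v (nbrs E v) (\<lambda>u. tr u v) (\<sigma> v)) \<and>
    (\<exists>h. from_nat (extend (memories cc v) (sorted_list_of_set (nbrs E v), Inr (box_list (nbrs E v) (\<lambda>u. transit cc u v)))) = (n, v, h :: observation list))" for v
  proof -
    obtain h where h: "from_nat (memories cc v) = (n, v, h :: observation list)"
      using cd unfolding codes_def by meson
    have "map_of (box_list (nbrs E v) (\<lambda>u. transit cc u v)) = (\<lambda>u. transit cc u v)"
      by (rule map_of_box_list) (use fin nb nbrs_sym in \<open>auto simp: tr\<close>)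
    then show ?thesis using h st[of v] fin[of v]
      by (simp add: extend_def state_of_def obs_step_def box)
  qed
  have m: "codes n (memories (next_round alg n E cc)) (fst (a_next n E c))"
    unfolding codes_def
  proof
    fix v
    show "state_of (memories (next_round alg n E cc) v) = fst (a_next n E c) v \<and>
      (\<exists>h. from_nat (memories (next_round alg n E cc) v) = (n, v, h :: observation list))"
    proof (cases "v \<in> active cc")
      case True
      then show ?thesis using ext[of v]
        by (simp add: next_round_def perform_def alg_def realise_def a_next_def c st box)
    next
      case False
      then show ?thesis using idl[OF False] cd
        by (simp add: next_round_def perform_def a_next_def c codes_def)
    qed
  qed
  moreover have "transit (next_round alg n E cc) u w = map_option enc (snd (a_next n E c) u w)" for u w
    using idl[of u] by (simp add: next_round_def perform_def alg_def realise_def a_next_def c st box)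
  moreover have "awake (next_round alg n E cc) = {v. awk (fst (a_next n E c) v)}"
  proof -
    have "awk (\<sigma> v) \<Longrightarrow> v \<in> active cc" for v by (simp add: act)
    then show ?thesis
      using idl by (auto simp: next_round_def perform_def alg_def realise_def a_next_def c st box)
        (metis fst_conv)
  qed
  moreover have "snd (a_next n E c) u w \<noteq> None \<Longrightarrow> w \<in> nbrs E u" for u w
    by (auto simp: a_next_def split: if_splits)
  ultimately show ?thesis by (simp add: represents_def)
qed

lemma active_represents: "represents n E cc c \<Longrightarrow> (active cc = {}) = (\<not> live c)"
  by (auto simp: represents_def active_def live_def)

definition msgs :: "(vertex \<Rightarrow> 's) \<times> (vertex \<Rightarrow> vertex \<Rightarrow> 'm option) \<Rightarrow> nat" where
  "msgs c = card {(u, w). snd c u w \<noteq> None}"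

definition small :: "nat \<Rightarrow> (vertex \<Rightarrow> 's) \<times> (vertex \<Rightarrow> vertex \<Rightarrow> 'm option) \<Rightarrow> bool" where
  "small b c \<longleftrightarrow> (\<forall>u w m. snd c u w = Some m \<longrightarrow> length (enc m) \<le> b)"

text \<open>In \<open>reach b n E c d r m\<close> the configuration \<open>d\<close> is reached from \<open>c\<close> in \<open>r\<close> rounds in which at
  most \<open>m\<close> messages, each of at most \<open>b\<close> bits, are sent. Nothing is claimed about the messages in
  transit in \<open>c\<close>.\<close>

inductive reach :: "nat \<Rightarrow> nat \<Rightarrow> edges \<Rightarrow> (vertex \<Rightarrow> 's) \<times> (vertex \<Rightarrow> vertex \<Rightarrow> 'm option) \<Rightarrow>
    (vertex \<Rightarrow> 's) \<times> (vertex \<Rightarrow> vertex \<Rightarrow> 'm option) \<Rightarrow> nat \<Rightarrow> nat \<Rightarrow> bool" for b n E c where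
  reach_refl: "reach b n E c c 0 m"
| reach_step: "reach b n E c d r m \<Longrightarrow> live d \<Longrightarrow> a_next n E d = d' \<Longrightarrow> small b d' \<Longrightarrow> msgs d' \<le> k \<Longrightarrow>
    reach b n E c d' (Suc r) (m + k)"

text \<open>The rule \<open>reach_refl\<close> admits any message bound. If the second run is empty,
  its bound is added to that of the last round of the first run.\<close>

lemma reach_trans:
  assumes "reach b n E d e r' m'" "reach b n E c d r m"
  shows "reach b n E c e (r + r') (m + m')"
  using assms
proof (induction rule: reach.induct)
  case (reach_refl m')
  from reach_refl show ?case
  proof (cases rule: reach.cases)
    case reach_refl
    then show ?thesis using reach.reach_refl by simp
  next
    case (reach_step d r m k)
    then show ?thesis using reach.reach_step[of b n E c d r m _ "k + m'"]
      by (simp add: add.assoc)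
  qed
next
  case (reach_step d r m d' k)
  then show ?case using reach.reach_step[OF reach_step.IH, of d' k] by (simp add: add.assoc)
qed

lemma reach_mono:
  assumes "reach b n E c d r m" "m \<le> m'"
  shows "reach b n E c d r m'"
  using reach_trans[OF reach_refl[of b n E d "m' - m"] assms(1)] assms(2) by simp

lemma reach_iterate:
  assumes "reach b n E c d r m"
  shows "d = (a_next n E ^^ r) c \<and> (\<forall>i<r. live ((a_next n E ^^ i) c)) \<and>
    (\<forall>i\<in>{1..r}. small b ((a_next n E ^^ i) c)) \<and> (\<Sum>i\<in>{1..r}. msgs ((a_next n E ^^ i) c)) \<le> m"
  using assms
proof induction
  case (reach_step d r m d' k)
  have s: "{1..Suc r} = insert (Suc r) {1..r}" by auto
  have d': "d' = (a_next n E ^^ Suc r) c" using reach_step by auto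
  show ?case unfolding s using reach_step d' by (auto simp: less_Suc_eq)
qed auto

lemma not_live_next: "\<not> live c \<Longrightarrow> a_next n E c = c"
proof -
  assume a: "\<not> live c"
  obtain \<sigma> tr where c: "c = (\<sigma>, tr)" by force
  have "tr = (\<lambda>_ _. None)" using a by (auto simp: live_def c intro!: ext)
  moreover have "stp n v N (\<lambda>_. None) (\<sigma> v) = (\<sigma> v, \<lambda>_. None)" for v N
    using a idle by (simp add: c live_def)
  ultimately show ?thesis by (auto simp: a_next_def c fun_eq_iff)
qed

text \<open>Every configuration before \<open>d\<close> is live and \<open>d\<close> is not, so the
  recovery stops exactly after \<open>r\<close> further rounds; an upper bound on the rounds would
  not determine \<open>last_index\<close>. From then on the configuration is constant and silent, so
  the length bound extends to all indices.\<close>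

lemma recovery:
  assumes ms: "codes n ms \<sigma>" and fin: "\<And>v. finite (nbrs E v)" and slp: "\<And>v. \<not> awk (\<sigma> v)"
    and c0: "small b (a_first n E x \<sigma>)" "msgs (a_first n E x \<sigma>) \<le> k"
    and r: "reach b n E (a_first n E x \<sigma>) d r m" and d: "\<not> live d"
  shows "recovers alg n E x ms" "rounds alg n E x ms = Suc r" "messages alg n E x ms \<le> k + m"
    "codes n (memories (config_at alg n E x ms (last_index alg n E x ms))) (fst d)"
    "\<And>i u w msg. transit (config_at alg n E x ms i) u w = Some msg \<Longrightarrow> length msg \<le> b"
proof -
  let ?c = "\<lambda>i. (a_next n E ^^ i) (a_first n E x \<sigma>)"
  have rep: "represents n E (config_at alg n E x ms i) (?c i)" for i
  proof (induction i)
    case 0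
    then show ?case using first_represents[OF ms fin slp] by (simp add: config_at_def)
  next
    case (Suc i)
    then show ?case using next_represents[OF Suc fin] by (simp add: config_at_def)
  qed
  note it = reach_iterate[OF r]
  have act: "(active (config_at alg n E x ms i) = {}) = (\<not> live (?c i))" for i
    by (rule active_represents[OF rep])
  have li: "last_index alg n E x ms = r"
    unfolding last_index_def
    by (rule Least_equality) (use act it d not_less in blast)+
  show "recovers alg n E x ms" unfolding recovers_def using act it d by blast
  show "rounds alg n E x ms = Suc r" by (simp add: rounds_def li)
  show "codes n (memories (config_at alg n E x ms (last_index alg n E x ms))) (fst d)"
    using rep[of r] it by (simp add: li represents_def)
  have "{(u, w). transit (config_at alg n E x ms i) u w \<noteq> None} = {(u, w). snd (?c i) u w \<noteq> None}" for i
    using rep[of i] by (auto simp: represents_def)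
  then have "messages alg n E x ms = (\<Sum>i\<le>r. msgs (?c i))"
    by (simp add: messages_def li msgs_def)
  also have "{..r} = insert 0 {1..r}" by auto
  also have "(\<Sum>i\<in>insert 0 {1..r}. msgs (?c i)) = msgs (?c 0) + (\<Sum>i\<in>{1..r}. msgs (?c i))" by simp
  finally show "messages alg n E x ms \<le> k + m" using it c0(2) by simp
  have after: "?c (r + j) = d" for j
    by (induction j) (use it not_live_next[OF d] in auto)
  have sm: "small b (?c i)" for i
  proof -
    consider "i = 0" | "i \<in> {1..r}" | "i > r" by fastforce
    then show ?thesis
    proof cases
      case 3
      then show ?thesis using after[of "i - r"] d by (simp add: small_def live_def)
    qed (use it c0 in auto)
  qed
  fix i u w msg assume "transit (config_at alg n E x ms i) u w = Some msg"
  then show "length msg \<le> b" using rep[of i] sm[of i]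
    by (auto simp: represents_def small_def)
qed

end

section \<open>The algorithm\<close>

datatype cmd = Query nat | Alive | Degr | Bit nat nat | Join nat

type_synonym tally = "nat \<times> nat \<times> nat"

text \<open>The last flag of \<open>Stat\<close> requests the status of the receiver in return.
  \<open>Cmd1\<close> goes from a hub to its heavy neighbours, \<open>Cmd2\<close> from these and
  from the hub to the leaves, and \<open>Rep\<close> carries sums back. \<open>Call\<close>,
  \<open>Start\<close> and \<open>Ret\<close> move the control of the recursion.\<close>

datatype msg = Stat bool bool nat bool | Pub nat | Cmd1 cmd | Cmd2 cmd | Rep tally | Call nat | Start | Ret

text \<open>\<open>Hub p K l\<close> is a hub loop at level \<open>K\<close> that was called by \<open>p\<close>; the flag \<open>l\<close> says that the light
  neighbours may have lost their cover as well. \<open>Fwd x\<close> passes a call of \<open>x\<close> on to another vertex.\<close>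

datatype frame = Hub "vertex option" nat bool | Fwd vertex

text \<open>\<open>Wait\<close> lets a broadcast status arrive before the hub loop starts,
  \<open>Pre\<close> begins an iteration of the loop, and \<open>InsW\<close> is the wait of the
  smaller endpoint of a new edge. The counters in \<open>Top\<close> and \<open>Mid\<close>
  synchronise a convergecast; \<open>Dec\<close> holds its result until the decision.\<close>

datatype ctl = Idle | Wait | Pre | InsW bool vertex | Top nat cmd tally | Dec cmd tally
  | Mid vertex nat cmd | Leaf vertex cmd

text \<open>\<open>pd\<close> is the last published degree, \<open>hv s u\<close> the degree published by \<open>u\<close> if \<open>u\<close> is a heavy neighbour,
  \<open>mv\<close> the set of neighbours believed to be in the independent set (reliable for light neighbours only),
  \<open>pub\<close> the numbers received in the current Luby phase, \<open>dem\<close> whether the current insertion has made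
  the vertex heavy, \<open>stk\<close> its part of the recursion stack, \<open>kids\<close> its children and \<open>badc\<close> the child
  reporting trouble in the last query.\<close>

record lstate =
  heavy :: bool
  inm :: bool
  pd :: nat
  hv :: "vertex \<Rightarrow> nat option"
  mv :: "vertex set"
  pub :: "vertex \<Rightarrow> nat option"
  dem :: bool
  stk :: "frame list"
  ctl :: ctl
  kids :: "vertex set"
  badc :: vertex

type_synonym box = "vertex \<Rightarrow> msg option"

text \<open>In the empty graph the only maximal independent set is the whole vertex set, so all
  vertices start as members, and as light ones.\<close>

definition ini :: lstate where
  "ini = \<lparr>heavy = False, inm = True, pd = 0, hv = (\<lambda>_. None), mv = {}, pub = (\<lambda>_. None),
     dem = False, stk = [], ctl = Idle, kids = {}, badc = 0\<rparr>"

definition hn :: "vertex set \<Rightarrow> lstate \<Rightarrow> vertex set" where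
  "hn N s = {u \<in> N. hv s u \<noteq> None}"

text \<open>Judged by the vertex's own view. The intersection with \<open>N\<close> matters because
  \<open>mv\<close> may still contain former neighbours.\<close>

definition unc :: "vertex set \<Rightarrow> lstate \<Rightarrow> bool" where
  "unc N s \<longleftrightarrow> heavy s \<and> \<not> inm s \<and> mv s \<inter> N = {}"

text \<open>Heavy members do not count as cover here: light vertices are not kept informed about
  them, and the light part is to be dominated by itself.\<close>

definition lcov :: "vertex set \<Rightarrow> lstate \<Rightarrow> bool" where
  "lcov N s \<longleftrightarrow> (\<exists>u\<in>N. hv s u = None \<and> u \<in> mv s)"

definition lunc :: "vertex set \<Rightarrow> lstate \<Rightarrow> bool" where
  "lunc N s \<longleftrightarrow> \<not> heavy s \<and> \<not> inm s \<and> \<not> lcov N s"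

definition lows :: "nat \<Rightarrow> vertex set \<Rightarrow> lstate \<Rightarrow> vertex set" where
  "lows K N s = {u \<in> N. \<exists>p. hv s u = Some p \<and> p \<le> 4 ^ K}"

definition over :: "nat \<Rightarrow> vertex set \<Rightarrow> lstate \<Rightarrow> bool" where
  "over K N s \<longleftrightarrow> card (hn N s) > 2 ^ K"

definition fit :: "nat \<Rightarrow> vertex set \<Rightarrow> lstate \<Rightarrow> bool" where
  "fit K N s \<longleftrightarrow> lows K N s = {} \<and> \<not> over K N s"

definition yn :: "vertex set \<Rightarrow> lstate \<Rightarrow> vertex set" where
  "yn N s = {u \<in> N. pub s u \<noteq> None}"

subsection \<open>The hash family and the local estimators\<close>

text \<open>The seed consists of the two coefficients of an affine map modulo \<open>2 ^ q\<close>, which makes the family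
  pairwise independent. A vertex \<open>v\<close> surely kills a neighbour \<open>w\<close> if \<open>v\<close> is the only vertex next to
  \<open>v\<close> or \<open>w\<close> with hash value below \<open>thr q (d v) (d w)\<close>; by Bonferroni the total \<open>gain\<close> minus the total
  \<open>loss\<close> bounds the degree sum of the killed vertices from below, and it is a sum of terms that the
  vertices can evaluate locally.\<close>

definition hash :: "nat \<Rightarrow> nat \<Rightarrow> nat \<Rightarrow> nat" where
  "hash q seed x = ((seed div 2 ^ q) * x + seed mod 2 ^ q) mod 2 ^ q"

definition thr :: "nat \<Rightarrow> nat \<Rightarrow> nat \<Rightarrow> nat" where
  "thr q d e = 2 ^ q div (8 * (d + e))"

definition gain :: "nat \<Rightarrow> vertex \<Rightarrow> vertex set \<Rightarrow> (vertex \<Rightarrow> nat) \<Rightarrow> nat \<Rightarrow> nat" where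
  "gain q v Y d seed = (\<Sum>w\<in>Y. d w * of_bool (hash q seed v < thr q (card Y) (d w)))"

definition loss :: "nat \<Rightarrow> vertex \<Rightarrow> vertex set \<Rightarrow> (vertex \<Rightarrow> nat) \<Rightarrow> nat \<Rightarrow> nat" where
  "loss q v Y d seed =
     (\<Sum>w\<in>Y. d w * (\<Sum>u\<in>Y. of_bool (hash q seed v < thr q (card Y) (d w) \<and> hash q seed u < thr q (card Y) (d w))))
   + (\<Sum>x\<in>Y. card Y * (\<Sum>u\<in>Y - {x}. of_bool (hash q seed x < thr q (d x) (card Y) \<and> hash q seed u < thr q (d x) (card Y))))"

text \<open>The seeds whose leading \<open>j\<close> bits, read as a number, are \<open>pre\<close>:
  the event conditioned on after \<open>j\<close> steps of the derandomisation.\<close>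

definition block :: "nat \<Rightarrow> nat \<Rightarrow> nat \<Rightarrow> nat set" where
  "block t j pre = {x. x < 2 ^ t \<and> x div 2 ^ (t - j) = pre}"

text \<open>The bit is chosen by comparing gain minus loss on the two halves of the block. Moving
  each loss to the other side of the comparison keeps all reported numbers natural.\<close>

definition tally_bit :: "nat \<Rightarrow> vertex \<Rightarrow> vertex set \<Rightarrow> (vertex \<Rightarrow> nat) \<Rightarrow> nat \<Rightarrow> nat \<Rightarrow> tally" where
  "tally_bit q v Y d j pre =
     ((\<Sum>x\<in>block (2 * q) (Suc j) (2 * pre). gain q v Y d x) + (\<Sum>x\<in>block (2 * q) (Suc j) (2 * pre + 1). loss q v Y d x),
      (\<Sum>x\<in>block (2 * q) (Suc j) (2 * pre + 1). gain q v Y d x) + (\<Sum>x\<in>block (2 * q) (Suc j) (2 * pre). loss q v Y d x), 0)"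

subsection \<open>Local steps\<close>

definition hv_after :: "msg option \<Rightarrow> nat option \<Rightarrow> nat option" where
  "hv_after mo d = (case mo of Some (Stat h m p r) \<Rightarrow> if h then Some p else None | _ \<Rightarrow> d)"

definition mv_after :: "msg option \<Rightarrow> bool \<Rightarrow> bool" where
  "mv_after mo d = (case mo of Some (Stat h m p r) \<Rightarrow> m | _ \<Rightarrow> d)"

definition pub_after :: "msg option \<Rightarrow> nat option \<Rightarrow> nat option" where
  "pub_after mo d = (case mo of Some (Pub x) \<Rightarrow> Some x | _ \<Rightarrow> d)"

text \<open>Statuses are processed in every round and every control state, before the actual
  protocol step. Hearing of a member among the neighbours makes a member leave the set.\<close>

definition absorb :: "box \<Rightarrow> lstate \<Rightarrow> lstate" where
  "absorb bx s = s\<lparr>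
     hv := (\<lambda>u. hv_after (bx u) (hv s u)),
     mv := {u. mv_after (bx u) (u \<in> mv s)},
     pub := (\<lambda>u. pub_after (bx u) (pub s u)),
     inm := (inm s \<and> \<not> (\<exists>u h p r. bx u = Some (Stat h True p r)))\<rparr>"

text \<open>The \<open>pd\<close> of a light vertex may be out of date, and the invariant does not
  bound it; reporting \<open>0\<close> instead keeps the message short.\<close>

definition own_stat :: "lstate \<Rightarrow> bool \<Rightarrow> msg" where
  "own_stat s r = Stat (heavy s) (inm s) (if heavy s then pd s else 0) r"

definition to_set :: "vertex set \<Rightarrow> msg \<Rightarrow> box" where
  "to_set A m = (\<lambda>u. if u \<in> A then Some m else None)"

definition reply :: "box \<Rightarrow> lstate \<Rightarrow> box" where
  "reply bx s = (\<lambda>u. case bx u of Some (Stat h m p r) \<Rightarrow> if r then Some (own_stat s False) else None | _ \<Rightarrow> None)"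

text \<open>A heavy hub may have too many light neighbours to ask them all. They are asked only if
  the flag \<open>l\<close> is set, in which case the degree is known to be small.\<close>

definition ttgt :: "cmd \<Rightarrow> vertex set \<Rightarrow> lstate \<Rightarrow> vertex set" where
  "ttgt k N s = (case k of
     Query K \<Rightarrow> (case stk s of Hub p K' l # fs \<Rightarrow> if l then N - hn N s else {} | _ \<Rightarrow> {})
   | _ \<Rightarrow> {})"

definition mtgt :: "cmd \<Rightarrow> vertex set \<Rightarrow> lstate \<Rightarrow> vertex set" where
  "mtgt k N s = (case k of Query K \<Rightarrow> if fit K N s then hn N s else {} | _ \<Rightarrow> kids s)"

definition act :: "nat \<Rightarrow> vertex \<Rightarrow> vertex set \<Rightarrow> bool \<Rightarrow> cmd \<Rightarrow> lstate \<Rightarrow> lstate \<times> box" where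
  "act q v N inner k s = (case k of
     Query K \<Rightarrow> (s\<lparr>pub := \<lambda>_. None\<rparr>, to_set (if inner \<and> fit K N s then hn N s else {}) (own_stat s False))
   | Alive \<Rightarrow> (s, to_set (if unc N s then hn N s else {}) (Pub 0))
   | Degr \<Rightarrow> (s, to_set (if unc N s then hn N s else {}) (Pub (card (yn N s))))
   | Bit j pre \<Rightarrow> (s, \<lambda>_. None)
   | Join seed \<Rightarrow>
       if unc N s \<and> (\<forall>u\<in>yn N s. hash q seed v < hash q seed u)
       then (s\<lparr>inm := True\<rparr>, to_set (hn N s) (Stat True True (pd s) False)) else (s, \<lambda>_. None))"

text \<open>The components answering a query report a vertex that can be turned light, a level that
  is too low, and an uncovered vertex. Uncovered vertices enter the third component only if they fit
  the level, so it is a complete count once the first two components vanish.\<close>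

definition con :: "nat \<Rightarrow> vertex \<Rightarrow> vertex set \<Rightarrow> bool \<Rightarrow> cmd \<Rightarrow> lstate \<Rightarrow> tally" where
  "con q v N inner k s = (case k of
     Query K \<Rightarrow>
       if \<not> heavy s then (of_bool (\<not> inner \<and> lunc N s), 0, 0)
       else if inner \<or> unc N s then
         (if lows K N s \<noteq> {} then (1, 0, 0)
          else if over K N s then (0, 1, 0) else (0, 0, of_bool (unc N s)))
       else 0
   | Bit j pre \<Rightarrow> if unc N s then tally_bit q v (yn N s) (\<lambda>u. the (pub s u)) j pre else 0
   | _ \<Rightarrow> 0)"

definition reps :: "box \<Rightarrow> vertex set" where
  "reps bx = {u. \<exists>t. bx u = Some (Rep t)}"

definition total :: "box \<Rightarrow> tally" where
  "total bx = (\<Sum>u\<in>reps bx. case bx u of Some (Rep t) \<Rightarrow> t | _ \<Rightarrow> 0)"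

definition bads :: "box \<Rightarrow> vertex set" where
  "bads bx = {u. \<exists>a b c. bx u = Some (Rep (a, b, c)) \<and> a > 0}"

definition upd_bad :: "vertex set \<Rightarrow> lstate \<Rightarrow> lstate" where
  "upd_bad B s = s\<lparr>badc := (if B = {} then badc s else (LEAST u. u \<in> B))\<rparr>"

definition become :: "vertex option \<Rightarrow> vertex set \<Rightarrow> lstate \<Rightarrow> lstate" where
  "become x N s = s\<lparr>heavy := False, inm := \<not> lcov N s, stk := Hub x 0 False # stk s, ctl := Wait\<rparr>"

text \<open>A call does not name its destination: each vertex on the way determines the next one
  from its own memory, preferring a low neighbour to the child that has complained.\<close>

definition on_call :: "vertex \<Rightarrow> nat \<Rightarrow> vertex set \<Rightarrow> lstate \<Rightarrow> lstate \<times> box" where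
  "on_call x K N s =
     (if \<not> heavy s \<or> pd s \<le> 4 ^ K
      then (let s' = become (Some x) N s in (s', to_set N (own_stat s' False)))
      else (s\<lparr>stk := Fwd x # stk s\<rparr>,
            to_set {if lows K N s \<noteq> {} then (LEAST u. u \<in> lows K N s) else badc s} (Call K)))"

text \<open>Chosen so that \<open>2 ^ q\<close> is at least \<open>16 * n * n ^ c\<close>, as the
  hash family requires for identifiers below \<open>n ^ c\<close> and degrees up to
  \<open>n\<close>.\<close>

definition qbits :: "nat \<Rightarrow> nat \<Rightarrow> nat" where
  "qbits c n = (c + 2) * (LEAST l. n \<le> 2 ^ l) + 6"

text \<open>A Luby phase ends by returning to \<open>Pre\<close>; the next query recounts the
  uncovered vertices and thereby decides whether another phase is due.\<close>

definition decide :: "nat \<Rightarrow> vertex \<Rightarrow> vertex set \<Rightarrow> cmd \<Rightarrow> tally \<Rightarrow> lstate \<Rightarrow> lstate \<times> box" where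
  "decide q v N k t s = (case k of
     Query K \<Rightarrow> (case t of (a, b, z) \<Rightarrow> (case stk s of
         Hub p K' l # fs \<Rightarrow>
           if a > 0 then (s\<lparr>ctl := Idle\<rparr>, to_set {badc s} (Call K))
           else if b > 0 \<or> z > 2 ^ K then (s\<lparr>ctl := Pre, stk := Hub p (Suc K) l # fs\<rparr>, \<lambda>_. None)
           else if z = 0 then (s\<lparr>ctl := Idle, stk := fs\<rparr>, to_set (set_option p) Ret)
           else (s\<lparr>ctl := Top 0 Alive 0\<rparr>, \<lambda>_. None)
       | _ \<Rightarrow> (s, \<lambda>_. None)))
   | Alive \<Rightarrow> (s\<lparr>ctl := Top 0 Degr 0\<rparr>, \<lambda>_. None)
   | Degr \<Rightarrow> (s\<lparr>ctl := Top 0 (Bit 0 0) 0\<rparr>, \<lambda>_. None)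
   | Bit j pre \<Rightarrow>
       (let pre' = (if fst t \<ge> fst (snd t) then 2 * pre else 2 * pre + 1)
        in (s\<lparr>ctl := Top 0 (if Suc j = 2 * q then Join pre' else Bit (Suc j) pre') 0\<rparr>, \<lambda>_. None))
   | Join seed \<Rightarrow> (s\<lparr>ctl := Pre\<rparr>, \<lambda>_. None))"

text \<open>A leaf may receive \<open>Cmd2\<close> from several parents. Answering only the least of
  them makes every vertex contribute once to the sum.\<close>

definition idle_step :: "nat \<Rightarrow> vertex \<Rightarrow> vertex set \<Rightarrow> box \<Rightarrow> lstate \<Rightarrow> lstate \<times> box" where
  "idle_step q v N bx s =
    (if \<exists>u. bx u = Some Ret then
       (case stk s of Fwd x # fs \<Rightarrow> (s\<lparr>stk := fs\<rparr>, to_set {x} Ret)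
        | Hub p K l # fs \<Rightarrow> (s\<lparr>ctl := Pre\<rparr>, \<lambda>_. None) | [] \<Rightarrow> (s, \<lambda>_. None))
     else if \<exists>u K. bx u = Some (Call K) then
       (let x = (LEAST u. \<exists>K. bx u = Some (Call K)) in on_call x (THE K. bx x = Some (Call K)) N s)
     else if \<exists>u. bx u = Some Start then
       (s\<lparr>stk := Hub (Some (LEAST u. bx u = Some Start)) 0 (dem s) # stk s, ctl := Pre\<rparr>, \<lambda>_. None)
     else if \<exists>u k. bx u = Some (Cmd1 k) then
       (let x = (LEAST u. \<exists>k. bx u = Some (Cmd1 k)); k = (THE k. bx x = Some (Cmd1 k))
        in (s\<lparr>ctl := Mid x 2 k\<rparr>, to_set (mtgt k N s) (Cmd2 k)))
     else if \<exists>u k. bx u = Some (Cmd2 k) then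
       (let x = (LEAST u. \<exists>k. bx u = Some (Cmd2 k)); k = (THE k. bx x = Some (Cmd2 k));
            r = act q v N False k s
        in ((fst r)\<lparr>ctl := Leaf x k\<rparr>, snd r))
     else (s, reply bx s))"

text \<open>The hub sends its own \<open>Cmd2\<close> one round after \<open>Cmd1\<close>, together
  with the heavy neighbours that pass the command on. Hence hub, inner vertices and leaves all act
  in the same following round.\<close>

definition top_step :: "nat \<Rightarrow> vertex \<Rightarrow> vertex set \<Rightarrow> box \<Rightarrow> lstate \<Rightarrow> nat \<Rightarrow> cmd \<Rightarrow> tally \<Rightarrow> lstate \<times> box" where
  "top_step q v N bx s t k a =
    (if t = 0 then (s\<lparr>ctl := Top 1 k a\<rparr>, to_set (hn N s) (Cmd1 k))
     else if t = 1 then (s\<lparr>ctl := Top 2 k a\<rparr>, to_set (ttgt k N s) (Cmd2 k))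
     else if t = 2 then (let r = act q v N True k s in ((fst r)\<lparr>ctl := Top 3 k a\<rparr>, snd r))
     else if t = 3 then (s\<lparr>ctl := Top 4 k a\<rparr>, \<lambda>_. None)
     else if t = 4 then ((upd_bad (bads bx) s)\<lparr>ctl := Top 5 k (a + total bx)\<rparr>, \<lambda>_. None)
     else ((upd_bad (bads bx) s)\<lparr>ctl := Dec k (a + total bx)\<rparr>, \<lambda>_. None))"

definition next_kids :: "cmd \<Rightarrow> vertex set \<Rightarrow> vertex set \<Rightarrow> vertex set" where
  "next_kids k A B = (case k of Query K \<Rightarrow> A | _ \<Rightarrow> B)"

definition mid_step :: "nat \<Rightarrow> vertex \<Rightarrow> vertex set \<Rightarrow> box \<Rightarrow> lstate \<Rightarrow> vertex \<Rightarrow> nat \<Rightarrow> cmd \<Rightarrow> lstate \<times> box" where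
  "mid_step q v N bx s x t k =
    (if t = 2 then (let r = act q v N True k s in ((fst r)\<lparr>ctl := Mid x 3 k\<rparr>, snd r))
     else if t = 3 then (s\<lparr>ctl := Mid x 4 k\<rparr>, \<lambda>_. None)
     else ((upd_bad (bads bx) s)\<lparr>ctl := Idle, kids := next_kids k (reps bx) (kids s)\<rparr>,
           to_set {x} (Rep (total bx + con q v N True k s))))"

text \<open>Complaints that the hub can see by itself are settled before messages are spent on a
  query, so a hub that issues a query fits its level.\<close>

definition pre_step :: "vertex set \<Rightarrow> lstate \<Rightarrow> lstate \<times> box" where
  "pre_step N s = (case stk s of
     Hub p K l # fs \<Rightarrow>
       if lows K N s \<noteq> {} then (s\<lparr>ctl := Idle\<rparr>, to_set {LEAST u. u \<in> lows K N s} (Call K))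
       else if over K N s then (s\<lparr>stk := Hub p (Suc K) l # fs\<rparr>, \<lambda>_. None)
       else (s\<lparr>ctl := Top 0 (Query K) 0\<rparr>, \<lambda>_. None)
   | _ \<Rightarrow> (s, \<lambda>_. None))"

definition step :: "nat \<Rightarrow> nat \<Rightarrow> vertex \<Rightarrow> vertex set \<Rightarrow> box \<Rightarrow> lstate \<Rightarrow> lstate \<times> box" where
  "step c n v N bx s0 = (let s = absorb bx s0; q = qbits c n in case ctl s0 of
      Idle \<Rightarrow> idle_step q v N bx s
    | Wait \<Rightarrow> (s\<lparr>ctl := Pre\<rparr>, \<lambda>_. None)
    | Pre \<Rightarrow> pre_step N s
    | InsW b u \<Rightarrow> if b then (s\<lparr>ctl := Idle, stk := [Hub None 0 (dem s)]\<rparr>, to_set {u} Start)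
                  else (s\<lparr>ctl := InsW True u\<rparr>, reply bx s)
    | Top t k a \<Rightarrow> top_step q v N bx s t k a
    | Dec k a \<Rightarrow> decide q v N k (a + con q v N True k s) s
    | Mid x t k \<Rightarrow> mid_step q v N bx s x t k
    | Leaf x k \<Rightarrow> (s\<lparr>ctl := Idle\<rparr>, to_set {x} (Rep (con q v N False k s))))"

text \<open>The symmetry between the endpoints of a new edge is broken by the identifiers: the
  smaller one waits and coordinates. A light vertex has reliable information about light neighbours
  only, so on turning heavy it requests the status of all neighbours.\<close>

definition upd :: "nat \<Rightarrow> vertex \<Rightarrow> vertex set \<Rightarrow> local_event \<Rightarrow> lstate \<Rightarrow> lstate \<times> box" where
  "upd n v N ev s = (case ev of
     Gained u \<Rightarrow>
       (let s1 = s\<lparr>dem := \<not> heavy s, ctl := (if v < u then InsW False u else Idle)\<rparr> in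
        if \<not> heavy s then (s1\<lparr>heavy := True, inm := False, pd := card N\<rparr>, to_set N (Stat True False (card N) True))
        else if card N \<ge> 2 * pd s then (s1\<lparr>pd := card N\<rparr>, to_set N (Stat True (inm s) (card N) False))
        else (s1, to_set {u} (own_stat s False)))
   | Lost u \<Rightarrow>
       if lunc N s then (let s1 = become None N s in (s1, to_set N (own_stat s1 False)))
       else (let s1 = (if heavy s \<and> 2 * card N \<le> pd s then s\<lparr>pd := card N\<rparr> else s);
                 ob = (if heavy s \<and> 2 * card N \<le> pd s then to_set N (own_stat s1 False) else (\<lambda>_. None))
             in (if unc N s then s1\<lparr>stk := Hub None 0 False # stk s, ctl := Wait\<rparr> else s1, ob)))"

definition awk :: "lstate \<Rightarrow> bool" where
  "awk s \<longleftrightarrow> ctl s \<noteq> Idle"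

section \<open>Codes of messages and their lengths\<close>

fun cmd_nats :: "cmd \<Rightarrow> nat list" where
  "cmd_nats (Query K) = [0, K]"
| "cmd_nats Alive = [1]"
| "cmd_nats Degr = [2]"
| "cmd_nats (Bit j p) = [3, j, p]"
| "cmd_nats (Join s) = [4, s]"

fun msg_nats :: "msg \<Rightarrow> nat list" where
  "msg_nats (Stat h m p r) = [0, of_bool h, of_bool m, p, of_bool r]"
| "msg_nats (Pub x) = [1, x]"
| "msg_nats (Cmd1 k) = 2 # cmd_nats k"
| "msg_nats (Cmd2 k) = 3 # cmd_nats k"
| "msg_nats (Rep t) = [4, fst t, fst (snd t), snd (snd t)]"
| "msg_nats (Call K) = [5, K]"
| "msg_nats Start = [6]"
| "msg_nats Ret = [7]"

definition enc_msg :: "msg \<Rightarrow> bool list" where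
  "enc_msg m = enc_nats (msg_nats m)"

definition mok :: "nat \<Rightarrow> msg \<Rightarrow> bool" where
  "mok t m \<longleftrightarrow> (\<forall>k\<in>set (msg_nats m). k < 2 ^ t)"

lemma inj_enc_msg: "inj enc_msg"
proof (rule injI)
  have c: "cmd_nats k = cmd_nats l \<Longrightarrow> k = l" for k l by (cases k; cases l) auto
  fix x y assume "enc_msg x = enc_msg y"
  then have "msg_nats x = msg_nats y" using inj_enc_nats by (simp add: enc_msg_def inj_eq)
  then show "x = y" by (cases x; cases y) (auto dest: c simp: prod_eq_iff of_bool_def split: if_splits)
qed

lemma length_enc_msg: "mok t m \<Longrightarrow> length (enc_msg m) \<le> 5 * (2 * t + 1)"
proof -
  assume a: "mok t m"
  have "length (cmd_nats k) \<le> 3" for k by (cases k) auto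
  then have "length (cmd_nats k) \<le> 4" for k by (rule order_trans) simp
  then have "length (msg_nats m) \<le> 5" by (cases m) auto
  moreover have "length (enc_msg m) \<le> length (msg_nats m) * (2 * t + 1)"
    unfolding enc_msg_def by (rule length_enc_nats) (use a in \<open>auto simp: mok_def\<close>)
  ultimately show ?thesis by (meson mult_le_mono1 order_trans)
qed

definition plain :: "box \<Rightarrow> bool" where
  "plain bx \<longleftrightarrow> (\<forall>u h m p r x. bx u \<noteq> Some (Stat h m p r) \<and> bx u \<noteq> Some (Pub x))"

lemma after_other:
  "(\<And>h m p r. mo \<noteq> Some (Stat h m p r)) \<Longrightarrow> hv_after mo d = d"
  "(\<And>h m p r. mo \<noteq> Some (Stat h m p r)) \<Longrightarrow> mv_after mo e = e"
  "(\<And>x. mo \<noteq> Some (Pub x)) \<Longrightarrow> pub_after mo d = d"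
  by (auto simp: hv_after_def mv_after_def pub_after_def split: option.splits msg.splits)

lemma after_simps [simp]:
  "hv_after None d = d" "hv_after (Some (Stat h m p r)) d = (if h then Some p else None)"
  "mv_after None e = e" "mv_after (Some (Stat h m p r)) e = m"
  "pub_after None d = d" "pub_after (Some (Pub x)) d = Some x"
  "hv_after (Some (Pub x)) d = d" "mv_after (Some (Pub x)) e = e"
  "pub_after (Some (Stat h m p r)) d = d"
  by (simp_all add: hv_after_def mv_after_def pub_after_def)

lemma absorb_plain: "plain bx \<Longrightarrow> absorb bx s = s"
proof -
  assume p: "plain bx"
  have 1: "(\<lambda>u. hv_after (bx u) (hv s u)) = hv s"
    using p by (auto simp: plain_def after_other)
  have 2: "{u. mv_after (bx u) (u \<in> mv s)} = mv s"
    using p by (auto simp: plain_def after_other)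
  have 3: "(\<lambda>u. pub_after (bx u) (pub s u)) = pub s"
    using p by (auto simp: plain_def after_other)
  show ?thesis unfolding absorb_def 1 2 3 using p by (simp add: plain_def)
qed

lemma absorb_sel [simp]:
  "heavy (absorb bx s) = heavy s" "pd (absorb bx s) = pd s" "dem (absorb bx s) = dem s"
  "stk (absorb bx s) = stk s" "ctl (absorb bx s) = ctl s" "kids (absorb bx s) = kids s"
  "badc (absorb bx s) = badc s"
  by (simp_all add: absorb_def)

lemma plain_None [simp]: "plain (\<lambda>_. None)" by (simp add: plain_def)

lemma absorb_None [simp]: "absorb (\<lambda>_. None) s = s"
  by (simp add: absorb_plain)

lemma absorb_upd [simp]:
  "absorb bx (s\<lparr>ctl := x\<rparr>) = (absorb bx s)\<lparr>ctl := x\<rparr>"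
  by (simp add: absorb_def)

lemma reply_None [simp]: "reply (\<lambda>_. None) s = (\<lambda>_. None)" by (simp add: reply_def)

lemma step_idle_None: "\<not> awk s \<Longrightarrow> step c n v N (\<lambda>_. None) s = (s, \<lambda>_. None)"
  by (simp add: awk_def step_def idle_step_def)

interpretation mis: automaton ini upd "step c" awk inm enc_msg for c
  by unfold_locales (simp_all add: inj_enc_msg step_idle_None)

section \<open>Broadcast and convergecast\<close>

lemma act_ctl [simp]: "act q v N i k (s\<lparr>ctl := x\<rparr>) = ((fst (act q v N i k s))\<lparr>ctl := x\<rparr>, snd (act q v N i k s))"
  by (auto simp: act_def unc_def hn_def yn_def fit_def lows_def over_def own_stat_def split: cmd.splits)

lemma con_ctl [simp]: "con q v N i k (s\<lparr>ctl := x\<rparr>) = con q v N i k s"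
  by (auto simp: con_def unc_def hn_def yn_def lows_def over_def lunc_def lcov_def split: cmd.splits)

lemma act_sel [simp]:
  "heavy (fst (act q v N i k s)) = heavy s" "pd (fst (act q v N i k s)) = pd s"
  "hv (fst (act q v N i k s)) = hv s" "mv (fst (act q v N i k s)) = mv s"
  "dem (fst (act q v N i k s)) = dem s" "stk (fst (act q v N i k s)) = stk s"
  "ctl (fst (act q v N i k s)) = ctl s" "kids (fst (act q v N i k s)) = kids s"
  "badc (fst (act q v N i k s)) = badc s"
  by (auto simp: act_def split: cmd.splits)

lemma act_out:
  "snd (act q v N i k s) u = Some m \<Longrightarrow> u \<in> hn N s \<and> ((\<exists>h b p. m = Stat h b p False) \<or> (\<exists>x. m = Pub x))"
  by (auto simp: act_def to_set_def own_stat_def split: cmd.splits if_splits)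

lemma to_set_Some [simp]: "to_set A m u = Some m' \<longleftrightarrow> u \<in> A \<and> m = m'"
  by (auto simp: to_set_def)

lemma to_set_empty [simp]: "to_set {} m = (\<lambda>_. None)" by (auto simp: to_set_def)

lemma Least_sing: "(LEAST u. u = x) = x" for x :: nat
  by (intro Least_equality) auto

lemma idle_Ret: "idle_step q v N (to_set {x} Ret) s =
    (case stk s of Fwd x # fs \<Rightarrow> (s\<lparr>stk := fs\<rparr>, to_set {x} Ret)
        | Hub p K l # fs \<Rightarrow> (s\<lparr>ctl := Pre\<rparr>, \<lambda>_. None) | [] \<Rightarrow> (s, \<lambda>_. None))"
  unfolding idle_step_def by (rule if_P) simp

lemma idle_Call: "idle_step q v N (to_set {x} (Call K)) s = on_call x K N s"
proof -
  have a: "\<not> (\<exists>u. to_set {x} (Call K) u = Some Ret)" by simp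
  have b: "\<exists>u K'. to_set {x} (Call K) u = Some (Call K')" by simp
  show ?thesis unfolding idle_step_def if_not_P[OF a] if_P[OF b] Let_def
    by (simp add: Least_sing)
qed

lemma idle_Start: "idle_step q v N (to_set {x} Start) s =
    (s\<lparr>stk := Hub (Some x) 0 (dem s) # stk s, ctl := Pre\<rparr>, \<lambda>_. None)"
proof -
  have a: "\<not> (\<exists>u. to_set {x} Start u = Some Ret)" "\<not> (\<exists>u K'. to_set {x} Start u = Some (Call K'))" by simp_all
  have b: "\<exists>u. to_set {x} Start u = Some Start" by simp
  show ?thesis unfolding idle_step_def if_not_P[OF a(1)] if_not_P[OF a(2)] if_P[OF b]
    by (simp add: Least_sing)
qed

lemma idle_Cmd1: "idle_step q v N (to_set {x} (Cmd1 k)) s = (s\<lparr>ctl := Mid x 2 k\<rparr>, to_set (mtgt k N s) (Cmd2 k))"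
proof -
  have a: "\<not> (\<exists>u. to_set {x} (Cmd1 k) u = Some Ret)" "\<not> (\<exists>u K'. to_set {x} (Cmd1 k) u = Some (Call K'))"
    "\<not> (\<exists>u. to_set {x} (Cmd1 k) u = Some Start)" by simp_all
  have b: "\<exists>u k'. to_set {x} (Cmd1 k) u = Some (Cmd1 k')" by simp
  show ?thesis unfolding idle_step_def if_not_P[OF a(1)] if_not_P[OF a(2)] if_not_P[OF a(3)] if_P[OF b] Let_def
    by (simp add: Least_sing)
qed

lemma plain_to_set [simp]:
  "plain (to_set A (Cmd1 k))" "plain (to_set A (Cmd2 k))" "plain (to_set A (Call K))"
  "plain (to_set A Start)" "plain (to_set A Ret)" "plain (to_set A (Rep r))"
  by (simp_all add: plain_def)

lemma bads_alt: "bads bx = {u. \<exists>t. bx u = Some (Rep t) \<and> fst t > 0}"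
  by (force simp: bads_def)

locale net =
  fixes c n t :: nat and E :: edges and V :: "vertex set"
  assumes finV: "finite V"
    and edge: "\<And>u w. w \<in> nbrs E u \<Longrightarrow> u \<in> V \<and> w \<in> V \<and> u \<noteq> w"
begin

abbreviation "N \<equiv> nbrs E"
abbreviation "q \<equiv> qbits c n"
abbreviation rch where "rch \<equiv> automaton.reach (step c) awk enc_msg (5 * (2 * t + 1)) n E"

lemma finN [simp]: "finite (N v)"
  by (rule finite_subset[OF _ finV]) (use edge in auto)

lemma Nsym: "w \<in> N u \<longleftrightarrow> u \<in> N w"
  by (simp add: nbrs_def insert_commute)

lemma not_self [simp]: "u \<notin> N u" using edge by blast

lemma hn_sub: "hn (N v) s \<subseteq> N v" by (auto simp: hn_def)

lemma fin_hn [simp]: "finite (hn (N v) s)" by (rule finite_subset[OF hn_sub finN])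

lemma rch1:
  assumes "\<And>v. step c n v (N v) (\<lambda>u. tr u v) (\<sigma> v) = (\<sigma>' v, ob v)"
    and "\<And>u w. tr' u w = (if w \<in> N u then ob u w else None)"
    and "(\<exists>v. ctl (\<sigma> v) \<noteq> Idle) \<or> (\<exists>u w. tr u w \<noteq> None)"
    and "\<And>u w m. tr' u w = Some m \<Longrightarrow> mok t m"
    and "card {(u, w). tr' u w \<noteq> None} \<le> k"
  shows "rch (\<sigma>, tr) (\<sigma>', tr') 1 k"
proof -
  have "mis.reach c (5 * (2 * t + 1)) n E (\<sigma>, tr) (\<sigma>', tr') (Suc 0) (0 + k)"
  proof (rule mis.reach_step[OF mis.reach_refl])
    show "mis.live (\<sigma>, tr)" using assms(3) by (auto simp: mis.live_def awk_def)
    show "mis.a_next c n E (\<sigma>, tr) = (\<sigma>', tr')"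
      using assms(1,2) by (auto simp: mis.a_next_def fun_eq_iff)
    show "mis.small (5 * (2 * t + 1)) (\<sigma>', tr')"
      using assms(4) length_enc_msg by (auto simp: mis.small_def)
    show "mis.msgs (\<sigma>', tr') \<le> k" using assms(5) by (simp add: mis.msgs_def)
  qed
  then show ?thesis by simp
qed

lemma rch_trans: "rch x y r m \<Longrightarrow> rch y z r' m' \<Longrightarrow> rch x z (r + r') (m + m')"
  by (rule mis.reach_trans)

lemma rch_mono: "rch x y r m \<Longrightarrow> m \<le> m' \<Longrightarrow> rch x y r m'"
  by (rule mis.reach_mono)

lemma rch_refl: "rch x x 0 m"
  by (rule mis.reach_refl)

end

lemma card_sends:
  assumes "finite A" "\<And>u. u \<in> A \<Longrightarrow> finite (B u)" "\<And>u w. tr u w \<noteq> None \<Longrightarrow> u \<in> A \<and> w \<in> B u"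
  shows "card {(u, w). tr u w \<noteq> None} \<le> (\<Sum>u\<in>A. card (B u))"
proof -
  have "card {(u, w). tr u w \<noteq> None} \<le> card (SIGMA u:A. B u)"
    by (rule card_mono) (use assms in auto)
  then show ?thesis using assms by (simp add: card_SigmaI)
qed

locale rpc = net +
  fixes \<sigma> :: "vertex \<Rightarrow> lstate" and w :: vertex and k :: cmd
begin

text \<open>The root \<open>w\<close> reaches \<open>S\<close> and then the leaves \<open>Lf\<close>, where \<open>P\<close> is the parent of a leaf; all of them
  act simultaneously (\<open>sa\<close>), receive the messages \<open>lat\<close> (\<open>sb\<close>), and send their contributions \<open>C\<close> up.\<close>

definition "S = hn (N w) (\<sigma> w)"
definition "I = insert w S"
definition "T x = (if x = w then ttgt k (N w) (\<sigma> w) else mtgt k (N x) (\<sigma> x))"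
definition "Lf = (\<Union>x\<in>I. T x) - I"
definition "P y = (LEAST x. x \<in> I \<and> y \<in> T x)"
definition "M = I \<union> Lf"
definition "A v = act q v (N v) (v \<in> I) k (\<sigma> v)"
definition "lat u = (if u \<in> M then snd (A u) else (\<lambda>_. None))"
definition "sa v = (if v \<in> M then fst (A v) else \<sigma> v)"
definition "sb v = absorb (\<lambda>u. lat u v) (sa v)"
definition "C v = con q v (N v) (v \<in> I) k (sb v)"
definition "ch x = {y \<in> Lf. P y = x}"
definition "R z = (\<Sum>y\<in>ch z. C y) + C z"
definition "bd x = {y \<in> ch x. fst (C y) > 0}"
definition "bw = {z \<in> S. fst (R z) > 0}"
definition "fin v =
  (if v = w then (upd_bad bw (upd_bad (bd w) (sb w)))\<lparr>ctl := Dec k ((\<Sum>y\<in>ch w. C y) + (\<Sum>z\<in>S. R z))\<rparr>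
   else if v \<in> S then (upd_bad (bd v) (sb v))\<lparr>kids := next_kids k (ch v) (kids (sb v))\<rparr>
   else sb v)"

lemma lat_form:
  "lat u v = Some m \<Longrightarrow> u \<in> M \<and> v \<in> hn (N u) (\<sigma> u) \<and> ((\<exists>h b p. m = Stat h b p False) \<or> (\<exists>x. m = Pub x))"
  unfolding lat_def A_def by (auto split: if_splits dest!: act_out)

lemma w_notin_S: "w \<notin> S" using edge by (auto simp: S_def hn_def)

lemma fin_S [simp]: "finite S" by (simp add: S_def)

lemma sa_ctl [simp]: "ctl (sa v) = ctl (\<sigma> v)" "stk (sa v) = stk (\<sigma> v)" by (simp_all add: sa_def A_def)

lemma sb_ctl [simp]: "ctl (sb v) = ctl (\<sigma> v)" "stk (sb v) = stk (\<sigma> v)" by (simp_all add: sb_def)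

lemma lf_parent: "y \<in> Lf \<Longrightarrow> P y \<in> I \<and> y \<in> T (P y)"
proof -
  assume "y \<in> Lf"
  then obtain x where "x \<in> I \<and> y \<in> T x" by (auto simp: Lf_def)
  then show ?thesis unfolding P_def by (rule LeastI)
qed

text \<open>Two rounds carry the command down, in the third all participants act, and the remaining
  three bring the sums to the root. Every edge used by a command carries at most one answer, whence
  the factors two in the bound; the messages \<open>lat\<close> are counted separately.\<close>

lemma round_trip:
  assumes top: "ctl (\<sigma> w) = Top 0 k 0"
    and idl: "\<And>v. v \<noteq> w \<Longrightarrow> ctl (\<sigma> v) = Idle"
    and TN: "\<And>x. x \<in> I \<Longrightarrow> T x \<subseteq> N x"
    and ok1: "mok t (Cmd1 k)" "mok t (Cmd2 k)"
    and ok2: "\<And>u v m. lat u v = Some m \<Longrightarrow> mok t m"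
    and ok3: "\<And>y. y \<in> Lf \<Longrightarrow> mok t (Rep (C y))" "\<And>z. z \<in> S \<Longrightarrow> mok t (Rep (R z))"
    and m: "2 * card S + 2 * (\<Sum>x\<in>I. card (T x)) + (\<Sum>u\<in>M. card {v. lat u v \<noteq> None}) \<le> m"
  shows "rch (\<sigma>, \<lambda>_ _. None) (fin, \<lambda>_ _. None) 6 m"
proof -
  have finT: "finite (T x)" if "x \<in> I" for x using TN[OF that] finN finite_subset by blast
  have finI [simp]: "finite I" by (simp add: I_def)
  have finLf [simp]: "finite Lf" unfolding Lf_def using finT by auto
  have finM [simp]: "finite M" by (simp add: M_def)
  have PN: "P y \<in> N y" if "y \<in> Lf" for y
    using lf_parent[OF that] TN Nsym by blast
  have wS: "w \<notin> S" by (rule w_notin_S)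
  have LfI: "y \<notin> I" if "y \<in> Lf" for y using that by (simp add: Lf_def)
  define t1 where "t1 = (\<lambda>u v. if u = w \<and> v \<in> S then Some (Cmd1 k) else None)"
  define s1 where "s1 = (\<lambda>v. if v = w then (\<sigma> w)\<lparr>ctl := Top 1 k 0\<rparr> else \<sigma> v)"
  have r1: "rch (\<sigma>, \<lambda>_ _. None) (s1, t1) 1 (card S)"
  proof (rule rch1)
    show "step c n v (N v) (\<lambda>u. None) (\<sigma> v) = (s1 v, if v = w then to_set S (Cmd1 k) else (\<lambda>_. None))" for v
      using top idl[of v] by (auto simp: step_def Let_def s1_def top_step_def S_def idle_step_def)
    show "t1 u v = (if v \<in> N u then (if u = w then to_set S (Cmd1 k) else (\<lambda>_. None)) v else None)" for u v
      by (auto simp: t1_def to_set_def S_def hn_def)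
    show "(\<exists>v. ctl (\<sigma> v) \<noteq> Idle) \<or> (\<exists>u w. None \<noteq> None)" using top by (intro disjI1 exI[of _ w]) simp
    show "t1 u v = Some m \<Longrightarrow> mok t m" for u v m using ok1 by (auto simp: t1_def split: if_splits)
    show "card {(u, v). t1 u v \<noteq> None} \<le> card S"
      by (rule order_trans[OF card_sends[of "{w}" "\<lambda>_. S"]]) (auto simp: t1_def split: if_splits)
  qed
  define t2 where "t2 = (\<lambda>u v. if u \<in> I \<and> v \<in> T u then Some (Cmd2 k) else None)"
  define s2 where "s2 = (\<lambda>v. if v = w then (\<sigma> w)\<lparr>ctl := Top 2 k 0\<rparr> else if v \<in> S then (\<sigma> v)\<lparr>ctl := Mid w 2 k\<rparr> else \<sigma> v)"
  have r2: "rch (s1, t1) (s2, t2) 1 (\<Sum>x\<in>I. card (T x))"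
  proof (rule rch1)
    fix v
    have pl: "plain (\<lambda>u. t1 u v)" by (auto simp: plain_def t1_def)
    have tt: "ttgt k (N w) ((\<sigma> w)\<lparr>ctl := x\<rparr>) = ttgt k (N w) (\<sigma> w)" for x
      by (auto simp: ttgt_def hn_def split: cmd.splits list.splits frame.splits)
    show "step c n v (N v) (\<lambda>u. t1 u v) (s1 v) = (s2 v, if v \<in> I then to_set (T v) (Cmd2 k) else (\<lambda>_. None))"
    proof (cases "v = w")
      case True
      then show ?thesis using absorb_plain[OF pl] tt
        by (simp add: step_def Let_def s1_def s2_def top_step_def T_def I_def)
    next
      case False
      show ?thesis
      proof (cases "v \<in> S")
        case True
        have "(\<lambda>u. t1 u v) = to_set {w} (Cmd1 k)" using True by (auto simp: t1_def to_set_def)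
        then show ?thesis using False True idl[of v]
          by (simp add: step_def Let_def absorb_plain s1_def s2_def idle_Cmd1 T_def I_def)
      next
        assume "v \<notin> S"
        then have "(\<lambda>u. t1 u v) = (\<lambda>u. None)" by (auto simp: t1_def)
        then show ?thesis using False \<open>v \<notin> S\<close> idl[of v]
          by (simp add: step_idle_None awk_def s1_def s2_def I_def)
      qed
    qed
  next
    show "t2 u v = (if v \<in> N u then (if u \<in> I then to_set (T u) (Cmd2 k) else (\<lambda>_. None)) v else None)" for u v
      using TN by (auto simp: t2_def to_set_def)
    show "(\<exists>v. ctl (s1 v) \<noteq> Idle) \<or> (\<exists>u w. t1 u w \<noteq> None)" by (intro disjI1 exI[of _ w]) (simp add: s1_def)
    show "t2 u v = Some m \<Longrightarrow> mok t m" for u v m using ok1 by (auto simp: t2_def split: if_splits)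
    show "card {(u, v). t2 u v \<noteq> None} \<le> (\<Sum>x\<in>I. card (T x))"
      by (rule card_sends) (use finT in \<open>auto simp: t2_def split: if_splits\<close>)
  qed
  define s3 where "s3 = (\<lambda>v. if v = w then (sa v)\<lparr>ctl := Top 3 k 0\<rparr> else if v \<in> S then (sa v)\<lparr>ctl := Mid w 3 k\<rparr>
     else if v \<in> Lf then (sa v)\<lparr>ctl := Leaf (P v) k\<rparr> else sa v)"
  have r3: "rch (s2, t2) (s3, lat) 1 (\<Sum>u\<in>M. card {v. lat u v \<noteq> None})"
  proof (rule rch1)
    fix v
    have pl: "plain (\<lambda>u. t2 u v)" by (auto simp: plain_def t2_def)
    show "step c n v (N v) (\<lambda>u. t2 u v) (s2 v) = (s3 v, lat v)"
    proof (cases "v \<in> I")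
      case True
      then show ?thesis using absorb_plain[OF pl]
        by (auto simp: step_def Let_def s2_def s3_def top_step_def mid_step_def I_def M_def lat_def sa_def A_def Let_def)
    next
      case False
      then have vw: "v \<noteq> w" "v \<notin> S" by (auto simp: I_def)
      show ?thesis
      proof (cases "v \<in> Lf")
        case True
        have a: "\<exists>u k'. t2 u v = Some (Cmd2 k')" using lf_parent[OF True] by (auto simp: t2_def)
        have b: "(LEAST u. \<exists>k'. t2 u v = Some (Cmd2 k')) = P v"
          unfolding P_def t2_def by (intro arg_cong[of _ _ Least] ext) auto
        have d: "(THE k'. t2 (P v) v = Some (Cmd2 k')) = k" using lf_parent[OF True] by (auto simp: t2_def)
        have e: "\<not> (\<exists>u. t2 u v = Some Ret)" "\<not> (\<exists>u K. t2 u v = Some (Call K))" "\<not> (\<exists>u. t2 u v = Some Start)"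
          "\<not> (\<exists>u k. t2 u v = Some (Cmd1 k))" by (auto simp: t2_def)
        have "step c n v (N v) (\<lambda>u. t2 u v) (s2 v) = idle_step q v (N v) (\<lambda>u. t2 u v) (\<sigma> v)"
          using absorb_plain[OF pl] vw idl[of v] by (simp add: step_def Let_def s2_def)
        also have "\<dots> = ((fst (A v))\<lparr>ctl := Leaf (P v) k\<rparr>, snd (A v))"
          unfolding idle_step_def if_not_P[OF e(1)] if_not_P[OF e(2)] if_not_P[OF e(3)] if_not_P[OF e(4)] if_P[OF a] Let_def b d
          using False by (simp add: A_def)
        finally show ?thesis using vw True by (simp add: s3_def sa_def lat_def M_def)
      next
        assume nl: "v \<notin> Lf"
        then have "(\<lambda>u. t2 u v) = (\<lambda>u. None)" using False by (auto simp: t2_def Lf_def)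
        then show ?thesis using vw nl idl[of v] False
          by (simp add: step_idle_None awk_def s2_def s3_def sa_def lat_def M_def)
      qed
    qed
  next
    show "lat u v = (if v \<in> N u then lat u v else None)" for u v
      using lat_form[of u v] by (cases "lat u v") (auto simp: hn_def)
    show "(\<exists>v. ctl (s2 v) \<noteq> Idle) \<or> (\<exists>u w. t2 u w \<noteq> None)" by (intro disjI1 exI[of _ w]) (simp add: s2_def)
    show "lat u v = Some m \<Longrightarrow> mok t m" for u v m by (rule ok2)
    show "card {(u, v). lat u v \<noteq> None} \<le> (\<Sum>u\<in>M. card {v. lat u v \<noteq> None})"
    proof (rule card_sends)
      fix u
      have "{v. lat u v \<noteq> None} \<subseteq> hn (N u) (\<sigma> u)" using lat_form by blast
      then show "finite {v. lat u v \<noteq> None}" by (rule finite_subset) simp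
    qed (use lat_form in auto)
  qed
  define t4 where "t4 = (\<lambda>u v. if u \<in> Lf \<and> v = P u then Some (Rep (C u)) else None)"
  define s4 where "s4 = (\<lambda>v. if v = w then (sb v)\<lparr>ctl := Top 4 k 0\<rparr> else if v \<in> S then (sb v)\<lparr>ctl := Mid w 4 k\<rparr> else sb v)"
  have r4: "rch (s3, lat) (s4, t4) 1 (\<Sum>x\<in>I. card (T x))"
  proof (rule rch1)
    fix v
    show "step c n v (N v) (\<lambda>u. lat u v) (s3 v) = (s4 v, if v \<in> Lf then to_set {P v} (Rep (C v)) else (\<lambda>_. None))"
    proof (cases "v \<in> M")
      case True
      have s: "ctl x = Idle \<Longrightarrow> x\<lparr>ctl := Idle\<rparr> = x" for x :: lstate by simp
      show ?thesis using True LfI idl[of v] wS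
        by (auto simp: step_def Let_def s3_def s4_def top_step_def mid_step_def I_def M_def sb_def C_def s)
    next
      case False
      then have vw: "v \<noteq> w" "v \<notin> S" "v \<notin> Lf" by (auto simp: I_def M_def)
      have "reply (\<lambda>u. lat u v) s = (\<lambda>_. None)" for s
        using lat_form[of _ v] by (auto simp: reply_def fun_eq_iff split: option.splits msg.splits)
      moreover have "lat u v \<noteq> Some Ret" "lat u v \<noteq> Some (Call K)" "lat u v \<noteq> Some Start" "lat u v \<noteq> Some (Cmd1 k')" "lat u v \<noteq> Some (Cmd2 k')" for u K k'
        using lat_form[of u v] by (cases "lat u v"; auto)+
      ultimately show ?thesis using vw idl[of v]
        by (simp add: step_def Let_def s3_def s4_def sb_def idle_step_def)
    qed
  next
    show "t4 u v = (if v \<in> N u then (if u \<in> Lf then to_set {P u} (Rep (C u)) else (\<lambda>_. None)) v else None)" for u v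
      using PN by (auto simp: t4_def to_set_def)
    show "(\<exists>v. ctl (s3 v) \<noteq> Idle) \<or> (\<exists>u w. lat u w \<noteq> None)" by (intro disjI1 exI[of _ w]) (simp add: s3_def)
    show "t4 u v = Some m \<Longrightarrow> mok t m" for u v m using ok3 by (auto simp: t4_def split: if_splits)
    \<comment> \<open>A leaf answers once even if several commands have reached it, so the answers
      are no more than the commands.\<close>
    have "card {(u, v). t4 u v \<noteq> None} \<le> (\<Sum>u\<in>Lf. card {P u})"
      by (rule card_sends) (auto simp: t4_def split: if_splits)
    also have "\<dots> = card Lf" by simp
    also have "\<dots> \<le> card (\<Union>x\<in>I. T x)" unfolding Lf_def by (rule card_mono) (use finT in auto)
    also have "\<dots> \<le> (\<Sum>x\<in>I. card (T x))" by (rule card_UN_le) simp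
    finally show "card {(u, v). t4 u v \<noteq> None} \<le> (\<Sum>x\<in>I. card (T x))" .
  qed
  have rp4: "reps (\<lambda>u. t4 u v) = ch v" for v by (auto simp: reps_def t4_def ch_def simp del: split_paired_Ex)
  have tot4: "total (\<lambda>u. t4 u v) = (\<Sum>y\<in>ch v. C y)" for v
    unfolding total_def rp4 by (rule sum.cong) (auto simp: t4_def ch_def)
  have bad4: "bads (\<lambda>u. t4 u v) = bd v" for v
    unfolding bads_alt t4_def bd_def ch_def by (auto simp del: split_paired_Ex)
  define t5 where "t5 = (\<lambda>u v. if u \<in> S \<and> v = w then Some (Rep (R u)) else None)"
  define s5 where "s5 = (\<lambda>v. if v = w then (upd_bad (bd w) (sb w))\<lparr>ctl := Top 5 k (\<Sum>y\<in>ch w. C y)\<rparr> else fin v)"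
  have r5: "rch (s4, t4) (s5, t5) 1 (card S)"
  proof (rule rch1)
    fix v
    have pl: "plain (\<lambda>u. t4 u v)" by (auto simp: plain_def t4_def)
    show "step c n v (N v) (\<lambda>u. t4 u v) (s4 v) = (s5 v, if v \<in> S then to_set {w} (Rep (R v)) else (\<lambda>_. None))"
    proof (cases "v \<in> I")
      case True
      show ?thesis
      proof (cases "v = w")
        case True
        then show ?thesis using absorb_plain[OF pl] wS
          by (simp add: step_def Let_def s4_def s5_def top_step_def upd_bad_def bad4 tot4)
      next
        case False
        then have "v \<in> S" using \<open>v \<in> I\<close> by (simp add: I_def)
        have s: "ctl x = Idle \<Longrightarrow> x\<lparr>ctl := Idle\<rparr> = x" for x :: lstate by simp
        have id: "ctl (sb v) = Idle" using idl[OF False] by simp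
        have "s4 v = (sb v)\<lparr>ctl := Mid w 4 k\<rparr>" using False \<open>v \<in> S\<close> by (simp add: s4_def)
        moreover have "s5 v = (upd_bad (bd v) (sb v))\<lparr>kids := next_kids k (ch v) (kids (sb v))\<rparr>"
          using False \<open>v \<in> S\<close> by (simp add: s5_def fin_def)
        moreover have "(upd_bad (bd v) ((sb v)\<lparr>ctl := Mid w 4 k\<rparr>))\<lparr>ctl := Idle, kids := x\<rparr> = (upd_bad (bd v) (sb v))\<lparr>kids := x\<rparr>" for x
          using id by (cases "sb v") (simp add: upd_bad_def)
        moreover have "C v = con q v (N v) True k (sb v)" using \<open>v \<in> I\<close> by (simp add: C_def)
        ultimately show ?thesis using absorb_plain[OF pl] \<open>v \<in> S\<close>
          by (simp add: step_def Let_def mid_step_def bad4 tot4 rp4 R_def)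
      qed
    next
      case False
      then have vw: "v \<noteq> w" "v \<notin> S" by (auto simp: I_def)
      have "(\<lambda>u. t4 u v) = (\<lambda>u. None)" using False lf_parent by (fastforce simp: t4_def fun_eq_iff)
      then show ?thesis using vw idl[of v]
        by (simp add: step_idle_None awk_def s4_def s5_def fin_def)
    qed
  next
    show "t5 u v = (if v \<in> N u then (if u \<in> S then to_set {w} (Rep (R u)) else (\<lambda>_. None)) v else None)" for u v
      using Nsym[of u w] by (auto simp: t5_def to_set_def S_def hn_def)
    show "(\<exists>v. ctl (s4 v) \<noteq> Idle) \<or> (\<exists>u w. t4 u w \<noteq> None)" by (intro disjI1 exI[of _ w]) (simp add: s4_def)
    show "t5 u v = Some m \<Longrightarrow> mok t m" for u v m using ok3 by (auto simp: t5_def split: if_splits)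
    have "card {(u, v). t5 u v \<noteq> None} \<le> (\<Sum>u\<in>S. card {w})"
      by (rule card_sends) (auto simp: t5_def split: if_splits)
    then show "card {(u, v). t5 u v \<noteq> None} \<le> card S" by simp
  qed
  have r6: "rch (s5, t5) (fin, \<lambda>_ _. None) 1 0"
  proof (rule rch1)
    fix v
    have pl: "plain (\<lambda>u. t5 u v)" by (auto simp: plain_def t5_def)
    have rp5: "reps (\<lambda>u. t5 u w) = S" by (auto simp: reps_def t5_def simp del: split_paired_Ex)
    have tot5: "total (\<lambda>u. t5 u w) = (\<Sum>z\<in>S. R z)"
      unfolding total_def rp5 by (rule sum.cong) (auto simp: t5_def)
    have bad5: "bads (\<lambda>u. t5 u w) = bw"
      unfolding bads_alt t5_def bw_def by (auto simp del: split_paired_Ex)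
    show "step c n v (N v) (\<lambda>u. t5 u v) (s5 v) = (fin v, \<lambda>_. None)"
    proof (cases "v = w")
      case True
      have "upd_bad bw (s\<lparr>ctl := x\<rparr>) = (upd_bad bw s)\<lparr>ctl := x\<rparr>" for s x by (simp add: upd_bad_def)
      then show ?thesis using absorb_plain[OF pl] True
        by (simp add: step_def Let_def s5_def fin_def top_step_def tot5 bad5)
    next
      case False
      have "(\<lambda>u. t5 u v) = (\<lambda>u. None)" using False by (auto simp: t5_def)
      moreover have "ctl (fin v) = Idle" using False idl[of v] by (simp add: fin_def upd_bad_def)
      ultimately show ?thesis using False
        by (simp add: step_idle_None awk_def s5_def)
    qed
  next
    show "(\<exists>v. ctl (s5 v) \<noteq> Idle) \<or> (\<exists>u w. t5 u w \<noteq> None)" by (intro disjI1 exI[of _ w]) (simp add: s5_def)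
  qed auto
  have e: "(1::nat) + 1 + 1 + 1 + 1 + 1 = 6" by simp
  have "rch (\<sigma>, \<lambda>_ _. None) (fin, \<lambda>_ _. None) (1 + 1 + 1 + 1 + 1 + 1) m"
    by (rule rch_mono[OF rch_trans[OF rch_trans[OF rch_trans[OF rch_trans[OF rch_trans[OF r1 r2] r3] r4] r5] r6]])
      (use m in simp)
  then show ?thesis unfolding e .
qed

end

section \<open>A derandomised Luby phase\<close>

lemma block_0: "block t 0 0 = {..<2 ^ t}" by (auto simp: block_def)

lemma block_full: "pre < 2 ^ t \<Longrightarrow> block t t pre = {pre}" by (auto simp: block_def)

lemma block_split:
  assumes "j < t"
  shows "block t j pre = block t (Suc j) (2 * pre) \<union> block t (Suc j) (2 * pre + 1)"
    "block t (Suc j) (2 * pre) \<inter> block t (Suc j) (2 * pre + 1) = {}"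
proof -
  have "x div 2 ^ (t - j) = x div 2 ^ (t - Suc j) div 2" for x :: nat
  proof -
    have "t - j = Suc (t - Suc j)" using assms by simp
    then show ?thesis by (simp only: power_Suc2 div_mult2_eq)
  qed
  then show "block t j pre = block t (Suc j) (2 * pre) \<union> block t (Suc j) (2 * pre + 1)"
    by (auto simp: block_def)
  show "block t (Suc j) (2 * pre) \<inter> block t (Suc j) (2 * pre + 1) = {}"
    by (auto simp: block_def)
qed

lemma finite_block [simp]: "finite (block t j pre)"
  by (rule finite_subset[of _ "{..<2 ^ t}"]) (auto simp: block_def)

text \<open>The method of conditional expectations: the better half of a block carries at least half
  of the sum.\<close>

lemma block_choice:
  fixes f :: "nat \<Rightarrow> int"
  assumes "j < t" and pre': "pre' = (if sum f (block t (Suc j) (2 * pre)) \<ge> sum f (block t (Suc j) (2 * pre + 1)) then 2 * pre else 2 * pre + 1)"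
  shows "2 * sum f (block t (Suc j) pre') \<ge> sum f (block t j pre)"
proof -
  have "sum f (block t j pre) = sum f (block t (Suc j) (2 * pre)) + sum f (block t (Suc j) (2 * pre + 1))"
    unfolding block_split(1)[OF assms(1)] by (rule sum.union_disjoint) (use block_split(2)[OF assms(1)] in auto)
  then show ?thesis using pre' by auto
qed

section \<open>Collisions in the affine hash family\<close>

lemma hits_bound:
  fixes d u t Q :: nat
  assumes "0 < d" "d \<le> t" "u < Q"
  shows "card {a. a < Q \<and> (u + a * d) mod Q < t} \<le> 4 * t"
proof -
  let ?A = "{a. a < Q \<and> (u + a * d) mod Q < t}"
  \<comment> \<open>Walking around a cycle of length \<open>Q\<close> in steps of \<open>d\<close>,
    the walk makes at most \<open>d + 1\<close> turns, and each turn meets the initial segment of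
    length \<open>t\<close> in at most \<open>t div d + 1\<close> points. The turn and the index of
    the point determine \<open>a\<close>; as \<open>d \<le> t\<close>, the product is at most
    \<open>4 * t\<close>.\<close>
  let ?f = "\<lambda>a. ((u + a * d) div Q, ((u + a * d) mod Q) div d)"
  have "inj_on ?f ?A"
  proof (rule inj_onI)
    have *: "a \<le> b" if "?f a = ?f b" for a b
    proof (rule ccontr)
      assume "\<not> a \<le> b"
      then have ba: "b < a" by simp
      have e: "(u + a * d) mod Q + Q * ((u + a * d) div Q) = u + a * d"
        "(u + b * d) mod Q + Q * ((u + b * d) div Q) = u + b * d" by simp_all
      have "(u + a * d) mod Q = (u + b * d) mod Q + (a - b) * d"
      proof -
        have "a * d = b * d + (a - b) * d" using ba by (metis add_mult_distrib le_add_diff_inverse less_imp_le)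
        moreover have "Q * ((u + a * d) div Q) = Q * ((u + b * d) div Q)" using that by simp
        ultimately show ?thesis using e by linarith
      qed
      moreover have "(a - b) * d \<ge> 1 * d" using ba by (intro mult_right_mono) auto
      then have "(a - b) * d \<ge> d" by simp
      ultimately have "((u + a * d) mod Q) div d \<ge> ((u + b * d) mod Q + d) div d" by (simp add: div_le_mono)
      then show False using that assms(1) by simp
    qed
    fix a b assume "?f a = ?f b"
    then show "a = b" using *[of a b] *[of b a] by simp
  qed
  moreover have "?f ` ?A \<subseteq> {..d} \<times> {..t div d}"
  proof
    fix p assume "p \<in> ?f ` ?A"
    then obtain a where a: "a < Q" "(u + a * d) mod Q < t" "p = ?f a" by auto
    have "u + a * d < Q * Suc d"
    proof -
      have "a * d \<le> Q * d" using a by (intro mult_right_mono) auto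
      then show ?thesis using assms(3) unfolding mult_Suc_right by linarith
    qed
    then have "(u + a * d) div Q < Suc d" using assms(3) by (simp add: less_mult_imp_div_less mult.commute)
    moreover have "((u + a * d) mod Q) div d \<le> t div d" using a(2) by (simp add: div_le_mono)
    ultimately show "p \<in> {..d} \<times> {..t div d}" using a(3) by auto
  qed
  ultimately have "card ?A \<le> card ({..d} \<times> {..t div d})"
    by (intro card_inj_on_le[of ?f]) auto
  also have "\<dots> = (d + 1) * (t div d + 1)" by (simp add: card_cartesian_product)
  also have "\<dots> = d * (t div d) + d + t div d + 1" by (simp add: algebra_simps)
  also have "\<dots> \<le> t + t + t + t" using assms by (intro add_mono) (auto simp: mult.commute[of d] div_times_less_eq_dividend)
  finally show ?thesis by simp
qed

lemma shift_count:
  fixes Q r t :: nat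
  assumes "t \<le> Q" "0 < Q"
  shows "card {b. b < Q \<and> (r + b) mod Q < t} = t"
    and "inj_on (\<lambda>b. (r + b) mod Q) {..<Q}"
proof -
  show inj: "inj_on (\<lambda>b. (r + b) mod Q) {..<Q}"
  proof (rule inj_onI)
    fix a b assume ab: "a \<in> {..<Q}" "b \<in> {..<Q}" "(r + a) mod Q = (r + b) mod Q"
    have *: "x = y" if "x \<le> y" "y < Q" "(r + x) mod Q = (r + y) mod Q" for x y
    proof -
      have "Q dvd (r + y) - (r + x)" using that(3) mod_eq_dvd_iff_nat[of "r + x" "r + y" Q] that(1) by auto
      then have "Q dvd y - x" by simp
      then show ?thesis using that dvd_imp_le[of Q "y - x"] by force
    qed
    show "a = b"
    proof (cases "a \<le> b")
      case True
      show ?thesis by (rule *[OF True _ ab(3)]) (use ab in simp)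
    next
      case False
      then have "b \<le> a" by simp
      from *[OF this _ ab(3)[symmetric]] show ?thesis using ab(1) by simp
    qed
  qed
  have im: "(\<lambda>b. (r + b) mod Q) ` {..<Q} = {..<Q}"
    by (rule endo_inj_surj) (use inj assms in auto)
  let ?B = "{b. b < Q \<and> (r + b) mod Q < t}"
  have "(\<lambda>b. (r + b) mod Q) ` ?B = {..<t}"
  proof
    show "{..<t} \<subseteq> (\<lambda>b. (r + b) mod Q) ` ?B"
    proof
      fix y assume y: "y \<in> {..<t}"
      then have "y \<in> (\<lambda>b. (r + b) mod Q) ` {..<Q}" using im assms(1) by auto
      then show "y \<in> (\<lambda>b. (r + b) mod Q) ` ?B" using y by auto
    qed
  qed auto
  moreover have "inj_on (\<lambda>b. (r + b) mod Q) ?B" by (rule inj_on_subset[OF inj]) auto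
  ultimately show "card ?B = t" using card_image by fastforce
qed

lemma seed_bij: "bij_betw (\<lambda>s. (s div 2 ^ q, s mod 2 ^ q)) {..<2 ^ (2 * q)} ({..<2 ^ q} \<times> {..<(2::nat) ^ q})"
proof (rule bij_betw_byWitness[where f' = "\<lambda>(a, b). a * 2 ^ q + b"])
  have e: "(2::nat) ^ (2 * q) = 2 ^ q * 2 ^ q" by (simp add: mult_2 power_add)
  show "(\<lambda>s. (s div 2 ^ q, s mod 2 ^ q)) ` {..<2 ^ (2 * q)} \<subseteq> {..<2 ^ q} \<times> {..<(2::nat) ^ q}"
    unfolding e by (auto simp: less_mult_imp_div_less)
  show "(\<lambda>(a, b). a * 2 ^ q + b) ` ({..<2 ^ q} \<times> {..<(2::nat) ^ q}) \<subseteq> {..<2 ^ (2 * q)}"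
  proof -
    have "a * 2 ^ q + b < 2 ^ q * 2 ^ q" if "a < 2 ^ q" "b < 2 ^ q" for a b :: nat
    proof -
      have "a * 2 ^ q + b < a * 2 ^ q + 2 ^ q" using that by simp
      also have "\<dots> = Suc a * 2 ^ q" by simp
      also have "\<dots> \<le> 2 ^ q * 2 ^ q" using that by (intro mult_right_mono) auto
      finally show ?thesis .
    qed
    then show ?thesis unfolding e by auto
  qed
qed (simp_all add: div_mult_mod_eq split_beta)

definition seeds :: "nat \<Rightarrow> (nat \<Rightarrow> nat \<Rightarrow> bool) \<Rightarrow> nat set" where
  "seeds q R = {s. s < 2 ^ (2 * q) \<and> R (s div 2 ^ q) (s mod 2 ^ q)}"

lemma card_seeds: "card (seeds q R) = (\<Sum>a<2 ^ q. card {b. b < 2 ^ q \<and> R a b})"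
proof -
  have "bij_betw (\<lambda>s. (s div 2 ^ q, s mod 2 ^ q)) (seeds q R) (SIGMA a:{..<2 ^ q}. {b. b < 2 ^ q \<and> R a b})"
  proof (rule bij_betw_subset[OF seed_bij])
    show "(\<lambda>s. (s div 2 ^ q, s mod 2 ^ q)) ` seeds q R = (SIGMA a:{..<2 ^ q}. {b. b < 2 ^ q \<and> R a b})"
    proof
      show "(\<lambda>s. (s div 2 ^ q, s mod 2 ^ q)) ` seeds q R \<subseteq> (SIGMA a:{..<2 ^ q}. {b. b < 2 ^ q \<and> R a b})"
      proof
        fix p assume "p \<in> (\<lambda>s. (s div 2 ^ q, s mod 2 ^ q)) ` seeds q R"
        then obtain s where s: "p = (s div 2 ^ q, s mod 2 ^ q)" "s \<in> {..<2 ^ (2 * q)}" "R (s div 2 ^ q) (s mod 2 ^ q)"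
          by (auto simp: seeds_def)
        then have "p \<in> {..<2 ^ q} \<times> {..<2 ^ q}" using bij_betwE[OF seed_bij[of q]] by blast
        then show "p \<in> (SIGMA a:{..<2 ^ q}. {b. b < 2 ^ q \<and> R a b})" using s by simp
      qed
      show "(SIGMA a:{..<2 ^ q}. {b. b < 2 ^ q \<and> R a b}) \<subseteq> (\<lambda>s. (s div 2 ^ q, s mod 2 ^ q)) ` seeds q R"
      proof
        fix p assume p: "p \<in> (SIGMA a:{..<2 ^ q}. {b. b < 2 ^ q \<and> R a b})"
        then have "p \<in> (\<lambda>s. (s div 2 ^ q, s mod 2 ^ q)) ` {..<2 ^ (2 * q)}"
          using seed_bij[of q] by (auto simp: bij_betw_def)
        then show "p \<in> (\<lambda>s. (s div 2 ^ q, s mod 2 ^ q)) ` seeds q R" using p by (auto simp: seeds_def)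
      qed
    qed
  qed (auto simp: seeds_def)
  then show ?thesis by (simp add: bij_betw_same_card)
qed

lemma single_count:
  assumes "t \<le> 2 ^ q"
  shows "card {s. s < 2 ^ (2 * q) \<and> hash q s x < t} = 2 ^ q * t"
proof -
  have "{s. s < 2 ^ (2 * q) \<and> hash q s x < t} = seeds q (\<lambda>a b. (a * x + b) mod 2 ^ q < t)"
    by (simp add: seeds_def hash_def)
  then show ?thesis using shift_count(1)[OF assms] by (simp add: card_seeds)
qed

text \<open>If the hash of \<open>x\<close> is \<open>u\<close>, that of \<open>y\<close> is
  \<open>u\<close> shifted by \<open>a * (y - x)\<close>, and \<open>hits_bound\<close> counts the
  coefficients \<open>a\<close> for which this is small too. The modulus is a power of two and not a
  prime, so independence is only approximate: the factor four and the condition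
  \<open>y - x \<le> t\<close> are the price.\<close>

lemma pair_count_less:
  assumes "t \<le> 2 ^ q" "x < y" "y - x \<le> t"
  shows "card {s. s < 2 ^ (2 * q) \<and> hash q s x < t \<and> hash q s y < t} \<le> 4 * t * t"
proof -
  let ?Q = "2 ^ q :: nat"
  let ?d = "y - x"
  have xy: "a * y + b = (a * x + b) + a * ?d" for a b
    using assms(2) by (metis add.assoc add.commute add_mult_distrib2 le_add_diff_inverse less_imp_le)
  let ?h = "\<lambda>(a, b). (a, (a * x + b) mod ?Q)"
  let ?G = "SIGMA a:{..<?Q}. {b. b < ?Q \<and> (a * x + b) mod ?Q < t \<and> (a * y + b) mod ?Q < t}"
  let ?H = "SIGMA u:{..<t}. {a. a < ?Q \<and> (u + a * ?d) mod ?Q < t}"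
  have "inj_on ?h ?G"
  proof (rule inj_onI)
    fix p p' assume a: "p \<in> ?G" "p' \<in> ?G" "?h p = ?h p'"
    obtain a b a' b' where p: "p = (a, b)" "p' = (a', b')" by (cases p, cases p') blast
    then have e: "a = a'" "(a * x + b) mod ?Q = (a * x + b') mod ?Q" "b < ?Q" "b' < ?Q" using a by auto
    have "b = b'" using inj_onD[OF shift_count(2)[of 0 ?Q "a * x"] e(2)] e by simp
    then show "p = p'" using p e by simp
  qed
  moreover have "prod.swap ` ?h ` ?G \<subseteq> ?H"
  proof -
    have "((a * x + b) mod ?Q + a * ?d) mod ?Q = (a * y + b) mod ?Q" for a b
      unfolding xy by (simp add: mod_add_left_eq)
    then show ?thesis by auto
  qed
  ultimately have "card ?G \<le> card ?H"
    by (intro card_inj_on_le[of "prod.swap \<circ> ?h"]) (auto simp: image_comp intro!: comp_inj_on)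
  also have "\<dots> = (\<Sum>u<t. card {a. a < ?Q \<and> (u + a * ?d) mod ?Q < t})" by simp
  also have "\<dots> \<le> (\<Sum>u<t. 4 * t)"
    by (rule sum_mono, rule hits_bound) (use assms in auto)
  also have "\<dots> = 4 * t * t" by simp
  finally have "card ?G \<le> 4 * t * t" .
  moreover have "card {s. s < 2 ^ (2 * q) \<and> hash q s x < t \<and> hash q s y < t} = card ?G"
  proof -
    have "{s. s < 2 ^ (2 * q) \<and> hash q s x < t \<and> hash q s y < t}
      = seeds q (\<lambda>a b. (a * x + b) mod ?Q < t \<and> (a * y + b) mod ?Q < t)"
      by (simp add: seeds_def hash_def)
    then show ?thesis by (simp add: card_seeds)
  qed
  ultimately show ?thesis by simp
qed

lemma pair_count:
  assumes "t \<le> 2 ^ q" "x \<noteq> y" "x < b" "y < b" "b \<le> t"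
  shows "card {s. s < 2 ^ (2 * q) \<and> hash q s x < t \<and> hash q s y < t} \<le> 4 * t * t"
proof (cases "x < y")
  case True
  then show ?thesis using pair_count_less[OF assms(1) True] assms by simp
next
  case False
  then have "y < x" using assms by simp
  then have "card {s. s < 2 ^ (2 * q) \<and> hash q s y < t \<and> hash q s x < t} \<le> 4 * t * t"
    using pair_count_less[OF assms(1)] assms by simp
  then show ?thesis by (simp add: conj_commute conj_left_commute)
qed

section \<open>Luby's analysis with local estimators\<close>

locale luby =
  fixes Y :: "vertex set" and adj :: "vertex \<Rightarrow> vertex set" and q b D :: nat
  assumes finY: "finite Y"
    and adj_sub: "\<And>v. v \<in> Y \<Longrightarrow> adj v \<subseteq> Y - {v}"
    and adj_sym: "\<And>u v. u \<in> Y \<Longrightarrow> v \<in> Y \<Longrightarrow> u \<in> adj v \<Longrightarrow> v \<in> adj u"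
    and ids: "\<And>v. v \<in> Y \<Longrightarrow> v < b"
    and deg: "card Y \<le> D"
    and big: "16 * D * b \<le> 2 ^ q"
begin

definition "d v = card (adj v)"
definition "F v s = int (gain q v (adj v) d s) - int (loss q v (adj v) d s)"
definition "joins s v \<longleftrightarrow> (\<forall>u\<in>adj v. hash q s v < hash q s u)"
definition "killed s = {w \<in> Y. \<exists>v\<in>adj w. joins s v}"
definition "tau v w = thr q (d v) (d w)"
definition "hit s v w u \<longleftrightarrow> hash q s v < tau v w \<and> hash q s u < tau v w"
definition "g v w s = int (d w) * (of_bool (hash q s v < tau v w)
   - (\<Sum>u\<in>adj v. of_bool (hit s v w u)) - (\<Sum>u\<in>adj w - {v}. of_bool (hit s v w u)))"

lemma fin_adj: "v \<in> Y \<Longrightarrow> finite (adj v)"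
  using finY adj_sub finite_subset by blast

lemma swap_pairs: "(\<Sum>v\<in>Y. \<Sum>w\<in>adj v. f v w) = (\<Sum>w\<in>Y. \<Sum>v\<in>adj w. f v w)"
proof -
  have a: "adj v = {w \<in> Y. w \<in> adj v}" if "v \<in> Y" for v using adj_sub that by blast
  have b: "adj w = {v \<in> Y. w \<in> adj v}" if "w \<in> Y" for w using adj_sub adj_sym that by blast
  have "(\<Sum>v\<in>Y. \<Sum>w\<in>adj v. f v w) = (\<Sum>v\<in>Y. \<Sum>w\<in>{w \<in> Y. w \<in> adj v}. f v w)"
    by (rule sum.cong) (use a in auto)
  also have "\<dots> = (\<Sum>w\<in>Y. \<Sum>v\<in>{v \<in> Y. w \<in> adj v}. f v w)"
    by (rule sum.swap_restrict) (rule finY)+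
  also have "\<dots> = (\<Sum>w\<in>Y. \<Sum>v\<in>adj w. f v w)"
    by (rule sum.cong) (use b in auto)
  finally show ?thesis .
qed

text \<open>A collision next to the killed vertex \<open>w\<close> may involve neighbours of
  \<open>w\<close> unknown to \<open>v\<close>. The second part of \<open>loss\<close> therefore
  lets \<open>w\<close> account for it, and exchanging the order of summation over adjacent pairs
  restores the terms \<open>g\<close>.\<close>

lemma sum_F: "(\<Sum>v\<in>Y. F v s) = (\<Sum>v\<in>Y. \<Sum>w\<in>adj v. g v w s)"
proof -
  have F: "F v s = (\<Sum>w\<in>adj v. int (d w) * (of_bool (hash q s v < tau v w) - (\<Sum>u\<in>adj v. of_bool (hit s v w u))))
      - (\<Sum>x\<in>adj v. int (d v) * (\<Sum>u\<in>adj v - {x}. of_bool (hit s x v u)))" for v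
    unfolding F_def gain_def loss_def d_def[symmetric] tau_def hit_def
    by (simp add: sum_subtractf right_diff_distrib)
  have "(\<Sum>v\<in>Y. F v s) = (\<Sum>v\<in>Y. \<Sum>w\<in>adj v. int (d w) * (of_bool (hash q s v < tau v w) - (\<Sum>u\<in>adj v. of_bool (hit s v w u))))
      - (\<Sum>v\<in>Y. \<Sum>x\<in>adj v. int (d v) * (\<Sum>u\<in>adj v - {x}. of_bool (hit s x v u)))"
    unfolding F by (rule sum_subtractf)
  also have "(\<Sum>v\<in>Y. \<Sum>x\<in>adj v. int (d v) * (\<Sum>u\<in>adj v - {x}. of_bool (hit s x v u)))
      = (\<Sum>v\<in>Y. \<Sum>w\<in>adj v. int (d w) * (\<Sum>u\<in>adj w - {v}. of_bool (hit s v w u)))"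
    by (rule swap_pairs[symmetric])
  finally show ?thesis
    by (simp add: g_def sum_subtractf right_diff_distrib)
qed

definition "kills s v w \<longleftrightarrow> hash q s v < tau v w \<and> (\<forall>u\<in>adj v \<union> adj w - {v}. \<not> hash q s u < tau v w)"

text \<open>Bonferroni's inequality: as soon as another vertex below the threshold spoils the kill,
  the collision terms subtract at least one.\<close>

lemma g_le: 
  assumes "v \<in> Y" "w \<in> adj v"
  shows "g v w s \<le> int (d w) * of_bool (kills s v w)"
proof -
  have w: "w \<in> Y" "v \<in> adj w" using assms adj_sub adj_sym by blast+
  have fa: "finite (adj v)" "finite (adj w - {v})" using fin_adj assms w by auto
  let ?a = "(\<Sum>u\<in>adj v. of_bool (hit s v w u)) :: int"
  let ?b = "(\<Sum>u\<in>adj w - {v}. of_bool (hit s v w u)) :: int"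
  have nn: "?a \<ge> 0" "?b \<ge> 0" by (auto intro: sum_nonneg)
  have "of_bool (hash q s v < tau v w) - ?a - ?b \<le> of_bool (kills s v w)"
  proof (cases "hash q s v < tau v w \<and> \<not> kills s v w")
    case True
    then obtain u where u: "u \<in> adj v \<union> adj w - {v}" "hit s v w u" by (auto simp: kills_def hit_def)
    have "u \<in> adj v \<or> u \<in> adj w - {v}" using u by auto
    then have "?a \<ge> 1 \<or> ?b \<ge> 1"
    proof
      assume "u \<in> adj v"
      then have "of_bool (hit s v w u) \<le> ?a" by (intro member_le_sum) (use fa in auto)
      then show ?thesis using u by simp
    next
      assume "u \<in> adj w - {v}"
      then have "of_bool (hit s v w u) \<le> ?b" by (intro member_le_sum) (use fa in auto)
      then show ?thesis using u by simp
    qed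
    then show ?thesis using nn True by auto
  next
    case False
    then show ?thesis using nn by auto
  qed
  then show ?thesis unfolding g_def by (intro mult_left_mono) auto
qed

text \<open>Of two killers each lies below its own threshold while the other does not, which would
  order the two hash values strictly both ways.\<close>

lemma kills_unique:
  assumes "w \<in> Y" "v \<in> adj w" "v' \<in> adj w" "kills s v w" "kills s v' w"
  shows "v = v'"
proof (rule ccontr)
  assume "v \<noteq> v'"
  then have "\<not> hash q s v' < tau v w" "\<not> hash q s v < tau v' w"
    "hash q s v < tau v w" "hash q s v' < tau v' w" using assms by (auto simp: kills_def)
  then show False by simp
qed

lemma kills_killed:
  assumes "w \<in> Y" "v \<in> adj w" "kills s v w"
  shows "w \<in> killed s"
proof -
  have "v \<notin> adj v" using adj_sub[of w] adj_sub[of v] assms by blast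
  have "joins s v" unfolding joins_def
  proof
    fix u assume "u \<in> adj v"
    then have "hash q s v < tau v w" "\<not> hash q s u < tau v w"
      using assms(3) \<open>v \<notin> adj v\<close> by (auto simp: kills_def)
    then show "hash q s v < hash q s u" by simp
  qed
  then show ?thesis using assms by (auto simp: killed_def)
qed

text \<open>Since only one neighbour can kill a given vertex in the sense of \<open>kills\<close>,
  no degree is counted twice.\<close>

lemma sum_F_le: "(\<Sum>v\<in>Y. F v s) \<le> int (\<Sum>w\<in>killed s. d w)"
proof -
  have "(\<Sum>v\<in>Y. F v s) \<le> (\<Sum>v\<in>Y. \<Sum>w\<in>adj v. int (d w) * of_bool (kills s v w))"
    unfolding sum_F by (intro sum_mono g_le)
  also have "\<dots> = (\<Sum>w\<in>Y. \<Sum>v\<in>adj w. int (d w) * of_bool (kills s v w))" by (rule swap_pairs)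
  also have "\<dots> \<le> (\<Sum>w\<in>Y. if w \<in> killed s then int (d w) else 0)"
  proof (rule sum_mono)
    fix w assume w: "w \<in> Y"
    have "(\<Sum>v\<in>adj w. of_bool (kills s v w)) = int (card {v \<in> adj w. kills s v w})"
      using fin_adj[OF w] by (simp add: of_bool_def sum.If_cases Int_def)
    moreover have "card {v \<in> adj w. kills s v w} \<le> of_bool (w \<in> killed s)"
    proof (cases "w \<in> killed s")
      case True
      have "{v \<in> adj w. kills s v w} \<subseteq> {SOME v. v \<in> adj w \<and> kills s v w}"
        using kills_unique[OF w] by (auto intro!: some_equality[symmetric])
      then have "card {v \<in> adj w. kills s v w} \<le> card {SOME v. v \<in> adj w \<and> kills s v w}"
        by (intro card_mono) auto
      then show ?thesis using True by simp
    next
      case False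
      then have "{v \<in> adj w. kills s v w} = {}" using kills_killed[OF w] by blast
      then have "card {v \<in> adj w. kills s v w} = 0" by (metis card.empty)
      then show ?thesis by simp
    qed
    ultimately have "(\<Sum>v\<in>adj w. of_bool (kills s v w)) \<le> (of_bool (w \<in> killed s) :: int)"
      by (cases "w \<in> killed s") auto
    then have "int (d w) * (\<Sum>v\<in>adj w. of_bool (kills s v w)) \<le> int (d w) * of_bool (w \<in> killed s)"
      by (intro mult_left_mono) auto
    then show "(\<Sum>v\<in>adj w. int (d w) * of_bool (kills s v w)) \<le> (if w \<in> killed s then int (d w) else 0)"
      by (cases "w \<in> killed s") (simp_all add: sum_distrib_left)
  qed
  also have "\<dots> = (\<Sum>w\<in>Y \<inter> killed s. int (d w))" by (simp add: sum.inter_restrict[OF finY])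
  also have "Y \<inter> killed s = killed s" by (auto simp: killed_def)
  finally show ?thesis by simp
qed

text \<open>Let \<open>e\<close> be the sum of both degrees. The hash of \<open>v\<close> is below
  the threshold with probability between \<open>1 / (16 * e)\<close> and \<open>1 / (8 * e)\<close>,
  the gap being due to rounding. The factor eight is chosen so that the expected number of
  collisions takes away at most half of this probability, leaving
  \<open>1 / (32 * e)\<close>.\<close>

lemma sum_g_ge:
  assumes "v \<in> Y" "w \<in> adj v"
  shows "2 ^ q * 2 ^ q * real (d w) / (32 * (real (d v) + real (d w))) \<le> real_of_int (\<Sum>s<2 ^ (2 * q). g v w s)"
proof -
  define Q :: nat where "Q = 2 ^ q"
  define \<tau> where "\<tau> = tau v w"
  define e where "e = d v + d w"
  have w: "w \<in> Y" "v \<in> adj w" "w \<noteq> v" using assms adj_sub adj_sym by blast+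
  have d1: "1 \<le> d v" "1 \<le> d w" using fin_adj assms w by (auto simp: d_def Suc_le_eq card_gt_0_iff)
  have dle: "d x \<le> D" if "x \<in> Y" for x
  proof -
    have "d x \<le> card Y" unfolding d_def by (rule card_mono[OF finY]) (use adj_sub that in auto)
    then show ?thesis using deg by simp
  qed
  have e: "1 \<le> e" "e \<le> 2 * D" using d1 dle[OF w(1)] dle[OF assms(1)] by (auto simp: e_def)
  have tau: "\<tau> = Q div (8 * e)" by (simp add: \<tau>_def tau_def thr_def Q_def e_def)
  have t1: "8 * e * \<tau> \<le> Q" unfolding tau by simp
  \<comment> \<open>The threshold has to exceed all identifiers, because \<open>pair_count\<close>
    covers only differences up to the threshold. This is what \<open>big\<close> provides.\<close>
  have "b * (8 * e) \<le> b * (16 * D)" using e by (intro mult_left_mono) auto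
  also have "\<dots> \<le> Q" using big by (simp add: Q_def mult_ac)
  finally have tb: "b \<le> \<tau>" unfolding tau using e by (simp add: less_eq_div_iff_mult_less_eq)
  have b1: "1 \<le> b" using ids[OF w(1)] by simp
  have t2: "Q \<le> 16 * e * \<tau>"
  proof -
    have "Q < 8 * e * (\<tau> + 1)" using e unfolding tau by (simp add: dividend_less_times_div)
    also have "\<dots> \<le> 8 * e * (2 * \<tau>)" using tb b1 by (intro mult_left_mono) auto
    finally show ?thesis by simp
  qed
  have tQ: "\<tau> \<le> 2 ^ q" unfolding tau Q_def by simp
  have cnt: "(\<Sum>s<2 ^ (2 * q). of_bool (R s)) = int (card {s. s < 2 ^ (2 * q) \<and> R s})" for R :: "nat \<Rightarrow> bool"
    by (simp add: of_bool_def sum.If_cases Int_def lessThan_def)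
  have pc: "(\<Sum>s<2 ^ (2 * q). of_bool (hit s v w u)) \<le> 4 * int \<tau> * int \<tau>" if "u \<in> Y" "u \<noteq> v" for u
  proof -
    have "card {s. s < 2 ^ (2 * q) \<and> hash q s v < \<tau> \<and> hash q s u < \<tau>} \<le> 4 * \<tau> * \<tau>"
      by (rule pair_count[of _ _ _ _ b]) (use tQ tb that ids assms in auto)
    then have "int (card {s. s < 2 ^ (2 * q) \<and> hash q s v < \<tau> \<and> hash q s u < \<tau>}) \<le> int (4 * \<tau> * \<tau>)" by (simp only: of_nat_le_iff)
    then show ?thesis unfolding cnt hit_def \<tau>_def[symmetric] by simp
  qed
  have s1: "(\<Sum>s<2 ^ (2 * q). of_bool (hash q s v < \<tau>)) = int Q * int \<tau>"
    unfolding cnt using single_count[OF tQ, of v] by (simp add: Q_def)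
  have bnd: "(\<Sum>s<2 ^ (2 * q). \<Sum>u\<in>A. of_bool (hit s v w u)) \<le> int (card A) * (4 * int \<tau> * int \<tau>)" if "A \<subseteq> Y - {v}" for A
  proof -
    have "(\<Sum>s<2 ^ (2 * q). \<Sum>u\<in>A. of_bool (hit s v w u)) = (\<Sum>u\<in>A. \<Sum>s<2 ^ (2 * q). of_bool (hit s v w u) :: int)"
      by (rule sum.swap)
    also have "\<dots> \<le> (\<Sum>u\<in>A. 4 * int \<tau> * int \<tau>)" by (rule sum_mono, rule pc) (use that in auto)
    finally show ?thesis by simp
  qed
  have A1: "adj v \<subseteq> Y - {v}" "adj w - {v} \<subseteq> Y - {v}" using adj_sub assms w by blast+
  have c2: "card (adj w - {v}) \<le> d w" unfolding d_def by (rule card_mono) (use fin_adj w in auto)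
  have "(\<Sum>s<2 ^ (2 * q). g v w s) = int (d w) * ((\<Sum>s<2 ^ (2 * q). of_bool (hash q s v < \<tau>))
     - (\<Sum>s<2 ^ (2 * q). \<Sum>u\<in>adj v. of_bool (hit s v w u)) - (\<Sum>s<2 ^ (2 * q). \<Sum>u\<in>adj w - {v}. of_bool (hit s v w u)))"
    unfolding g_def \<tau>_def by (simp add: sum_distrib_left[symmetric] sum_subtractf)
  also have "\<dots> \<ge> int (d w) * (int Q * int \<tau> - int (d v) * (4 * int \<tau> * int \<tau>) - int (d w) * (4 * int \<tau> * int \<tau>))"
  proof (rule mult_left_mono)
    have "int (card (adj w - {v})) * (4 * int \<tau> * int \<tau>) \<le> int (d w) * (4 * int \<tau> * int \<tau>)"
      using c2 by (intro mult_right_mono) auto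
    then show "int Q * int \<tau> - int (d v) * (4 * int \<tau> * int \<tau>) - int (d w) * (4 * int \<tau> * int \<tau>)
      \<le> (\<Sum>s<2 ^ (2 * q). of_bool (hash q s v < \<tau>))
     - (\<Sum>s<2 ^ (2 * q). \<Sum>u\<in>adj v. of_bool (hit s v w u)) - (\<Sum>s<2 ^ (2 * q). \<Sum>u\<in>adj w - {v}. of_bool (hit s v w u))"
      using bnd[OF A1(1)] bnd[OF A1(2)] unfolding s1 d_def[of v, symmetric] by linarith
  qed simp
  finally have "real_of_int (int (d w) * (int Q * int \<tau> - int (d v) * (4 * int \<tau> * int \<tau>) - int (d w) * (4 * int \<tau> * int \<tau>)))
    \<le> real_of_int (\<Sum>s<2 ^ (2 * q). g v w s)"
    by (simp only: of_int_le_iff)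
  moreover have "real_of_int (int (d w) * (int Q * int \<tau> - int (d v) * (4 * int \<tau> * int \<tau>) - int (d w) * (4 * int \<tau> * int \<tau>)))
    = real (d w) * (real Q * real \<tau> - real e * (4 * real \<tau> * real \<tau>))"
    by (simp add: e_def algebra_simps)
  ultimately have ge: "real (d w) * (real Q * real \<tau> - real e * (4 * real \<tau> * real \<tau>)) \<le> real_of_int (\<Sum>s<2 ^ (2 * q). g v w s)"
    by (simp only:)
  have r1: "8 * real e * real \<tau> \<le> real Q" "real Q \<le> 16 * real e * real \<tau>"
    using t1 t2 by (metis of_nat_le_iff of_nat_mult of_nat_numeral)+
  have "real e * (4 * real \<tau> * real \<tau>) \<le> real Q * real \<tau> / 2"
    using mult_right_mono[OF r1(1), of "real \<tau>"] by (simp add: mult_ac)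
  then have "real Q * real \<tau> / 2 \<le> real Q * real \<tau> - real e * (4 * real \<tau> * real \<tau>)" by simp
  moreover have "real Q * real Q / (32 * real e) \<le> real Q * real \<tau> / 2"
  proof -
    have "real Q * real Q \<le> real Q * (16 * real e * real \<tau>)" using r1 by (intro mult_left_mono) auto
    then show ?thesis using e by (simp add: field_simps)
  qed
  ultimately have "real (d w) * (real Q * real Q / (32 * real e)) \<le> real (d w) * (real Q * real \<tau> - real e * (4 * real \<tau> * real \<tau>))"
    by (intro mult_left_mono) auto
  then have "real (d w) * (real Q * real Q / (32 * real e)) \<le> real_of_int (\<Sum>s<2 ^ (2 * q). g v w s)"
    using ge by linarith
  then show ?thesis by (simp add: Q_def e_def mult_ac)
qed

text \<open>The weights \<open>h\<close> of the two orientations of an edge add up to one. So,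
  however unequal the degrees are, a fixed fraction of the degree sum is killed on average.\<close>

lemma sum_F_ge: "2 ^ (2 * q) * real (\<Sum>v\<in>Y. d v) / 64 \<le> real_of_int (\<Sum>s<2 ^ (2 * q). \<Sum>v\<in>Y. F v s)"
proof -
  let ?c = "2 ^ q * 2 ^ q / 32 :: real"
  define h where "h v w = real (d w) / (real (d v) + real (d w))" for v w
  have "(\<Sum>v\<in>Y. \<Sum>w\<in>adj v. h v w) = (\<Sum>v\<in>Y. \<Sum>w\<in>adj v. h w v)" by (rule swap_pairs[symmetric])
  then have "2 * (\<Sum>v\<in>Y. \<Sum>w\<in>adj v. h v w) = (\<Sum>v\<in>Y. \<Sum>w\<in>adj v. h v w + h w v)"
    by (simp add: sum.distrib)
  also have "\<dots> = (\<Sum>v\<in>Y. \<Sum>w\<in>adj v. 1)"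
  proof (intro sum.cong refl)
    fix v w assume "v \<in> Y" "w \<in> adj v"
    then have "d v > 0" using fin_adj by (auto simp: d_def card_gt_0_iff)
    then show "h v w + h w v = 1" by (simp add: h_def add.commute flip: add_divide_distrib)
  qed
  also have "\<dots> = real (\<Sum>v\<in>Y. d v)" by (simp add: d_def)
  finally have hh: "(\<Sum>v\<in>Y. \<Sum>w\<in>adj v. h v w) = real (\<Sum>v\<in>Y. d v) / 2" by simp
  have "(\<Sum>s<2 ^ (2 * q). \<Sum>v\<in>Y. F v s) = (\<Sum>v\<in>Y. \<Sum>w\<in>adj v. \<Sum>s<2 ^ (2 * q). g v w s)"
  proof -
    have "(\<Sum>s<2 ^ (2 * q). \<Sum>v\<in>Y. F v s) = (\<Sum>s<2 ^ (2 * q). \<Sum>v\<in>Y. \<Sum>w\<in>adj v. g v w s)" by (simp only: sum_F)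
    also have "\<dots> = (\<Sum>v\<in>Y. \<Sum>s<2 ^ (2 * q). \<Sum>w\<in>adj v. g v w s)" by (rule sum.swap)
    also have "\<dots> = (\<Sum>v\<in>Y. \<Sum>w\<in>adj v. \<Sum>s<2 ^ (2 * q). g v w s)" by (intro sum.cong refl sum.swap)
    finally show ?thesis .
  qed
  then have "real_of_int (\<Sum>s<2 ^ (2 * q). \<Sum>v\<in>Y. F v s) = (\<Sum>v\<in>Y. \<Sum>w\<in>adj v. real_of_int (\<Sum>s<2 ^ (2 * q). g v w s))"
    by (simp only: of_int_sum)
  also have "\<dots> \<ge> (\<Sum>v\<in>Y. \<Sum>w\<in>adj v. ?c * h v w)"
    by (intro sum_mono) (use sum_g_ge in \<open>simp add: h_def\<close>)
  also have "(\<Sum>v\<in>Y. \<Sum>w\<in>adj v. ?c * h v w) = ?c * (\<Sum>v\<in>Y. \<Sum>w\<in>adj v. h v w)"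
    by (simp add: sum_distrib_left)
  also have "\<dots> = 2 ^ (2 * q) * real (\<Sum>v\<in>Y. d v) / 64" unfolding hh by (simp add: mult_2 power_add)
  finally show ?thesis .
qed

text \<open>A seed that is at least as good as the average of the estimator kills a sixty-fourth of
  the degree sum, because the estimator is a lower bound for what is killed.\<close>

lemma progress:
  assumes "(\<Sum>s<2 ^ (2 * q). \<Sum>v\<in>Y. F v s) \<le> 2 ^ (2 * q) * (\<Sum>v\<in>Y. F v seed)"
  shows "(\<Sum>v\<in>Y. d v) \<le> 64 * (\<Sum>w\<in>killed seed. d w)"
proof -
  have "2 ^ (2 * q) * real (\<Sum>v\<in>Y. d v) / 64 \<le> real_of_int (2 ^ (2 * q) * (\<Sum>v\<in>Y. F v seed))"
    using sum_F_ge assms of_int_le_iff order_trans by blast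
  also have "\<dots> \<le> 2 ^ (2 * q) * real (\<Sum>w\<in>killed seed. d w)"
  proof -
    have "real_of_int (\<Sum>v\<in>Y. F v seed) \<le> real_of_int (int (\<Sum>w\<in>killed seed. d w))" using sum_F_le of_int_le_iff by blast
    then show ?thesis by (simp del: of_nat_sum)
  qed
  finally have "real (\<Sum>v\<in>Y. d v) \<le> 64 * real (\<Sum>w\<in>killed seed. d w)" by (simp del: of_nat_sum)
  then have "real (\<Sum>v\<in>Y. d v) \<le> real (64 * (\<Sum>w\<in>killed seed. d w))" by (simp del: of_nat_sum)
  then show ?thesis by (simp only: of_nat_le_iff)
qed

end

section \<open>Invariants\<close>

definition par :: "frame \<Rightarrow> vertex option" where
  "par f = (case f of Hub p K l \<Rightarrow> p | Fwd x \<Rightarrow> Some x)"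

lemma par_simps [simp]: "par (Hub p K l) = p" "par (Fwd x) = Some x" by (simp_all add: par_def)

type_synonym frames = "(vertex \<times> frame) list"
type_synonym world = "vertex \<Rightarrow> lstate"

locale proto = net +
  fixes kap :: nat
begin

definition "none = (\<lambda>_ _. None :: msg option)"
definition "many x A m = (\<lambda>u v. if u = x \<and> v \<in> A then Some (m :: msg) else None)"
definition "W = (4::nat) ^ kap"

text \<open>A list of frames describes the recursion stack, innermost frame first. Whatever is wrong with the
  maintained set is close to a hub: only vertices of \<open>Z1\<close> may have left the set without all heavy
  neighbours knowing (\<open>stale\<close>), only vertices of \<open>Z2\<close> may be heavy and uncovered, and only vertices of
  \<open>PL\<close> may be light and uncovered. The set \<open>X\<close> holds temporary exceptions during a deletion.\<close>

definition "Z1 gs = {u. \<exists>x p K l. (x, Hub p K l) \<in> set gs \<and> (u = x \<or> u \<in> N x)}"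
definition "Z2 \<sigma> gs = Z1 gs \<union> {y. \<exists>z\<in>Z1 gs. heavy (\<sigma> z) \<and> y \<in> N z}"
definition "PL gs = {v. \<exists>x p K. (x, Hub p K True) \<in> set gs \<and> v \<in> N x}"

definition hv_exact :: "world \<Rightarrow> bool" where
  "hv_exact \<sigma> \<longleftrightarrow> (\<forall>v\<in>V. \<forall>u\<in>N v. hv (\<sigma> v) u = (if heavy (\<sigma> u) then Some (pd (\<sigma> u)) else None))"
definition mv_light :: "world \<Rightarrow> bool" where
  "mv_light \<sigma> \<longleftrightarrow> (\<forall>v\<in>V. \<forall>u\<in>N v. \<not> heavy (\<sigma> u) \<longrightarrow> (u \<in> mv (\<sigma> v) \<longleftrightarrow> inm (\<sigma> u)))"
text \<open>Only one direction: a heavy vertex may fail to notice that a heavy neighbour has left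
  the set. Where this can happen is the subject of \<open>stale\<close>.\<close>

definition mv_heavy :: "world \<Rightarrow> bool" where
  "mv_heavy \<sigma> \<longleftrightarrow> (\<forall>v\<in>V. \<forall>u\<in>N v. heavy (\<sigma> v) \<and> heavy (\<sigma> u) \<and> inm (\<sigma> u) \<longrightarrow> u \<in> mv (\<sigma> v))"
definition indep :: "world \<Rightarrow> bool" where
  "indep \<sigma> \<longleftrightarrow> (\<forall>v. \<forall>u\<in>N v. \<not> (inm (\<sigma> u) \<and> inm (\<sigma> v)))"
definition light_cov :: "vertex set \<Rightarrow> world \<Rightarrow> frames \<Rightarrow> bool" where
  "light_cov X \<sigma> gs \<longleftrightarrow> (\<forall>v\<in>V. lunc (N v) (\<sigma> v) \<longrightarrow> v \<in> PL gs \<or> v \<in> X)"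
definition heavy_cov :: "vertex set \<Rightarrow> world \<Rightarrow> frames \<Rightarrow> bool" where
  "heavy_cov X \<sigma> gs \<longleftrightarrow> (\<forall>v\<in>V. unc (N v) (\<sigma> v) \<longrightarrow> v \<in> Z2 \<sigma> gs \<or> v \<in> X)"
definition stale :: "world \<Rightarrow> frames \<Rightarrow> bool" where
  "stale \<sigma> gs \<longleftrightarrow> (\<forall>v\<in>V. \<forall>u\<in>N v. heavy (\<sigma> v) \<and> heavy (\<sigma> u) \<and> u \<in> mv (\<sigma> v) \<and> \<not> inm (\<sigma> u) \<longrightarrow> u \<in> Z1 gs)"
text \<open>A vertex that turns light because of its published degree has degree at most
  \<open>2 * W\<close>. As every insertion makes its endpoints heavy, the degree of a light vertex
  can only fall afterwards.\<close>

definition degrees :: "world \<Rightarrow> bool" where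
  "degrees \<sigma> \<longleftrightarrow> (\<forall>v\<in>V. if heavy (\<sigma> v) then card (N v) \<le> 2 * pd (\<sigma> v) \<and> pd (\<sigma> v) \<le> 2 * card (N v) else card (N v) \<le> 2 * W)"
definition stacks :: "world \<Rightarrow> frames \<Rightarrow> bool" where
  "stacks \<sigma> gs \<longleftrightarrow> (\<forall>v. stk (\<sigma> v) = map snd (filter (\<lambda>f. fst f = v) gs))"
text \<open>The flag is set for vertices that were light just before the insertion of an edge; this
  edge accounts for the additional one.\<close>

definition bounded :: "frames \<Rightarrow> bool" where
  "bounded gs \<longleftrightarrow> (\<forall>(x, f) \<in> set gs. x \<in> V \<and> (\<forall>p K l. f = Hub p K l \<longrightarrow> K \<le> kap \<and> (l \<longrightarrow> card (N x) \<le> 2 * W + 1)))"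

fun linked :: "frames \<Rightarrow> bool" where
  "linked [] = True"
| "linked [(x, f)] = (par f = None)"
| "linked ((x, f) # (y, h) # gs) = (par f = Some y \<and> y \<in> N x \<and> linked ((y, h) # gs))"

definition Inv :: "vertex set \<Rightarrow> world \<Rightarrow> frames \<Rightarrow> bool" where
  "Inv X \<sigma> gs \<longleftrightarrow> hv_exact \<sigma> \<and> mv_light \<sigma> \<and> mv_heavy \<sigma> \<and> indep \<sigma> \<and> light_cov X \<sigma> gs \<and> heavy_cov X \<sigma> gs \<and> stale \<sigma> gs \<and> degrees \<sigma> \<and> stacks \<sigma> gs \<and> bounded gs \<and> linked gs"

definition quiet :: "world \<Rightarrow> bool" where
  "quiet \<sigma> \<longleftrightarrow> (\<forall>v. ctl (\<sigma> v) = Idle)"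

definition solo :: "world \<Rightarrow> vertex \<Rightarrow> ctl \<Rightarrow> bool" where
  "solo \<sigma> w x \<longleftrightarrow> ctl (\<sigma> w) = x \<and> (\<forall>v. v \<noteq> w \<longrightarrow> ctl (\<sigma> v) = Idle)"

text \<open>Every vertex that turns light lowers \<open>Phi\<close>, and an update raises it by at most four.\<close>

definition Phi :: "world \<Rightarrow> nat" where
  "Phi \<sigma> = card {v \<in> V. heavy (\<sigma> v)} + card {v \<in> V. heavy (\<sigma> v) \<or> \<not> inm (\<sigma> v)}"

definition shrinks :: "world \<Rightarrow> world \<Rightarrow> bool" where
  "shrinks \<sigma> \<sigma>' \<longleftrightarrow> (\<forall>v. (heavy (\<sigma>' v) \<longrightarrow> heavy (\<sigma> v)) \<and> pd (\<sigma>' v) = pd (\<sigma> v))"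

lemma shrinks_trans: "shrinks x y \<Longrightarrow> shrinks y z \<Longrightarrow> shrinks x z" by (auto simp: shrinks_def)

lemma hv_eq: "hv_exact \<sigma> \<Longrightarrow> u \<in> N v \<Longrightarrow> hv (\<sigma> v) u = (if heavy (\<sigma> u) then Some (pd (\<sigma> u)) else None)"
  using edge[of u v] by (simp add: hv_exact_def)

lemma hn_eq: "hv_exact \<sigma> \<Longrightarrow> hn (N v) (\<sigma> v) = {u \<in> N v. heavy (\<sigma> u)}"
  using hv_eq by (auto simp: hn_def split: if_splits)

lemma lows_eq: "hv_exact \<sigma> \<Longrightarrow> lows K (N v) (\<sigma> v) = {u \<in> N v. heavy (\<sigma> u) \<and> pd (\<sigma> u) \<le> 4 ^ K}"
  using hv_eq by (auto simp: lows_def split: if_splits)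

lemma lcov_eq:
  assumes "hv_exact \<sigma>" "mv_light \<sigma>" "v \<in> V"
  shows "lcov (N v) (\<sigma> v) \<longleftrightarrow> (\<exists>u\<in>N v. \<not> heavy (\<sigma> u) \<and> inm (\<sigma> u))"
proof -
  have "hv (\<sigma> v) u = None \<longleftrightarrow> \<not> heavy (\<sigma> u)" if "u \<in> N v" for u using assms that by (simp add: hv_exact_def)
  moreover have "u \<in> mv (\<sigma> v) \<longleftrightarrow> inm (\<sigma> u)" if "u \<in> N v" "\<not> heavy (\<sigma> u)" for u using assms that by (simp add: mv_light_def)
  ultimately show ?thesis unfolding lcov_def by blast
qed

lemma NV: "u \<in> N v \<Longrightarrow> u \<in> V" "u \<in> N v \<Longrightarrow> v \<in> V" using edge by blast+

text \<open>A heavy vertex errs only by believing in members that have left. If it sees no member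
  around it, there is none, and it may join safely.\<close>

lemma unc_nbr:
  assumes "mv_light \<sigma>" "mv_heavy \<sigma>" "unc (N v) (\<sigma> v)" "u \<in> N v"
  shows "\<not> inm (\<sigma> u)"
proof
  assume "inm (\<sigma> u)"
  moreover have "v \<in> V" using NV assms by blast
  ultimately have "u \<in> mv (\<sigma> v)" using assms by (cases "heavy (\<sigma> u)") (auto simp: mv_light_def mv_heavy_def unc_def)
  then show False using assms by (auto simp: unc_def)
qed

text \<open>A heavy vertex may learn the exact status of some neighbours; whoever turns out to be
  uncovered had a view of a heavy neighbour that was out of date.\<close>

definition refresh :: "world \<Rightarrow> world \<Rightarrow> bool" where
  "refresh \<sigma> \<sigma>' \<longleftrightarrow> (\<forall>v. heavy (\<sigma>' v) = heavy (\<sigma> v) \<and> inm (\<sigma>' v) = inm (\<sigma> v) \<and> pd (\<sigma>' v) = pd (\<sigma> v)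
     \<and> hv (\<sigma>' v) = hv (\<sigma> v) \<and> stk (\<sigma>' v) = stk (\<sigma> v) \<and>
     (\<forall>u\<in>N v. (u \<in> mv (\<sigma>' v)) = (u \<in> mv (\<sigma> v)) \<or> (u \<in> mv (\<sigma>' v)) = inm (\<sigma> u)))"

lemma refresh_sel:
  assumes "refresh \<sigma> \<sigma>'"
  shows "heavy (\<sigma>' v) = heavy (\<sigma> v)" "inm (\<sigma>' v) = inm (\<sigma> v)" "pd (\<sigma>' v) = pd (\<sigma> v)"
    "hv (\<sigma>' v) = hv (\<sigma> v)" "stk (\<sigma>' v) = stk (\<sigma> v)"
  using assms by (auto simp: refresh_def)

lemma refresh_sets:
  assumes "refresh \<sigma> \<sigma>'"
  shows "hn (N v) (\<sigma>' v) = hn (N v) (\<sigma> v)" "lows K (N v) (\<sigma>' v) = lows K (N v) (\<sigma> v)"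
    "over K (N v) (\<sigma>' v) = over K (N v) (\<sigma> v)" "fit K (N v) (\<sigma>' v) = fit K (N v) (\<sigma> v)"
    "Phi \<sigma>' = Phi \<sigma>" "shrinks \<sigma> \<sigma>'"
  by (simp_all add: hn_def lows_def over_def fit_def Phi_def shrinks_def refresh_sel[OF assms])

lemma refresh_Inv:
  assumes r: "refresh \<sigma> \<sigma>'" and i: "Inv X \<sigma> gs"
  shows "Inv X \<sigma>' gs"
proof -
  note s = refresh_sel[OF r]
  have m: "(u \<in> mv (\<sigma>' v)) = (u \<in> mv (\<sigma> v)) \<or> (u \<in> mv (\<sigma>' v)) = inm (\<sigma> u)" if "u \<in> N v" for u v
    using r that by (simp add: refresh_def)
  have g: "hv_exact \<sigma>" "mv_light \<sigma>" "mv_heavy \<sigma>" "indep \<sigma>" "light_cov X \<sigma> gs" "heavy_cov X \<sigma> gs" "stale \<sigma> gs" "degrees \<sigma>" "stacks \<sigma> gs" "bounded gs" "linked gs"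
    using i by (auto simp: Inv_def)
  have 1: "hv_exact \<sigma>'" using g(1) by (simp add: hv_exact_def s)
  have 2: "mv_light \<sigma>'" unfolding mv_light_def s
  proof (intro ballI impI)
    fix v u assume "v \<in> V" "u \<in> N v" "\<not> heavy (\<sigma> u)"
    then show "(u \<in> mv (\<sigma>' v)) = inm (\<sigma> u)" using m[of u v] g(2) by (auto simp: mv_light_def)
  qed
  have 3: "mv_heavy \<sigma>'" unfolding mv_heavy_def s
  proof (intro ballI impI)
    fix v u assume "v \<in> V" "u \<in> N v" "heavy (\<sigma> v) \<and> heavy (\<sigma> u) \<and> inm (\<sigma> u)"
    then show "u \<in> mv (\<sigma>' v)" using m[of u v] g(3) by (auto simp: mv_heavy_def)
  qed
  have 7: "stale \<sigma>' gs" unfolding stale_def s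
  proof (intro ballI impI)
    fix v u assume "v \<in> V" "u \<in> N v" "heavy (\<sigma> v) \<and> heavy (\<sigma> u) \<and> u \<in> mv (\<sigma>' v) \<and> \<not> inm (\<sigma> u)"
    then show "u \<in> Z1 gs" using m[of u v] g(7) by (auto simp: stale_def)
  qed
  have Z: "Z2 \<sigma>' gs = Z2 \<sigma> gs" by (simp add: Z2_def s)
  have 6: "heavy_cov X \<sigma>' gs" unfolding heavy_cov_def Z
  proof (intro ballI impI)
    fix v assume v: "v \<in> V" "unc (N v) (\<sigma>' v)"
    show "v \<in> Z2 \<sigma> gs \<or> v \<in> X"
    proof (cases "unc (N v) (\<sigma> v)")
      case True
      then show ?thesis using g(6) v by (simp add: heavy_cov_def)
    next
      case False
      then obtain u where u: "u \<in> N v" "u \<in> mv (\<sigma> v)" "u \<notin> mv (\<sigma>' v)" using v by (auto simp: unc_def s)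
      then have nu: "\<not> inm (\<sigma> u)" using m[of u v] by auto
      then have hu: "heavy (\<sigma> u)" using u g(2) v by (auto simp: mv_light_def)
      have "u \<in> Z1 gs" using g(7) u nu hu v by (auto simp: stale_def unc_def s)
      then show ?thesis using hu u Nsym by (auto simp: Z2_def)
    qed
  qed
  have 5: "light_cov X \<sigma>' gs" unfolding light_cov_def
  proof (intro ballI impI)
    fix v assume v: "v \<in> V" "lunc (N v) (\<sigma>' v)"
    then have "lunc (N v) (\<sigma> v)"
      using lcov_eq[OF 1 2 v(1)] lcov_eq[OF g(1,2) v(1)] by (simp add: lunc_def s)
    then show "v \<in> PL gs \<or> v \<in> X" using g(5) v by (simp add: light_cov_def)
  qed
  have 4: "indep \<sigma>'" "degrees \<sigma>'" "stacks \<sigma>' gs" using g by (simp_all add: indep_def degrees_def stacks_def s)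
  show ?thesis using 1 2 3 4 5 6 7 g by (simp add: Inv_def)
qed

lemma Z1_mono: "Z1 gs \<subseteq> Z1 (f # gs)" by (auto simp: Z1_def)
lemma PL_mono: "PL gs \<subseteq> PL (f # gs)" by (auto simp: PL_def)

lemma linked_tl: "linked (f # gs) \<Longrightarrow> gs \<noteq> [] \<Longrightarrow> linked gs"
  by (cases gs; cases f) (auto simp: neq_Nil_conv)

text \<open>A vertex becomes light, either because it is heavy with few neighbours or because it is light
  and has just lost its cover. It joins unless a light neighbour is in the set; its heavy neighbours
  in the set have to leave, and the new frame makes it responsible for them.\<close>

definition tell :: "world \<Rightarrow> vertex \<Rightarrow> world" where
  "tell \<sigma> v = (\<lambda>y. if y \<in> N v then absorb (\<lambda>u. if u = v then Some (own_stat (\<sigma> v) False) else None) (\<sigma> y) else \<sigma> y)"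

definition bec :: "world \<Rightarrow> vertex \<Rightarrow> vertex option \<Rightarrow> world" where
  "bec \<sigma> v p = tell (\<sigma>(v := (become p (N v) (\<sigma> v))\<lparr>ctl := Pre\<rparr>)) v"

lemma absorb_one:
  "absorb (\<lambda>u. if u = v then Some (Stat h m p r) else None) s = s\<lparr>
     hv := (hv s)(v := if h then Some p else None), mv := (if m then insert v (mv s) else mv s - {v}),
     inm := inm s \<and> \<not> m\<rparr>"
proof -
  have 1: "(\<lambda>u. hv_after (if u = v then Some (Stat h m p r) else None) (hv s u)) = (hv s)(v := if h then Some p else None)"
    by (auto simp: fun_eq_iff)
  have 2: "{u. mv_after (if u = v then Some (Stat h m p r) else None) (u \<in> mv s)} = (if m then insert v (mv s) else mv s - {v})"
    by auto
  have 3: "(\<lambda>u. pub_after (if u = v then Some (Stat h m p r) else None) (pub s u)) = pub s"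
    by (auto simp: fun_eq_iff)
  show ?thesis unfolding absorb_def 1 2 3 by simp
qed

lemma bec_sel:
  fixes \<sigma> v p
  defines "m \<equiv> \<not> lcov (N v) (\<sigma> v)"
  shows "heavy (bec \<sigma> v p y) = (heavy (\<sigma> y) \<and> y \<noteq> v)"
    "inm (bec \<sigma> v p y) = (if y = v then m else inm (\<sigma> y) \<and> \<not> (y \<in> N v \<and> m))"
    "pd (bec \<sigma> v p y) = pd (\<sigma> y)"
    "hv (bec \<sigma> v p y) = (if y \<in> N v then (hv (\<sigma> y))(v := None) else hv (\<sigma> y))"
    "mv (bec \<sigma> v p y) = (if y \<in> N v then (if m then insert v (mv (\<sigma> y)) else mv (\<sigma> y) - {v}) else mv (\<sigma> y))"
    "stk (bec \<sigma> v p y) = (if y = v then Hub p 0 False # stk (\<sigma> v) else stk (\<sigma> y))"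
    "ctl (bec \<sigma> v p y) = (if y = v then Pre else ctl (\<sigma> y))"
    "badc (bec \<sigma> v p y) = badc (\<sigma> y)"
proof -
  have e: "bec \<sigma> v p y = (if y \<in> N v then absorb (\<lambda>u. if u = v then Some (Stat False m 0 False) else None) (\<sigma> y)
    else if y = v then (become p (N v) (\<sigma> v))\<lparr>ctl := Pre\<rparr> else \<sigma> y)"
  proof -
    have o: "own_stat ((\<sigma>(v := (become p (N v) (\<sigma> v))\<lparr>ctl := Pre\<rparr>)) v) False = Stat False m 0 False"
      by (simp add: own_stat_def become_def m_def)
    show ?thesis unfolding bec_def tell_def o by auto
  qed
  show "heavy (bec \<sigma> v p y) = (heavy (\<sigma> y) \<and> y \<noteq> v)"
    "inm (bec \<sigma> v p y) = (if y = v then m else inm (\<sigma> y) \<and> \<not> (y \<in> N v \<and> m))"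
    "pd (bec \<sigma> v p y) = pd (\<sigma> y)"
    "hv (bec \<sigma> v p y) = (if y \<in> N v then (hv (\<sigma> y))(v := None) else hv (\<sigma> y))"
    "mv (bec \<sigma> v p y) = (if y \<in> N v then (if m then insert v (mv (\<sigma> y)) else mv (\<sigma> y) - {v}) else mv (\<sigma> y))"
    "stk (bec \<sigma> v p y) = (if y = v then Hub p 0 False # stk (\<sigma> v) else stk (\<sigma> y))"
    "ctl (bec \<sigma> v p y) = (if y = v then Pre else ctl (\<sigma> y))"
    "badc (bec \<sigma> v p y) = badc (\<sigma> y)"
    unfolding e absorb_one by (auto simp: become_def m_def)
qed

lemma bec_Inv:
  assumes i: "Inv X \<sigma> gs" and v: "v \<in> V"
    and d: "card (N v) \<le> 2 * W"
    and l: "\<not> heavy (\<sigma> v) \<Longrightarrow> lunc (N v) (\<sigma> v)"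
    and lk: "linked ((v, Hub p 0 False) # gs)"
  shows "Inv (X - {v}) (bec \<sigma> v p) ((v, Hub p 0 False) # gs)"
proof -
  let ?s = "bec \<sigma> v p"
  let ?gs = "(v, Hub p 0 False) # gs"
  define m where "m = (\<not> lcov (N v) (\<sigma> v))"
  note s = bec_sel[of \<sigma> v p, folded m_def]
  have g: "hv_exact \<sigma>" "mv_light \<sigma>" "mv_heavy \<sigma>" "indep \<sigma>" "light_cov X \<sigma> gs" "heavy_cov X \<sigma> gs" "stale \<sigma> gs" "degrees \<sigma>" "stacks \<sigma> gs" "bounded gs"
    using i by (auto simp: Inv_def)
  have m: "m \<longleftrightarrow> \<not> (\<exists>u\<in>N v. \<not> heavy (\<sigma> u) \<and> inm (\<sigma> u))" unfolding m_def using lcov_eq[OF g(1,2)] v by simp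
  have vm: "m" if "inm (\<sigma> v)" using that g(4) m by (auto simp: indep_def)
  have lv: "m" if "\<not> heavy (\<sigma> v)" using l[OF that] by (simp add: lunc_def m_def)
  have vn: "\<not> inm (\<sigma> v)" if "\<not> heavy (\<sigma> v)" using l[OF that] by (simp add: lunc_def)
  \<comment> \<open>If \<open>v\<close> joins, none of its light neighbours is in the set; so only
    heavy vertices are ejected, and the cover of light vertices by light ones survives.\<close>
  have light: "inm (?s y) = inm (\<sigma> y)" if "\<not> heavy (\<sigma> y)" "y \<noteq> v" for y
    using that m by (auto simp: s)
  have zv: "N v \<subseteq> Z1 ?gs" "v \<in> Z1 ?gs" by (auto simp: Z1_def)
  have 1: "hv_exact ?s" unfolding hv_exact_def
  proof (intro ballI)
    fix y u assume a: "y \<in> V" "u \<in> N y"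
    show "hv (?s y) u = (if heavy (?s u) then Some (pd (?s u)) else None)"
    proof (cases "u = v")
      case True
      then show ?thesis using a Nsym[of u y] by (simp add: s)
    next
      case False
      then show ?thesis using a g(1) by (simp add: s hv_exact_def)
    qed
  qed
  have 2: "mv_light ?s" unfolding mv_light_def
  proof (intro ballI impI)
    fix y u assume a: "y \<in> V" "u \<in> N y" "\<not> heavy (?s u)"
    show "(u \<in> mv (?s y)) = inm (?s u)"
    proof (cases "u = v")
      case True
      then show ?thesis using a Nsym[of u y] by (auto simp: s)
    next
      case False
      then have "\<not> heavy (\<sigma> u)" using a by (simp add: s)
      then show ?thesis using light False a g(2) by (auto simp: s(5) mv_light_def)
    qed
  qed
  have 3: "mv_heavy ?s" unfolding mv_heavy_def
  proof (intro ballI impI)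
    fix y u assume a: "y \<in> V" "u \<in> N y" "heavy (?s y) \<and> heavy (?s u) \<and> inm (?s u)"
    then have "u \<noteq> v" "heavy (\<sigma> y)" "heavy (\<sigma> u)" "inm (\<sigma> u)" by (auto simp: s split: if_splits)
    then show "u \<in> mv (?s y)" using g(3) a by (simp add: s mv_heavy_def)
  qed
  have 4: "indep ?s" unfolding indep_def
  proof (intro allI ballI notI)
    fix y u assume a: "u \<in> N y" "inm (?s u) \<and> inm (?s y)"
    show False
    proof (cases "u = v \<or> y = v")
      case True
      then show ?thesis using a Nsym[of u y] by (auto simp: s split: if_splits)
    next
      case False
      then show ?thesis using a g(4) by (auto simp: s indep_def)
    qed
  qed
  have 5: "light_cov (X - {v}) ?s ?gs" unfolding light_cov_def
  proof (intro ballI impI)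
    fix y assume y: "y \<in> V" "lunc (N y) (?s y)"
    have lc: "lcov (N y) (?s y) \<longleftrightarrow> (\<exists>u\<in>N y. \<not> heavy (?s u) \<and> inm (?s u))" by (rule lcov_eq[OF 1 2 y(1)])
    have yv: "y \<noteq> v"
    proof
      assume yv: "y = v"
      then have "\<not> m" using y by (simp add: lunc_def s(2))
      then obtain u where u: "u \<in> N v" "\<not> heavy (\<sigma> u)" "inm (\<sigma> u)" using m by blast
      then have "u \<noteq> v" by auto
      then have "inm (?s u)" "\<not> heavy (?s u)" using light[of u] u by (auto simp: s(1))
      then have "lcov (N y) (?s y)" unfolding lc using u yv by blast
      then show False using y by (simp add: lunc_def)
    qed
    then have "\<not> heavy (\<sigma> y)" "\<not> inm (\<sigma> y)" using y light[of y] by (auto simp: lunc_def s(1))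
    moreover have "\<not> lcov (N y) (\<sigma> y)"
    proof
      assume "lcov (N y) (\<sigma> y)"
      then obtain u where u: "u \<in> N y" "\<not> heavy (\<sigma> u)" "inm (\<sigma> u)" using lcov_eq[OF g(1,2) y(1)] by blast
      then have "u \<noteq> v" using vn by auto
      then have "inm (?s u)" "\<not> heavy (?s u)" using light u by (auto simp: s(1))
      then have "lcov (N y) (?s y)" unfolding lc using u by blast
      then show False using y by (simp add: lunc_def)
    qed
    ultimately have "lunc (N y) (\<sigma> y)" by (simp add: lunc_def)
    then show "y \<in> PL ?gs \<or> y \<in> X - {v}" using g(5) y yv PL_mono[of gs "(v, Hub p 0 False)"] by (auto simp: light_cov_def)
  qed
  have 7: "stale ?s ?gs" unfolding stale_def
  proof (intro ballI impI)
    fix y u assume a: "y \<in> V" "u \<in> N y" "heavy (?s y) \<and> heavy (?s u) \<and> u \<in> mv (?s y) \<and> \<not> inm (?s u)"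
    then have b: "u \<noteq> v" "heavy (\<sigma> y)" "heavy (\<sigma> u)" "u \<in> mv (\<sigma> y)" by (auto simp: s split: if_splits)
    show "u \<in> Z1 ?gs"
    proof (cases "inm (\<sigma> u)")
      case True
      then have "u \<in> N v" using a b by (auto simp: s)
      then show ?thesis using zv by blast
    next
      case False
      then have "u \<in> Z1 gs" using g(7) a b by (auto simp: stale_def)
      then show ?thesis using Z1_mono[of gs "(v, Hub p 0 False)"] by blast
    qed
  qed
  have 6: "heavy_cov (X - {v}) ?s ?gs" unfolding heavy_cov_def
  proof (intro ballI impI)
    fix y assume y: "y \<in> V" "unc (N y) (?s y)"
    then have yv: "y \<noteq> v" "heavy (\<sigma> y)" by (auto simp: unc_def s(1))
    show "y \<in> Z2 ?s ?gs \<or> y \<in> X - {v}"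
    proof (cases "y \<in> N v")
      case True
      then show ?thesis using zv by (auto simp: Z2_def)
    next
      case False
      then have "unc (N y) (\<sigma> y)" using y yv by (auto simp: unc_def s)
      then have "y \<in> Z2 \<sigma> gs \<or> y \<in> X" using g(6) y by (simp add: heavy_cov_def)
      moreover have "y \<in> Z2 ?s ?gs" if yz: "y \<in> Z2 \<sigma> gs"
      proof -
        consider "y \<in> Z1 gs" | z where "z \<in> Z1 gs" "heavy (\<sigma> z)" "y \<in> N z" using yz unfolding Z2_def by blast
        then show ?thesis
        proof cases
          case 1
          then show ?thesis using Z1_mono[of gs "(v, Hub p 0 False)"] by (auto simp: Z2_def)
        next
          case 2
          show ?thesis
          proof (cases "z = v")
            case True
            then show ?thesis using 2 False by simp
          next
            case False
            then have "heavy (?s z)" "z \<in> Z1 ?gs" using 2 Z1_mono[of gs "(v, Hub p 0 False)"] by (auto simp: s)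
            then show ?thesis using 2 by (auto simp: Z2_def)
          qed
        qed
      qed
      ultimately show ?thesis using yv by auto
    qed
  qed
  have 8: "degrees ?s" using g(8) d unfolding degrees_def s by auto
  have 9: "stacks ?s ?gs" using g(9) unfolding stacks_def s by auto
  have 10: "bounded ?gs" using g(10) v by (auto simp: bounded_def)
  show ?thesis using 1 2 3 4 5 6 7 8 9 10 lk by (simp add: Inv_def)
qed

text \<open>The ejected neighbours are heavy, hence counted in the second summand before and after.
  A heavy \<open>v\<close> leaves the first summand, and a light one leaves the second because it
  joins.\<close>

lemma bec_Phi:
  assumes i: "Inv X \<sigma> gs" and v: "v \<in> V" and l: "\<not> heavy (\<sigma> v) \<Longrightarrow> lunc (N v) (\<sigma> v)"
  shows "Phi (bec \<sigma> v p) < Phi \<sigma>" "shrinks \<sigma> (bec \<sigma> v p)"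
proof -
  let ?s = "bec \<sigma> v p"
  define m where "m = (\<not> lcov (N v) (\<sigma> v))"
  note s = bec_sel[of \<sigma> v p, folded m_def]
  have g: "hv_exact \<sigma>" "mv_light \<sigma>" using i by (auto simp: Inv_def)
  have m: "m \<longleftrightarrow> \<not> (\<exists>u\<in>N v. \<not> heavy (\<sigma> u) \<and> inm (\<sigma> u))" unfolding m_def using lcov_eq[OF g v] by simp
  have sub: "{y \<in> V. heavy (?s y)} \<subseteq> {y \<in> V. heavy (\<sigma> y)}"
    "{y \<in> V. heavy (?s y) \<or> \<not> inm (?s y)} \<subseteq> {y \<in> V. heavy (\<sigma> y) \<or> \<not> inm (\<sigma> y)}"
    using m l v by (auto simp: s lunc_def split: if_splits)
  have f: "finite {y \<in> V. heavy (\<sigma> y)}" "finite {y \<in> V. heavy (\<sigma> y) \<or> \<not> inm (\<sigma> y)}" using finV by auto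
  show "Phi ?s < Phi \<sigma>"
  proof (cases "heavy (\<sigma> v)")
    case True
    then have "v \<in> {y \<in> V. heavy (\<sigma> y)}" "v \<notin> {y \<in> V. heavy (?s y)}" using v by (auto simp: s(1))
    then have "{y \<in> V. heavy (?s y)} \<subset> {y \<in> V. heavy (\<sigma> y)}" using sub by blast
    from psubset_card_mono[OF f(1) this] card_mono[OF f(2) sub(2)] show ?thesis unfolding Phi_def by (rule add_less_le_mono)
  next
    case False
    then have "v \<in> {y \<in> V. heavy (\<sigma> y) \<or> \<not> inm (\<sigma> y)}" "v \<notin> {y \<in> V. heavy (?s y) \<or> \<not> inm (?s y)}"
      using v l[OF False] by (auto simp: s lunc_def m_def)
    then have "{y \<in> V. heavy (?s y) \<or> \<not> inm (?s y)} \<subset> {y \<in> V. heavy (\<sigma> y) \<or> \<not> inm (\<sigma> y)}" using sub by blast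
    from card_mono[OF f(1) sub(1)] psubset_card_mono[OF f(2) this] show ?thesis unfolding Phi_def by (rule add_le_less_mono)
  qed
  show "shrinks \<sigma> ?s" by (auto simp: shrinks_def s)
qed

definition joined :: "world \<Rightarrow> world \<Rightarrow> vertex set \<Rightarrow> bool" where
  "joined \<sigma> \<sigma>' J \<longleftrightarrow> (\<forall>v. heavy (\<sigma>' v) = heavy (\<sigma> v) \<and> inm (\<sigma>' v) = (inm (\<sigma> v) \<or> v \<in> J) \<and> pd (\<sigma>' v) = pd (\<sigma> v)
     \<and> hv (\<sigma>' v) = hv (\<sigma> v) \<and> stk (\<sigma>' v) = stk (\<sigma> v) \<and>
     mv (\<sigma>' v) = mv (\<sigma> v) \<union> {u \<in> J. v \<in> hn (N u) (\<sigma> u)})"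

text \<open>The members of \<open>J\<close> inform only heavy neighbours. This is consistent, as
  \<open>mv_light\<close> and \<open>lcov\<close> speak about light members, and all of
  \<open>J\<close> is heavy.\<close>

lemma joined_Inv:
  assumes r: "joined \<sigma> \<sigma>' J" and i: "Inv X \<sigma> gs"
    and J: "\<And>v. v \<in> J \<Longrightarrow> v \<in> V \<and> unc (N v) (\<sigma> v)" "\<And>u v. u \<in> J \<Longrightarrow> v \<in> J \<Longrightarrow> u \<notin> N v"
  shows "Inv X \<sigma>' gs" "Phi \<sigma>' = Phi \<sigma>" "shrinks \<sigma> \<sigma>'"
proof -
  have s: "heavy (\<sigma>' v) = heavy (\<sigma> v)" "inm (\<sigma>' v) = (inm (\<sigma> v) \<or> v \<in> J)" "pd (\<sigma>' v) = pd (\<sigma> v)"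
    "hv (\<sigma>' v) = hv (\<sigma> v)" "stk (\<sigma>' v) = stk (\<sigma> v)" "mv (\<sigma>' v) = mv (\<sigma> v) \<union> {u \<in> J. v \<in> hn (N u) (\<sigma> u)}" for v
    using r by (auto simp: joined_def)
  have g: "hv_exact \<sigma>" "mv_light \<sigma>" "mv_heavy \<sigma>" "indep \<sigma>" "light_cov X \<sigma> gs" "heavy_cov X \<sigma> gs" "stale \<sigma> gs" "degrees \<sigma>" "stacks \<sigma> gs" "bounded gs" "linked gs"
    using i by (auto simp: Inv_def)
  have hJ: "heavy (\<sigma> v)" if "v \<in> J" for v using J(1)[OF that] by (simp add: unc_def)
  have 1: "hv_exact \<sigma>'" using g(1) by (simp add: hv_exact_def s)
  have 2: "mv_light \<sigma>'" using g(2) hJ by (auto simp: mv_light_def s)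
  have 3: "mv_heavy \<sigma>'" unfolding mv_heavy_def
  proof (intro ballI impI)
    fix v u assume a: "v \<in> V" "u \<in> N v" "heavy (\<sigma>' v) \<and> heavy (\<sigma>' u) \<and> inm (\<sigma>' u)"
    show "u \<in> mv (\<sigma>' v)"
    proof (cases "u \<in> J")
      case True
      have "v \<in> hn (N u) (\<sigma> u)" using hn_eq[OF g(1)] a Nsym[of v u] by (simp add: s)
      then show ?thesis using True by (simp add: s)
    next
      case False
      then show ?thesis using a g(3) by (auto simp: mv_heavy_def s)
    qed
  qed
  have 4: "indep \<sigma>'" unfolding indep_def
  proof (intro allI ballI notI)
    fix v u assume a: "u \<in> N v" "inm (\<sigma>' u) \<and> inm (\<sigma>' v)"
    have "\<not> inm (\<sigma> u)" if "v \<in> J" using unc_nbr[OF g(2,3)] J(1)[OF that] a by blast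
    moreover have "\<not> inm (\<sigma> v)" if "u \<in> J" using unc_nbr[OF g(2,3)] J(1)[OF that] a Nsym by blast
    ultimately show False using a J(2) g(4) by (auto simp: s indep_def)
  qed
  have 5: "light_cov X \<sigma>' gs" unfolding light_cov_def
  proof (intro ballI impI)
    fix v assume v: "v \<in> V" "lunc (N v) (\<sigma>' v)"
    have "lcov (N v) (\<sigma>' v) = lcov (N v) (\<sigma> v)"
      unfolding lcov_eq[OF 1 2 v(1)] lcov_eq[OF g(1,2) v(1)] using hJ by (auto simp: s)
    then have "lunc (N v) (\<sigma> v)" using v by (simp add: lunc_def s)
    then show "v \<in> PL gs \<or> v \<in> X" using g(5) v by (simp add: light_cov_def)
  qed
  have 6: "heavy_cov X \<sigma>' gs" using g(6) by (auto simp: heavy_cov_def unc_def s Z2_def)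
  have 7: "stale \<sigma>' gs" using g(7) by (auto simp: stale_def s)
  have 8: "degrees \<sigma>'" "stacks \<sigma>' gs" using g by (simp_all add: degrees_def stacks_def s)
  show "Inv X \<sigma>' gs" using 1 2 3 4 5 6 7 8 g by (simp add: Inv_def)
  have "{v \<in> V. heavy (\<sigma> v) \<or> \<not> (inm (\<sigma> v) \<or> v \<in> J)} = {v \<in> V. heavy (\<sigma> v) \<or> \<not> inm (\<sigma> v)}" using hJ by auto
  then show "Phi \<sigma>' = Phi \<sigma>" by (simp add: Phi_def s)
  show "shrinks \<sigma> \<sigma>'" by (simp add: shrinks_def s)
qed

definition same :: "world \<Rightarrow> world \<Rightarrow> bool" where
  "same \<sigma> \<sigma>' \<longleftrightarrow> (\<forall>v. heavy (\<sigma>' v) = heavy (\<sigma> v) \<and> inm (\<sigma>' v) = inm (\<sigma> v) \<and> pd (\<sigma>' v) = pd (\<sigma> v)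
     \<and> hv (\<sigma>' v) = hv (\<sigma> v) \<and> mv (\<sigma>' v) = mv (\<sigma> v))"

lemma same_sel:
  assumes "same \<sigma> \<sigma>'"
  shows "heavy (\<sigma>' v) = heavy (\<sigma> v)" "inm (\<sigma>' v) = inm (\<sigma> v)" "pd (\<sigma>' v) = pd (\<sigma> v)"
    "hv (\<sigma>' v) = hv (\<sigma> v)" "mv (\<sigma>' v) = mv (\<sigma> v)"
  using assms by (auto simp: same_def)

lemma same_sets:
  assumes "same \<sigma> \<sigma>'"
  shows "hn M (\<sigma>' v) = hn M (\<sigma> v)" "lows K M (\<sigma>' v) = lows K M (\<sigma> v)"
    "over K M (\<sigma>' v) = over K M (\<sigma> v)" "fit K M (\<sigma>' v) = fit K M (\<sigma> v)"
    "unc M (\<sigma>' v) = unc M (\<sigma> v)" "lunc M (\<sigma>' v) = lunc M (\<sigma> v)" "lcov M (\<sigma>' v) = lcov M (\<sigma> v)"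
    "Phi \<sigma>' = Phi \<sigma>" "shrinks \<sigma> \<sigma>'"
  by (simp_all add: hn_def lows_def over_def fit_def Phi_def shrinks_def unc_def lunc_def lcov_def same_sel[OF assms])

text \<open>Serves all manipulations of stacks and control states: enlarging the neighbourhoods of
  the hubs only weakens what the invariant demands.\<close>

lemma same_Inv:
  assumes sm: "same \<sigma> \<sigma>'" and i: "Inv X \<sigma> gs"
    and z: "Z1 gs \<subseteq> Z1 gs'" "PL gs \<subseteq> PL gs'" "stacks \<sigma>' gs'" "bounded gs'" "linked gs'"
  shows "Inv X \<sigma>' gs'"
proof -
  note s = same_sel[OF sm] and e = same_sets[OF sm]
  have g: "hv_exact \<sigma>" "mv_light \<sigma>" "mv_heavy \<sigma>" "indep \<sigma>" "light_cov X \<sigma> gs" "heavy_cov X \<sigma> gs" "stale \<sigma> gs" "degrees \<sigma>"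
    using i by (auto simp: Inv_def)
  have "hv_exact \<sigma>'" "mv_light \<sigma>'" "mv_heavy \<sigma>'" "indep \<sigma>'" "degrees \<sigma>'" using g by (simp_all add: hv_exact_def mv_light_def mv_heavy_def indep_def degrees_def s)
  moreover have "light_cov X \<sigma>' gs'" using g(5) z(2) by (auto simp: light_cov_def e)
  moreover have "heavy_cov X \<sigma>' gs'" using g(6) z(1) by (fastforce simp: heavy_cov_def e Z2_def s)
  moreover have "stale \<sigma>' gs'" using g(7) z(1) by (auto simp: stale_def s)
  ultimately show ?thesis using z by (simp add: Inv_def)
qed

end

section \<open>Elementary runs\<close>

text \<open>The number of edges enters the analysis of a recovery through \<open>evid\<close> alone,
  which turns a crowd of vertices of large degree into room for another level. The bound
  \<open>tq\<close> lets sums over \<open>n\<close> vertices and all seeds fit into \<open>t\<close>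
  bits.\<close>

locale arena = proto +
  assumes cardV: "card V = n"
    and ids: "\<And>v. v \<in> V \<Longrightarrow> v < n ^ c"
    and evid: "\<And>H K. H \<subseteq> V \<Longrightarrow> 2 ^ K \<le> card H \<Longrightarrow> (\<And>v. v \<in> H \<Longrightarrow> 4 ^ K < 2 * card (N v)) \<Longrightarrow> K < kap"
    and tq: "4 * n ^ 4 * 2 ^ (2 * q) < 2 ^ t" "kap < 2 ^ t" "3 \<le> t"
begin

lemma t8: "8 \<le> (2::nat) ^ t"
proof -
  have "(2::nat) ^ 3 \<le> 2 ^ t" by (rule power_increasing) (use tq in auto)
  then show ?thesis by simp
qed

lemma n2: "2 * n < 2 ^ t"
proof (cases "n = 0")
  case False
  then have "n * 1 \<le> n * n ^ 3" by (intro mult_left_mono) auto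
  also have "n * n ^ 3 = n ^ 4" by (simp add: eval_nat_numeral)
  finally have a: "2 * n \<le> 4 * n ^ 4" by linarith
  have "4 * n ^ 4 * 1 \<le> 4 * n ^ 4 * (2::nat) ^ (2 * q)" by (intro mult_left_mono) auto
  then show ?thesis using a tq(1) by linarith
qed simp

lemma q2: "2 ^ (2 * q) < (2::nat) ^ t" if "V \<noteq> {}"
proof -
  have "n \<noteq> 0" using that cardV finV by auto
  then have "1 * 2 ^ (2 * q) \<le> 4 * n ^ 4 * (2::nat) ^ (2 * q)" by (intro mult_right_mono) auto
  then show ?thesis using tq(1) by linarith
qed

lemma degn: "card (N v) \<le> n"
  using card_mono[OF finV, of "N v"] NV cardV by blast

lemma mok_Call: "K \<le> kap \<Longrightarrow> mok t (Call K)" using t8 tq by (simp add: mok_def)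
lemma mok_Ret: "mok t Ret" and mok_Start: "mok t Start" using t8 by (simp_all add: mok_def)
lemma mok_Query: "K \<le> kap \<Longrightarrow> mok t (Cmd1 (Query K)) \<and> mok t (Cmd2 (Query K))"
  using t8 tq by (simp add: mok_def)

lemma mok_Stat: "p \<le> 2 * n \<Longrightarrow> mok t (Stat h m p r)"
  using t8 n2 by (simp add: mok_def of_bool_def)

lemma mok_own: "Inv X \<sigma> gs \<Longrightarrow> v \<in> V \<Longrightarrow> mok t (own_stat (\<sigma> v) r)"
proof -
  assume a: "Inv X \<sigma> gs" "v \<in> V"
  then have "heavy (\<sigma> v) \<Longrightarrow> pd (\<sigma> v) \<le> 2 * card (N v)" by (auto simp: Inv_def degrees_def split: if_splits)
  then have "(if heavy (\<sigma> v) then pd (\<sigma> v) else 0) \<le> 2 * n" using degn[of v] by auto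
  then show ?thesis unfolding own_stat_def by (rule mok_Stat)
qed

lemma card_many: "finite A \<Longrightarrow> card {(u, w). many x A m u w \<noteq> None} \<le> card A"
  by (rule order_trans[OF card_sends[of "{x}" "\<lambda>_. A"]]) (auto simp: many_def split: if_splits)

lemma many_empty [simp]: "many x {} m = none" by (auto simp: many_def none_def)

lemma step_idle: "ctl s = Idle \<Longrightarrow> step c n v M (\<lambda>_. None) s = (s, \<lambda>_. None)"
  by (simp add: step_idle_None awk_def)

definition control :: "msg \<Rightarrow> bool" where
  "control m \<longleftrightarrow> (\<forall>h b p r x. m \<noteq> Stat h b p r \<and> m \<noteq> Pub x)"

lemma own_stat_ctl [simp]: "own_stat (s\<lparr>ctl := x\<rparr>) r = own_stat s r"
  by (simp add: own_stat_def)

lemma control_simps [simp]: "control (Call K)" "control Ret" "control Start" by (simp_all add: control_def)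

lemma deliver:
  assumes q: "quiet \<sigma>" and c: "control m"
    and s: "idle_step q y (N y) (to_set {x} m) (\<sigma> y) = (s', to_set A m')"
    and A: "A \<subseteq> N y" "A \<noteq> {} \<Longrightarrow> mok t m'"
  shows "rch (\<sigma>, many x {y} m) (\<sigma>(y := s'), many y A m') 1 (card A)"
proof (rule rch1)
  fix v
  have pl: "plain (to_set {x} m)" using c by (auto simp: plain_def control_def)
  show "step c n v (N v) (\<lambda>u. many x {y} m u v) (\<sigma> v) = ((\<sigma>(y := s')) v, if v = y then to_set A m' else (\<lambda>_. None))"
  proof (cases "v = y")
    case True
    then have "(\<lambda>u. many x {y} m u v) = to_set {x} m" by (auto simp: many_def to_set_def)
    then show ?thesis using True s q absorb_plain[OF pl] by (simp add: step_def Let_def quiet_def)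
  next
    case False
    then have "(\<lambda>u. many x {y} m u v) = (\<lambda>_. None)" by (auto simp: many_def)
    then show ?thesis using False q by (simp add: step_idle quiet_def)
  qed
next
  show "many y A m' u w = (if w \<in> N u then (if u = y then to_set A m' else (\<lambda>_. None)) w else None)" for u w
    using A by (auto simp: many_def to_set_def)
  show "(\<exists>v. ctl (\<sigma> v) \<noteq> Idle) \<or> (\<exists>u w. many x {y} m u w \<noteq> None)"
    by (intro disjI2 exI[of _ x] exI[of _ y]) (simp add: many_def)
  show "many y A m' u w = Some m'' \<Longrightarrow> mok t m''" for u w m'' using A(2) by (auto simp: many_def split: if_splits)
  show "card {(u, w). many y A m' u w \<noteq> None} \<le> card A"
    by (rule card_many) (rule finite_subset[OF A(1) finN])
qed

lemma solo_step:
  assumes so: "solo \<sigma> w x" "x \<noteq> Idle"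
    and s: "step c n w (N w) (\<lambda>_. None) (\<sigma> w) = (s', to_set A m')"
    and A: "A \<subseteq> N w" "A \<noteq> {} \<Longrightarrow> mok t m'"
  shows "rch (\<sigma>, none) (\<sigma>(w := s'), many w A m') 1 (card A)"
proof (rule rch1)
  fix v
  show "step c n v (N v) (\<lambda>u. none u v) (\<sigma> v) = ((\<sigma>(w := s')) v, if v = w then to_set A m' else (\<lambda>_. None))"
    using so s by (cases "v = w") (auto simp: none_def step_idle solo_def)
next
  show "many w A m' u y = (if y \<in> N u then (if u = w then to_set A m' else (\<lambda>_. None)) y else None)" for u y
    using A by (auto simp: many_def to_set_def)
  show "(\<exists>v. ctl (\<sigma> v) \<noteq> Idle) \<or> (\<exists>u y. none u y \<noteq> None)"
    using so by (intro disjI1 exI[of _ w]) (simp add: solo_def)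
  show "many w A m' u y = Some m'' \<Longrightarrow> mok t m''" for u y m'' using A(2) by (auto simp: many_def split: if_splits)
  show "card {(u, y). many w A m' u y \<noteq> None} \<le> card A"
    by (rule card_many) (rule finite_subset[OF A(1) finN])
qed

lemma solo_silent:
  assumes "solo \<sigma> w x" "x \<noteq> Idle" "step c n w (N w) (\<lambda>_. None) (\<sigma> w) = (s', \<lambda>_. None)"
  shows "rch (\<sigma>, none) (\<sigma>(w := s'), none) 1 0"
  using solo_step[of \<sigma> w x s' "{}"] assms by simp

lemma tell_round:
  assumes so: "solo \<sigma> v Wait" and v: "v \<in> V"
  shows "rch (\<sigma>, many v (N v) (own_stat (\<sigma> v) False)) (tell (\<sigma>(v := (\<sigma> v)\<lparr>ctl := Pre\<rparr>)) v, none) 1 0"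
proof (rule rch1)
  fix y
  obtain h b p where os: "own_stat (\<sigma> v) False = Stat h b p False" by (simp add: own_stat_def)
  have os': "own_stat ((\<sigma>(v := (\<sigma> v)\<lparr>ctl := Pre\<rparr>)) v) False = Stat h b p False" using os by simp
  show "step c n y (N y) (\<lambda>u. many v (N v) (own_stat (\<sigma> v) False) u y) (\<sigma> y) = (tell (\<sigma>(v := (\<sigma> v)\<lparr>ctl := Pre\<rparr>)) v y, \<lambda>_. None)"
  proof (cases "y \<in> N v")
    case True
    then have yv: "y \<noteq> v" by auto
    then have id: "ctl (\<sigma> y) = Idle" using so by (simp add: solo_def)
    have bx: "(\<lambda>u. many v (N v) (own_stat (\<sigma> v) False) u y) = (\<lambda>u. if u = v then Some (Stat h b p False) else None)"
      using True by (auto simp: many_def os)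
    have rp: "reply (\<lambda>u. if u = v then Some (Stat h b p False) else None) s = (\<lambda>_. None)" for s
      by (auto simp: reply_def fun_eq_iff)
    have "idle_step q y (N y) (\<lambda>u. if u = v then Some (Stat h b p False) else None) s = (s, \<lambda>_. None)" for s
      unfolding idle_step_def by (simp add: rp)
    then show ?thesis unfolding bx tell_def os' using id True yv by (simp add: step_def Let_def)
  next
    case False
    have bx: "(\<lambda>u. many v (N v) (own_stat (\<sigma> v) False) u y) = (\<lambda>_. None)" using False by (auto simp: many_def)
    show ?thesis
    proof (cases "y = v")
      case True
      then show ?thesis using so unfolding bx by (simp add: tell_def solo_def step_def)
    next
      case yv: False
      then have "ctl (\<sigma> y) = Idle" using so by (simp add: solo_def)
      then show ?thesis using False yv unfolding bx by (simp add: step_idle tell_def)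
    qed
  qed
next
  show "(\<exists>y. ctl (\<sigma> y) \<noteq> Idle) \<or> (\<exists>u y. many v (N v) (own_stat (\<sigma> v) False) u y \<noteq> None)"
    using so by (intro disjI1 exI[of _ v]) (simp add: solo_def)
qed (auto simp: none_def)

lemma call_bec:
  assumes q: "quiet \<sigma>" and v: "x \<in> N v" and h: "\<not> heavy (\<sigma> v) \<or> pd (\<sigma> v) \<le> 4 ^ K"
  shows "rch (\<sigma>, many x {v} (Call K)) (bec \<sigma> v (Some x), none) 2 (card (N v))" "solo (bec \<sigma> v (Some x)) v Pre"
proof -
  let ?s = "become (Some x) (N v) (\<sigma> v)"
  have m: "mok t (own_stat ?s False)" unfolding own_stat_def by (rule mok_Stat) (simp add: become_def)
  have 1: "rch (\<sigma>, many x {v} (Call K)) (\<sigma>(v := ?s), many v (N v) (own_stat ?s False)) 1 (card (N v))"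
    by (rule deliver) (use q h m in \<open>simp_all add: idle_Call on_call_def Let_def\<close>)
  have 2: "solo (\<sigma>(v := ?s)) v Wait" using q by (simp add: solo_def become_def quiet_def)
  have "rch (\<sigma>(v := ?s), many v (N v) (own_stat ?s False)) (bec \<sigma> v (Some x), none) 1 0"
    using tell_round[OF 2 NV(2)[OF v]] by (simp add: bec_def)
  from rch_trans[OF 1 this] show "rch (\<sigma>, many x {v} (Call K)) (bec \<sigma> v (Some x), none) 2 (card (N v))"
    by (simp add: numeral_2_eq_2)
  show "solo (bec \<sigma> v (Some x)) v Pre" using q by (simp add: solo_def bec_sel quiet_def)
qed

lemma stacks_hd: "stacks \<sigma> ((x, f) # gs) \<Longrightarrow> stk (\<sigma> x) = f # map snd (filter (\<lambda>f. fst f = x) gs)"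
  by (simp add: stacks_def)

lemma Z1_Fwd [simp]: "Z1 ((x, Fwd z) # gs) = Z1 gs" and PL_Fwd [simp]: "PL ((x, Fwd z) # gs) = PL gs"
  by (auto simp: Z1_def PL_def)

lemma Z1_Hub: "Z1 ((x, Hub p K l) # gs) = insert x (N x) \<union> Z1 gs"
  by (auto simp: Z1_def)

lemma PL_Hub: "PL ((x, Hub p K l) # gs) = (if l then N x else {}) \<union> PL gs"
  by (auto simp: PL_def)

lemma ret_hub:
  assumes q: "quiet \<sigma>" and i: "Inv X \<sigma> ((x, Hub p K l) # gs)"
  shows "rch (\<sigma>, many y {x} Ret) (\<sigma>(x := (\<sigma> x)\<lparr>ctl := Pre\<rparr>), none) 1 0"
    "Inv X (\<sigma>(x := (\<sigma> x)\<lparr>ctl := Pre\<rparr>)) ((x, Hub p K l) # gs)"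
    "solo (\<sigma>(x := (\<sigma> x)\<lparr>ctl := Pre\<rparr>)) x Pre" "same \<sigma> (\<sigma>(x := (\<sigma> x)\<lparr>ctl := Pre\<rparr>))"
proof -
  have st: "stk (\<sigma> x) = Hub p K l # map snd (filter (\<lambda>f. fst f = x) gs)"
    using i stacks_hd by (auto simp: Inv_def)
  have "rch (\<sigma>, many y {x} Ret) (\<sigma>(x := (\<sigma> x)\<lparr>ctl := Pre\<rparr>), many x {} Ret) 1 (card ({}::nat set))"
    by (rule deliver) (use q st in \<open>simp_all add: idle_Ret\<close>)
  then show "rch (\<sigma>, many y {x} Ret) (\<sigma>(x := (\<sigma> x)\<lparr>ctl := Pre\<rparr>), none) 1 0" by simp
  show sm: "same \<sigma> (\<sigma>(x := (\<sigma> x)\<lparr>ctl := Pre\<rparr>))" by (simp add: same_def)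
  show "Inv X (\<sigma>(x := (\<sigma> x)\<lparr>ctl := Pre\<rparr>)) ((x, Hub p K l) # gs)"
    by (rule same_Inv[OF sm i]) (use i in \<open>auto simp: Inv_def stacks_def\<close>)
  show "solo (\<sigma>(x := (\<sigma> x)\<lparr>ctl := Pre\<rparr>)) x Pre" using q by (simp add: solo_def quiet_def)
qed

lemma ret_fwd:
  assumes q: "quiet \<sigma>" and i: "Inv X \<sigma> ((x, Fwd z) # f # gs)"
  shows "\<exists>\<sigma>'. rch (\<sigma>, many y {x} Ret) (\<sigma>', many x {z} Ret) 1 1 \<and> Inv X \<sigma>' (f # gs) \<and> quiet \<sigma>' \<and> same \<sigma> \<sigma>' \<and> fst f = z"
proof -
  have st: "stk (\<sigma> x) = Fwd z # map snd (filter (\<lambda>f. fst f = x) (f # gs))"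
    using i stacks_hd by (fastforce simp: Inv_def)
  have lk: "linked ((x, Fwd z) # f # gs)" using i by (simp add: Inv_def)
  obtain a b where f: "f = (a, b)" by force
  have fz: "a = z" "z \<in> N x" "linked (f # gs)" using lk by (auto simp: f)
  let ?s = "\<sigma>(x := (\<sigma> x)\<lparr>stk := tl (stk (\<sigma> x))\<rparr>)"
  have "rch (\<sigma>, many y {x} Ret) (?s, many x {z} Ret) 1 (card {z})"
    by (rule deliver) (use q st fz mok_Ret in \<open>simp_all add: idle_Ret\<close>)
  moreover have sm: "same \<sigma> ?s" by (simp add: same_def)
  moreover have "Inv X ?s (f # gs)"
    by (rule same_Inv[OF sm i]) (use i st fz in \<open>auto simp: Inv_def stacks_def bounded_def f\<close>)
  moreover have "quiet ?s" using q by (simp add: quiet_def)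
  ultimately show ?thesis using fz f by auto
qed

definition tgt :: "nat \<Rightarrow> world \<Rightarrow> vertex \<Rightarrow> vertex" where
  "tgt K \<sigma> v = (if lows K (N v) (\<sigma> v) \<noteq> {} then (LEAST u. u \<in> lows K (N v) (\<sigma> v)) else badc (\<sigma> v))"

lemma call_fwd:
  assumes q: "quiet \<sigma>" and i: "Inv X \<sigma> ((x, f) # gs)" and v: "x \<in> N v"
    and h: "heavy (\<sigma> v)" "pd (\<sigma> v) > 4 ^ K" and tg: "tgt K \<sigma> v \<in> N v" and K: "K \<le> kap"
  defines "\<sigma>' \<equiv> \<sigma>(v := (\<sigma> v)\<lparr>stk := Fwd x # stk (\<sigma> v)\<rparr>)"
  shows "rch (\<sigma>, many x {v} (Call K)) (\<sigma>', many v {tgt K \<sigma> v} (Call K)) 1 1"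
    "Inv X \<sigma>' ((v, Fwd x) # (x, f) # gs)" "quiet \<sigma>'" "same \<sigma> \<sigma>'"
proof -
  have "rch (\<sigma>, many x {v} (Call K)) (\<sigma>', many v {tgt K \<sigma> v} (Call K)) 1 (card {tgt K \<sigma> v})"
    unfolding \<sigma>'_def
    by (rule deliver) (use q h tg mok_Call[OF K] in \<open>simp_all add: idle_Call on_call_def tgt_def\<close>)
  then show "rch (\<sigma>, many x {v} (Call K)) (\<sigma>', many v {tgt K \<sigma> v} (Call K)) 1 1" by simp
  show sm: "same \<sigma> \<sigma>'" by (simp add: same_def \<sigma>'_def)
  show "Inv X \<sigma>' ((v, Fwd x) # (x, f) # gs)"
    by (rule same_Inv[OF sm i]) (use i v NV in \<open>auto simp: Inv_def stacks_def bounded_def \<sigma>'_def\<close>)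
  show "quiet \<sigma>'" using q by (simp add: quiet_def \<sigma>'_def)
qed

text \<open>The index is the number of forwarding steps before a call arrives at a vertex that turns
  light. The route depends on the memories on the way, hence the separate lemma that changes of
  control do not affect it.\<close>

inductive callable :: "nat \<Rightarrow> world \<Rightarrow> vertex \<Rightarrow> nat \<Rightarrow> bool" for K where
  base: "v \<in> V \<Longrightarrow> heavy (\<sigma> v) \<and> pd (\<sigma> v) \<le> 4 ^ K \<or> lunc (N v) (\<sigma> v) \<Longrightarrow> callable K \<sigma> v 0"
| fwd: "heavy (\<sigma> v) \<Longrightarrow> pd (\<sigma> v) > 4 ^ K \<Longrightarrow> tgt K \<sigma> v \<in> N v \<Longrightarrow> callable K \<sigma> (tgt K \<sigma> v) d \<Longrightarrow>
    callable K \<sigma> v (Suc d)"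

lemma callable_same:
  assumes "callable K \<sigma> v d" "same \<sigma> \<sigma>'" "\<And>v. badc (\<sigma>' v) = badc (\<sigma> v)"
  shows "callable K \<sigma>' v d"
  using assms
proof (induction rule: callable.induct)
  case (base v \<sigma>)
  then show ?case by (intro callable.base) (auto simp: same_sel same_sets)
next
  case (fwd \<sigma> v d)
  have t: "tgt K \<sigma>' v = tgt K \<sigma> v" using fwd.prems by (simp add: tgt_def same_sets)
  show ?case by (rule callable.fwd) (use fwd t in \<open>auto simp: same_sel\<close>)
qed

end

section \<open>Queries\<close>

definition tle :: "tally \<Rightarrow> nat \<Rightarrow> bool" where
  "tle x b \<longleftrightarrow> fst x \<le> b \<and> fst (snd x) \<le> b \<and> snd (snd x) \<le> b"

lemma tle_sum: "(\<And>y. y \<in> A \<Longrightarrow> tle (f y) b) \<Longrightarrow> tle (\<Sum>y\<in>A. f y) (card A * b)"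
  unfolding tle_def fst_sum snd_sum by (auto intro!: sum_bounded_above[of A _ b, simplified])

lemma tle_add: "tle x b \<Longrightarrow> tle y d \<Longrightarrow> tle (x + y) (b + d)"
  by (auto simp: tle_def)

lemma con_cong:
  assumes "heavy s = heavy s'" "inm s = inm s'" "mv s = mv s'" "hv s = hv s'" "pub s = pub s'"
  shows "con q v M i k s = con q v M i k s'"
proof -
  have e: "unc M s = unc M s'" "lunc M s = lunc M s'" "lows K M s = lows K M s'" "over K M s = over K M s'"
    "yn M s = yn M s'" for K
    by (simp_all add: unc_def lunc_def lcov_def lows_def over_def hn_def yn_def assms)
  show ?thesis unfolding con_def e assms(1,5) ..
qed

context rpc
begin

text \<open>The choice of parents partitions the leaves, so the two-stage sum contains each leaf
  once.\<close>

lemma fin_total: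
  assumes "\<And>x. x \<in> I \<Longrightarrow> finite (T x)"
  shows "(\<Sum>y\<in>ch w. C y) + (\<Sum>z\<in>S. R z) = (\<Sum>v\<in>S \<union> Lf. C v)"
proof -
  have fL: "finite Lf" unfolding Lf_def by (intro finite_Diff finite_UN_I) (use assms in \<open>auto simp: I_def\<close>)
  have fch: "finite (ch x)" for x using fL by (simp add: ch_def)
  have "Lf = (\<Union>x\<in>I. ch x)" using lf_parent by (auto simp: ch_def)
  then have "(\<Sum>y\<in>Lf. C y) = (\<Sum>y\<in>(\<Union>x\<in>I. ch x). C y)" by (rule arg_cong)
  also have "\<dots> = (\<Sum>x\<in>I. \<Sum>y\<in>ch x. C y)"
    by (rule sum.UNION_disjoint) (use fL in \<open>auto simp: ch_def I_def\<close>)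
  also have "\<dots> = (\<Sum>y\<in>ch w. C y) + (\<Sum>z\<in>S. \<Sum>y\<in>ch z. C y)"
    unfolding I_def using w_notin_S by simp
  finally have "(\<Sum>y\<in>ch w. C y) + (\<Sum>z\<in>S. R z) = (\<Sum>y\<in>Lf. C y) + (\<Sum>z\<in>S. C z)"
    by (simp add: R_def sum.distrib add.assoc)
  also have "\<dots> = (\<Sum>v\<in>S \<union> Lf. C v)"
  proof -
    have "S \<inter> Lf = {}" by (auto simp: Lf_def I_def)
    then show ?thesis using fL by (simp add: sum.union_disjoint add.commute)
  qed
  finally show ?thesis .
qed

lemma fin_sel [simp]:
  "heavy (fin v) = heavy (sb v)" "inm (fin v) = inm (sb v)" "pd (fin v) = pd (sb v)" "hv (fin v) = hv (sb v)"
  "mv (fin v) = mv (sb v)" "pub (fin v) = pub (sb v)" "stk (fin v) = stk (sb v)" "dem (fin v) = dem (sb v)"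
  by (simp_all add: fin_def upd_bad_def)

lemma fin_ctl: "v \<noteq> w \<Longrightarrow> ctl (fin v) = ctl (\<sigma> v)"
  by (simp add: fin_def upd_bad_def)

lemma sb_sel: "heavy (sb v) = heavy (\<sigma> v)" "pd (sb v) = pd (\<sigma> v)" "stk (sb v) = stk (\<sigma> v)" "kids (sb v) = kids (\<sigma> v)"
  by (simp_all add: sb_def sa_def A_def)

lemma fin_con: "con q v (N v) i k (fin v) = con q v (N v) i k (sb v)"
  by (rule con_cong) simp_all

lemma C_fin: "C v = con q v (N v) (v \<in> I) k (fin v)"
  by (simp add: C_def fin_con)

end

context arena
begin

definition sphere :: "world \<Rightarrow> vertex \<Rightarrow> vertex set" where
  "sphere \<sigma> w = hn (N w) (\<sigma> w)"

definition ball :: "world \<Rightarrow> vertex \<Rightarrow> vertex set" where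
  "ball \<sigma> w = insert w (sphere \<sigma> w) \<union> (\<Union>z\<in>sphere \<sigma> w. hn (N z) (\<sigma> z))"

text \<open>What a query without complaints establishes. The clause about \<open>mv\<close> holds
  because the query makes the hub and its heavy neighbours announce their status; it is what permits
  the hub to give up its responsibility for outdated views.\<close>

definition clean :: "nat \<Rightarrow> bool \<Rightarrow> world \<Rightarrow> vertex \<Rightarrow> bool" where
  "clean K l \<sigma> w \<longleftrightarrow> fit K (N w) (\<sigma> w) \<and> (\<forall>z\<in>sphere \<sigma> w. fit K (N z) (\<sigma> z)) \<and>
     (\<forall>v\<in>ball \<sigma> w. unc (N v) (\<sigma> v) \<longrightarrow> fit K (N v) (\<sigma> v)) \<and>
     (\<forall>u\<in>insert w (sphere \<sigma> w). \<forall>v\<in>hn (N u) (\<sigma> u). u \<in> mv (\<sigma> v) \<longleftrightarrow> inm (\<sigma> u)) \<and>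
     (l \<longrightarrow> (\<forall>v\<in>N w. \<not> lunc (N v) (\<sigma> v)))"

definition uncs :: "world \<Rightarrow> vertex \<Rightarrow> vertex set" where
  "uncs \<sigma> w = {v \<in> ball \<sigma> w. unc (N v) (\<sigma> v)}"

lemma ball_V: "w \<in> V \<Longrightarrow> ball \<sigma> w \<subseteq> V"
  using NV by (auto simp: ball_def sphere_def hn_def)

lemma fin_ball [simp]: "finite (ball \<sigma> w)"
  by (simp add: ball_def sphere_def)

lemma W1: "1 \<le> W" "K \<le> kap \<Longrightarrow> 2 ^ K * 2 ^ K \<le> W" "K \<le> kap \<Longrightarrow> 2 ^ K \<le> W"
proof -
  show "1 \<le> W" by (simp add: W_def)
  assume K: "K \<le> kap"
  have "(2::nat) ^ K * 2 ^ K = 4 ^ K" by (simp flip: power_mult_distrib)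
  also have "\<dots> \<le> 4 ^ kap" by (rule power_increasing) (use K in auto)
  finally show a: "2 ^ K * 2 ^ K \<le> W" by (simp add: W_def)
  show "2 ^ K \<le> W" by (rule order_trans[OF _ a]) simp
qed

text \<open>Published degrees are at most twice the true ones, so a crowd of large published degrees
  is the evidence that \<open>evid\<close> asks for.\<close>

lemma heavies_kap:
  assumes i: "Inv X \<sigma> gs" and H: "H \<subseteq> V" "2 ^ K \<le> card H"
    and h: "\<And>v. v \<in> H \<Longrightarrow> heavy (\<sigma> v) \<and> 4 ^ K < pd (\<sigma> v)"
  shows "K < kap"
proof (rule evid[OF H])
  fix v assume v: "v \<in> H"
  then have "pd (\<sigma> v) \<le> 2 * card (N v)" using i H h[OF v] by (auto simp: Inv_def degrees_def)
  then show "4 ^ K < 2 * card (N v)" using h[OF v] by linarith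
qed

lemma over_kap:
  assumes i: "Inv X \<sigma> gs" and o: "over K (N v) (\<sigma> v)" "lows K (N v) (\<sigma> v) = {}"
  shows "K < kap"
proof (rule heavies_kap[OF i])
  have g: "hv_exact \<sigma>" using i by (simp add: Inv_def)
  show "hn (N v) (\<sigma> v) \<subseteq> V" using NV by (auto simp: hn_def)
  show "2 ^ K \<le> card (hn (N v) (\<sigma> v))" using o by (simp add: over_def)
  fix u assume "u \<in> hn (N v) (\<sigma> v)"
  then show "heavy (\<sigma> u) \<and> 4 ^ K < pd (\<sigma> u)" using o(2) unfolding hn_eq[OF g] lows_eq[OF g]
    by (auto simp: not_le)
qed

end

locale asking = arena +
  fixes \<sigma> w K p l gs X
  assumes i: "Inv X \<sigma> ((w, Hub p K l) # gs)"
    and so: "solo \<sigma> w (Top 0 (Query K) 0)"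
    and fw: "fit K (N w) (\<sigma> w)"
begin

sublocale R: rpc c n t E V \<sigma> w "Query K" by unfold_locales

abbreviation "S \<equiv> sphere \<sigma> w"
abbreviation "I \<equiv> insert w S"

lemma gg: "hv_exact \<sigma>" "mv_light \<sigma>" "mv_heavy \<sigma>" "indep \<sigma>" using i by (auto simp: Inv_def)

lemma wV: "w \<in> V" and Kk: "K \<le> kap" and lW: "l \<Longrightarrow> card (N w) \<le> 2 * W + 1"
  using i by (auto simp: Inv_def bounded_def)

lemma RS: "R.S = S" "R.I = I" by (simp_all add: R.S_def R.I_def sphere_def)

lemma stw: "\<exists>fs. stk (\<sigma> w) = Hub p K l # fs"
  using i stacks_hd by (auto simp: Inv_def)

lemma RT: "R.T w = (if l then N w - S else {})"
  "z \<in> S \<Longrightarrow> R.T z = (if fit K (N z) (\<sigma> z) then hn (N z) (\<sigma> z) else {})"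
proof -
  show "R.T w = (if l then N w - S else {})" using stw by (auto simp: R.T_def ttgt_def sphere_def)
  assume "z \<in> S"
  then have "z \<noteq> w" using R.w_notin_S RS by auto
  then show "R.T z = (if fit K (N z) (\<sigma> z) then hn (N z) (\<sigma> z) else {})" by (simp add: R.T_def mtgt_def)
qed

lemma TN: "x \<in> I \<Longrightarrow> R.T x \<subseteq> N x"
  using RT by (auto simp: hn_def split: if_splits)

lemma finT: "x \<in> R.I \<Longrightarrow> finite (R.T x)"
  using TN finN finite_subset RS by metis

lemma lat_eq: "R.lat u = to_set (if u \<in> I \<and> fit K (N u) (\<sigma> u) then hn (N u) (\<sigma> u) else {}) (own_stat (\<sigma> u) False)"
  using RS by (auto simp: R.lat_def R.A_def act_def R.M_def)

lemma lat_Some: "R.lat u v = Some m \<longleftrightarrow> u \<in> I \<and> fit K (N u) (\<sigma> u) \<and> v \<in> hn (N u) (\<sigma> u) \<and> m = own_stat (\<sigma> u) False"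
  by (auto simp: lat_eq)

lemma sa_sel: "hv (R.sa v) = hv (\<sigma> v)" "mv (R.sa v) = mv (\<sigma> v)" "inm (R.sa v) = inm (\<sigma> v)"
  "pub (R.sa v) = (if v \<in> R.M then (\<lambda>_. None) else pub (\<sigma> v))"
  by (simp_all add: R.sa_def R.A_def act_def)

lemma lat_N: "R.lat u v = Some m \<Longrightarrow> u \<in> N v"
  using Nsym by (auto simp: lat_Some hn_def)

lemma sb_sel:
  "hv (R.sb v) = hv (\<sigma> v)" "inm (R.sb v) = inm (\<sigma> v)"
  "(u \<in> mv (R.sb v)) = (if u \<in> I \<and> fit K (N u) (\<sigma> u) \<and> v \<in> hn (N u) (\<sigma> u) then inm (\<sigma> u) else u \<in> mv (\<sigma> v))"
  "pub (R.sb v) = (if v \<in> R.M then (\<lambda>_. None) else pub (\<sigma> v))"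
proof -
  show "hv (R.sb v) = hv (\<sigma> v)"
  proof
    fix u
    show "hv (R.sb v) u = hv (\<sigma> v) u"
    proof (cases "R.lat u v")
      case None
      then show ?thesis by (simp add: R.sb_def absorb_def sa_sel)
    next
      case (Some m)
      then have "m = own_stat (\<sigma> u) False" "u \<in> N v" using lat_N by (auto simp: lat_Some)
      then show ?thesis using hv_eq[OF gg(1), of u v] Some by (simp add: R.sb_def absorb_def own_stat_def)
    qed
  qed
  show "inm (R.sb v) = inm (\<sigma> v)"
  proof -
    have "\<not> inm (\<sigma> v)" if "R.lat u v = Some (Stat h True p r)" for u h p r
      using that lat_N[OF that] gg(4) by (auto simp: lat_Some own_stat_def indep_def)
    then show ?thesis by (auto simp: R.sb_def absorb_def sa_sel)
  qed
  show "(u \<in> mv (R.sb v)) = (if u \<in> I \<and> fit K (N u) (\<sigma> u) \<and> v \<in> hn (N u) (\<sigma> u) then inm (\<sigma> u) else u \<in> mv (\<sigma> v))"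
  proof (cases "R.lat u v")
    case None
    then have "\<not> (u \<in> I \<and> fit K (N u) (\<sigma> u) \<and> v \<in> hn (N u) (\<sigma> u))" using lat_Some[of u v] by auto
    then show ?thesis using None by (auto simp: R.sb_def absorb_def sa_sel)
  next
    case (Some m)
    then have "u \<in> I \<and> fit K (N u) (\<sigma> u) \<and> v \<in> hn (N u) (\<sigma> u) \<and> m = own_stat (\<sigma> u) False"
      using lat_Some by blast
    then show ?thesis using Some by (simp add: R.sb_def absorb_def own_stat_def)
  qed
  have "R.lat u v \<noteq> Some (Pub x)" for u x by (simp add: lat_Some own_stat_def)
  then show "pub (R.sb v) = (if v \<in> R.M then (\<lambda>_. None) else pub (\<sigma> v))"
    by (simp add: R.sb_def absorb_def after_other sa_sel)
qed

lemma fresh: "refresh \<sigma> R.fin"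
  unfolding refresh_def by (simp add: R.sb_sel sb_sel)

lemma inv: "Inv X R.fin ((w, Hub p K l) # gs)"
  by (rule refresh_Inv[OF fresh i])

lemmas fr = refresh_sel[OF fresh] refresh_sets[OF fresh] R.sb_sel(1,2) sb_sel(1,2)

lemma g': "hv_exact R.fin" "mv_light R.fin" using inv by (auto simp: Inv_def)

lemma Lf_eq: "R.Lf = (R.T w \<union> (\<Union>z\<in>S. R.T z)) - I"
  by (simp add: R.Lf_def RS)

lemma Lf_V: "R.Lf \<subseteq> V"
proof -
  have "R.T x \<subseteq> V" if "x \<in> I" for x using TN[OF that] NV by blast
  then show ?thesis by (auto simp: Lf_eq)
qed

lemma S_V: "S \<subseteq> V" using NV by (auto simp: sphere_def hn_def)

lemma C_eq: "R.C v = con q v (N v) (v \<in> I) (Query K) (R.fin v)"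
  using R.C_fin RS by simp

lemma C_le: "tle (R.C v) 1"
  unfolding C_eq by (auto simp: con_def tle_def)

lemma run: "rch (\<sigma>, none) (R.fin, none) 6 (12 * W)"
  unfolding none_def
proof (rule R.round_trip)
  show "ctl (\<sigma> w) = Top 0 (Query K) 0" "v \<noteq> w \<Longrightarrow> ctl (\<sigma> v) = Idle" for v using so by (auto simp: solo_def)
  show "x \<in> R.I \<Longrightarrow> R.T x \<subseteq> N x" for x using TN RS by simp
  show "mok t (Cmd1 (Query K))" "mok t (Cmd2 (Query K))" using mok_Query[OF Kk] by auto
  show "R.lat u v = Some m \<Longrightarrow> mok t m" for u v m
    using mok_own[OF i, of u] lat_N[of u v m] NV by (auto simp: lat_Some)
  have small: "mok t (Rep x)" if "tle x n" "V \<noteq> {}" for x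
  proof -
    have "0 < n" using that cardV finV by auto
    then show ?thesis using that n2 t8 by (auto simp: mok_def tle_def)
  qed
  have one: "1 \<le> n" using wV cardV finV by (metis One_nat_def Suc_leI card_gt_0_iff empty_iff)
  have ne: "V \<noteq> {}" using wV by auto
  show "mok t (Rep (R.C y))" for y
    by (rule small[OF _ ne]) (use C_le[of y] one in \<open>auto simp: tle_def\<close>)
  show "mok t (Rep (R.R z))" if z: "z \<in> R.S" for z
  proof (rule small[OF _ ne])
    have "tle (R.R z) (card (R.ch z) * 1 + 1)"
      unfolding R.R_def by (rule tle_add[OF tle_sum]) (use C_le in auto)
    moreover have "card (insert z (R.ch z)) \<le> card V"
      by (rule card_mono[OF finV]) (use Lf_V S_V z RS in \<open>auto simp: R.ch_def\<close>)
    moreover have "z \<notin> R.ch z" using z by (auto simp: R.ch_def R.Lf_def R.I_def)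
    moreover have "finite (R.ch z)" by (rule finite_subset[OF _ finV]) (use Lf_V in \<open>auto simp: R.ch_def\<close>)
    ultimately show "tle (R.R z) n" using cardV by (auto simp: tle_def)
  qed
  \<comment> \<open>The hub and at most \<open>2 ^ K\<close> inner vertices address at most
    \<open>2 ^ K\<close> heavy neighbours each, since only vertices that fit the level do so; the
    square is at most \<open>W\<close>. The light neighbours of the hub, if asked, add at most
    \<open>2 * W + 1\<close>.\<close>
  let ?k = "(2::nat) ^ K"
  have kk: "?k * ?k \<le> W" "?k \<le> W" using W1 Kk by auto
  have hnS: "card (hn (N u) (\<sigma> u)) \<le> ?k" if "fit K (N u) (\<sigma> u)" for u
    using that by (simp add: fit_def over_def)
  have cS: "card S \<le> ?k" using hnS[OF fw] by (simp add: sphere_def)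
  have wS: "w \<notin> S" using R.w_notin_S RS by simp
  have fS: "finite S" using RS R.fin_S by simp
  have cI: "card I \<le> ?k + 1" using cS fS wS by simp
  have "card (R.T w) \<le> 2 * W + 1"
  proof (cases l)
    case True
    have "card (R.T w) \<le> card (N w)" by (rule card_mono) (use TN in auto)
    then show ?thesis using lW[OF True] by simp
  next
    case False
    then show ?thesis by (simp add: RT)
  qed
  moreover have "(\<Sum>z\<in>S. card (R.T z)) \<le> card S * ?k"
    using sum_bounded_above[of S "\<lambda>z. card (R.T z)" ?k] RT(2) hnS by auto
  moreover have "card S * ?k \<le> ?k * ?k" using cS by (intro mult_right_mono) auto
  moreover have "(\<Sum>x\<in>R.I. card (R.T x)) = card (R.T w) + (\<Sum>z\<in>S. card (R.T z))"
    unfolding RS using fS wS by simp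
  ultimately have sT: "(\<Sum>x\<in>R.I. card (R.T x)) \<le> 3 * W + 1" using kk by linarith
  have M: "R.M = I \<union> R.Lf" by (simp add: R.M_def RS)
  have fL: "finite R.Lf" by (rule finite_subset[OF Lf_V finV])
  have LI: "R.Lf \<inter> I = {}" by (auto simp: Lf_eq)
  have lz: "{v. R.lat u v \<noteq> None} = (if u \<in> I \<and> fit K (N u) (\<sigma> u) then hn (N u) (\<sigma> u) else {})" for u
    using lat_Some[of u] by (auto simp del: not_None_eq simp: lat_eq to_set_def)
  have "(\<Sum>u\<in>R.M. card {v. R.lat u v \<noteq> None}) = (\<Sum>u\<in>I. card {v. R.lat u v \<noteq> None}) + (\<Sum>u\<in>R.Lf. card {v. R.lat u v \<noteq> None})"
    unfolding M by (rule sum.union_disjoint) (use fS fL LI in auto)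
  also have "(\<Sum>u\<in>R.Lf. card {v. R.lat u v \<noteq> None}) = 0"
    unfolding lz using LI by (intro sum.neutral) auto
  also have "(\<Sum>u\<in>I. card {v. R.lat u v \<noteq> None}) \<le> card I * ?k"
    using sum_bounded_above[of I "\<lambda>u. card {v. R.lat u v \<noteq> None}" ?k] hnS unfolding lz by auto
  also have "card I * ?k \<le> (?k + 1) * ?k" by (rule mult_right_mono[OF cI]) simp
  finally have "(\<Sum>u\<in>R.M. card {v. R.lat u v \<noteq> None}) \<le> 2 * W" using kk by simp
  then show "2 * card R.S + 2 * (\<Sum>x\<in>R.I. card (R.T x)) + (\<Sum>u\<in>R.M. card {v. R.lat u v \<noteq> None}) \<le> 12 * W"
    using sT cS kk W1(1) unfolding RS by linarith
qed

definition "tot = (\<Sum>v\<in>S \<union> R.Lf. R.C v)"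

lemma fin_solo: "solo R.fin w (Dec (Query K) tot)"
proof -
  have "ctl (R.fin w) = Dec (Query K) tot"
    using R.fin_total[OF finT] RS by (simp add: R.fin_def tot_def)
  then show ?thesis using so R.fin_ctl by (simp add: solo_def)
qed

lemma exact: "u \<in> I \<Longrightarrow> fit K (N u) (\<sigma> u) \<Longrightarrow> v \<in> hn (N u) (\<sigma> u) \<Longrightarrow> u \<in> mv (R.fin v) \<longleftrightarrow> inm (\<sigma> u)"
  by (simp add: sb_sel)

lemma clean_same:
  assumes "clean K l \<sigma> w"
  shows "same \<sigma> R.fin"
proof -
  have "mv (R.sb v) = mv (\<sigma> v)" for v
    using assms by (auto simp: sb_sel(3) clean_def split: if_splits)
  then show ?thesis unfolding same_def by (simp add: R.sb_sel sb_sel)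
qed

definition "all = tot + con q w (N w) True (Query K) (R.fin w)"

lemma own: "fst (con q w (N w) True (Query K) (R.fin w)) = 0"
  "fst (snd (con q w (N w) True (Query K) (R.fin w))) = 0"
  "snd (snd (con q w (N w) True (Query K) (R.fin w))) = of_bool (unc (N w) (R.fin w))"
proof -
  have f: "lows K (N w) (R.fin w) = {}" "\<not> over K (N w) (R.fin w)"
    using fw by (simp_all add: fr fit_def)
  show "fst (con q w (N w) True (Query K) (R.fin w)) = 0"
    "fst (snd (con q w (N w) True (Query K) (R.fin w))) = 0"
    "snd (snd (con q w (N w) True (Query K) (R.fin w))) = of_bool (unc (N w) (R.fin w))"
    using f by (auto simp: con_def unc_def)
qed

lemma fin_SL: "finite (S \<union> R.Lf)"
  by (rule finite_subset[OF _ finV]) (use Lf_V S_V in auto)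

lemma all_bad: "fst all = 0 \<longleftrightarrow> (\<forall>v\<in>S \<union> R.Lf. fst (R.C v) = 0)"
  using fin_SL own by (simp add: all_def tot_def fst_sum)

lemma all_over: "fst (snd all) = 0 \<longleftrightarrow> (\<forall>v\<in>S \<union> R.Lf. fst (snd (R.C v)) = 0)"
  using fin_SL own by (simp add: all_def tot_def fst_sum snd_sum)

lemma heavy_S: "z \<in> S \<Longrightarrow> heavy (\<sigma> z) \<and> 4 ^ K < pd (\<sigma> z)"
  using fw unfolding sphere_def fit_def hn_eq[OF gg(1)] lows_eq[OF gg(1)] by (auto simp: not_le)

lemma ch_S: 
  assumes "z \<in> S" "y \<in> R.ch z"
  shows "heavy (\<sigma> y)" "4 ^ K < pd (\<sigma> y)" "y \<in> N z" "fit K (N z) (\<sigma> z)" "y \<notin> I"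
proof -
  have y: "y \<in> R.Lf" "R.P y = z" using assms by (auto simp: R.ch_def)
  then have T: "y \<in> R.T z" using R.lf_parent by blast
  then show f: "fit K (N z) (\<sigma> z)" using RT(2)[OF assms(1)] by (auto split: if_splits)
  have h: "y \<in> hn (N z) (\<sigma> z)" using T RT(2)[OF assms(1)] by (auto split: if_splits)
  show "heavy (\<sigma> y)" "y \<in> N z" "4 ^ K < pd (\<sigma> y)"
    using h f unfolding hn_eq[OF gg(1)] fit_def lows_eq[OF gg(1)] by (auto simp: not_le)
  show "y \<notin> I" using y by (simp add: Lf_eq)
qed

lemma ch_w:
  assumes "y \<in> R.ch w"
  shows "l" "y \<in> N w" "\<not> heavy (\<sigma> y)" "y \<notin> I"
proof -
  have y: "y \<in> R.Lf" "R.P y = w" using assms by (auto simp: R.ch_def)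
  then have T: "y \<in> R.T w" using R.lf_parent by metis
  then show "l" using RT(1) by (auto split: if_splits)
  show "y \<in> N w" using T RT(1) by (auto split: if_splits)
  show "\<not> heavy (\<sigma> y)" using T RT(1) unfolding sphere_def hn_eq[OF gg(1)] by (auto split: if_splits)
  show "y \<notin> I" using y by (simp add: Lf_eq)
qed

lemma Lf_ch: "y \<in> R.Lf \<Longrightarrow> y \<in> R.ch w \<or> (\<exists>z\<in>S. y \<in> R.ch z)"
  using R.lf_parent[of y] RS by (auto simp: R.ch_def)

lemma tgt_low: "lows K (N v) (R.fin v) \<noteq> {} \<Longrightarrow> tgt K R.fin v \<in> N v \<and> callable K R.fin (tgt K R.fin v) 0"
proof -
  assume a: "lows K (N v) (R.fin v) \<noteq> {}"
  then have "tgt K R.fin v \<in> lows K (N v) (R.fin v)" unfolding tgt_def by (auto intro: LeastI)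
  then show ?thesis unfolding lows_eq[OF g'(1)] using NV by (auto intro: callable.base)
qed

lemma call_leaf:
  assumes "z \<in> S" "y \<in> R.ch z" "fst (R.C y) > 0"
  shows "callable K R.fin y 1"
proof -
  have "lows K (N y) (R.fin y) \<noteq> {}"
    using assms(3) ch_S[OF assms(1,2)] unfolding C_eq con_def by (auto simp: fr split: if_splits)
  from tgt_low[OF this] show ?thesis
    using callable.fwd[of R.fin y K 0] ch_S[OF assms(1,2)] by (simp add: fr)
qed

lemma badc_S: "z \<in> S \<Longrightarrow> R.bd z \<noteq> {} \<Longrightarrow> badc (R.fin z) \<in> R.bd z"
proof -
  assume z: "z \<in> S" "R.bd z \<noteq> {}"
  then have "z \<noteq> w" using R.w_notin_S RS by auto
  then have "badc (R.fin z) = (LEAST u. u \<in> R.bd z)" using z RS by (simp add: R.fin_def upd_bad_def)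
  then show ?thesis using z by (auto intro: LeastI)
qed

text \<open>Either the inner vertex has a low neighbour itself, or its complaint stems from a leaf
  that has one and is remembered in \<open>badc\<close>. Two forwarding steps suffice in both
  cases.\<close>

lemma call_mid:
  assumes "z \<in> S" "fst (R.R z) > 0"
  shows "\<exists>d\<le>2. callable K R.fin z d"
proof -
  note hz = heavy_S[OF assms(1)]
  show ?thesis
  proof (cases "lows K (N z) (R.fin z) = {}")
    case False
    from tgt_low[OF False] have "callable K R.fin z 1"
      using callable.fwd[of R.fin z K 0] hz by (simp add: fr)
    then show ?thesis by (intro exI[of _ 1]) simp
  next
    case True
    then have "fst (R.C z) = 0" unfolding C_eq con_def using hz by (auto simp: fr)
    have "\<exists>y\<in>R.ch z. fst (R.C y) > 0"
    proof (rule ccontr)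
      assume "\<not> (\<exists>y\<in>R.ch z. fst (R.C y) > 0)"
      then have "fst (\<Sum>y\<in>R.ch z. R.C y) = 0" by (simp add: fst_sum)
      then show False using assms(2) \<open>fst (R.C z) = 0\<close> by (simp add: R.R_def)
    qed
    then have b: "badc (R.fin z) \<in> R.bd z" by (intro badc_S[OF assms(1)]) (auto simp: R.bd_def)
    have "tgt K R.fin z = badc (R.fin z)" using True by (simp add: tgt_def)
    moreover have y: "badc (R.fin z) \<in> R.ch z" "fst (R.C (badc (R.fin z))) > 0" using b by (auto simp: R.bd_def)
    ultimately have "callable K R.fin z 2"
      using callable.fwd[of R.fin z K 1] hz ch_S[OF assms(1) y(1)] call_leaf[OF assms(1) y] by (simp add: fr numeral_2_eq_2)
    then show ?thesis by blast
  qed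
qed

text \<open>A positive total comes from the report of a heavy neighbour or from a light neighbour
  without cover. The former reports arrive one round later and overwrite \<open>badc\<close>, so
  they take precedence.\<close>

lemma bad_case:
  assumes "fst all > 0"
  shows "badc (R.fin w) \<in> N w" "\<exists>d\<le>2. callable K R.fin (badc (R.fin w)) d"
proof -
  have bc: "badc (R.fin w) = (if R.bw = {} then (if R.bd w = {} then badc (R.sb w) else (LEAST u. u \<in> R.bd w)) else (LEAST u. u \<in> R.bw))"
    by (simp add: R.fin_def upd_bad_def)
  have "badc (R.fin w) \<in> N w \<and> (\<exists>d\<le>2. callable K R.fin (badc (R.fin w)) d)"
  proof (cases "R.bw = {}")
    case False
    then have "badc (R.fin w) \<in> R.bw" unfolding bc by (auto intro: LeastI)
    then have z: "badc (R.fin w) \<in> S" "fst (R.R (badc (R.fin w))) > 0" using RS by (auto simp: R.bw_def)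
    then show ?thesis using call_mid[OF z] by (auto simp: sphere_def hn_def)
  next
    case True
    have "R.bd w \<noteq> {}"
    proof
      assume b: "R.bd w = {}"
      have "fst (\<Sum>v\<in>S \<union> R.Lf. R.C v) = fst ((\<Sum>y\<in>R.ch w. R.C y) + (\<Sum>z\<in>S. R.R z))"
        using R.fin_total[OF finT] RS by simp
      also have "\<dots> = 0" using b True RS by (auto simp: fst_sum R.bd_def R.bw_def)
      finally show False using assms own by (simp add: all_def tot_def)
    qed
    then have "badc (R.fin w) \<in> R.bd w" unfolding bc using True by (auto intro: LeastI)
    then have y: "badc (R.fin w) \<in> R.ch w" "fst (R.C (badc (R.fin w))) > 0" by (auto simp: R.bd_def)
    note cw = ch_w[OF y(1)]
    have "lunc (N (badc (R.fin w))) (R.fin (badc (R.fin w)))"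
      using y(2) cw unfolding C_eq con_def by (auto simp: fr split: if_splits)
    then have "callable K R.fin (badc (R.fin w)) 0" using cw NV by (auto intro: callable.base)
    then show ?thesis using cw by blast
  qed
  then show "badc (R.fin w) \<in> N w" "\<exists>d\<le>2. callable K R.fin (badc (R.fin w)) d" by auto
qed

lemma good_fit:
  assumes "fst all = 0" "fst (snd all) = 0"
  shows "z \<in> S \<Longrightarrow> fit K (N z) (\<sigma> z)" "y \<in> R.Lf \<Longrightarrow> unc (N y) (R.fin y) \<Longrightarrow> fit K (N y) (\<sigma> y)"
    "y \<in> R.Lf \<Longrightarrow> \<not> lunc (N y) (R.fin y)"
proof -
  have c: "fst (R.C v) = 0" "fst (snd (R.C v)) = 0" if "v \<in> S \<union> R.Lf" for v
    using assms that all_bad all_over by auto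
  show "fit K (N z) (\<sigma> z)" if z: "z \<in> S"
    using c[of z] z heavy_S[OF z] unfolding C_eq con_def by (auto simp: fr fit_def split: if_splits)
  show "fit K (N y) (\<sigma> y)" if y: "y \<in> R.Lf" "unc (N y) (R.fin y)"
    using c[of y] y unfolding C_eq con_def by (auto simp: fr fit_def unc_def split: if_splits)
  show "\<not> lunc (N y) (R.fin y)" if y: "y \<in> R.Lf"
    using c[of y] y unfolding C_eq con_def by (auto simp: Lf_eq lunc_def fr split: if_splits)
qed

lemma good_Lf:
  assumes "\<forall>z\<in>S. fit K (N z) (\<sigma> z)"
  shows "R.Lf = ((if l then N w - S else {}) \<union> (\<Union>z\<in>S. hn (N z) (\<sigma> z))) - I"
    "ball R.fin w = I \<union> (\<Union>z\<in>S. hn (N z) (\<sigma> z))"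
    "ball R.fin w \<subseteq> insert w (S \<union> R.Lf)"
    "v \<in> insert w (S \<union> R.Lf) \<Longrightarrow> heavy (\<sigma> v) \<Longrightarrow> v \<in> ball R.fin w"
proof -
  show L: "R.Lf = ((if l then N w - S else {}) \<union> (\<Union>z\<in>S. hn (N z) (\<sigma> z))) - I"
    unfolding Lf_eq RT(1) using RT(2) assms by auto
  show b: "ball R.fin w = I \<union> (\<Union>z\<in>S. hn (N z) (\<sigma> z))"
    by (simp add: ball_def sphere_def fr)
  show "ball R.fin w \<subseteq> insert w (S \<union> R.Lf)" unfolding L b by auto
  show "v \<in> insert w (S \<union> R.Lf) \<Longrightarrow> heavy (\<sigma> v) \<Longrightarrow> v \<in> ball R.fin w"
    unfolding L b sphere_def hn_eq[OF gg(1)] by (auto split: if_splits)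
qed

text \<open>Without complaints every inner vertex fits and has passed the query on, so the
  participants comprise the whole ball, and each contributes once.\<close>

lemma good_count:
  assumes "fst all = 0" "fst (snd all) = 0"
  shows "snd (snd all) = card (uncs R.fin w)"
proof -
  note gf = good_fit[OF assms]
  have "\<forall>z\<in>S. fit K (N z) (\<sigma> z)" using gf(1) by blast
  note L = good_Lf[OF this]
  have c3: "snd (snd (R.C v)) = of_bool (unc (N v) (R.fin v))" if v: "v \<in> S \<union> R.Lf" for v
  proof (cases "heavy (\<sigma> v) \<and> (v \<in> I \<or> unc (N v) (R.fin v))")
    case True
    then have "fit K (N v) (R.fin v)" using v gf(1,2) fw by (auto simp: fr)
    then show ?thesis using True unfolding C_eq con_def by (auto simp: fr fit_def)
  next
    case False
    then show ?thesis unfolding C_eq con_def by (auto simp: fr unc_def)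
  qed
  have wn: "w \<notin> S \<union> R.Lf" using R.w_notin_S RS by (auto simp: Lf_eq)
  have "snd (snd all) = (\<Sum>v\<in>S \<union> R.Lf. of_bool (unc (N v) (R.fin v))) + of_bool (unc (N w) (R.fin w))"
    using c3 own by (simp add: all_def tot_def snd_sum)
  also have "\<dots> = (\<Sum>v\<in>insert w (S \<union> R.Lf). of_bool (unc (N v) (R.fin v)))"
    using wn fin_SL by simp
  also have "\<dots> = card {v \<in> insert w (S \<union> R.Lf). unc (N v) (R.fin v)}"
    using fin_SL by (simp add: of_bool_def sum.If_cases Int_def)
  also have "{v \<in> insert w (S \<union> R.Lf). unc (N v) (R.fin v)} = uncs R.fin w"
    unfolding uncs_def using L(3,4) by (auto simp: unc_def fr)
  finally show ?thesis .
qed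

lemma good_clean:
  assumes "fst all = 0" "fst (snd all) = 0"
  shows "clean K l R.fin w"
proof -
  note gf = good_fit[OF assms]
  have "\<forall>z\<in>S. fit K (N z) (\<sigma> z)" using gf(1) by blast
  note L = good_Lf[OF this]
  have sp: "sphere R.fin w = S" by (simp add: sphere_def fr)
  have "fit K (N v) (R.fin v)" if "v \<in> ball R.fin w" "unc (N v) (R.fin v)" for v
    using that L(3) gf fw by (auto simp: fr)
  moreover have "\<not> lunc (N v) (R.fin v)" if "l" "v \<in> N w" for v
  proof (cases "v \<in> S")
    case True
    then show ?thesis using heavy_S by (auto simp: lunc_def fr)
  next
    case False
    moreover have "v \<noteq> w" using that by auto
    ultimately have "v \<in> R.Lf" using that unfolding L(1) by auto
    then show ?thesis using gf(3) by blast
  qed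
  moreover have "u \<in> mv (R.fin v) \<longleftrightarrow> inm (R.fin u)" if "u \<in> I" "v \<in> hn (N u) (R.fin u)" for u v
    using exact[of u v] that gf(1) fw by (auto simp: fr)
  ultimately show ?thesis using fw gf(1) unfolding clean_def sp by (auto simp: fr)
qed

text \<open>Either some vertex has too many heavy neighbours, or too many vertices of the ball are
  uncovered. Both yield \<open>2 ^ K\<close> heavy vertices, and their published degrees exceed
  \<open>4 ^ K\<close> because nobody has reported a low one.\<close>

lemma raise_case:
  assumes "fst all = 0" "fst (snd all) > 0 \<or> snd (snd all) > 2 ^ K"
  shows "K < kap"
proof (cases "fst (snd all) = 0")
  case False
  then obtain v where v: "v \<in> S \<union> R.Lf" "fst (snd (R.C v)) > 0" using all_over by auto
  moreover have "fst (R.C v) = 0" using all_bad assms v by auto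
  ultimately have "over K (N v) (R.fin v)" "lows K (N v) (R.fin v) = {}"
    unfolding C_eq con_def by (auto split: if_splits)
  then show ?thesis by (rule over_kap[OF inv])
next
  case True
  note c = good_count[OF assms(1) True]
  note gf = good_fit[OF assms(1) True]
  have "\<forall>z\<in>S. fit K (N z) (\<sigma> z)" using gf(1) by blast
  note L = good_Lf[OF this]
  show ?thesis
  proof (rule heavies_kap[OF i])
    have "2 ^ K < card (uncs R.fin w)" using c assms True by simp
    \<comment> \<open>The hub itself may have a small degree and is left out; the strict inequality
      makes up for it.\<close>
    then have "2 ^ K \<le> card (uncs R.fin w - {w})" by (cases "w \<in> uncs R.fin w") (auto simp: uncs_def card_Diff_singleton_if)
    then show "2 ^ K \<le> card (uncs R.fin w - {w})" .
    show "uncs R.fin w - {w} \<subseteq> V" using ball_V[OF wV] by (auto simp: uncs_def)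
    fix v assume v: "v \<in> uncs R.fin w - {w}"
    then consider "v \<in> S" | z where "z \<in> S" "v \<in> hn (N z) (\<sigma> z)" using L(2) by (auto simp: uncs_def)
    then show "heavy (\<sigma> v) \<and> 4 ^ K < pd (\<sigma> v)"
    proof cases
      case 1
      then show ?thesis by (rule heavy_S)
    next
      case 2
      then show ?thesis using gf(1)[OF 2(1)] unfolding fit_def hn_eq[OF gg(1)] lows_eq[OF gg(1)] by (auto simp: not_le)
    qed
  qed
qed

text \<open>Prepares the Luby phases: their commands travel along the tree recorded in
  \<open>kids\<close>, which reaches exactly the ball, and the numbers published in an earlier phase
  have been erased.\<close>

lemma good_kids:
  assumes "fst all = 0" "fst (snd all) = 0"
  shows "\<forall>z\<in>S. kids (R.fin z) \<subseteq> hn (N z) (\<sigma> z)" "(\<Union>z\<in>S. kids (R.fin z)) = ball R.fin w - I"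
    "v \<in> ball R.fin w \<Longrightarrow> pub (R.fin v) = (\<lambda>_. None)"
proof -
  note gf = good_fit[OF assms]
  have "\<forall>z\<in>S. fit K (N z) (\<sigma> z)" using gf(1) by blast
  note L = good_Lf[OF this]
  have k: "kids (R.fin z) = R.ch z" if "z \<in> S" for z
    using that RS R.w_notin_S by (auto simp: R.fin_def next_kids_def)
  show "\<forall>z\<in>S. kids (R.fin z) \<subseteq> hn (N z) (\<sigma> z)"
    using k ch_S unfolding hn_eq[OF gg(1)] by auto
  show "(\<Union>z\<in>S. kids (R.fin z)) = ball R.fin w - I"
  proof
    show "(\<Union>z\<in>S. kids (R.fin z)) \<subseteq> ball R.fin w - I"
    proof
      fix y assume "y \<in> (\<Union>z\<in>S. kids (R.fin z))"
      then obtain z where z: "z \<in> S" "y \<in> R.ch z" using k by auto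
      then have "y \<in> hn (N z) (\<sigma> z)" using ch_S[OF z] unfolding hn_eq[OF gg(1)] by simp
      then show "y \<in> ball R.fin w - I" using ch_S(5)[OF z] z(1) unfolding L(2) by blast
    qed
    show "ball R.fin w - I \<subseteq> (\<Union>z\<in>S. kids (R.fin z))"
    proof
      fix y assume y: "y \<in> ball R.fin w - I"
      then have "y \<in> R.Lf" using L(3) by auto
      moreover have "heavy (\<sigma> y)" using y unfolding L(2) hn_eq[OF gg(1)] by auto
      ultimately obtain z where "z \<in> S" "y \<in> R.ch z" using Lf_ch[of y] ch_w(3)[of y] by blast
      then show "y \<in> (\<Union>z\<in>S. kids (R.fin z))" using k by auto
    qed
  qed
  assume "v \<in> ball R.fin w"
  then have "v \<in> R.M" using L(3) RS by (auto simp: R.M_def)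
  then show "pub (R.fin v) = (\<lambda>_. None)" by (simp add: sb_sel)
qed

end

section \<open>Luby phases\<close>

lemma gain_cong: "(\<And>u. u \<in> Y \<Longrightarrow> d u = d' u) \<Longrightarrow> gain q v Y d s = gain q v Y d' s"
  unfolding gain_def by (rule sum.cong) auto

lemma loss_cong: "(\<And>u. u \<in> Y \<Longrightarrow> d u = d' u) \<Longrightarrow> loss q v Y d s = loss q v Y d' s"
  unfolding loss_def by (intro arg_cong2[of _ _ _ _ "(+)"] sum.cong) auto

lemma gain_le: "finite Y \<Longrightarrow> card Y \<le> n \<Longrightarrow> (\<And>u. u \<in> Y \<Longrightarrow> d u \<le> n) \<Longrightarrow> gain q v Y d s \<le> n * n"
  unfolding gain_def by (rule order_trans[OF sum_bounded_above[of _ _ n]]) auto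

lemma loss_le:
  assumes "finite Y" "card Y \<le> n" "\<And>u. u \<in> Y \<Longrightarrow> d u \<le> n"
  shows "loss q v Y d s \<le> 2 * (n * n * n)"
proof -
  have a: "(\<Sum>u\<in>A. of_bool (B u)) \<le> n" if "A \<subseteq> Y" for A and B :: "nat \<Rightarrow> bool"
  proof -
    have "(\<Sum>u\<in>A. of_bool (B u)) \<le> (\<Sum>u\<in>A. 1::nat)" by (rule sum_mono) auto
    also have "\<dots> \<le> card Y" using card_mono[OF assms(1) that] by simp
    finally show ?thesis using assms(2) by simp
  qed
  have cn: "card Y * (n * n) \<le> n * (n * n)" by (rule mult_right_mono[OF assms(2)]) simp
  have t1: "d w * (\<Sum>u\<in>Y. of_bool (B u)) \<le> n * n" if "w \<in> Y" for w B
    by (rule mult_le_mono[OF assms(3)[OF that] a]) simp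
  have t2: "card Y * (\<Sum>u\<in>Y - {x}. of_bool (B u)) \<le> n * n" for x B
    by (rule mult_le_mono[OF assms(2) a]) auto
  have 1: "(\<Sum>w\<in>Y. d w * (\<Sum>u\<in>Y. of_bool (hash q s v < thr q (card Y) (d w) \<and> hash q s u < thr q (card Y) (d w)))) \<le> n * (n * n)"
    by (rule order_trans[OF sum_bounded_above[of _ _ "n * n"]], rule t1) (use cn in simp_all)
  have 2: "(\<Sum>x\<in>Y. card Y * (\<Sum>u\<in>Y - {x}. of_bool (hash q s x < thr q (d x) (card Y) \<and> hash q s u < thr q (d x) (card Y)))) \<le> n * (n * n)"
    by (rule order_trans[OF sum_bounded_above[of _ _ "n * n"]], rule t2) (use cn in simp)
  show ?thesis unfolding loss_def using add_mono[OF 1 2] by simp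
qed

lemma card_block: "card (block t j pre) \<le> 2 ^ t"
proof -
  have "card (block t j pre) \<le> card {..<(2::nat) ^ t}" by (rule card_mono) (auto simp: block_def)
  then show ?thesis by simp
qed

lemma tle_mono: "tle x a \<Longrightarrow> a \<le> b \<Longrightarrow> tle x b"
  by (auto simp: tle_def)

context arena
begin

definition adj :: "vertex set \<Rightarrow> vertex \<Rightarrow> vertex set" where
  "adj U v = N v \<inter> U"

definition keeps :: "world \<Rightarrow> world \<Rightarrow> bool" where
  "keeps \<sigma> \<sigma>' \<longleftrightarrow> same \<sigma> \<sigma>' \<and> (\<forall>v. stk (\<sigma>' v) = stk (\<sigma> v) \<and> kids (\<sigma>' v) = kids (\<sigma> v))"

text \<open>The situation between two commands of a Luby phase. The tree left behind by the last
  query still spans the ball, and the bound on the uncovered vertices limits the cost of the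
  messages between them.\<close>

definition phs :: "vertex set \<Rightarrow> frames \<Rightarrow> nat \<Rightarrow> vertex option \<Rightarrow> bool \<Rightarrow> world \<Rightarrow> vertex \<Rightarrow> bool" where
  "phs X gs K p l \<sigma> w \<longleftrightarrow> Inv X \<sigma> ((w, Hub p K l) # gs) \<and> clean K l \<sigma> w \<and>
     (\<forall>z\<in>sphere \<sigma> w. kids (\<sigma> z) \<subseteq> hn (N z) (\<sigma> z)) \<and>
     (\<Union>z\<in>sphere \<sigma> w. kids (\<sigma> z)) = ball \<sigma> w - insert w (sphere \<sigma> w) \<and>
     card (uncs \<sigma> w) \<le> 2 ^ K"

lemma same_geo:
  assumes "same \<sigma> \<sigma>'"
  shows "sphere \<sigma>' w = sphere \<sigma> w" "ball \<sigma>' w = ball \<sigma> w" "uncs \<sigma>' w = uncs \<sigma> w" "clean K l \<sigma>' w = clean K l \<sigma> w"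
proof -
  show a: "sphere \<sigma>' w = sphere \<sigma> w" "ball \<sigma>' w = ball \<sigma> w"
    by (simp_all add: sphere_def ball_def same_sets[OF assms])
  show "uncs \<sigma>' w = uncs \<sigma> w" by (simp add: uncs_def a same_sets[OF assms])
  show "clean K l \<sigma>' w = clean K l \<sigma> w" by (simp add: clean_def a same_sets[OF assms] same_sel[OF assms])
qed

lemma keeps_Inv: "keeps \<sigma> \<sigma>' \<Longrightarrow> Inv X \<sigma> gs \<Longrightarrow> Inv X \<sigma>' gs"
  by (rule refresh_Inv) (auto simp: keeps_def refresh_def same_sel)

lemma keeps_phs:
  assumes k: "keeps \<sigma> \<sigma>'" and p: "phs X gs K p l \<sigma> w"
  shows "phs X gs K p l \<sigma>' w"
proof -
  have sm: "same \<sigma> \<sigma>'" and kd: "kids (\<sigma>' v) = kids (\<sigma> v)" for v using k by (auto simp: keeps_def)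
  have "Inv X \<sigma>' ((w, Hub p K l) # gs)" using keeps_Inv[OF k] p by (simp add: phs_def)
  then show ?thesis using p by (simp add: phs_def same_geo[OF sm] same_sets[OF sm] kd)
qed

lemma keeps_trans: "keeps x y \<Longrightarrow> keeps y z \<Longrightarrow> keeps x z"
  by (auto simp: keeps_def same_def)

lemma keeps_ctl: "keeps \<sigma> (\<sigma>(w := (\<sigma> w)\<lparr>ctl := x\<rparr>))"
  by (auto simp: keeps_def same_def)

lemma dec_step:
  assumes "solo \<sigma> w (Dec k T)" "decide q w (N w) k (T + con q w (N w) True k (\<sigma> w)) (\<sigma> w) = ((\<sigma> w)\<lparr>ctl := x\<rparr>, \<lambda>_. None)"
  shows "rch (\<sigma>, none) (\<sigma>(w := (\<sigma> w)\<lparr>ctl := x\<rparr>), none) 1 0" "solo (\<sigma>(w := (\<sigma> w)\<lparr>ctl := x\<rparr>)) w x"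
proof -
  show "rch (\<sigma>, none) (\<sigma>(w := (\<sigma> w)\<lparr>ctl := x\<rparr>), none) 1 0"
    by (rule solo_silent[OF assms(1)]) (use assms in \<open>simp_all add: step_def Let_def solo_def\<close>)
  show "solo (\<sigma>(w := (\<sigma> w)\<lparr>ctl := x\<rparr>)) w x" using assms by (simp add: solo_def)
qed

end

locale phase_op = arena +
  fixes \<sigma> w K p l gs X k
  assumes ph: "phs X gs K p l \<sigma> w"
    and so: "solo \<sigma> w (Top 0 k 0)"
    and nq: "\<And>K. k \<noteq> Query K"
begin

sublocale R: rpc c n t E V \<sigma> w k by unfold_locales

abbreviation "S \<equiv> sphere \<sigma> w"
abbreviation "I \<equiv> insert w S"
abbreviation "B \<equiv> ball \<sigma> w"
abbreviation "U \<equiv> uncs \<sigma> w"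

lemma i: "Inv X \<sigma> ((w, Hub p K l) # gs)" and cl: "clean K l \<sigma> w"
  and k1: "z \<in> S \<Longrightarrow> kids (\<sigma> z) \<subseteq> hn (N z) (\<sigma> z)" and k2: "(\<Union>z\<in>S. kids (\<sigma> z)) = B - I"
  and cU: "card U \<le> 2 ^ K"
  using ph by (auto simp: phs_def)

lemma gg: "hv_exact \<sigma>" "mv_light \<sigma>" "mv_heavy \<sigma>" "indep \<sigma>" using i by (auto simp: Inv_def)

lemma wV: "w \<in> V" and Kk: "K \<le> kap" using i by (auto simp: Inv_def bounded_def)

lemma RS: "R.S = S" "R.I = I" by (simp_all add: R.S_def R.I_def sphere_def)

lemma wS: "w \<notin> S" using R.w_notin_S RS by simp

lemma RT: "R.T w = {}" "z \<in> S \<Longrightarrow> R.T z = kids (\<sigma> z)"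
proof -
  have t: "ttgt k M s = {}" "mtgt k M s = kids s" for M s
    using nq by (cases k; simp add: ttgt_def mtgt_def)+
  show "R.T w = {}" by (simp add: R.T_def t)
  assume "z \<in> S"
  then have "z \<noteq> w" using wS by auto
  then show "R.T z = kids (\<sigma> z)" by (simp add: R.T_def t)
qed

lemma Lf_eq: "R.Lf = B - I"
  using k2 RT by (auto simp: R.Lf_def RS)

lemma RM: "R.M = B"
  by (auto simp: R.M_def RS Lf_eq ball_def)

lemma lat_eq: "R.lat u = (if u \<in> B then snd (act q u (N u) (u \<in> I) k (\<sigma> u)) else (\<lambda>_. None))"
  by (simp add: R.lat_def RM R.A_def RS)

lemma act_unc: "snd (act q u (N u) b k (\<sigma> u)) v = Some m \<Longrightarrow> unc (N u) (\<sigma> u)"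
  using nq by (auto simp: act_def to_set_def split: cmd.splits if_splits)

lemma lat_U: "R.lat u v = Some m \<Longrightarrow> u \<in> U \<and> v \<in> hn (N u) (\<sigma> u) \<and> u \<in> N v"
  using R.lat_form[of u v m] act_unc[of u "u \<in> I" v m] Nsym
  by (auto simp: lat_eq uncs_def hn_def split: if_splits)

lemma fits: "z \<in> I \<Longrightarrow> fit K (N z) (\<sigma> z)" "u \<in> U \<Longrightarrow> fit K (N u) (\<sigma> u)"
  using cl by (auto simp: clean_def uncs_def)

lemma BV: "B \<subseteq> V" by (rule ball_V[OF wV])

lemma UV: "U \<subseteq> V" using BV by (auto simp: uncs_def)

lemma C_eq: "R.C v = con q v (N v) (v \<in> I) k (R.fin v)"
  using R.C_fin RS by simp

lemma run:
  assumes m1: "mok t (Cmd1 k)" "mok t (Cmd2 k)" "\<And>u v m. R.lat u v = Some m \<Longrightarrow> mok t m"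
    and m2: "\<And>v. v \<in> B \<Longrightarrow> tle (R.C v) b" "n * b < 2 ^ t"
  shows "rch (\<sigma>, none) (R.fin, none) 6 (12 * W)"
  unfolding none_def
proof (rule R.round_trip)
  show "ctl (\<sigma> w) = Top 0 k 0" "v \<noteq> w \<Longrightarrow> ctl (\<sigma> v) = Idle" for v using so by (auto simp: solo_def)
  show TN: "R.T x \<subseteq> N x" if "x \<in> R.I" for x
  proof (cases "x = w")
    case True
    then show ?thesis using RT(1) by simp
  next
    case False
    then have "x \<in> S" using that RS by simp
    then show ?thesis using RT(2)[of x] k1[of x] hn_sub[of x "\<sigma> x"] by auto
  qed
  show "mok t (Cmd1 k)" "mok t (Cmd2 k)" by fact+
  show "R.lat u v = Some m \<Longrightarrow> mok t m" for u v m by (rule m1(3))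
  have small: "mok t (Rep x)" if "tle x (n * b)" for x
    using that m2(2) t8 by (auto simp: mok_def tle_def)
  have one: "1 \<le> n" using wV cardV finV by (metis One_nat_def Suc_leI card_gt_0_iff empty_iff)
  show "mok t (Rep (R.C y))" if "y \<in> R.Lf" for y
  proof (rule small)
    have "y \<in> B" using that Lf_eq by blast
    then have "tle (R.C y) b" by (rule m2(1))
    moreover have "b \<le> n * b" using one by simp
    ultimately show "tle (R.C y) (n * b)" by (rule tle_mono)
  qed
  show "mok t (Rep (R.R z))" if z: "z \<in> R.S" for z
  proof (rule small)
    have ch: "R.ch z \<subseteq> B" using Lf_eq by (auto simp: R.ch_def)
    have zB: "z \<in> B" using z RS by (auto simp: ball_def)
    have "tle (R.R z) (card (R.ch z) * b + b)"
      unfolding R.R_def by (rule tle_add[OF tle_sum]) (use m2 ch zB in auto)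
    moreover have "card (R.ch z) * b + b = (card (R.ch z) + 1) * b" by simp
    ultimately have "tle (R.R z) ((card (R.ch z) + 1) * b)" by (simp only:)
    moreover have "card (insert z (R.ch z)) \<le> card V"
      by (rule card_mono[OF finV]) (use ch zB BV in auto)
    moreover have "z \<notin> R.ch z" using z by (auto simp: R.ch_def R.Lf_def R.I_def)
    moreover have "finite (R.ch z)" by (rule finite_subset[OF ch]) simp
    ultimately have r: "tle (R.R z) ((card (R.ch z) + 1) * b)" "card (R.ch z) + 1 \<le> n" using cardV by auto
    from r(2) have "(card (R.ch z) + 1) * b \<le> n * b" by (rule mult_right_mono) simp
    with r(1) show "tle (R.R z) (n * b)" by (rule tle_mono)
  qed
  let ?k = "(2::nat) ^ K"
  have kk: "?k * ?k \<le> W" "?k \<le> W" using W1 Kk by auto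
  have hnS: "card (hn (N u) (\<sigma> u)) \<le> ?k" if "fit K (N u) (\<sigma> u)" for u
    using that by (simp add: fit_def over_def)
  have cS: "card S \<le> ?k" using hnS[OF fits(1)[of w]] by (simp add: sphere_def)
  have fS: "finite S" using RS R.fin_S by simp
  have cT: "card (R.T z) \<le> ?k" if "z \<in> S" for z
  proof -
    have "card (R.T z) \<le> card (hn (N z) (\<sigma> z))" unfolding RT(2)[OF that] by (rule card_mono) (use k1[OF that] in auto)
    then show ?thesis using hnS[OF fits(1)[of z]] that by simp
  qed
  have "(\<Sum>z\<in>S. card (R.T z)) \<le> card S * ?k"
    using sum_bounded_above[of S "\<lambda>z. card (R.T z)" ?k] cT by auto
  moreover have "card S * ?k \<le> ?k * ?k" using cS by (intro mult_right_mono) auto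
  moreover have "(\<Sum>x\<in>R.I. card (R.T x)) = card (R.T w) + (\<Sum>z\<in>S. card (R.T z))"
    unfolding RS using fS wS by simp
  moreover have "card (R.T w) = 0" using RT(1) by simp
  ultimately have sT: "(\<Sum>x\<in>R.I. card (R.T x)) \<le> W" using kk by linarith
  \<comment> \<open>Only uncovered vertices send messages besides the commands and reports. There
    are at most \<open>2 ^ K\<close> of them, and each fits the level.\<close>
  have lz: "card {v. R.lat u v \<noteq> None} \<le> (if u \<in> U then ?k else 0)" for u
  proof -
    have "{v. R.lat u v \<noteq> None} \<subseteq> (if u \<in> U then hn (N u) (\<sigma> u) else {})"
    proof
      fix v assume "v \<in> {v. R.lat u v \<noteq> None}"
      then obtain m where "R.lat u v = Some m" by auto
      then show "v \<in> (if u \<in> U then hn (N u) (\<sigma> u) else {})" using lat_U by auto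
    qed
    then have "card {v. R.lat u v \<noteq> None} \<le> card (if u \<in> U then hn (N u) (\<sigma> u) else {})" by (rule card_mono[rotated]) auto
    then show ?thesis using hnS[OF fits(2)[of u]] by (auto split: if_splits)
  qed
  have "(\<Sum>u\<in>R.M. card {v. R.lat u v \<noteq> None}) \<le> (\<Sum>u\<in>B. if u \<in> U then ?k else 0)"
    unfolding RM by (rule sum_mono) (rule lz)
  also have "\<dots> = card (B \<inter> U) * ?k" by (simp add: sum.If_cases)
  also have "B \<inter> U = U" by (auto simp: uncs_def)
  also have "card U * ?k \<le> ?k * ?k" by (rule mult_right_mono[OF cU]) simp
  finally have "(\<Sum>u\<in>R.M. card {v. R.lat u v \<noteq> None}) \<le> W" using kk by simp
  then show "2 * card R.S + 2 * (\<Sum>x\<in>R.I. card (R.T x)) + (\<Sum>u\<in>R.M. card {v. R.lat u v \<noteq> None}) \<le> 12 * W"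
    using sT cS kk W1(1) unfolding RS by linarith
qed

definition "tot = (\<Sum>v\<in>B - {w}. R.C v)"

lemma fin_solo: "solo R.fin w (Dec k tot)"
proof -
  have "finite (R.T x)" if "x \<in> R.I" for x
    using that RS RT k1[of x] finite_subset[OF _ fin_hn] by (cases "x = w") auto
  then have "(\<Sum>y\<in>R.ch w. R.C y) + (\<Sum>z\<in>R.S. R.R z) = (\<Sum>v\<in>R.S \<union> R.Lf. R.C v)" by (rule R.fin_total)
  moreover have "R.S \<union> R.Lf = B - {w}" unfolding RS Lf_eq using wS by (auto simp: ball_def)
  ultimately have "ctl (R.fin w) = Dec k tot" by (simp add: R.fin_def tot_def)
  then show ?thesis using so R.fin_ctl by (simp add: solo_def)
qed

lemma fin_kids: "kids (R.fin v) = kids (\<sigma> v)"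
proof -
  have "next_kids k x y = y" for x y using nq by (cases k) (auto simp: next_kids_def)
  then show ?thesis by (simp add: R.fin_def upd_bad_def R.sb_sel)
qed

lemma publish:
  assumes nj: "\<And>s. k \<noteq> Join s"
  shows "keeps \<sigma> R.fin" "pub (R.fin v) u = (case R.lat u v of Some (Pub x) \<Rightarrow> Some x | _ \<Rightarrow> pub (\<sigma> v) u)"
proof -
  have fa: "fst (act q v M b k s) = s" "snd (act q v M b k s) y \<noteq> Some (Stat h m p r)" for v M b s y h m p r
    using nq nj by (cases k; simp add: act_def to_set_def)+
  have sa: "R.sa v = \<sigma> v" for v by (simp add: R.sa_def R.A_def fa)
  have ns: "R.lat u v \<noteq> Some (Stat h b p r)" for u v h b p r
    by (simp add: lat_eq fa)
  have "same \<sigma> R.fin" unfolding same_def R.fin_sel by (simp add: R.sb_def sa absorb_def after_other ns)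
  then show "keeps \<sigma> R.fin" unfolding keeps_def by (simp add: fin_kids R.sb_sel)
  show "pub (R.fin v) u = (case R.lat u v of Some (Pub x) \<Rightarrow> Some x | _ \<Rightarrow> pub (\<sigma> v) u)"
    by (simp add: R.sb_def sa absorb_def pub_after_def)
qed

end

context arena
begin

definition pubs :: "world \<Rightarrow> vertex set \<Rightarrow> (vertex \<Rightarrow> nat option) \<Rightarrow> bool" where
  "pubs \<sigma> U f \<longleftrightarrow> (\<forall>v\<in>U. \<forall>u\<in>N v. pub (\<sigma> v) u = (if u \<in> U then f u else None))"

lemma pubs_yn:
  assumes "pubs \<sigma> U f" "v \<in> U" "\<And>u. u \<in> U \<Longrightarrow> f u \<noteq> None"
  shows "yn (N v) (\<sigma> v) = adj U v"
proof -
  have p: "pub (\<sigma> v) u = (if u \<in> U then f u else None)" if "u \<in> N v" for u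
    using assms(1,2) that unfolding pubs_def by blast
  show ?thesis using assms(3) by (auto simp: yn_def adj_def p split: if_splits)
qed

text \<open>The published \<open>0\<close> only signals being uncovered. From these signals every
  uncovered vertex learns its neighbours, and so its degree, in the graph on which Luby's algorithm
  runs.\<close>

lemma alive_phase:
  assumes ph: "phs X gs K p l \<sigma> w" and so: "solo \<sigma> w (Top 0 Alive 0)" and U: "U = uncs \<sigma> w"
    and pb: "pubs \<sigma> U (\<lambda>_. None)"
  shows "\<exists>\<sigma>'. rch (\<sigma>, none) (\<sigma>', none) 7 (12 * W) \<and> solo \<sigma>' w (Top 0 Degr 0) \<and> keeps \<sigma> \<sigma>' \<and> pubs \<sigma>' U (\<lambda>_. Some 0)"
proof -
  interpret P: phase_op c n t E V kap \<sigma> w K p l gs X Alive by unfold_locales (use ph so in auto)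
  have lat: "P.R.lat u v = Some m \<longleftrightarrow> u \<in> U \<and> v \<in> hn (N u) (\<sigma> u) \<and> m = Pub 0" for u v m
    by (auto simp: P.lat_eq act_def U uncs_def to_set_def)
  have r: "rch (\<sigma>, none) (P.R.fin, none) 6 (12 * W)"
    by (rule P.run[of 0]) (use t8 in \<open>auto simp: mok_def lat P.C_eq con_def tle_def\<close>)
  let ?s = "P.R.fin(w := (P.R.fin w)\<lparr>ctl := Top 0 Degr 0\<rparr>)"
  note d = dec_step[OF P.fin_solo, of "Top 0 Degr 0"]
  have d': "rch (P.R.fin, none) (?s, none) 1 0" "solo ?s w (Top 0 Degr 0)"
    by (rule d; simp add: decide_def)+
  have k: "keeps \<sigma> P.R.fin" using P.publish(1) by simp
  have "pubs P.R.fin U (\<lambda>_. Some 0)" unfolding pubs_def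
  proof (intro ballI)
    fix v u assume vu: "v \<in> U" "u \<in> N v"
    have h: "v \<in> hn (N u) (\<sigma> u)" using vu Nsym unfolding hn_eq[OF P.gg(1)] U by (auto simp: uncs_def unc_def)
    show "pub (P.R.fin v) u = (if u \<in> U then Some 0 else None)"
    proof (cases "u \<in> U")
      case True
      then have "P.R.lat u v = Some (Pub 0)" using lat h by simp
      then show ?thesis using P.publish(2)[of v u] True by simp
    next
      case False
      then have "P.R.lat u v = None" using lat by (cases "P.R.lat u v") auto
      then show ?thesis using P.publish(2)[of v u] False pb vu by (simp add: pubs_def)
    qed
  qed
  then have "pubs ?s U (\<lambda>_. Some 0)" by (simp add: pubs_def)
  then show ?thesis using rch_trans[OF r d'(1)] d'(2) keeps_trans[OF k keeps_ctl] by auto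
qed

lemma degree_phase:
  assumes ph: "phs X gs K p l \<sigma> w" and so: "solo \<sigma> w (Top 0 Degr 0)" and U: "U = uncs \<sigma> w"
    and pb: "pubs \<sigma> U (\<lambda>_. Some 0)"
  shows "\<exists>\<sigma>'. rch (\<sigma>, none) (\<sigma>', none) 7 (12 * W) \<and> solo \<sigma>' w (Top 0 (Bit 0 0) 0) \<and> keeps \<sigma> \<sigma>' \<and>
    pubs \<sigma>' U (\<lambda>u. Some (card (adj U u)))"
proof -
  interpret P: phase_op c n t E V kap \<sigma> w K p l gs X Degr by unfold_locales (use ph so in auto)
  have yn: "yn (N u) (\<sigma> u) = adj U u" if "u \<in> U" for u by (rule pubs_yn[OF pb that]) simp
  have lat: "P.R.lat u v = Some m \<longleftrightarrow> u \<in> U \<and> v \<in> hn (N u) (\<sigma> u) \<and> m = Pub (card (adj U u))" for u v m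
    using yn[of u] by (auto simp: P.lat_eq act_def U uncs_def to_set_def)
  have ca: "card (adj U u) < 2 ^ t" for u
  proof -
    have "card (adj U u) \<le> card (N u)" by (rule card_mono) (auto simp: adj_def)
    then show ?thesis using degn[of u] n2 by linarith
  qed
  have r: "rch (\<sigma>, none) (P.R.fin, none) 6 (12 * W)"
    by (rule P.run[of 0]) (use t8 ca in \<open>auto simp: mok_def lat P.C_eq con_def tle_def\<close>)
  let ?s = "P.R.fin(w := (P.R.fin w)\<lparr>ctl := Top 0 (Bit 0 0) 0\<rparr>)"
  note d = dec_step[OF P.fin_solo, of "Top 0 (Bit 0 0) 0"]
  have d': "rch (P.R.fin, none) (?s, none) 1 0" "solo ?s w (Top 0 (Bit 0 0) 0)"
    by (rule d; simp add: decide_def)+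
  have k: "keeps \<sigma> P.R.fin" using P.publish(1) by simp
  have "pubs P.R.fin U (\<lambda>u. Some (card (adj U u)))" unfolding pubs_def
  proof (intro ballI)
    fix v u assume vu: "v \<in> U" "u \<in> N v"
    have h: "v \<in> hn (N u) (\<sigma> u)" using vu Nsym unfolding hn_eq[OF P.gg(1)] U by (auto simp: uncs_def unc_def)
    show "pub (P.R.fin v) u = (if u \<in> U then Some (card (adj U u)) else None)"
    proof (cases "u \<in> U")
      case True
      then have "P.R.lat u v = Some (Pub (card (adj U u)))" using lat h by simp
      then show ?thesis using P.publish(2)[of v u] True by simp
    next
      case False
      then have "P.R.lat u v = None" using lat by (cases "P.R.lat u v") auto
      then show ?thesis using P.publish(2)[of v u] False pb vu by (simp add: pubs_def)
    qed
  qed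
  then have "pubs ?s U (\<lambda>u. Some (card (adj U u)))" by (simp add: pubs_def)
  then show ?thesis using rch_trans[OF r d'(1)] d'(2) keeps_trans[OF k keeps_ctl] by auto
qed

lemma qbig: "16 * n * n ^ c \<le> 2 ^ q"
proof -
  define lg where "lg = (LEAST l. n \<le> 2 ^ l)"
  have "n \<le> 2 ^ n" using less_exp[of n] by simp
  then have nl: "n \<le> 2 ^ lg" unfolding lg_def by (rule LeastI)
  have "16 * n * n ^ c = 16 * n ^ Suc c" by simp
  also have "\<dots> \<le> 2 ^ 4 * (2 ^ lg) ^ Suc c" by (intro mult_le_mono power_mono nl) simp_all
  also have "\<dots> = 2 ^ (4 + lg * Suc c)" by (simp only: power_add power_mult)
  also have "\<dots> \<le> 2 ^ q" by (rule power_increasing) (simp_all add: qbits_def lg_def)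
  finally show ?thesis .
qed

lemma uncs_luby:
  assumes "Inv X \<sigma> gs" "w \<in> V" "U = uncs \<sigma> w"
  shows "luby U (adj U) q (n ^ c) n"
proof
  have UV: "U \<subseteq> V" using ball_V assms by (auto simp: uncs_def)
  show "finite U" by (rule finite_subset[OF UV finV])
  show "adj U v \<subseteq> U - {v}" for v by (auto simp: adj_def)
  show "u \<in> U \<Longrightarrow> v \<in> U \<Longrightarrow> u \<in> adj U v \<Longrightarrow> v \<in> adj U u" for u v using Nsym by (auto simp: adj_def)
  show "v \<in> U \<Longrightarrow> v < n ^ c" for v using ids UV by blast
  show "card U \<le> n" using card_mono[OF finV UV] cardV by simp
  show "16 * n * n ^ c \<le> 2 ^ q" by (rule qbig)
qed

lemma bit_phase:
  assumes ph: "phs X gs K p l \<sigma> w" and so: "solo \<sigma> w (Top 0 (Bit j pre) 0)" and U: "U = uncs \<sigma> w"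
    and pb: "pubs \<sigma> U (\<lambda>u. Some (card (adj U u)))"
    and j: "j < 2 * q" "pre < 2 ^ j"
  defines "f \<equiv> \<lambda>s. \<Sum>v\<in>U. luby.F (adj U) q v s"
  shows "\<exists>\<sigma>' pre'. rch (\<sigma>, none) (\<sigma>', none) 7 (12 * W) \<and>
    solo \<sigma>' w (Top 0 (if Suc j = 2 * q then Join pre' else Bit (Suc j) pre') 0) \<and> keeps \<sigma> \<sigma>' \<and>
    pubs \<sigma>' U (\<lambda>u. Some (card (adj U u))) \<and> pre' < 2 ^ Suc j \<and>
    sum f (block (2 * q) j pre) \<le> 2 * sum f (block (2 * q) (Suc j) pre')"
proof -
  interpret P: phase_op c n t E V kap \<sigma> w K p l gs X "Bit j pre" by unfold_locales (use ph so in auto)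
  interpret L: luby U "adj U" q "n ^ c" n by (rule uncs_luby[OF P.i P.wV U])
  have lat: "P.R.lat u v = None" for u v by (auto simp: P.lat_eq act_def)
  have k: "keeps \<sigma> P.R.fin" using P.publish(1) by simp
  have pub: "pub (P.R.fin v) u = pub (\<sigma> v) u" for v u using P.publish(2)[of v u] lat by simp
  have Uf: "uncs P.R.fin w = U" using k same_geo(3) U by (auto simp: keeps_def)
  have unc: "unc (N v) (P.R.fin v) = unc (N v) (\<sigma> v)" for v using k by (auto simp: keeps_def same_sets)
  have pf: "pubs P.R.fin U (\<lambda>u. Some (card (adj U u)))" using pb pub by (simp add: pubs_def)
  let ?d = "\<lambda>u. card (adj U u)"
  have g: "gain q v (yn (N v) (P.R.fin v)) (\<lambda>u. the (pub (P.R.fin v) u)) s = gain q v (adj U v) L.d s"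
    "loss q v (yn (N v) (P.R.fin v)) (\<lambda>u. the (pub (P.R.fin v) u)) s = loss q v (adj U v) L.d s" if "v \<in> U" for v s
  proof -
    have y: "yn (N v) (P.R.fin v) = adj U v" by (rule pubs_yn[OF pf that]) simp
    have e: "u \<in> adj U v \<Longrightarrow> the (pub (P.R.fin v) u) = L.d u" for u
      using pf that by (auto simp: pubs_def adj_def L.d_def)
    show "gain q v (yn (N v) (P.R.fin v)) (\<lambda>u. the (pub (P.R.fin v) u)) s = gain q v (adj U v) L.d s"
      "loss q v (yn (N v) (P.R.fin v)) (\<lambda>u. the (pub (P.R.fin v) u)) s = loss q v (adj U v) L.d s"
      unfolding y by (rule gain_cong[OF e] loss_cong[OF e]; assumption)+
  qed
  let ?t = "\<lambda>v. tally_bit q v (adj U v) L.d j pre"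
  have con: "con q v (N v) b (Bit j pre) (P.R.fin v) = (if v \<in> U then ?t v else 0)" if "v \<in> P.B" for v b
  proof (cases "v \<in> U")
    case True
    then have "unc (N v) (P.R.fin v)" using unc U by (simp add: uncs_def)
    then show ?thesis using True g[OF True] by (simp add: con_def tally_bit_def)
  next
    case False
    then have "\<not> unc (N v) (P.R.fin v)" using unc U that by (simp add: uncs_def)
    then show ?thesis using False by (simp add: con_def)
  qed
  have dn: "card (adj U v) \<le> n" for v
    using card_mono[of "N v" "adj U v"] degn[of v] by (auto simp: adj_def)
  \<comment> \<open>Each seed yields a gain of at most \<open>n ^ 3\<close> and a loss of at most
    twice as much, and a block has at most \<open>2 ^ (2 * q)\<close> seeds.\<close>
  have tb: "tle (?t v) (3 * n ^ 3 * 2 ^ (2 * q))" if "v \<in> U" for v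
  proof -
    have fa: "finite (adj U v)" by (simp add: adj_def)
    have n0: "n * n \<le> n ^ 3" "n * n * n = n ^ 3" by (cases n; simp add: eval_nat_numeral)+
    have G: "gain q v (adj U v) L.d s \<le> n ^ 3" for s
      using gain_le[OF fa dn, of L.d q v s] dn n0 by (auto simp: L.d_def)
    have Lo: "loss q v (adj U v) L.d s \<le> 2 * n ^ 3" for s
      using loss_le[OF fa dn, of L.d q v s] dn n0 by (auto simp: L.d_def)
    have sG: "(\<Sum>s\<in>block (2 * q) a b. gain q v (adj U v) L.d s) \<le> 2 ^ (2 * q) * n ^ 3" for a b
      by (rule order_trans[OF sum_bounded_above[of _ _ "n ^ 3"]]) (use G card_block in \<open>auto intro: mult_right_mono\<close>)
    have sL: "(\<Sum>s\<in>block (2 * q) a b. loss q v (adj U v) L.d s) \<le> 2 ^ (2 * q) * (2 * n ^ 3)" for a b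
      by (rule order_trans[OF sum_bounded_above[of _ _ "2 * n ^ 3"]]) (use Lo card_block in \<open>auto intro: mult_right_mono\<close>)
    have e: "2 ^ (2 * q) * n ^ 3 + 2 ^ (2 * q) * (2 * n ^ 3) = 3 * n ^ 3 * 2 ^ (2 * q)" by (simp add: algebra_simps)
    have "(\<Sum>s\<in>block (2 * q) a b. gain q v (adj U v) L.d s) + (\<Sum>s\<in>block (2 * q) a' b'. loss q v (adj U v) L.d s)
      \<le> 3 * n ^ 3 * 2 ^ (2 * q)" for a b a' b' using add_mono[OF sG sL] unfolding e .
    then show ?thesis by (simp add: tle_def tally_bit_def)
  qed
  have r: "rch (\<sigma>, none) (P.R.fin, none) 6 (12 * W)"
  proof (rule P.run[of "3 * n ^ 3 * 2 ^ (2 * q)"])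
    have a: "j < 2 ^ (2 * q)" by (rule less_trans[OF j(1) less_exp])
    have b: "pre < 2 ^ (2 * q)" by (rule less_le_trans[OF j(2) power_increasing]) (use j in simp_all)
    have "2 ^ (2 * q) < (2::nat) ^ t" using q2 P.wV by blast
    from less_trans[OF a this] less_trans[OF b this] show "mok t (Cmd1 (Bit j pre))" "mok t (Cmd2 (Bit j pre))" using t8 by (simp_all add: mok_def)
    show "P.R.lat u v = Some m \<Longrightarrow> mok t m" for u v m using lat by simp
    show "tle (P.R.C v) (3 * n ^ 3 * 2 ^ (2 * q))" if "v \<in> P.B" for v
      unfolding P.C_eq con[OF that] using tb by (simp add: tle_def)
    have "n * (3 * n ^ 3 * 2 ^ (2 * q)) = 3 * n ^ 4 * 2 ^ (2 * q)" by (simp add: power4_eq_xxxx power3_eq_cube mult_ac)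
    also have "\<dots> \<le> 4 * n ^ 4 * 2 ^ (2 * q)" by simp
    finally show "n * (3 * n ^ 3 * 2 ^ (2 * q)) < 2 ^ t" using tq(1) by linarith
  qed
  let ?T = "P.tot + con q w (N w) True (Bit j pre) (P.R.fin w)"
  have wB: "w \<in> P.B" by (simp add: ball_def)
  \<comment> \<open>The total over the tree together with the hub's own term contains each uncovered
    vertex of the ball once, so it is the global estimator.\<close>
  have T: "?T = (\<Sum>v\<in>U. ?t v)"
  proof -
    have "?T = (\<Sum>v\<in>P.B - {w}. if v \<in> U then ?t v else 0) + (if w \<in> U then ?t w else 0)"
      unfolding P.tot_def P.C_eq using con wB by simp
    also have "\<dots> = (\<Sum>v\<in>P.B. if v \<in> U then ?t v else 0)"
      using wB by (simp add: sum.remove[of P.B w] add.commute)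
    also have "\<dots> = (\<Sum>v\<in>P.B \<inter> U. ?t v)" by (simp add: sum.inter_restrict)
    also have "P.B \<inter> U = U" by (auto simp: U uncs_def)
    finally show ?thesis .
  qed
  let ?G = "\<lambda>b. \<Sum>v\<in>U. \<Sum>s\<in>b. gain q v (adj U v) L.d s"
  let ?L = "\<lambda>b. \<Sum>v\<in>U. \<Sum>s\<in>b. loss q v (adj U v) L.d s"
  let ?b0 = "block (2 * q) (Suc j) (2 * pre)" and ?b1 = "block (2 * q) (Suc j) (2 * pre + 1)"
  have T1: "fst ?T = ?G ?b0 + ?L ?b1" "fst (snd ?T) = ?G ?b1 + ?L ?b0"
    unfolding T by (simp_all add: fst_sum snd_sum tally_bit_def sum.distrib)
  have fs: "sum f b = int (?G b) - int (?L b)" for b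
  proof -
    have "sum f b = (\<Sum>v\<in>U. \<Sum>s\<in>b. L.F v s)" unfolding f_def by (rule sum.swap)
    then show ?thesis by (simp add: L.F_def sum_subtractf)
  qed
  define pre' where "pre' = (if fst ?T \<ge> fst (snd ?T) then 2 * pre else 2 * pre + 1)"
  have pr: "pre' = (if sum f ?b0 \<ge> sum f ?b1 then 2 * pre else 2 * pre + 1)"
  proof -
    have "fst ?T \<ge> fst (snd ?T) \<longleftrightarrow> sum f ?b0 \<ge> sum f ?b1" unfolding T1 fs by linarith
    then show ?thesis unfolding pre'_def by (simp only:)
  qed
  have ch: "sum f (block (2 * q) j pre) \<le> 2 * sum f (block (2 * q) (Suc j) pre')"
    by (rule block_choice[OF j(1) pr])
  let ?x = "Top 0 (if Suc j = 2 * q then Join pre' else Bit (Suc j) pre') 0"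
  let ?s = "P.R.fin(w := (P.R.fin w)\<lparr>ctl := ?x\<rparr>)"
  have d: "decide q w (N w) (Bit j pre) ?T (P.R.fin w) = ((P.R.fin w)\<lparr>ctl := ?x\<rparr>, \<lambda>_. None)"
    unfolding decide_def pre'_def by (simp add: Let_def)
  note d' = dec_step[OF P.fin_solo d]
  have "pubs ?s U (\<lambda>u. Some (card (adj U u)))" using pf by (simp add: pubs_def)
  moreover have "pre' < 2 ^ Suc j" using j(2) by (simp add: pre'_def)
  moreover have "keeps \<sigma> ?s" by (rule keeps_trans[OF k keeps_ctl])
  moreover have "rch (\<sigma>, none) (?s, none) 7 (12 * W)" using rch_trans[OF r d'(1)] by simp
  ultimately show ?thesis using d'(2) ch by blast
qed

text \<open>Every bit keeps at least half of the sum over the current block, so the single seed that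
  remains is worth at least the average of the block.\<close>

lemma bits_phase:
  assumes ph: "phs X gs K p l \<sigma> w" and so: "solo \<sigma> w (Top 0 (Bit j pre) 0)" and U: "U = uncs \<sigma> w"
    and pb: "pubs \<sigma> U (\<lambda>u. Some (card (adj U u)))"
    and j: "j + Suc d = 2 * q" "pre < 2 ^ j"
  defines "f \<equiv> \<lambda>s. \<Sum>v\<in>U. luby.F (adj U) q v s"
  shows "\<exists>\<sigma>' seed. rch (\<sigma>, none) (\<sigma>', none) (7 * Suc d) (12 * W * Suc d) \<and>
    solo \<sigma>' w (Top 0 (Join seed) 0) \<and> keeps \<sigma> \<sigma>' \<and>
    pubs \<sigma>' U (\<lambda>u. Some (card (adj U u))) \<and> seed < 2 ^ (2 * q) \<and>
    sum f (block (2 * q) j pre) \<le> 2 ^ Suc d * f seed"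
  using ph so U pb j
proof (induction d arbitrary: \<sigma> j pre)
  case 0
  then have j: "Suc j = 2 * q" by simp
  obtain \<sigma>' pre' where s: "rch (\<sigma>, none) (\<sigma>', none) 7 (12 * W)"
    "solo \<sigma>' w (Top 0 (if Suc j = 2 * q then Join pre' else Bit (Suc j) pre') 0)" "keeps \<sigma> \<sigma>'"
    "pubs \<sigma>' U (\<lambda>u. Some (card (adj U u)))" "pre' < 2 ^ Suc j"
    "sum f (block (2 * q) j pre) \<le> 2 * sum f (block (2 * q) (Suc j) pre')"
    using bit_phase[OF 0(1-4) _ 0(6)] j unfolding f_def by auto
  have "block (2 * q) (Suc j) pre' = {pre'}" unfolding j using block_full s(5) j by simp
  then show ?case using s j by (intro exI[of _ \<sigma>'] exI[of _ pre']) simp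
next
  case (Suc d)
  have j: "j < 2 * q" "Suc j \<noteq> 2 * q" using Suc.prems(5) by auto
  obtain \<sigma>1 pre' where s: "rch (\<sigma>, none) (\<sigma>1, none) 7 (12 * W)"
    "solo \<sigma>1 w (Top 0 (Bit (Suc j) pre') 0)" "keeps \<sigma> \<sigma>1"
    "pubs \<sigma>1 U (\<lambda>u. Some (card (adj U u)))" "pre' < 2 ^ Suc j"
    "sum f (block (2 * q) j pre) \<le> 2 * sum f (block (2 * q) (Suc j) pre')"
    using bit_phase[OF Suc.prems(1-4) j(1) Suc.prems(6)] j(2) unfolding f_def by auto
  have U1: "U = uncs \<sigma>1 w" using s(3) Suc.prems(3) same_geo(3) by (auto simp: keeps_def)
  have jd: "Suc j + Suc d = 2 * q" using Suc.prems(5) by simp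
  obtain \<sigma>2 seed where r: "rch (\<sigma>1, none) (\<sigma>2, none) (7 * Suc d) (12 * W * Suc d)"
    "solo \<sigma>2 w (Top 0 (Join seed) 0)" "keeps \<sigma>1 \<sigma>2" "pubs \<sigma>2 U (\<lambda>u. Some (card (adj U u)))" "seed < 2 ^ (2 * q)"
    "sum f (block (2 * q) (Suc j) pre') \<le> 2 ^ Suc d * f seed"
    using Suc.IH[OF keeps_phs[OF s(3) Suc.prems(1)] s(2) U1 s(4) jd s(5)] by blast
  have "rch (\<sigma>, none) (\<sigma>2, none) (7 * Suc (Suc d)) (12 * W * Suc (Suc d))"
    using rch_trans[OF s(1) r(1)] by (simp add: algebra_simps)
  moreover have "sum f (block (2 * q) j pre) \<le> 2 ^ Suc (Suc d) * f seed" using s(6) r(6) by simp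
  ultimately show ?case using r keeps_trans[OF s(3) r(3)] by blast
qed

lemma join_phase:
  assumes ph: "phs X gs K p l \<sigma> w" and so: "solo \<sigma> w (Top 0 (Join seed) 0)" and U: "U = uncs \<sigma> w"
    and pb: "pubs \<sigma> U (\<lambda>u. Some (card (adj U u)))" and sd: "seed < 2 ^ (2 * q)"
  defines "J \<equiv> {v \<in> U. luby.joins (adj U) q seed v}"
  shows "\<exists>\<sigma>'. rch (\<sigma>, none) (\<sigma>', none) 7 (12 * W) \<and> solo \<sigma>' w Pre \<and> joined \<sigma> \<sigma>' J"
proof -
  interpret P: phase_op c n t E V kap \<sigma> w K p l gs X "Join seed" by unfold_locales (use ph so in auto)
  interpret L: luby U "adj U" q "n ^ c" n by (rule uncs_luby[OF P.i P.wV U])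
  have yn: "yn (N u) (\<sigma> u) = adj U u" if "u \<in> U" for u by (rule pubs_yn[OF pb that]) simp
  have JU: "v \<in> J \<longleftrightarrow> v \<in> P.B \<and> unc (N v) (\<sigma> v) \<and> (\<forall>u\<in>yn (N v) (\<sigma> v). hash q seed v < hash q seed u)" for v
    using yn[of v] unfolding J_def U L.joins_def[unfolded U] by (auto simp: uncs_def)
  have lat: "P.R.lat u v = Some m \<longleftrightarrow> u \<in> J \<and> v \<in> hn (N u) (\<sigma> u) \<and> m = Stat True True (pd (\<sigma> u)) False" for u v m
    unfolding JU by (auto simp: P.lat_eq act_def)
  have sa: "P.R.sa v = (if v \<in> J then (\<sigma> v)\<lparr>inm := True\<rparr> else \<sigma> v)" for v
    unfolding JU by (auto simp: P.R.sa_def P.R.A_def P.RM act_def)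
  have Jn: "u \<notin> N v" if "u \<in> J" "v \<in> J" for u v
  proof
    assume "u \<in> N v"
    then have "u \<in> adj U v" "v \<in> adj U u" using that Nsym by (auto simp: adj_def J_def)
    then have "hash q seed v < hash q seed u" "hash q seed u < hash q seed v" using that by (auto simp: J_def L.joins_def)
    then show False by simp
  qed
  have hJ: "heavy (\<sigma> u)" if "u \<in> J" for u using that by (simp add: JU unc_def)
  have latN: "u \<in> N v \<and> v \<in> N u" if "P.R.lat u v = Some m" for u v m using that lat Nsym by (auto simp: hn_def)
  have latNone: "P.R.lat u v = None" if "\<not> (u \<in> J \<and> v \<in> hn (N u) (\<sigma> u))" for u v
    using lat[of u v] that by (cases "P.R.lat u v") auto
  have sel: "hv (P.R.sb v) = hv (\<sigma> v)" "inm (P.R.sb v) = (inm (\<sigma> v) \<or> v \<in> J)"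
    "mv (P.R.sb v) = mv (\<sigma> v) \<union> {u \<in> J. v \<in> hn (N u) (\<sigma> u)}" for v
  proof -
    show "hv (P.R.sb v) = hv (\<sigma> v)"
    proof
      fix u
      show "hv (P.R.sb v) u = hv (\<sigma> v) u"
      proof (cases "P.R.lat u v")
        case None
        then show ?thesis by (simp add: P.R.sb_def absorb_def sa)
      next
        case (Some m)
        then have "m = Stat True True (pd (\<sigma> u)) False" "u \<in> J" "u \<in> N v" using lat latN by auto
        then show ?thesis using hv_eq[OF P.gg(1), of u v] hJ Some by (simp add: P.R.sb_def absorb_def)
      qed
    qed
    have "\<not> (inm (\<sigma> v) \<or> v \<in> J)" if "P.R.lat u v = Some m" for u m
    proof -
      have u: "u \<in> J" "v \<in> N u" using that lat latN by auto
      then have "unc (N u) (\<sigma> u)" by (simp add: JU)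
      then show ?thesis using unc_nbr[OF P.gg(2,3), of u v] u Jn Nsym by blast
    qed
    then show "inm (P.R.sb v) = (inm (\<sigma> v) \<or> v \<in> J)" by (auto simp: P.R.sb_def absorb_def sa)
    show "mv (P.R.sb v) = mv (\<sigma> v) \<union> {u \<in> J. v \<in> hn (N u) (\<sigma> u)}"
    proof (rule set_eqI)
      fix u
      show "(u \<in> mv (P.R.sb v)) = (u \<in> mv (\<sigma> v) \<union> {u \<in> J. v \<in> hn (N u) (\<sigma> u)})"
      proof (cases "P.R.lat u v")
        case None
        then have "\<not> (u \<in> J \<and> v \<in> hn (N u) (\<sigma> u))" using lat[of u v] by auto
        then show ?thesis using None by (auto simp: P.R.sb_def absorb_def sa)
      next
        case (Some m)
        then show ?thesis using lat[of u v m] by (simp add: P.R.sb_def absorb_def)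
      qed
    qed
  qed
  have jn: "joined \<sigma> P.R.fin J" unfolding joined_def P.R.fin_sel by (simp add: P.R.sb_sel sel)
  have r: "rch (\<sigma>, none) (P.R.fin, none) 6 (12 * W)"
  proof (rule P.run[of 0])
    have "2 ^ (2 * q) < (2::nat) ^ t" using q2 P.wV by blast
    from less_trans[OF sd this] show "mok t (Cmd1 (Join seed))" "mok t (Cmd2 (Join seed))" using t8 by (simp_all add: mok_def)
    show "mok t m" if "P.R.lat u v = Some m" for u v m
    proof -
      have u: "u \<in> J" "m = Stat True True (pd (\<sigma> u)) False" using that lat by auto
      then have "u \<in> V" using P.UV U by (auto simp: J_def)
      then have "pd (\<sigma> u) \<le> 2 * card (N u)" using hJ[OF u(1)] P.i by (auto simp: Inv_def degrees_def)
      then show ?thesis using u degn[of u] by (auto intro!: mok_Stat)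
    qed
  qed (auto simp: P.C_eq con_def tle_def)
  let ?s = "P.R.fin(w := (P.R.fin w)\<lparr>ctl := Pre\<rparr>)"
  note d = dec_step[OF P.fin_solo, of Pre]
  have d': "rch (P.R.fin, none) (?s, none) 1 0" "solo ?s w Pre"
    by (rule d; simp add: decide_def)+
  have "joined \<sigma> ?s J" using jn by (auto simp: joined_def)
  then show ?thesis using rch_trans[OF r d'(1)] d'(2) by auto
qed

end

section \<open>The hub loop\<close>

context asking
begin

text \<open>In a clean state the announcements of a query change nothing, so the answers are those
  that \<open>clean\<close> prescribes. Hence no call and no raised level interrupts a sequence of
  Luby phases.\<close>

lemma clean_good:
  assumes cl: "clean K l \<sigma> w"
  shows "fst all = 0" "fst (snd all) = 0"
proof -
  have sm: "same \<sigma> R.fin" by (rule clean_same[OF cl])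
  have sf: "\<forall>z\<in>S. fit K (N z) (\<sigma> z)" using cl by (simp add: clean_def)
  note L = good_Lf[OF sf]
  have "fst (R.C v) = 0 \<and> fst (snd (R.C v)) = 0" if v: "v \<in> S \<union> R.Lf" for v
  proof (cases "heavy (\<sigma> v)")
    case False
    then have nS: "v \<notin> I" using heavy_S R.w_notin_S v by (auto simp: Lf_eq)
    then have "l \<and> v \<in> N w" using v False L(1) unfolding hn_eq[OF gg(1)] by (auto split: if_splits)
    then have "\<not> lunc (N v) (R.fin v)" using cl by (simp add: clean_def same_sets[OF sm])
    then show ?thesis using False nS unfolding C_eq con_def by (simp add: fr)
  next
    case True
    have "fit K (N v) (\<sigma> v)" if "v \<in> I \<or> unc (N v) (R.fin v)"
    proof -
      have "v \<in> ball \<sigma> w" using L(4)[of v] v True by (simp add: same_geo[OF sm])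
      then show ?thesis using cl that by (auto simp: clean_def same_sets[OF sm])
    qed
    then show ?thesis using True unfolding C_eq con_def by (auto simp: fr fit_def)
  qed
  then show "fst all = 0" "fst (snd all) = 0" using all_bad all_over by auto
qed

end

context arena
begin

text \<open>The moment at which the hub has gathered a query without complaints. Consecutive Luby
  phases are cut at this point so that they compose.\<close>

definition PQ :: "frames \<Rightarrow> nat \<Rightarrow> vertex option \<Rightarrow> bool \<Rightarrow> world \<Rightarrow> vertex \<Rightarrow> bool" where
  "PQ gs K p l \<sigma> w \<longleftrightarrow> phs {} gs K p l \<sigma> w \<and>
     (\<exists>T. solo \<sigma> w (Dec (Query K) T) \<and> T + con q w (N w) True (Query K) (\<sigma> w) = (0, 0, card (uncs \<sigma> w))) \<and>
     (\<forall>v\<in>ball \<sigma> w. pub (\<sigma> v) = (\<lambda>_. None))"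

text \<open>\<open>rch\<close> counts rounds exactly, as the end of a recovery requires; amortised
  estimates are made with the number of rounds merely bounded.\<close>

definition rb where "rb x y r m \<longleftrightarrow> (\<exists>r'\<le>r. rch x y r' m)"

lemma rbI: "rch x y r m \<Longrightarrow> r \<le> r' \<Longrightarrow> m \<le> m' \<Longrightarrow> rb x y r' m'"
  using rch_mono unfolding rb_def by blast

lemma rb_trans: "rb x y r m \<Longrightarrow> rb y z r' m' \<Longrightarrow> rb x z (r + r') (m + m')"
  unfolding rb_def using rch_trans add_mono by meson

lemma rb_mono: "rb x y r m \<Longrightarrow> r \<le> r' \<Longrightarrow> m \<le> m' \<Longrightarrow> rb x y r' m'"
  unfolding rb_def using rch_mono order_trans by meson

lemma stk_hd: "Inv X \<sigma> ((w, f) # gs) \<Longrightarrow> stk (\<sigma> w) = f # map snd (filter (\<lambda>f. fst f = w) gs)"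
  using stacks_hd by (simp add: Inv_def)

lemma par_nbr: "Inv X \<sigma> ((w, Hub p K l) # gs) \<Longrightarrow> set_option p \<subseteq> N w \<and> card (set_option p) \<le> 1"
proof -
  assume "Inv X \<sigma> ((w, Hub p K l) # gs)"
  then have "linked ((w, Hub p K l) # gs)" by (simp add: Inv_def)
  then show ?thesis by (cases gs) auto
qed

text \<open>The frame was responsible for outdated views of the hub and its neighbours, for
  uncovered vertices of the ball and, with the flag, for light neighbours. A clean ball without
  uncovered vertices has none of these defects.\<close>

lemma pop_Inv:
  assumes i: "Inv X \<sigma> ((w, Hub p K l) # gs)" and cl: "clean K l \<sigma> w" and u: "uncs \<sigma> w = {}"
  shows "Inv X (\<sigma>(w := (\<sigma> w)\<lparr>ctl := Idle, stk := tl (stk (\<sigma> w))\<rparr>)) gs"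
proof -
  let ?s = "\<sigma>(w := (\<sigma> w)\<lparr>ctl := Idle, stk := tl (stk (\<sigma> w))\<rparr>)"
  have g: "hv_exact \<sigma>" "mv_light \<sigma>" "mv_heavy \<sigma>" "indep \<sigma>" "light_cov X \<sigma> ((w, Hub p K l) # gs)" "heavy_cov X \<sigma> ((w, Hub p K l) # gs)"
    "stale \<sigma> ((w, Hub p K l) # gs)" "degrees \<sigma>" "stacks \<sigma> ((w, Hub p K l) # gs)" "bounded ((w, Hub p K l) # gs)" "linked ((w, Hub p K l) # gs)"
    using i by (auto simp: Inv_def)
  have sm: "same \<sigma> ?s" by (simp add: same_def)
  note s = same_sel[OF sm] and e = same_sets[OF sm]
  have sp: "sphere \<sigma> w = {u \<in> N w. heavy (\<sigma> u)}" unfolding sphere_def hn_eq[OF g(1)] ..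
  have nb: "v \<notin> ball \<sigma> w" if "unc (N v) (\<sigma> v)" for v using that u by (auto simp: uncs_def)
  have "hv_exact ?s" "mv_light ?s" "mv_heavy ?s" "indep ?s" "degrees ?s" using g unfolding hv_exact_def mv_light_def mv_heavy_def indep_def degrees_def s by simp_all
  moreover have "light_cov X ?s gs" unfolding light_cov_def e
  proof (intro ballI impI)
    fix v assume v: "v \<in> V" "lunc (N v) (\<sigma> v)"
    then have "v \<in> PL ((w, Hub p K l) # gs) \<or> v \<in> X" using g(5) by (simp add: light_cov_def)
    then show "v \<in> PL gs \<or> v \<in> X" using v cl by (auto simp: PL_Hub clean_def split: if_splits)
  qed
  moreover have "heavy_cov X ?s gs" unfolding heavy_cov_def e
  proof (intro ballI impI)
    fix v assume v: "v \<in> V" "unc (N v) (\<sigma> v)"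
    note nv = nb[OF v(2)]
    have hv: "heavy (\<sigma> v)" using v by (simp add: unc_def)
    have "v \<in> Z2 \<sigma> ((w, Hub p K l) # gs) \<or> v \<in> X" using g(6) v by (simp add: heavy_cov_def)
    moreover have "v \<in> Z2 ?s gs" if z: "v \<in> Z2 \<sigma> ((w, Hub p K l) # gs)"
    proof -
      consider "v \<in> insert w (N w)" | "v \<in> Z1 gs" | z where "z \<in> insert w (N w)" "heavy (\<sigma> z)" "v \<in> N z"
        | z where "z \<in> Z1 gs" "heavy (\<sigma> z)" "v \<in> N z"
        using z unfolding Z2_def Z1_Hub by blast
      then show ?thesis
      proof cases
        case 1
        then show ?thesis using nv hv by (auto simp: ball_def sp)
      next
        case 2
        then show ?thesis by (simp add: Z2_def)
      next
        case 3
        then have "z = w \<and> v \<in> sphere \<sigma> w \<or> z \<in> sphere \<sigma> w \<and> v \<in> hn (N z) (\<sigma> z)"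
          using hv unfolding sp hn_eq[OF g(1)] by auto
        then show ?thesis using nv by (auto simp: ball_def)
      next
        case 4
        then show ?thesis unfolding Z2_def s by blast
      qed
    qed
    ultimately show "v \<in> Z2 ?s gs \<or> v \<in> X" by blast
  qed
  moreover have "stale ?s gs" unfolding stale_def s
  proof (intro ballI impI)
    fix v y assume a: "v \<in> V" "y \<in> N v" "heavy (\<sigma> v) \<and> heavy (\<sigma> y) \<and> y \<in> mv (\<sigma> v) \<and> \<not> inm (\<sigma> y)"
    then have "y \<in> Z1 ((w, Hub p K l) # gs)" using g(7) by (simp add: stale_def)
    moreover have "y \<notin> insert w (N w)"
    proof
      assume "y \<in> insert w (N w)"
      then have "y \<in> insert w (sphere \<sigma> w)" "v \<in> hn (N y) (\<sigma> y)" using a Nsym unfolding sp hn_eq[OF g(1)] by auto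
      then show False using cl a by (auto simp: clean_def)
    qed
    ultimately show "y \<in> Z1 gs" by (simp add: Z1_Hub)
  qed
  moreover have "stacks ?s gs" using g(9) by (auto simp: stacks_def)
  moreover have "bounded gs" using g(10) by (simp add: bounded_def)
  moreover have "linked gs" using g(11) linked_tl by (cases gs) auto
  ultimately show ?thesis by (simp add: Inv_def)
qed

lemma pop:
  assumes pq: "PQ gs K p l \<sigma> w" and u: "uncs \<sigma> w = {}"
  shows "\<exists>\<sigma>'. rb (\<sigma>, none) (\<sigma>', many w (set_option p) Ret) 1 1 \<and> Inv {} \<sigma>' gs \<and> quiet \<sigma>' \<and> same \<sigma> \<sigma>'"
proof -
  let ?s = "\<sigma>(w := (\<sigma> w)\<lparr>ctl := Idle, stk := tl (stk (\<sigma> w))\<rparr>)"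
  obtain T where T: "solo \<sigma> w (Dec (Query K) T)" "T + con q w (N w) True (Query K) (\<sigma> w) = (0, 0, 0)"
    using pq u by (auto simp: PQ_def)
  have i: "Inv {} \<sigma> ((w, Hub p K l) # gs)" and cl: "clean K l \<sigma> w" using pq by (auto simp: PQ_def phs_def)
  have st: "step c n w (N w) (\<lambda>_. None) (\<sigma> w) = ((\<sigma> w)\<lparr>ctl := Idle, stk := tl (stk (\<sigma> w))\<rparr>, to_set (set_option p) Ret)"
    using T stk_hd[OF i] by (simp add: step_def Let_def solo_def decide_def)
  have "rch (\<sigma>, none) (?s, many w (set_option p) Ret) 1 (card (set_option p))"
    by (rule solo_step[OF T(1) _ st]) (use par_nbr[OF i] mok_Ret in auto)
  then have "rb (\<sigma>, none) (?s, many w (set_option p) Ret) 1 1" by (rule rbI) (use par_nbr[OF i] in auto)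
  moreover have "quiet ?s" using T by (auto simp: quiet_def solo_def)
  moreover have "same \<sigma> ?s" by (simp add: same_def)
  ultimately show ?thesis using pop_Inv[OF i cl u] by blast
qed

lemma joined_geo:
  assumes j: "joined \<sigma> \<sigma>' J" and i: "Inv X \<sigma> gs" and cl: "clean K l \<sigma> w" and J: "J \<subseteq> uncs \<sigma> w"
  shows "clean K l \<sigma>' w" "uncs \<sigma>' w \<subseteq> {v \<in> uncs \<sigma> w. v \<notin> J \<and> N v \<inter> J = {}}"
proof -
  have s: "heavy (\<sigma>' v) = heavy (\<sigma> v)" "inm (\<sigma>' v) = (inm (\<sigma> v) \<or> v \<in> J)" "pd (\<sigma>' v) = pd (\<sigma> v)"
    "hv (\<sigma>' v) = hv (\<sigma> v)" "mv (\<sigma>' v) = mv (\<sigma> v) \<union> {u \<in> J. v \<in> hn (N u) (\<sigma> u)}" for v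
    using j by (auto simp: joined_def)
  have g: "hv_exact \<sigma>" using i by (simp add: Inv_def)
  have hJ: "heavy (\<sigma> u)" if "u \<in> J" for u using J that by (auto simp: uncs_def unc_def)
  have geo: "sphere \<sigma>' w = sphere \<sigma> w" "ball \<sigma>' w = ball \<sigma> w" "hn (N v) (\<sigma>' v) = hn (N v) (\<sigma> v)"
    "fit K (N v) (\<sigma>' v) = fit K (N v) (\<sigma> v)" for v
    by (simp_all add: sphere_def ball_def hn_def fit_def over_def lows_def s)
  have un: "unc (N v) (\<sigma>' v) \<Longrightarrow> unc (N v) (\<sigma> v)" for v by (auto simp: unc_def s)
  have lu: "lunc (N v) (\<sigma>' v) \<Longrightarrow> lunc (N v) (\<sigma> v)" for v
    by (auto simp: lunc_def lcov_def s)
  show "clean K l \<sigma>' w" using cl un lu unfolding clean_def geo s by blast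
  show "uncs \<sigma>' w \<subseteq> {v \<in> uncs \<sigma> w. v \<notin> J \<and> N v \<inter> J = {}}"
  proof
    fix v assume v: "v \<in> uncs \<sigma>' w"
    then have "v \<in> uncs \<sigma> w" "v \<notin> J" using un by (auto simp: uncs_def geo unc_def s)
    moreover have "u \<notin> J" if "u \<in> N v" for u
    proof
      assume "u \<in> J"
      then have "v \<in> hn (N u) (\<sigma> u)" using v that Nsym unfolding hn_eq[OF g] by (auto simp: uncs_def unc_def s)
      then show False using v \<open>u \<in> J\<close> that by (auto simp: uncs_def unc_def s)
    qed
    ultimately show "v \<in> {v \<in> uncs \<sigma> w. v \<notin> J \<and> N v \<inter> J = {}}" by blast
  qed
qed

text \<open>Twice the number of edges among the uncovered vertices, the measure that Luby's
  algorithm reduces geometrically.\<close>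

definition edges2 :: "vertex set \<Rightarrow> nat" where
  "edges2 U = (\<Sum>v\<in>U. card (adj U v))"

text \<open>One decision, \<open>3 + 2 * q\<close> commands of seven rounds each, one round in
  \<open>Pre\<close>, and a query of six rounds.\<close>

definition "lr = 29 + 14 * q"
definition "lm = 12 * W * (4 + 2 * q)"

text \<open>A killed vertex gets a neighbour in the set, so what stays uncovered has lost a
  sixty-fourth of the degree sum. Once no edges are left, every uncovered vertex is a local minimum
  and joins.\<close>

lemma luby_phase:
  assumes pq: "PQ gs K p l \<sigma> w" and ne: "uncs \<sigma> w \<noteq> {}"
  shows "\<exists>\<sigma>'. rb (\<sigma>, none) (\<sigma>', none) lr lm \<and> PQ gs K p l \<sigma>' w \<and> Phi \<sigma>' = Phi \<sigma> \<and> shrinks \<sigma> \<sigma>' \<and>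
    64 * edges2 (uncs \<sigma>' w) \<le> 63 * edges2 (uncs \<sigma> w) \<and> (edges2 (uncs \<sigma> w) = 0 \<longrightarrow> uncs \<sigma>' w = {})"
proof -
  define U where "U = uncs \<sigma> w"
  obtain T where T: "solo \<sigma> w (Dec (Query K) T)" "T + con q w (N w) True (Query K) (\<sigma> w) = (0, 0, card (uncs \<sigma> w))"
    using pq by (auto simp: PQ_def)
  have ph: "phs {} gs K p l \<sigma> w" and pb: "\<forall>v\<in>ball \<sigma> w. pub (\<sigma> v) = (\<lambda>_. None)" using pq by (auto simp: PQ_def)
  have i: "Inv {} \<sigma> ((w, Hub p K l) # gs)" and cU: "card U \<le> 2 ^ K" using ph by (auto simp: phs_def U_def)
  have wV: "w \<in> V" using i by (auto simp: Inv_def bounded_def)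
  have fU: "finite U" by (simp add: U_def uncs_def)
  define s1 where "s1 = \<sigma>(w := (\<sigma> w)\<lparr>ctl := Top 0 Alive 0\<rparr>)"
  have "card U > 0" using ne fU by (simp add: U_def card_gt_0_iff)
  then have d: "decide q w (N w) (Query K) (T + con q w (N w) True (Query K) (\<sigma> w)) (\<sigma> w) = ((\<sigma> w)\<lparr>ctl := Top 0 Alive 0\<rparr>, \<lambda>_. None)"
    unfolding T(2) using stk_hd[OF i] cU by (simp add: decide_def U_def)
  note d1 = dec_step[OF T(1) d, folded s1_def]
  have k1: "keeps \<sigma> s1" unfolding s1_def by (rule keeps_ctl)
  note p1 = keeps_phs[OF k1 ph]
  have u1: "U = uncs s1 w" using k1 same_geo(3) by (auto simp: keeps_def U_def)
  have b1: "pubs s1 U (\<lambda>_. None)" using pb by (auto simp: pubs_def s1_def U_def uncs_def)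
  obtain s2 where s2: "rch (s1, none) (s2, none) 7 (12 * W)" "solo s2 w (Top 0 Degr 0)" "keeps s1 s2" "pubs s2 U (\<lambda>_. Some 0)"
    using alive_phase[OF p1 d1(2) u1 b1] by blast
  note p2 = keeps_phs[OF s2(3) p1]
  have u2: "U = uncs s2 w" using s2(3) same_geo(3) u1 by (auto simp: keeps_def)
  obtain s3 where s3: "rch (s2, none) (s3, none) 7 (12 * W)" "solo s3 w (Top 0 (Bit 0 0) 0)" "keeps s2 s3"
    "pubs s3 U (\<lambda>u. Some (card (adj U u)))"
    using degree_phase[OF p2 s2(2) u2 s2(4)] by blast
  note p3 = keeps_phs[OF s3(3) p2]
  have u3: "U = uncs s3 w" using s3(3) same_geo(3) u2 by (auto simp: keeps_def)
  interpret L: luby U "adj U" q "n ^ c" n by (rule uncs_luby[OF i wV]) (simp add: U_def)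
  have q0: "0 + Suc (2 * q - 1) = 2 * q" by (simp add: qbits_def)
  obtain s4 seed where s4: "rch (s3, none) (s4, none) (7 * Suc (2 * q - 1)) (12 * W * Suc (2 * q - 1))"
    "solo s4 w (Top 0 (Join seed) 0)" "keeps s3 s4" "pubs s4 U (\<lambda>u. Some (card (adj U u)))" "seed < 2 ^ (2 * q)"
    "(\<Sum>s\<in>block (2 * q) 0 0. \<Sum>v\<in>U. L.F v s) \<le> 2 ^ Suc (2 * q - 1) * (\<Sum>v\<in>U. L.F v seed)"
    using bits_phase[OF p3 s3(2) u3 s3(4) q0] by auto
  note p4 = keeps_phs[OF s4(3) p3]
  have u4: "U = uncs s4 w" using s4(3) same_geo(3) u3 by (auto simp: keeps_def)
  have q1: "Suc (2 * q - 1) = 2 * q" using q0 by simp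
  have pr: "(\<Sum>v\<in>U. L.d v) \<le> 64 * (\<Sum>v\<in>L.killed seed. L.d v)"
    by (rule L.progress) (use s4(6)[unfolded q1 block_0] in simp)
  define J where "J = {v \<in> U. L.joins seed v}"
  obtain s5 where s5: "rch (s4, none) (s5, none) 7 (12 * W)" "solo s5 w Pre" "joined s4 s5 J"
    using join_phase[OF p4 s4(2) u4 s4(4,5)] unfolding J_def by blast
  have i4: "Inv {} s4 ((w, Hub p K l) # gs)" and cl4: "clean K l s4 w" using p4 by (auto simp: phs_def)
  have J1: "v \<in> J \<Longrightarrow> v \<in> V \<and> unc (N v) (s4 v)" for v using ball_V[OF wV] u4 by (auto simp: J_def uncs_def)
  have J2: "u \<in> J \<Longrightarrow> v \<in> J \<Longrightarrow> u \<notin> N v" for u v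
  proof
    assume a: "u \<in> J" "v \<in> J" "u \<in> N v"
    then have "u \<in> adj U v" "v \<in> adj U u" using Nsym by (auto simp: adj_def J_def)
    then have "hash q seed v < hash q seed u" "hash q seed u < hash q seed v" using a by (auto simp: J_def L.joins_def)
    then show False by simp
  qed
  note j5 = joined_Inv[OF s5(3) i4 J1 J2]
  have JU: "J \<subseteq> uncs s4 w" using u4 by (auto simp: J_def)
  note c5 = joined_geo[OF s5(3) i4 cl4 JU]
  define s6 where "s6 = s5(w := (s5 w)\<lparr>ctl := Top 0 (Query K) 0\<rparr>)"
  have fw: "fit K (N w) (s5 w)" using c5(1) by (simp add: clean_def)
  have st5: "step c n w (N w) (\<lambda>_. None) (s5 w) = ((s5 w)\<lparr>ctl := Top 0 (Query K) 0\<rparr>, \<lambda>_. None)"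
    using s5(2) stk_hd[OF j5(1)] fw by (simp add: step_def Let_def solo_def pre_step_def fit_def)
  have r6: "rch (s5, none) (s6, none) 1 0" unfolding s6_def by (rule solo_silent[OF s5(2) _ st5]) simp
  have k6: "keeps s5 s6" unfolding s6_def by (rule keeps_ctl)
  have sm6: "same s5 s6" using k6 by (simp add: keeps_def)
  have so6: "solo s6 w (Top 0 (Query K) 0)" using s5(2) by (auto simp: solo_def s6_def)
  have cl6: "clean K l s6 w" using c5(1) by (simp add: same_geo[OF sm6])
  interpret Q: asking c n t E V kap s6 w K p l gs "{}"
    by unfold_locales (use keeps_Inv[OF k6 j5(1)] so6 cl6 in \<open>auto simp: clean_def\<close>)
  note cg = Q.clean_good[OF cl6]
  note smf = Q.clean_same[OF cl6]
  have uf: "uncs Q.R.fin w = uncs s5 w" by (simp add: same_geo[OF smf] same_geo[OF sm6])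
  have usub: "uncs s5 w \<subseteq> U - L.killed seed" "uncs s5 w \<subseteq> U - J"
  proof -
    show "uncs s5 w \<subseteq> U - J" using c5(2) u4 by auto
    show "uncs s5 w \<subseteq> U - L.killed seed"
    proof
      fix v assume v: "v \<in> uncs s5 w"
      then have a: "v \<in> U" "N v \<inter> J = {}" using c5(2) u4 by auto
      have "v \<notin> L.killed seed"
      proof
        assume "v \<in> L.killed seed"
        then obtain u where "u \<in> adj U v" "L.joins seed u" by (auto simp: L.killed_def)
        then have "u \<in> N v \<inter> J" by (auto simp: adj_def J_def)
        then show False using a by blast
      qed
      then show "v \<in> U - L.killed seed" using a by blast
    qed
  qed
  have cU': "card (uncs s5 w) \<le> card U" by (rule card_mono[OF fU]) (use usub in auto)
  have "phs {} gs K p l Q.R.fin w" unfolding phs_def uf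
  proof (intro conjI)
    show "Inv {} Q.R.fin ((w, Hub p K l) # gs)" by (rule Q.inv)
    show "clean K l Q.R.fin w" by (rule Q.good_clean[OF cg])
    have sp: "sphere Q.R.fin w = Q.S" by (simp add: same_geo[OF smf])
    show "\<forall>z\<in>sphere Q.R.fin w. kids (Q.R.fin z) \<subseteq> hn (N z) (Q.R.fin z)"
      using Q.good_kids(1)[OF cg] unfolding sp by (simp add: Q.fr)
    show "(\<Union>z\<in>sphere Q.R.fin w. kids (Q.R.fin z)) = ball Q.R.fin w - insert w (sphere Q.R.fin w)"
      using Q.good_kids(2)[OF cg] unfolding sp by simp
    show "card (uncs s5 w) \<le> 2 ^ K" using cU' cU by simp
  qed
  moreover have "Q.tot + con q w (N w) True (Query K) (Q.R.fin w) = (0, 0, card (uncs Q.R.fin w))"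
    using cg Q.good_count[OF cg] unfolding Q.all_def[symmetric] by (simp add: prod_eq_iff)
  ultimately have PQ': "PQ gs K p l Q.R.fin w"
    using Q.fin_solo Q.good_kids(3)[OF cg] unfolding PQ_def by blast
  have rr: "rch (\<sigma>, none) (Q.R.fin, none) (1 + 7 + 7 + 7 * Suc (2 * q - 1) + 7 + 1 + 6)
     (0 + 12 * W + 12 * W + 12 * W * Suc (2 * q - 1) + 12 * W + 0 + 12 * W)"
    by (rule rch_trans[OF rch_trans[OF rch_trans[OF rch_trans[OF rch_trans[OF rch_trans[OF d1(1) s2(1)] s3(1)] s4(1)] s5(1)] r6] Q.run])
  have "rb (\<sigma>, none) (Q.R.fin, none) lr lm"
    by (rule rbI[OF rr[unfolded q1]]) (simp_all add: lr_def lm_def algebra_simps)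
  moreover have "Phi Q.R.fin = Phi \<sigma> \<and> shrinks \<sigma> Q.R.fin"
  proof -
    have k: "same \<sigma> s4" using keeps_trans[OF keeps_trans[OF keeps_trans[OF k1 s2(3)] s3(3)] s4(3)] by (simp add: keeps_def)
    show ?thesis using same_sets(8,9)[OF k] j5(2,3) same_sets(8,9)[OF sm6] same_sets(8,9)[OF smf]
      by (auto intro: shrinks_trans)
  qed
  moreover have "64 * edges2 (uncs Q.R.fin w) \<le> 63 * edges2 U"
  proof -
    let ?U' = "uncs s5 w"
    have kU: "L.killed seed \<subseteq> U" by (auto simp: L.killed_def)
    have "edges2 ?U' \<le> (\<Sum>v\<in>?U'. L.d v)" unfolding edges2_def L.d_def
      by (intro sum_mono card_mono) (use usub in \<open>auto simp: adj_def\<close>)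
    also have "\<dots> \<le> (\<Sum>v\<in>U - L.killed seed. L.d v)" by (rule sum_mono2) (use fU usub in auto)
    finally have "edges2 ?U' \<le> (\<Sum>v\<in>U - L.killed seed. L.d v)" .
    moreover have "(\<Sum>v\<in>U. L.d v) = (\<Sum>v\<in>U - L.killed seed. L.d v) + (\<Sum>v\<in>L.killed seed. L.d v)"
      by (rule sum.subset_diff[OF kU fU])
    moreover have "edges2 U = (\<Sum>v\<in>U. L.d v)" by (simp add: edges2_def L.d_def)
    ultimately show ?thesis using pr unfolding uf by linarith
  qed
  moreover have "edges2 U = 0 \<longrightarrow> uncs Q.R.fin w = {}"
  proof
    assume "edges2 U = 0"
    then have "adj U v = {}" if "v \<in> U" for v using that fU by (auto simp: edges2_def adj_def)
    then have "J = U" by (auto simp: J_def L.joins_def)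
    then show "uncs Q.R.fin w = {}" using usub uf by auto
  qed
  ultimately show ?thesis using PQ' unfolding U_def by - (intro exI[of _ Q.R.fin] conjI; (elim conjE)?; assumption)
qed

text \<open>After \<open>j - 1\<close> phases the measure has fallen below one, that is, to zero;
  the last phase takes in the remaining isolated vertices.\<close>

lemma luby_run:
  assumes "PQ gs K p l \<sigma> w" "uncs \<sigma> w = {} \<or> (0 < j \<and> edges2 (uncs \<sigma> w) * 63 ^ (j - 1) < 64 ^ (j - 1))"
  shows "\<exists>\<sigma>'. rb (\<sigma>, none) (\<sigma>', many w (set_option p) Ret) (j * lr + 1) (j * lm + 1) \<and>
    Inv {} \<sigma>' gs \<and> quiet \<sigma>' \<and> Phi \<sigma>' = Phi \<sigma> \<and> shrinks \<sigma> \<sigma>'"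
  using assms
proof (induction j arbitrary: \<sigma>)
  case 0
  then obtain \<sigma>' where "rb (\<sigma>, none) (\<sigma>', many w (set_option p) Ret) 1 1" "Inv {} \<sigma>' gs" "quiet \<sigma>'" "same \<sigma> \<sigma>'"
    using pop by blast
  then show ?case using same_sets(8,9) by (intro exI[of _ \<sigma>']) auto
next
  case (Suc j)
  show ?case
  proof (cases "uncs \<sigma> w = {}")
    case True
    then obtain \<sigma>' where "rb (\<sigma>, none) (\<sigma>', many w (set_option p) Ret) 1 1" "Inv {} \<sigma>' gs" "quiet \<sigma>'" "same \<sigma> \<sigma>'"
      using pop Suc.prems by blast
    then show ?thesis using same_sets(8,9) by (intro exI[of _ \<sigma>']) (auto elim: rb_mono)
  next
    case False
    then have e: "edges2 (uncs \<sigma> w) * 63 ^ j < 64 ^ j" using Suc.prems by auto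
    obtain \<sigma>1 where s: "rb (\<sigma>, none) (\<sigma>1, none) lr lm" "PQ gs K p l \<sigma>1 w" "Phi \<sigma>1 = Phi \<sigma>" "shrinks \<sigma> \<sigma>1"
      "64 * edges2 (uncs \<sigma>1 w) \<le> 63 * edges2 (uncs \<sigma> w)" "edges2 (uncs \<sigma> w) = 0 \<longrightarrow> uncs \<sigma>1 w = {}"
      using luby_phase[OF Suc.prems(1) False] by (elim exE conjE) (rule that; assumption)
    have "uncs \<sigma>1 w = {} \<or> (0 < j \<and> edges2 (uncs \<sigma>1 w) * 63 ^ (j - 1) < 64 ^ (j - 1))"
    proof (cases j)
      case 0
      then show ?thesis using e s(6) by simp
    next
      case (Suc i)
      have "64 * (edges2 (uncs \<sigma>1 w) * 63 ^ i) \<le> 63 * edges2 (uncs \<sigma> w) * 63 ^ i"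
        using mult_right_mono[OF s(5), of "63 ^ i"] by (simp add: mult_ac)
      also have "\<dots> < 64 * 64 ^ i" using e Suc by (simp add: mult_ac)
      finally show ?thesis using Suc by simp
    qed
    from Suc.IH[OF s(2) this] obtain \<sigma>' where r: "rb (\<sigma>1, none) (\<sigma>', many w (set_option p) Ret) (j * lr + 1) (j * lm + 1)"
      "Inv {} \<sigma>' gs" "quiet \<sigma>'" "Phi \<sigma>' = Phi \<sigma>1" "shrinks \<sigma>1 \<sigma>'" by blast
    have "rb (\<sigma>, none) (\<sigma>', many w (set_option p) Ret) (Suc j * lr + 1) (Suc j * lm + 1)"
      using rb_trans[OF s(1) r(1)] by (simp add: algebra_simps)
    then show ?thesis using r s shrinks_trans by (intro exI[of _ \<sigma>']) auto
  qed
qed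

section \<open>Costs of a hub loop\<close>

definition "lg = (LEAST k. n \<le> 2 ^ k)"
text \<open>As \<open>(64 / 63) ^ 63\<close> is at least two, \<open>63\<close> phases halve the
  measure \<open>edges2\<close>, which starts below \<open>2 ^ (2 * lg + 1)\<close>. One more phase
  deals with isolated vertices.\<close>

definition "jm = 63 * (2 * lg + 1) + 1"
definition "Lr = jm * lr + 1"
definition "Lm = jm * lm + 1"

lemma n_lg: "n \<le> 2 ^ lg"
proof -
  have "n \<le> 2 ^ n" using less_exp[of n] by simp
  then show ?thesis unfolding lg_def by (rule LeastI)
qed

lemma jm_enough:
  assumes "U \<subseteq> V"
  shows "edges2 U * 63 ^ (jm - 1) < 64 ^ (jm - 1)"
proof -
  have fU: "finite U" by (rule finite_subset[OF assms finV])
  have "card (adj U v) \<le> n" for v using card_mono[of "N v" "adj U v"] degn[of v] by (auto simp: adj_def)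
  then have "edges2 U \<le> card U * n" unfolding edges2_def by (rule sum_bounded_above[of U _ n, simplified])
  also have "\<dots> \<le> n * n" using card_mono[OF finV assms] cardV by (intro mult_right_mono) auto
  also have "\<dots> \<le> 2 ^ lg * 2 ^ lg" by (rule mult_mono) (use n_lg in auto)
  also have "\<dots> < 2 ^ (2 * lg + 1)" by (simp add: mult_2 power_add)
  finally have e: "edges2 U < 2 ^ (2 * lg + 1)" .
  have "(2::nat) * 63 ^ 63 \<le> 64 ^ 63" by simp
  then have "((2::nat) * 63 ^ 63) ^ (2 * lg + 1) \<le> (64 ^ 63) ^ (2 * lg + 1)" by (rule power_mono) simp
  then have p: "(2::nat) ^ (2 * lg + 1) * 63 ^ (63 * (2 * lg + 1)) \<le> 64 ^ (63 * (2 * lg + 1))"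
    unfolding power_mult_distrib power_mult[symmetric] .
  have "edges2 U * 63 ^ (63 * (2 * lg + 1)) < 2 ^ (2 * lg + 1) * 63 ^ (63 * (2 * lg + 1))"
    using e by (rule mult_strict_right_mono) simp
  then have "edges2 U * 63 ^ (63 * (2 * lg + 1)) < 64 ^ (63 * (2 * lg + 1))" using p by (rule less_le_trans)
  moreover have "jm - 1 = 63 * (2 * lg + 1)" by (simp add: jm_def)
  ultimately show ?thesis by (simp only:)
qed

text \<open>The price of one unit of \<open>Phi\<close>: the hub loop of the called vertex, at most
  six rounds to carry the call and bring it back, one round to wake the caller, and at most eight
  rounds for the caller's attempt. Besides the loop of \<open>8 * kap + 8 + Lr\<close> rounds this
  makes \<open>15\<close>, hence \<open>23\<close>.\<close>

definition "Ar = 8 * kap + Lr + 23"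
definition "Am = (12 * W + 1) * (kap + 2) + Lm + 2 * W + 4"

definition served :: "world \<Rightarrow> frames \<Rightarrow> world \<Rightarrow> bool" where
  "served \<sigma> gs \<sigma>' \<longleftrightarrow> Inv {} \<sigma>' gs \<and> quiet \<sigma>' \<and> shrinks \<sigma> \<sigma>'"

text \<open>Raising the level costs at most eight rounds and happens at most once per level, and the
  Luby phases are run through once at the end. All calls in between are paid for by the fall of
  \<open>Phi\<close>.\<close>

definition loops :: "world \<Rightarrow> vertex \<Rightarrow> vertex option \<Rightarrow> nat \<Rightarrow> frames \<Rightarrow> bool" where
  "loops \<sigma> w p K gs \<longleftrightarrow> (\<exists>\<sigma>' r m. rb (\<sigma>, none) (\<sigma>', many w (set_option p) Ret) r m \<and> served \<sigma> gs \<sigma>' \<and>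
     Phi \<sigma>' \<le> Phi \<sigma> \<and> r + Ar * Phi \<sigma>' \<le> Ar * Phi \<sigma> + (8 * (kap - K) + 8 + Lr) \<and>
     m + Am * Phi \<sigma>' \<le> Am * Phi \<sigma> + ((12 * W + 1) * (kap - K) + 12 * W + 1 + Lm))"

text \<open>The called vertex starts its loop in a state of smaller \<open>Phi\<close>, so the
  hypothesis on loops applies to it. Forwarding vertices add a frame, pass the call on, and later
  hand the return back.\<close>

lemma call_return:
  assumes IH: "\<And>\<sigma>0 w0 p0 gs0. Phi \<sigma>0 < b \<Longrightarrow> Inv {} \<sigma>0 ((w0, Hub p0 0 False) # gs0) \<Longrightarrow> solo \<sigma>0 w0 Pre \<Longrightarrow> loops \<sigma>0 w0 p0 0 gs0"
    and c: "callable K \<sigma> v d" and "quiet \<sigma>" "Inv {} \<sigma> ((x, f) # gs)" "x \<in> N v" "Phi \<sigma> \<le> b" "K < kap \<or> K = kap"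
  shows "\<exists>\<sigma>' r m. rb (\<sigma>, many x {v} (Call K)) (\<sigma>', many v {x} Ret) r m \<and> served \<sigma> ((x, f) # gs) \<sigma>' \<and>
     Phi \<sigma>' < Phi \<sigma> \<and> r + Ar * Phi \<sigma>' + Ar \<le> Ar * Phi \<sigma> + (8 * kap + 8 + Lr + 2 + 2 * d) \<and>
     m + Am * Phi \<sigma>' + Am \<le> Am * Phi \<sigma> + ((12 * W + 1) * (kap + 1) + Lm + 2 * W + 2 * d)"
  using c assms(3-7)
proof (induction d arbitrary: \<sigma> v x f gs rule: nat_induct)
  case 0
  have cb: "v \<in> V" "heavy (\<sigma> v) \<and> pd (\<sigma> v) \<le> 4 ^ K \<or> lunc (N v) (\<sigma> v)"
    using "0.prems"(1) by (auto elim: callable.cases)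
  have degrees: "degrees \<sigma>" and lk: "linked ((x, f) # gs)" using "0.prems" by (auto simp: Inv_def)
  have Kk: "K \<le> kap" using "0.prems" by auto
  have h: "\<not> heavy (\<sigma> v) \<or> pd (\<sigma> v) \<le> 4 ^ K" and lu: "\<not> heavy (\<sigma> v) \<Longrightarrow> lunc (N v) (\<sigma> v)"
    using cb by (auto simp: lunc_def)
  have dW: "card (N v) \<le> 2 * W"
  proof (cases "heavy (\<sigma> v)")
    case True
    then have "card (N v) \<le> 2 * pd (\<sigma> v)" using degrees cb(1) by (auto simp: degrees_def)
    also have "pd (\<sigma> v) \<le> 4 ^ K" using h True by simp
    also have "(4::nat) ^ K \<le> W" unfolding W_def by (rule power_increasing[OF Kk]) simp
    finally show ?thesis by simp
  next
    case False
    then show ?thesis using degrees cb(1) by (auto simp: degrees_def)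
  qed
  let ?s = "bec \<sigma> v (Some x)"
  note kb = call_bec[OF "0.prems"(2,4) h]
  have lk': "linked ((v, Hub (Some x) 0 False) # (x, f) # gs)" using lk "0.prems"(4) by simp
  have i1: "Inv {} ?s ((v, Hub (Some x) 0 False) # (x, f) # gs)"
    using bec_Inv[OF "0.prems"(3) cb(1) dW lu lk'] by simp
  note bp = bec_Phi[OF "0.prems"(3) cb(1) lu, of "Some x"]
  have "loops ?s v (Some x) 0 ((x, f) # gs)"
    by (rule IH[OF _ i1 kb(2)]) (use bp "0.prems"(5) in simp)
  then obtain \<sigma>' r m where l: "rb (?s, none) (\<sigma>', many v {x} Ret) r m" "served ?s ((x, f) # gs) \<sigma>'"
    "Phi \<sigma>' \<le> Phi ?s" "r + Ar * Phi \<sigma>' \<le> Ar * Phi ?s + (8 * kap + 8 + Lr)"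
    "m + Am * Phi \<sigma>' \<le> Am * Phi ?s + ((12 * W + 1) * kap + 12 * W + 1 + Lm)"
    unfolding loops_def by auto
  have "rb (\<sigma>, many x {v} (Call K)) (?s, none) 2 (2 * W)" by (rule rbI[OF kb(1)]) (use dW in auto)
  from rb_trans[OF this l(1)] have r: "rb (\<sigma>, many x {v} (Call K)) (\<sigma>', many v {x} Ret) (2 + r) (2 * W + m)" .
  have P: "Phi ?s + 1 \<le> Phi \<sigma>" using bp by simp
  have a: "Ar * Phi ?s + Ar \<le> Ar * Phi \<sigma>" using mult_le_mono2[OF P, of Ar] by simp
  have b: "Am * Phi ?s + Am \<le> Am * Phi \<sigma>" using mult_le_mono2[OF P, of Am] by simp
  have e: "(12 * W + 1) * (kap + 1) = (12 * W + 1) * kap + 12 * W + 1" by simp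
  have "served \<sigma> ((x, f) # gs) \<sigma>'" using l(2) bp(2) shrinks_trans unfolding served_def by blast
  moreover have "Phi \<sigma>' < Phi \<sigma>" using l(3) bp(1) by simp
  moreover have "2 + r + Ar * Phi \<sigma>' + Ar \<le> Ar * Phi \<sigma> + (8 * kap + 8 + Lr + 2 + 2 * 0)" using l(4) a by linarith
  moreover have "2 * W + m + Am * Phi \<sigma>' + Am \<le> Am * Phi \<sigma> + ((12 * W + 1) * (kap + 1) + Lm + 2 * W + 2 * 0)"
    unfolding e using l(5) b by linarith
  ultimately show ?case using r by blast
next
  case (Suc d)
  have fw: "heavy (\<sigma> v)" "pd (\<sigma> v) > 4 ^ K" "tgt K \<sigma> v \<in> N v" "callable K \<sigma> (tgt K \<sigma> v) d"
    using Suc.prems(1) by (auto elim: callable.cases)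
  have Kk: "K \<le> kap" using Suc.prems by auto
  let ?y = "tgt K \<sigma> v"
  define s1 where "s1 = \<sigma>(v := (\<sigma> v)\<lparr>stk := Fwd x # stk (\<sigma> v)\<rparr>)"
  note cf = call_fwd[OF Suc.prems(2,3,4) fw(1,2,3) Kk, folded s1_def]
  have cs: "callable K s1 ?y d" by (rule callable_same[OF fw(4) cf(4)]) (simp add: s1_def)
  have P1: "Phi s1 = Phi \<sigma>" using same_sets(8)[OF cf(4)] .
  have vy: "v \<in> N ?y" using fw(3) Nsym by blast
  obtain s2 r m where l: "rb (s1, many v {?y} (Call K)) (s2, many ?y {v} Ret) r m" "served s1 ((v, Fwd x) # (x, f) # gs) s2"
      "Phi s2 < Phi s1" "r + Ar * Phi s2 + Ar \<le> Ar * Phi s1 + (8 * kap + 8 + Lr + 2 + 2 * d)"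
      "m + Am * Phi s2 + Am \<le> Am * Phi s1 + ((12 * W + 1) * (kap + 1) + Lm + 2 * W + 2 * d)"
    using Suc.IH[OF cs cf(3,2) vy _ Suc.prems(6)] P1 Suc.prems(5) by auto
    have sv: "Inv {} s2 ((v, Fwd x) # (x, f) # gs)" "quiet s2" "shrinks s1 s2" using l(2) by (auto simp: served_def)
    obtain s3 where f: "rch (s2, many ?y {v} Ret) (s3, many v {x} Ret) 1 1" "Inv {} s3 ((x, f) # gs)" "quiet s3" "same s2 s3"
      using ret_fwd[OF sv(2,1)] by blast
    have "rb (\<sigma>, many x {v} (Call K)) (s3, many v {x} Ret) (1 + r + 1) (1 + m + 1)"
      by (rule rb_trans[OF rb_trans[OF rbI[OF cf(1)] l(1)] rbI[OF f(1)]]) auto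
    moreover have "served \<sigma> ((x, f) # gs) s3"
      using f same_sets(9)[OF cf(4)] sv(3) same_sets(9)[OF f(4)] shrinks_trans unfolding served_def by blast
    moreover have "Phi s3 = Phi s2" using same_sets(8)[OF f(4)] .
    ultimately show ?case using l(3-5) P1
      by - (rule exI[of _ s3], rule exI[of _ "1 + r + 1"], rule exI[of _ "1 + m + 1"], simp)
qed


definition IHb where
  "IHb b \<longleftrightarrow> (\<forall>\<sigma> w p K l gs. Phi \<sigma> < b \<longrightarrow> Inv {} \<sigma> ((w, Hub p K l) # gs) \<longrightarrow> solo \<sigma> w Pre \<longrightarrow> loops \<sigma> w p K gs)"

lemma Ar_ge: "8 * kap + Lr + 23 \<le> Ar" and Am_ge: "(12 * W + 1) * (kap + 2) + Lm + 2 * W + 4 \<le> Am"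
  by (simp_all add: Ar_def Am_def)

text \<open>After the return the caller starts over at the same level with its full budget: the fall
  of \<open>Phi\<close> has paid for the call and for the attempt that led to it.\<close>

lemma call_case:
  assumes IH: "IHb (Phi \<sigma>)" and r0: "rch (\<sigma>, none) (s1, many w {v} (Call K)) r0 m0" "r0 \<le> 8" "m0 \<le> 12 * W + 1"
    and s1: "quiet s1" "Inv {} s1 ((w, Hub p K l) # gs)" "Phi s1 = Phi \<sigma>" "shrinks \<sigma> s1"
    and v: "callable K s1 v d" "d \<le> 2" "v \<in> N w"
  shows "loops \<sigma> w p K gs"
proof -
  have Kk: "K \<le> kap" using s1(2) by (simp add: Inv_def bounded_def)
  have wv: "w \<in> N v" using v(3) Nsym by blast
  obtain s2 r m where l: "rb (s1, many w {v} (Call K)) (s2, many v {w} Ret) r m" "served s1 ((w, Hub p K l) # gs) s2"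
    "Phi s2 < Phi s1" "r + Ar * Phi s2 + Ar \<le> Ar * Phi s1 + (8 * kap + 8 + Lr + 2 + 2 * d)"
    "m + Am * Phi s2 + Am \<le> Am * Phi s1 + ((12 * W + 1) * (kap + 1) + Lm + 2 * W + 2 * d)"
    using call_return[OF _ v(1) s1(1,2) wv, of "Phi \<sigma>"] IH Kk s1(3) unfolding IHb_def by (metis le_neq_implies_less order_refl)
  have sv: "Inv {} s2 ((w, Hub p K l) # gs)" "quiet s2" "shrinks s1 s2" using l(2) by (auto simp: served_def)
  define s3 where "s3 = s2(w := (s2 w)\<lparr>ctl := Pre\<rparr>)"
  note f = ret_hub[OF sv(2,1), folded s3_def]
  note sm = same_sets(8,9)[OF f(4)]
  have "loops s3 w p K gs" using IH f l(3) s1(3) unfolding IHb_def sm(1)[symmetric] by metis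
  then obtain s4 r' m' where e: "rb (s3, none) (s4, many w (set_option p) Ret) r' m'" "served s3 gs s4"
    "Phi s4 \<le> Phi s3" "r' + Ar * Phi s4 \<le> Ar * Phi s3 + (8 * (kap - K) + 8 + Lr)"
    "m' + Am * Phi s4 \<le> Am * Phi s3 + ((12 * W + 1) * (kap - K) + 12 * W + 1 + Lm)"
    unfolding loops_def by blast
  have "rb (\<sigma>, none) (s4, many w (set_option p) Ret) (r0 + r + 1 + r') (m0 + m + 0 + m')"
    by (rule rb_trans[OF rb_trans[OF rb_trans[OF rbI[OF r0(1)] l(1)] rbI[OF f(1)]] e(1)]) auto
  moreover have "served \<sigma> gs s4" using e(2) s1(4) sv(3) sm(2) shrinks_trans unfolding served_def by blast
  moreover have "Phi s4 \<le> Phi \<sigma>" using e(3) l(3) s1(3) sm(1) by simp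
  moreover have "r0 + r + 1 + r' + Ar * Phi s4 \<le> Ar * Phi \<sigma> + (8 * (kap - K) + 8 + Lr)"
    using e(4) l(4) r0(2) v(2) Ar_ge unfolding sm(1) s1(3) by linarith
  moreover have "m0 + m + 0 + m' + Am * Phi s4 \<le> Am * Phi \<sigma> + ((12 * W + 1) * (kap - K) + 12 * W + 1 + Lm)"
  proof -
    have "(12 * W + 1) * (kap + 2) = (12 * W + 1) * (kap + 1) + 12 * W + 1" by simp
    then show ?thesis using e(5) l(5) r0(3) v(2) Am_ge unfolding sm(1) s1(3) by linarith
  qed
  ultimately show ?thesis unfolding loops_def by blast
qed

lemma raise_loop:
  assumes r0: "rch (\<sigma>, none) (s1, none) r0 m0" "r0 \<le> 8" "m0 \<le> 12 * W"
    and s1: "loops s1 w p (Suc K) gs" "Phi s1 = Phi \<sigma>" "shrinks \<sigma> s1" and K: "K < kap"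
  shows "loops \<sigma> w p K gs"
proof -
  obtain s4 r' m' where e: "rb (s1, none) (s4, many w (set_option p) Ret) r' m'" "served s1 gs s4"
    "Phi s4 \<le> Phi s1" "r' + Ar * Phi s4 \<le> Ar * Phi s1 + (8 * (kap - Suc K) + 8 + Lr)"
    "m' + Am * Phi s4 \<le> Am * Phi s1 + ((12 * W + 1) * (kap - Suc K) + 12 * W + 1 + Lm)"
    using s1(1) unfolding loops_def by blast
  have k: "kap - K = Suc (kap - Suc K)" using K by simp
  have "rb (\<sigma>, none) (s4, many w (set_option p) Ret) (r0 + r') (m0 + m')"
    by (rule rb_trans[OF rbI[OF r0(1)] e(1)]) auto
  moreover have "served \<sigma> gs s4" using e(2) s1(3) shrinks_trans unfolding served_def by blast
  moreover have "r0 + r' + Ar * Phi s4 \<le> Ar * Phi \<sigma> + (8 * (kap - K) + 8 + Lr)"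
    unfolding k using e(4) r0(2) s1(2) by simp
  moreover have "m0 + m' + Am * Phi s4 \<le> Am * Phi \<sigma> + ((12 * W + 1) * (kap - K) + 12 * W + 1 + Lm)"
    unfolding k using e(5) r0(3) s1(2) by simp
  ultimately show ?thesis using e(3) s1(2) unfolding loops_def by metis
qed

lemma level_Inv:
  assumes i: "Inv X \<sigma> ((w, Hub p K l) # gs)" and K: "K < kap"
  shows "Inv X (\<sigma>(w := (\<sigma> w)\<lparr>ctl := x, stk := Hub p (Suc K) l # tl (stk (\<sigma> w))\<rparr>)) ((w, Hub p (Suc K) l) # gs)"
proof (rule same_Inv[OF _ i])
  show "same \<sigma> (\<sigma>(w := (\<sigma> w)\<lparr>ctl := x, stk := Hub p (Suc K) l # tl (stk (\<sigma> w))\<rparr>))" by (simp add: same_def)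
  have g: "stacks \<sigma> ((w, Hub p K l) # gs)" "bounded ((w, Hub p K l) # gs)" "linked ((w, Hub p K l) # gs)"
    using i by (auto simp: Inv_def)
  show "stacks (\<sigma>(w := (\<sigma> w)\<lparr>ctl := x, stk := Hub p (Suc K) l # tl (stk (\<sigma> w))\<rparr>)) ((w, Hub p (Suc K) l) # gs)"
    using g(1) by (auto simp: stacks_def)
  show "bounded ((w, Hub p (Suc K) l) # gs)" using g(2) K by (auto simp: bounded_def)
  show "linked ((w, Hub p (Suc K) l) # gs)" using g(3) by (cases gs) auto
qed (simp_all add: Z1_Hub PL_Hub)

lemma query_loop:
  assumes IH: "IHb (Phi \<sigma>)" and up: "\<And>s1. K < kap \<Longrightarrow> Phi s1 = Phi \<sigma> \<Longrightarrow> Inv {} s1 ((w, Hub p (Suc K) l) # gs) \<Longrightarrow> solo s1 w Pre \<Longrightarrow> loops s1 w p (Suc K) gs"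
    and i: "Inv {} \<sigma> ((w, Hub p K l) # gs)" and so: "solo \<sigma> w Pre" and fw: "fit K (N w) (\<sigma> w)"
  shows "loops \<sigma> w p K gs"
proof -
  define s0 where "s0 = \<sigma>(w := (\<sigma> w)\<lparr>ctl := Top 0 (Query K) 0\<rparr>)"
  have st: "step c n w (N w) (\<lambda>_. None) (\<sigma> w) = ((\<sigma> w)\<lparr>ctl := Top 0 (Query K) 0\<rparr>, \<lambda>_. None)"
    using so stk_hd[OF i] fw by (simp add: step_def Let_def solo_def pre_step_def fit_def)
  have r0: "rch (\<sigma>, none) (s0, none) 1 0" unfolding s0_def by (rule solo_silent[OF so _ st]) simp
  have k0: "keeps \<sigma> s0" unfolding s0_def by (rule keeps_ctl)
  have sm0: "same \<sigma> s0" using k0 by (simp add: keeps_def)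
  have so0: "solo s0 w (Top 0 (Query K) 0)" using so by (auto simp: solo_def s0_def)
  interpret Q: asking c n t E V kap s0 w K p l gs "{}"
    by unfold_locales (use keeps_Inv[OF k0 i] so0 fw in \<open>simp_all add: same_sets[OF sm0]\<close>)
  let ?f = "Q.R.fin"
  have Ph: "Phi ?f = Phi \<sigma>" using refresh_sets(5)[OF Q.fresh] same_sets(8)[OF sm0] by simp
  have sh: "shrinks \<sigma> ?f" using refresh_sets(6)[OF Q.fresh] same_sets(9)[OF sm0] shrinks_trans by blast
  have r1: "rch (\<sigma>, none) (?f, none) (1 + 6) (0 + 12 * W)" by (rule rch_trans[OF r0 Q.run])
  note so1 = Q.fin_solo and i1 = Q.inv
  have all: "Q.tot + con q w (N w) True (Query K) (?f w) = Q.all" by (simp add: Q.all_def)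
  obtain a b z where abz: "Q.all = (a, b, z)" by (cases Q.all) auto
  have de: "step c n w (N w) (\<lambda>_. None) (?f w) = decide q w (N w) (Query K) (a, b, z) (?f w)"
    using so1 all abz by (simp add: step_def Let_def solo_def)
  show ?thesis
  proof (cases "a > 0")
    case True
    then have al: "fst Q.all > 0" using abz by simp
    obtain d where d: "d \<le> 2" "callable K ?f (badc (?f w)) d" "badc (?f w) \<in> N w" using Q.bad_case[OF al] by blast
    define s1 where "s1 = ?f(w := (?f w)\<lparr>ctl := Idle\<rparr>)"
    have st1: "step c n w (N w) (\<lambda>_. None) (?f w) = ((?f w)\<lparr>ctl := Idle\<rparr>, to_set {badc (?f w)} (Call K))"
      unfolding de using True stk_hd[OF i1] by (simp add: decide_def)
    have r2: "rch (?f, none) (s1, many w {badc (?f w)} (Call K)) 1 (card {badc (?f w)})"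
      unfolding s1_def by (rule solo_step[OF so1 _ st1]) (use d mok_Call[OF Q.Kk] in auto)
    have k1: "keeps ?f s1" unfolding s1_def by (rule keeps_ctl)
    have sm1: "same ?f s1" using k1 by (simp add: keeps_def)
    have c1: "callable K s1 (badc (?f w)) d" by (rule callable_same[OF d(2) sm1]) (simp add: s1_def)
    have q1: "quiet s1" using so1 by (auto simp: quiet_def solo_def s1_def)
    show ?thesis
      by (rule call_case[OF IH rch_trans[OF r1 r2] _ _ q1 keeps_Inv[OF k1 i1] _ _ c1 d(1,3)])
        (use Ph sh same_sets(8,9)[OF sm1] shrinks_trans in auto)
  next
    case a0: False
    show ?thesis
    proof (cases "b > 0 \<or> z > 2 ^ K")
      case True
      have Kk: "K < kap" by (rule Q.raise_case) (use True a0 abz in auto)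
      define s1 where "s1 = ?f(w := (?f w)\<lparr>ctl := Pre, stk := Hub p (Suc K) l # tl (stk (?f w))\<rparr>)"
      have st1: "step c n w (N w) (\<lambda>_. None) (?f w) = ((?f w)\<lparr>ctl := Pre, stk := Hub p (Suc K) l # tl (stk (?f w))\<rparr>, \<lambda>_. None)"
        unfolding de using True a0 stk_hd[OF i1] by (auto simp: decide_def)
      have r2: "rch (?f, none) (s1, none) 1 0" unfolding s1_def by (rule solo_silent[OF so1 _ st1]) simp
      have i2: "Inv {} s1 ((w, Hub p (Suc K) l) # gs)" unfolding s1_def by (rule level_Inv[OF i1 Kk])
      have sm: "same ?f s1" by (simp add: same_def s1_def)
      note sm1 = same_sets(8,9)[OF sm]
      have "solo s1 w Pre" using so1 by (auto simp: solo_def s1_def)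
      then have lp: "loops s1 w p (Suc K) gs" using up[OF Kk _ i2] sm1 Ph by simp
      show ?thesis
        by (rule raise_loop[OF rch_trans[OF r1 r2] _ _ lp _ _ Kk]) (use Ph sh sm1 shrinks_trans in auto)
    next
      case False
      have cg: "fst Q.all = 0" "fst (snd Q.all) = 0" and z: "z \<le> 2 ^ K" using False a0 abz by auto
      have z2: "z = card (uncs ?f w)" using Q.good_count[OF cg] abz by simp
      have sp: "sphere ?f w = sphere s0 w" by (simp add: sphere_def Q.fr)
      have ph: "phs {} gs K p l ?f w" unfolding phs_def
      proof (intro conjI)
        show "Inv {} ?f ((w, Hub p K l) # gs)" by (rule i1)
        show "clean K l ?f w" by (rule Q.good_clean[OF cg])
        show "\<forall>z\<in>sphere ?f w. kids (?f z) \<subseteq> hn (N z) (?f z)" using Q.good_kids(1)[OF cg] unfolding sp by (simp add: Q.fr)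
        show "(\<Union>z\<in>sphere ?f w. kids (?f z)) = ball ?f w - insert w (sphere ?f w)" using Q.good_kids(2)[OF cg] unfolding sp by simp
        show "card (uncs ?f w) \<le> 2 ^ K" using z z2 by simp
      qed
      have "Q.tot + con q w (N w) True (Query K) (?f w) = (0, 0, card (uncs ?f w))"
        unfolding all using cg abz z2 by simp
      then have pq: "PQ gs K p l ?f w" unfolding PQ_def using ph so1 Q.good_kids(3)[OF cg] by blast
      have wV: "w \<in> V" using i by (auto simp: Inv_def bounded_def)
      have un: "uncs ?f w \<subseteq> V" using ball_V[OF wV] by (auto simp: uncs_def)
      have j0: "0 < jm" by (simp add: jm_def)
      obtain s2 where s2: "rb (?f, none) (s2, many w (set_option p) Ret) (jm * lr + 1) (jm * lm + 1)" "Inv {} s2 gs"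
        "quiet s2" "Phi s2 = Phi ?f" "shrinks ?f s2"
        using luby_run[OF pq, of jm] jm_enough[OF un] j0 by blast
      have "rb (\<sigma>, none) (s2, many w (set_option p) Ret) (1 + 6 + (jm * lr + 1)) (0 + 12 * W + (jm * lm + 1))"
        by (rule rb_trans[OF rbI[OF r1] s2(1)]) auto
      moreover have "served \<sigma> gs s2" using s2 sh shrinks_trans unfolding served_def by blast
      moreover have "1 + 6 + (jm * lr + 1) + Ar * Phi s2 \<le> Ar * Phi \<sigma> + (8 * (kap - K) + 8 + Lr)"
        using s2(4) Ph by (simp add: Lr_def)
      moreover have "0 + 12 * W + (jm * lm + 1) + Am * Phi s2 \<le> Am * Phi \<sigma> + ((12 * W + 1) * (kap - K) + 12 * W + 1 + Lm)"
        using s2(4) Ph by (simp add: Lm_def)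
      moreover have "Phi s2 \<le> Phi \<sigma>" using s2(4) Ph by simp
      ultimately show ?thesis unfolding loops_def by blast
    qed
  qed
qed

lemma hub_loop:
  assumes "Inv {} \<sigma> ((w, Hub p K l) # gs)" "solo \<sigma> w Pre"
  shows "loops \<sigma> w p K gs"
  using assms
\<comment> \<open>The lexicographic order on \<open>Phi\<close> and the number of levels left, coded
  as one number: a call lowers the former, and raising the level lowers the latter.\<close>
proof (induction "Phi \<sigma> * (kap + 1) + (kap - K)" arbitrary: \<sigma> w p K l gs rule: less_induct)
  case less
  note i = less.prems(1) and so = less.prems(2)
  have g: "hv_exact \<sigma>" using i by (simp add: Inv_def)
  have Kk: "K \<le> kap" using i by (simp add: Inv_def bounded_def)
  have IH: "IHb (Phi \<sigma>)" unfolding IHb_def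
  proof (intro allI impI)
    fix \<sigma>' w' p' K' l' gs'
    assume a: "Phi \<sigma>' < Phi \<sigma>" "Inv {} \<sigma>' ((w', Hub p' K' l') # gs')" "solo \<sigma>' w' Pre"
    have "Phi \<sigma>' * (kap + 1) + (kap - K') < Suc (Phi \<sigma>') * (kap + 1)" by simp
    also have "Suc (Phi \<sigma>') * (kap + 1) \<le> Phi \<sigma> * (kap + 1)" by (rule mult_right_mono) (use a in auto)
    finally show "loops \<sigma>' w' p' K' gs'" by (intro less.hyps[OF _ a(2,3)]) simp
  qed
  have up: "loops s1 w p (Suc K) gs" if "K < kap" "Phi s1 = Phi \<sigma>" "Inv {} s1 ((w, Hub p (Suc K) l) # gs)" "solo s1 w Pre" for s1
    by (rule less.hyps[OF _ that(3,4)]) (use that in simp)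
  consider "lows K (N w) (\<sigma> w) \<noteq> {}" | "lows K (N w) (\<sigma> w) = {}" "over K (N w) (\<sigma> w)" | "fit K (N w) (\<sigma> w)"
    by (auto simp: fit_def)
  then show ?case
  proof cases
    case 1
    define v where "v = (LEAST u. u \<in> lows K (N w) (\<sigma> w))"
    have "v \<in> lows K (N w) (\<sigma> w)" unfolding v_def by (rule LeastI_ex) (use 1 in auto)
    then have v: "v \<in> N w" "heavy (\<sigma> v)" "pd (\<sigma> v) \<le> 4 ^ K" unfolding lows_eq[OF g] by auto
    define s1 where "s1 = \<sigma>(w := (\<sigma> w)\<lparr>ctl := Idle\<rparr>)"
    have st1: "step c n w (N w) (\<lambda>_. None) (\<sigma> w) = ((\<sigma> w)\<lparr>ctl := Idle\<rparr>, to_set {v} (Call K))"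
      using 1 so stk_hd[OF i] by (simp add: step_def Let_def solo_def pre_step_def v_def)
    have r2: "rch (\<sigma>, none) (s1, many w {v} (Call K)) 1 (card {v})"
      unfolding s1_def by (rule solo_step[OF so _ st1]) (use v mok_Call[OF Kk] in auto)
    have k1: "keeps \<sigma> s1" unfolding s1_def by (rule keeps_ctl)
    have sm1: "same \<sigma> s1" using k1 by (simp add: keeps_def)
    have c1: "callable K s1 v 0" by (rule callable.base) (use v NV in \<open>auto simp: same_sel[OF sm1]\<close>)
    have q1: "quiet s1" using so by (auto simp: quiet_def solo_def s1_def)
    show ?thesis
      by (rule call_case[OF IH r2 _ _ q1 keeps_Inv[OF k1 i] _ _ c1 _ v(1)]) (use same_sets(8,9)[OF sm1] in auto)
  next
    case 2
    have Kk: "K < kap" by (rule over_kap[OF i 2(2,1)])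
    define s1 where "s1 = \<sigma>(w := (\<sigma> w)\<lparr>ctl := Pre, stk := Hub p (Suc K) l # tl (stk (\<sigma> w))\<rparr>)"
    have "(\<sigma> w)\<lparr>ctl := Pre, stk := X\<rparr> = (\<sigma> w)\<lparr>stk := X\<rparr>" for X using so by (simp add: solo_def)
    then have st1: "step c n w (N w) (\<lambda>_. None) (\<sigma> w) = ((\<sigma> w)\<lparr>ctl := Pre, stk := Hub p (Suc K) l # tl (stk (\<sigma> w))\<rparr>, \<lambda>_. None)"
      using so 2 stk_hd[OF i] by (simp add: step_def Let_def solo_def pre_step_def)
    have r2: "rch (\<sigma>, none) (s1, none) 1 0" unfolding s1_def by (rule solo_silent[OF so _ st1]) simp
    have i2: "Inv {} s1 ((w, Hub p (Suc K) l) # gs)" unfolding s1_def by (rule level_Inv[OF i Kk])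
    have sm: "same \<sigma> s1" by (simp add: same_def s1_def)
    have "solo s1 w Pre" using so by (auto simp: solo_def s1_def)
    then have lp: "loops s1 w p (Suc K) gs" using up[OF Kk _ i2] same_sets(8)[OF sm] by simp
    show ?thesis by (rule raise_loop[OF r2 _ _ lp _ _ Kk]) (use same_sets(8,9)[OF sm] in auto)
  next
    case 3
    show ?thesis by (rule query_loop[OF IH up i so 3])
  qed
qed

end

section \<open>Updates\<close>

lemma idle_stats:
  assumes "\<And>u m. bx u = Some m \<Longrightarrow> \<exists>h i p r. m = Stat h i p r"
  shows "idle_step q v M bx s = (s, reply bx s)"
proof -
  have "bx u \<noteq> Some Ret" "bx u \<noteq> Some (Call K)" "bx u \<noteq> Some Start" "bx u \<noteq> Some (Cmd1 k)" "bx u \<noteq> Some (Cmd2 k)" for u k K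
    using assms[of u] by auto
  then show ?thesis by (simp add: idle_step_def)
qed

lemma reply_stats: "(\<And>u m. bx u = Some m \<Longrightarrow> \<exists>h i p. m = Stat h i p False) \<Longrightarrow> reply bx s = (\<lambda>_. None)"
  unfolding reply_def by (rule ext) (fastforce split: option.splits)

context proto
begin

text \<open>The invariant for an empty stack in resolved form: every view that matters is exact and
  every vertex outside the set has a cover of the admissible kind. The next update starts from these
  facts.\<close>

definition rest :: "world \<Rightarrow> bool" where
  "rest \<sigma> \<longleftrightarrow> (\<forall>v. ctl (\<sigma> v) = Idle \<and> stk (\<sigma> v) = []) \<and> hv_exact \<sigma> \<and>
     (\<forall>v\<in>V. \<forall>u\<in>N v. heavy (\<sigma> v) \<or> \<not> heavy (\<sigma> u) \<longrightarrow> (u \<in> mv (\<sigma> v) \<longleftrightarrow> inm (\<sigma> u))) \<and> indep \<sigma> \<and>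
     (\<forall>v\<in>V. \<not> inm (\<sigma> v) \<longrightarrow> (\<exists>u\<in>N v. inm (\<sigma> u) \<and> (heavy (\<sigma> v) \<or> \<not> heavy (\<sigma> u)))) \<and> degrees \<sigma>"

lemma rest_Inv:
  assumes i: "Inv {} \<sigma> []" and q: "quiet \<sigma>"
  shows "rest \<sigma>"
proof -
  have g: "hv_exact \<sigma>" "mv_light \<sigma>" "mv_heavy \<sigma>" "indep \<sigma>" "light_cov {} \<sigma> []" "heavy_cov {} \<sigma> []" "stale \<sigma> []" "degrees \<sigma>" "stacks \<sigma> []"
    using i by (auto simp: Inv_def)
  have e: "u \<in> mv (\<sigma> v) \<longleftrightarrow> inm (\<sigma> u)" if "v \<in> V" "u \<in> N v" "heavy (\<sigma> v) \<or> \<not> heavy (\<sigma> u)" for u v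
    
  proof (cases "heavy (\<sigma> u)")
    case True
    have "inm (\<sigma> u) \<longrightarrow> u \<in> mv (\<sigma> v)" using that g(3) True by (simp add: mv_heavy_def)
    moreover have "u \<in> mv (\<sigma> v) \<longrightarrow> inm (\<sigma> u)" using that g(7) True by (fastforce simp: stale_def Z1_def)
    ultimately show ?thesis by blast
  next
    case False
    then show ?thesis using that g(2) by (simp add: mv_light_def)
  qed
  have "\<exists>u\<in>N v. inm (\<sigma> u) \<and> (heavy (\<sigma> v) \<or> \<not> heavy (\<sigma> u))" if v: "v \<in> V" "\<not> inm (\<sigma> v)" for v
  proof (cases "heavy (\<sigma> v)")
    case True
    have "\<not> unc (N v) (\<sigma> v)" using g(6) v by (auto simp: heavy_cov_def Z2_def Z1_def)
    then obtain u where "u \<in> N v" "u \<in> mv (\<sigma> v)" using True v by (auto simp: unc_def)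
    then show ?thesis using e v True by blast
  next
    case False
    have "\<not> lunc (N v) (\<sigma> v)" using g(5) v by (auto simp: light_cov_def PL_def)
    then show ?thesis using False v lcov_eq[OF g(1,2) v(1)] by (auto simp: lunc_def)
  qed
  then show ?thesis using g q e by (auto simp: rest_def quiet_def stacks_def)
qed

lemma rest_MIS:
  assumes "rest \<sigma>"
  shows "is_MIS V E {v \<in> V. inm (\<sigma> v)}"
proof -
  have g: "indep \<sigma>" and m: "\<And>v. v \<in> V \<Longrightarrow> \<not> inm (\<sigma> v) \<Longrightarrow> \<exists>u\<in>N v. inm (\<sigma> u)" using assms by (auto simp: rest_def)
  have "\<not> (\<exists>T. T \<subseteq> V \<and> independent E T \<and> {v \<in> V. inm (\<sigma> v)} \<subset> T)"
  proof
    assume "\<exists>T. T \<subseteq> V \<and> independent E T \<and> {v \<in> V. inm (\<sigma> v)} \<subset> T"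
    then obtain T x where T: "T \<subseteq> V" "independent E T" "{v \<in> V. inm (\<sigma> v)} \<subseteq> T" "x \<in> T" "\<not> inm (\<sigma> x)" by blast
    then obtain u where "u \<in> N x" "inm (\<sigma> u)" using m by blast
    moreover from this have "u \<in> T" using T NV by blast
    ultimately show False using T by (auto simp: independent_def nbrs_def)
  qed
  then show ?thesis using g by (auto simp: is_MIS_def independent_def indep_def nbrs_def)
qed

text \<open>A heavy vertex publishes its degree when the degree has doubled or halved; the cost of telling all
  neighbours is paid for by the drift accumulated since the last time.\<close>

definition drift :: "world \<Rightarrow> vertex \<Rightarrow> nat" where
  "drift \<sigma> x = (if heavy (\<sigma> x) then (card (N x) - pd (\<sigma> x)) + (pd (\<sigma> x) - card (N x)) else 0)"

definition Psi :: "world \<Rightarrow> nat" where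
  "Psi \<sigma> = (\<Sum>x\<in>V. drift \<sigma> x)"

lemma Psi_shrinks: "shrinks \<sigma> \<sigma>' \<Longrightarrow> Psi \<sigma>' \<le> Psi \<sigma>"
  unfolding Psi_def by (rule sum_mono) (auto simp: drift_def shrinks_def)

end

text \<open>Two instances of the protocol, for the graphs before and after the update. The world
  \<open>\<sigma>\<close> is at rest with respect to the old graph.\<close>

locale change = arena c n t E V kap + old: proto c n t E0 V kap
  for c n t :: nat and E V kap E0 +
  fixes \<sigma> :: world
  assumes rst: "old.rest \<sigma>"
begin

text \<open>The \<open>6 * Ar\<close> consist of the four units by which an insertion may raise
  \<open>Phi\<close> and of one hub loop for each endpoint. \<open>Psi\<close> has weight two
  because a degree that has doubled exceeds the published one by only half of its size.\<close>

definition handled :: "edge_update \<Rightarrow> bool" where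
  "handled x \<longleftrightarrow> (\<exists>\<sigma>' r m k. mis.small (5 * (2 * t + 1)) (mis.a_first n E x \<sigma>) \<and> mis.msgs (mis.a_first n E x \<sigma>) \<le> k \<and>
     rb (mis.a_first n E x \<sigma>) (\<sigma>', none) r m \<and> rest \<sigma>' \<and>
     r + Ar * Phi \<sigma>' \<le> Ar * Phi \<sigma> + (6 * Ar + 4) \<and>
     k + m + Am * Phi \<sigma>' + 2 * Psi \<sigma>' \<le> Am * Phi \<sigma> + 2 * old.Psi \<sigma> + (6 * Am + 8 * W + 8))"

lemma loop_cost: "8 * (kap - K) + 8 + Lr \<le> Ar" "(12 * W + 1) * (kap - K) + 12 * W + 1 + Lm \<le> Am"
proof -
  have "(12 * W + 1) * (kap - K) + 12 * W + 1 = (12 * W + 1) * (kap - K + 1)" by simp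
  also have "\<dots> \<le> (12 * W + 1) * (kap + 2)" by (rule mult_left_mono) auto
  finally show "(12 * W + 1) * (kap - K) + 12 * W + 1 + Lm \<le> Am" by (simp add: Am_def)
qed (simp add: Ar_def)

lemma run_hub:
  assumes "Inv {} \<sigma>0 ((w, Hub p K l) # gs)" "solo \<sigma>0 w Pre"
  obtains s r m where "rb (\<sigma>0, none) (s, many w (set_option p) Ret) r m" "Inv {} s gs" "quiet s" "Psi s \<le> Psi \<sigma>0"
    "r + Ar * Phi s \<le> Ar * Phi \<sigma>0 + Ar" "m + Am * Phi s \<le> Am * Phi \<sigma>0 + Am"
proof -
  obtain s r m where a: "rb (\<sigma>0, none) (s, many w (set_option p) Ret) r m" "served \<sigma>0 gs s"
    "r + Ar * Phi s \<le> Ar * Phi \<sigma>0 + (8 * (kap - K) + 8 + Lr)"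
    "m + Am * Phi s \<le> Am * Phi \<sigma>0 + ((12 * W + 1) * (kap - K) + 12 * W + 1 + Lm)"
    using hub_loop[OF assms] unfolding loops_def by blast
  show thesis
    by (rule that[of s r m]) (use a loop_cost[of K] Psi_shrinks in \<open>unfold served_def, auto\<close>)
qed

lemma old_rest:
  "ctl (\<sigma> v) = Idle" "stk (\<sigma> v) = []"
  "y \<in> nbrs E0 x \<Longrightarrow> hv (\<sigma> x) y = (if heavy (\<sigma> y) then Some (pd (\<sigma> y)) else None)"
  "y \<in> nbrs E0 x \<Longrightarrow> heavy (\<sigma> x) \<or> \<not> heavy (\<sigma> y) \<Longrightarrow> y \<in> mv (\<sigma> x) \<longleftrightarrow> inm (\<sigma> y)"
  "y \<in> nbrs E0 x \<Longrightarrow> inm (\<sigma> y) \<Longrightarrow> \<not> inm (\<sigma> x)"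
  "x \<in> V \<Longrightarrow> \<not> inm (\<sigma> x) \<Longrightarrow> \<exists>y\<in>nbrs E0 x. inm (\<sigma> y) \<and> (heavy (\<sigma> x) \<or> \<not> heavy (\<sigma> y))"
  "x \<in> V \<Longrightarrow> heavy (\<sigma> x) \<Longrightarrow> card (nbrs E0 x) \<le> 2 * pd (\<sigma> x) \<and> pd (\<sigma> x) \<le> 2 * card (nbrs E0 x)"
  "x \<in> V \<Longrightarrow> \<not> heavy (\<sigma> x) \<Longrightarrow> card (nbrs E0 x) \<le> 2 * W"
  using rst old.NV unfolding old.rest_def old.hv_exact_def old.indep_def old.degrees_def by (auto split: if_splits)

end

section \<open>Insertion of an edge\<close>

locale insertion = change c n t E V kap E0 \<sigma> for c n t E V kap E0 \<sigma> +
  fixes u v :: vertex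
  assumes uv: "u < v" "u \<in> V" "v \<in> V" "{u, v} \<notin> E0" and EE: "E = insert {u, v} E0"
begin

abbreviation "N0 \<equiv> nbrs E0"

lemma N_cases: "N y = (if y = u then insert v (N0 u) else if y = v then insert u (N0 v) else N0 y)"
  using uv(1) by (auto simp: EE nbrs_def doubleton_eq_iff)

lemma N_other: "x \<in> N y \<Longrightarrow> x \<notin> {u, v} \<or> y \<notin> {u, v} \<Longrightarrow> x \<in> N0 y"
  by (auto simp: N_cases split: if_splits)

lemma card_N: "card (N y) = card (N0 y) + of_bool (y \<in> {u, v})"
proof -
  have "v \<notin> N0 u" "u \<notin> N0 v" using uv(4) by (auto simp: nbrs_def insert_commute)
  then show ?thesis using uv(1) by (simp add: N_cases)
qed

text \<open>\<open>D\<close> are the endpoints that turn heavy, \<open>P\<close> those that publish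
  their degree to all neighbours, and \<open>A\<close> the receivers of an endpoint's message. The
  worlds \<open>s1\<close> to \<open>s4\<close> are those after the four rounds that precede the
  first hub loop.\<close>

definition "D = {x \<in> {u, v}. \<not> heavy (\<sigma> x)}"
definition "P = {x \<in> {u, v}. \<not> heavy (\<sigma> x) \<or> 2 * pd (\<sigma> x) \<le> card (N x)}"
definition "A x = (if x \<in> P then N x else if x \<in> {u, v} then {u, v} - {x} else {})"
definition "s1 y = (if y \<in> {u, v} then (\<sigma> y)\<lparr>heavy := True, inm := inm (\<sigma> y) \<and> y \<notin> D,
    pd := if y \<in> P then card (N y) else pd (\<sigma> y), dem := y \<in> D, ctl := if y = u then InsW False v else Idle\<rparr> else \<sigma> y)"
definition "tr1 x y = (if y \<in> A x then Some (Stat True (inm (s1 x)) (pd (s1 x)) (x \<in> D)) else None)"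
definition "s2 y = (absorb (\<lambda>x. tr1 x y) (s1 y))\<lparr>ctl := if y = u then InsW True v else Idle\<rparr>"
definition "tr2 x y = (if y \<in> D \<and> x \<in> N y then Some (own_stat (s2 x) False) else None)"
definition "s3 y = (if y = u then (absorb (\<lambda>x. tr2 x y) (s2 y))\<lparr>ctl := Idle, stk := [Hub None 0 (u \<in> D)]\<rparr>
    else absorb (\<lambda>x. tr2 x y) (s2 y))"
definition "s4 = s3(v := (s3 v)\<lparr>stk := [Hub (Some u) 0 (v \<in> D)], ctl := Pre\<rparr>)"

lemma DP: "D \<subseteq> P" "P \<subseteq> {u, v}" by (auto simp: D_def P_def)

lemma A_N: "A x \<subseteq> N x"
  by (auto simp: A_def N_cases)

lemma s1_sel: "heavy (s1 y) = (heavy (\<sigma> y) \<or> y \<in> {u, v})" "inm (s1 y) = (inm (\<sigma> y) \<and> y \<notin> D)"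
  "pd (s1 y) = (if y \<in> P then card (N y) else pd (\<sigma> y))" "hv (s1 y) = hv (\<sigma> y)" "mv (s1 y) = mv (\<sigma> y)"
  "stk (s1 y) = []" "ctl (s1 y) = (if y = u then InsW False v else Idle)" "y \<in> {u, v} \<Longrightarrow> dem (s1 y) = (y \<in> D)"
  using DP old_rest(1,2) by (auto simp: s1_def)

lemma first: "mis.a_first n E (Insert u v) \<sigma> = (s1, tr1)"
proof -
  have b: "upd n x (N x) (Gained w) (\<sigma> x) = (s1 x, to_set (A x) (Stat True (inm (s1 x)) (pd (s1 x)) (x \<in> D)))"
    if "x = u \<and> w = v \<or> x = v \<and> w = u" for x w
  proof -
    have cw: "(if x < w then InsW False w else Idle) = (if x = u then InsW False v else Idle)" "x \<in> {u, v}" "{u, v} - {x} = {w}"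
      using that uv(1) by auto
    show ?thesis
    proof (cases "heavy (\<sigma> x)")
      case False
      then have "x \<in> D" "x \<in> P" using cw by (auto simp: D_def P_def)
      then show ?thesis using False cw by (simp add: upd_def s1_def A_def Let_def)
    next
      case True
      then have d: "x \<notin> D" by (simp add: D_def)
      have e: "s\<lparr>heavy := True\<rparr> = s" if "heavy s" for s :: lstate using that by (intro lstate.equality) auto
      show ?thesis
      proof (cases "2 * pd (\<sigma> x) \<le> card (N x)")
        case t: True
        then have "x \<in> P" using cw by (simp add: P_def)
        then show ?thesis using True d t cw by (simp add: upd_def s1_def A_def Let_def e)
      next
        case False
        then have "x \<notin> P" using True by (simp add: P_def)
        then show ?thesis using True d False cw by (simp add: upd_def s1_def A_def Let_def e own_stat_def)
      qed
    qed
  qed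
  have b1: "upd n u (N u) (Gained v) (\<sigma> u) = (s1 u, to_set (A u) (Stat True (inm (s1 u)) (pd (s1 u)) (u \<in> D)))"
    and b2: "upd n v (N v) (Gained u) (\<sigma> v) = (s1 v, to_set (A v) (Stat True (inm (s1 v)) (pd (s1 v)) (v \<in> D)))"
    by (rule b, simp)+
  have n1: "tr1 x y = None" if "x \<notin> {u, v}" for x y using that DP by (auto simp: tr1_def A_def)
  have n2: "tr1 x y = None" if "y \<notin> N x" for x y using that A_N by (auto simp: tr1_def)
  have tr: "to_set (A x) (Stat True (inm (s1 x)) (pd (s1 x)) (x \<in> D)) = tr1 x" for x
    by (simp add: fun_eq_iff to_set_def tr1_def)
  have ev: "event_at u (Insert u v) = Gained v" "event_at v (Insert u v) = Gained u" using uv(1) by auto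
  have "(\<lambda>y. if y \<in> endpoints (Insert u v) then fst (upd n y (N y) (event_at y (Insert u v)) (\<sigma> y)) else \<sigma> y) = s1"
  proof
    fix y
    show "(if y \<in> endpoints (Insert u v) then fst (upd n y (N y) (event_at y (Insert u v)) (\<sigma> y)) else \<sigma> y) = s1 y"
      using uv(1) ev b1 b2 by (cases "y = u"; cases "y = v") (simp_all add: s1_def)
  qed
  moreover have "(if x \<in> endpoints (Insert u v) \<and> w \<in> N x then snd (upd n x (N x) (event_at x (Insert u v)) (\<sigma> x)) w else None) = tr1 x w" for x w
  proof (cases "x \<in> {u, v} \<and> w \<in> N x")
    case True
    then have "snd (upd n x (N x) (event_at x (Insert u v)) (\<sigma> x)) = tr1 x" using ev b1 b2 tr by auto
    then show ?thesis using True by simp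
  next
    case False
    then show ?thesis using n1 n2 by auto
  qed
  ultimately show ?thesis unfolding mis.a_first_def by simp
qed


lemma stats1: "tr1 x y = Some m \<Longrightarrow> \<exists>h i p r. m = Stat h i p r" by (auto simp: tr1_def split: if_splits)
lemma stats2: "tr2 x y = Some m \<Longrightarrow> \<exists>h i p. m = Stat h i p False" by (auto simp: tr2_def own_stat_def split: if_splits)

lemma s2_sel: "heavy (s2 y) = heavy (s1 y)" "pd (s2 y) = pd (s1 y)" "dem (s2 y) = dem (s1 y)" "stk (s2 y) = []"
  "inm (s2 y) = (inm (s1 y) \<and> \<not> (y \<in> {u, v} \<and> inm (s1 u) \<and> inm (s1 v)))"
  "hv (s2 y) x = (if y \<in> A x then Some (pd (s1 x)) else hv (\<sigma> y) x)"
  "x \<in> mv (s2 y) \<longleftrightarrow> (if y \<in> A x then inm (s1 x) else x \<in> mv (\<sigma> y))"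
proof -
  show "inm (s2 y) = (inm (s1 y) \<and> \<not> (y \<in> {u, v} \<and> inm (s1 u) \<and> inm (s1 v)))"
  proof -
    have "inm (s2 y) = (inm (s1 y) \<and> \<not> (\<exists>x. y \<in> A x \<and> inm (s1 x)))"
      by (auto simp: s2_def absorb_def tr1_def)
    \<comment> \<open>Old neighbours are independent, so a conflict can arise only across the new
      edge; in that case both endpoints leave the set.\<close>
    moreover have "y \<in> {u, v} \<and> inm (s1 u) \<and> inm (s1 v)" if a: "inm (s1 y)" "y \<in> A x" "inm (s1 x)" for x
    proof -
      have xy: "x \<in> {u, v}" "y \<in> N x" using a(2) A_N DP(2) by (fastforce simp: A_def split: if_splits, blast)
      have "y \<notin> N0 x" using old_rest(5)[of y x] a(1,3) by (auto simp: s1_sel(2))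
      then have "y \<in> {u, v}" using N_other[OF xy(2)] by auto
      moreover have "x \<noteq> y" using xy by auto
      ultimately show ?thesis using xy a by auto
    qed
    moreover have "\<exists>x. y \<in> A x \<and> inm (s1 x)" if "y \<in> {u, v}" "inm (s1 u)" "inm (s1 v)"
    proof -
      have "v \<in> A u" "u \<in> A v" using uv(1) by (auto simp: A_def N_cases)
      then show ?thesis using that by auto
    qed
    ultimately show ?thesis by blast
  qed
qed (auto simp: s2_def s1_sel absorb_def tr1_def)

lemma s3_sel: "heavy (s3 y) = heavy (s1 y)" "pd (s3 y) = pd (s1 y)" "inm (s3 y) = inm (s2 y)"
  "hv (s3 y) x = (if y \<in> D \<and> x \<in> N y then (if heavy (s1 x) then Some (pd (s1 x)) else None) else hv (s2 y) x)"
  "x \<in> mv (s3 y) \<longleftrightarrow> (if y \<in> D \<and> x \<in> N y then inm (s2 x) else x \<in> mv (s2 y))"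
  "stk (s3 y) = (if y = u then [Hub None 0 (u \<in> D)] else [])" "ctl (s3 y) = Idle" "dem (s3 v) = (v \<in> D)"
proof -
  have "inm (s3 y) = (inm (s2 y) \<and> \<not> (\<exists>x. y \<in> D \<and> x \<in> N y \<and> inm (s2 x)))"
    by (auto simp: s3_def absorb_def tr2_def own_stat_def)
  then show "inm (s3 y) = inm (s2 y)" by (auto simp: s2_sel s1_sel)
qed (use uv(1) in \<open>auto simp: s3_def s2_sel s1_sel s2_def absorb_def tr2_def own_stat_def\<close>)

lemma s4_sel: "heavy (s4 y) = (heavy (\<sigma> y) \<or> y \<in> {u, v})" "pd (s4 y) = pd (s1 y)" "inm (s4 y) = inm (s2 y)"
  "hv (s4 y) = hv (s3 y)" "mv (s4 y) = mv (s3 y)"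
  "stk (s4 y) = (if y = u then [Hub None 0 (u \<in> D)] else if y = v then [Hub (Some u) 0 (v \<in> D)] else [])"
  "ctl (s4 y) = (if y = v then Pre else Idle)"
  using uv(1) by (auto simp: s4_def s3_sel s1_sel)

lemma hv_exact_s4: "hv_exact s4" unfolding hv_exact_def
proof (intro ballI)
  fix y x assume a: "y \<in> V" "x \<in> N y"
  have "heavy (s1 x)" if "y \<in> A x" using that DP by (auto simp: A_def s1_sel split: if_splits)
  moreover have "hv (\<sigma> y) x = (if heavy (s1 x) then Some (pd (s1 x)) else None)" if na: "y \<notin> A x"
  proof -
    have xy: "y \<in> N x" using a Nsym by blast
    then have "x \<notin> P" using na by (auto simp: A_def)
    moreover have "x \<in> {u, v} \<Longrightarrow> y \<notin> {u, v}" using na xy \<open>x \<notin> P\<close> by (auto simp: A_def)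
    ultimately have o: "x \<notin> {u, v} \<or> y \<notin> {u, v}" by blast
    have "heavy (s1 x) = heavy (\<sigma> x)" "pd (s1 x) = pd (\<sigma> x)" using \<open>x \<notin> P\<close> by (auto simp: s1_sel P_def)
    then show ?thesis using old_rest(3)[OF N_other[OF a(2) o]] by simp
  qed
  ultimately show "hv (s4 y) x = (if heavy (s4 x) then Some (pd (s4 x)) else None)"
    unfolding s4_sel(1,2,4) s3_sel s2_sel(6) s1_sel(1)[symmetric] by auto
qed

lemma exact1:
  assumes "x \<in> N y" "x \<notin> {u, v}" "heavy (s4 y) \<or> \<not> heavy (s4 x)"
  shows "x \<in> mv (s4 y) \<longleftrightarrow> inm (s4 x)"
proof (cases "y \<in> D")
  case True
  then show ?thesis using assms by (simp add: s4_sel s3_sel)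
next
  case False
  have "A x = {}" using assms(2) DP by (auto simp: A_def)
  moreover have "heavy (\<sigma> y) \<or> \<not> heavy (\<sigma> x)" using assms(2,3) False by (auto simp: s4_sel D_def)
  moreover have "inm (s4 x) = inm (\<sigma> x)" using assms(2) DP by (auto simp: s4_sel s2_sel s1_sel)
  ultimately show ?thesis using old_rest(4)[OF N_other[OF assms(1)]] assms(2) False by (simp add: s4_sel s3_sel s2_sel)
qed

lemma exact2:
  assumes "x \<in> N y" "x \<in> {u, v}" "heavy (s4 y)" "inm (s4 x)"
  shows "x \<in> mv (s4 y)"
proof (cases "y \<in> D \<or> y \<in> A x")
  case True
  then show ?thesis using assms by (auto simp: s4_sel s3_sel s2_sel)
next
  case False
  have xy: "y \<in> N x" using assms(1) Nsym by blast
  then have "x \<notin> P" using False by (auto simp: A_def)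
  then have y: "y \<notin> {u, v}" using False xy assms(2) by (auto simp: A_def)
  then have "heavy (\<sigma> y)" "x \<in> N0 y" using assms(1,3) N_other by (auto simp: s4_sel)
  then have "x \<in> mv (\<sigma> y)" using old_rest(4)[of x y] assms(4) by (simp add: s4_sel s2_sel s1_sel)
  then show ?thesis using False by (simp add: s4_sel s3_sel s2_sel)
qed

text \<open>The larger endpoint works first and returns to the smaller one. A flag records that the
  vertex was light before, so that light neighbours may have lost their cover.\<close>

definition "gs4 = [(v, Hub (Some u) 0 (v \<in> D)), (u, Hub None 0 (u \<in> D))]"

lemma Z4: "{u, v} \<subseteq> Z1 gs4" "x \<in> {u, v} \<Longrightarrow> N x \<subseteq> Z1 gs4" "PL gs4 = (\<Union>x\<in>D. N x)"
proof -
  have D: "D = (if u \<in> D then {u} else {}) \<union> (if v \<in> D then {v} else {})" by (auto simp: D_def)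
  show "PL gs4 = (\<Union>x\<in>D. N x)" by (subst D) (auto simp: gs4_def PL_Hub PL_def)
qed (auto simp: gs4_def Z1_Hub)

lemma small_N: "x \<in> D \<Longrightarrow> card (N x) \<le> 2 * W + 1"
  using uv old_rest(8)[of x] by (auto simp: card_N D_def)

lemma light_old: "\<not> heavy (s4 y) \<Longrightarrow> \<not> heavy (\<sigma> y) \<and> y \<notin> {u, v}" by (simp add: s4_sel)

lemma inm_old: "y \<notin> {u, v} \<Longrightarrow> inm (s4 y) = inm (\<sigma> y)" using DP by (auto simp: s4_sel s2_sel s1_sel)

lemma inm_mono: "inm (s4 y) \<Longrightarrow> inm (\<sigma> y)" by (simp add: s4_sel s2_sel s1_sel)

text \<open>Only the endpoints can leave the set, which harms only their neighbours: light ones if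
  the endpoint was light, and then its flag accounts for them, and heavy ones, which lie in
  \<open>Z1\<close>.\<close>

lemma Inv4: "Inv {} s4 gs4"
proof -
  have 2: "mv_light s4" unfolding mv_light_def using exact1 light_old by blast
  have 3: "mv_heavy s4" unfolding mv_heavy_def using exact1 exact2 by blast
  have 4: "indep s4" unfolding indep_def
  proof (intro allI ballI notI)
    fix y x assume a: "x \<in> N y" "inm (s4 x) \<and> inm (s4 y)"
    then have "x \<in> N0 y" using N_other[OF a(1)] by (auto simp: s4_sel s2_sel N_cases split: if_splits)
    then show False using old_rest(5)[of x y] a inm_mono by blast
  qed
  have 5: "light_cov {} s4 gs4" unfolding light_cov_def
  proof (intro ballI impI)
    fix y assume y: "y \<in> V" "lunc (N y) (s4 y)"
    then have l: "\<not> heavy (\<sigma> y)" "y \<notin> {u, v}" "\<not> inm (\<sigma> y)"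
      using light_old[of y] inm_old[of y] by (auto simp: lunc_def)
    obtain x where x: "x \<in> N0 y" "inm (\<sigma> x)" "\<not> heavy (\<sigma> x)" using old_rest(6)[OF y(1) l(3)] l(1) by blast
    have xN: "x \<in> N y" using x(1) l(2) by (auto simp: N_cases)
    have "\<not> (\<not> heavy (s4 x) \<and> inm (s4 x))"
      using y xN lcov_eq[OF hv_exact_s4 2 y(1)] by (auto simp: lunc_def)
    then have "x \<in> D" using x inm_old[of x] by (auto simp: s4_sel D_def)
    then show "y \<in> PL gs4 \<or> y \<in> {}" using xN Nsym unfolding Z4 by blast
  qed
  have 6: "heavy_cov {} s4 gs4" unfolding heavy_cov_def
  proof (intro ballI impI)
    fix y assume y: "y \<in> V" "unc (N y) (s4 y)"
    have "y \<in> Z1 gs4"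
    proof (cases "y \<in> {u, v}")
      case False
      then have l: "heavy (\<sigma> y)" "\<not> inm (\<sigma> y)" "\<And>x. x \<in> N y \<Longrightarrow> x \<notin> mv (s4 y)"
        using y inm_old[of y] by (auto simp: unc_def s4_sel(1))
      obtain x where x: "x \<in> N0 y" "inm (\<sigma> x)" using old_rest(6)[OF y(1) l(2)] by blast
      have xN: "x \<in> N y" using x(1) False by (auto simp: N_cases)
      have "x \<in> {u, v}"
      proof (rule ccontr)
        assume nx: "x \<notin> {u, v}"
        have "x \<in> mv (s4 y)" using exact1[OF xN nx] inm_old[OF nx] x(2) l(1) by (auto simp: s4_sel(1))
        then show False using l(3) xN by blast
      qed
      then show ?thesis using Z4(2) xN Nsym by blast
    qed (use Z4 in blast)
    then show "y \<in> Z2 s4 gs4 \<or> y \<in> {}" by (simp add: Z2_def)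
  qed
  have 7: "stale s4 gs4" unfolding stale_def using exact1 Z4(1) by blast
  have 8: "degrees s4" unfolding degrees_def
  proof
    fix y assume y: "y \<in> V"
    have "2 * pd (\<sigma> y) \<le> card (N y)" if "y \<in> P" "heavy (\<sigma> y)" using that by (auto simp: P_def)
    moreover have "card (N y) \<le> 2 * pd (\<sigma> y)" if "y \<notin> P" "y \<in> {u, v}" using that by (auto simp: P_def)
    moreover have "heavy (\<sigma> y)" if "y \<notin> P" "y \<in> {u, v}" using that by (auto simp: P_def)
    ultimately show "if heavy (s4 y) then card (N y) \<le> 2 * pd (s4 y) \<and> pd (s4 y) \<le> 2 * card (N y) else card (N y) \<le> 2 * W"
      using old_rest(7,8)[OF y] DP by (cases "y \<in> P"; cases "y \<in> {u, v}") (auto simp: s4_sel s1_sel card_N)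
  qed
  have 9: "stacks s4 gs4" using uv(1) by (auto simp: stacks_def gs4_def s4_sel)
  have 10: "bounded gs4" using small_N uv by (auto simp: bounded_def gs4_def)
  have "linked gs4" using uv(1) by (simp add: gs4_def N_cases)
  then show ?thesis using hv_exact_s4 2 3 4 5 6 7 8 9 10 by (simp add: Inv_def)
qed

lemma solo4: "solo s4 v Pre" by (simp add: solo_def s4_sel)

text \<open>Nobody but the two endpoints turns heavy or leaves the set, so each of the two summands
  grows by at most two.\<close>

lemma Phi4: "Phi s4 \<le> Phi \<sigma> + 4"
proof -
  have c: "card {u, v} = 2" using uv(1) by simp
  have f: "finite {y \<in> V. Q y}" for Q using finV by simp
  have le: "card (B \<union> {u, v}) \<le> card B + 2" for B using card_Un_le[of B "{u, v}"] c by simp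
  have "card {y \<in> V. heavy (s4 y)} \<le> card ({y \<in> V. heavy (\<sigma> y)} \<union> {u, v})"
    by (rule card_mono) (use f in \<open>auto simp: s4_sel\<close>)
  moreover have "card {y \<in> V. heavy (s4 y) \<or> \<not> inm (s4 y)} \<le> card ({y \<in> V. heavy (\<sigma> y) \<or> \<not> inm (\<sigma> y)} \<union> {u, v})"
    by (rule card_mono) (use f inm_old in \<open>auto simp: s4_sel(1)\<close>)
  ultimately show ?thesis
    using le[of "{y \<in> V. heavy (\<sigma> y)}"] le[of "{y \<in> V. heavy (\<sigma> y) \<or> \<not> inm (\<sigma> y)}"] unfolding Phi_def by linarith
qed

lemma mok1: "x \<in> V \<Longrightarrow> pd (s1 x) \<le> 2 * n \<or> \<not> heavy (s1 x)"
  using Inv4 degn[of x] by (auto simp: Inv_def degrees_def s4_sel s1_sel split: if_splits)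

lemma tr1_mok: "tr1 x y = Some m \<Longrightarrow> mok t m"
proof -
  assume a: "tr1 x y = Some m"
  then have "x \<in> {u, v}" using DP by (auto simp: tr1_def A_def split: if_splits)
  then have "pd (s1 x) \<le> 2 * n" using mok1[of x] uv by (auto simp: s1_sel)
  then show ?thesis using a mok_Stat by (auto simp: tr1_def split: if_splits)
qed

lemma tr2_mok: "tr2 x y = Some m \<Longrightarrow> mok t m"
proof -
  assume a: "tr2 x y = Some m"
  then have "x \<in> V" using NV(1)[of x y] by (auto simp: tr2_def split: if_splits)
  then show ?thesis using a mok1[of x] mok_Stat by (auto simp: tr2_def own_stat_def s2_sel split: if_splits)
qed

lemma msgs1: "card {(x, y). tr1 x y \<noteq> None} \<le> (\<Sum>x\<in>{u, v}. card (A x))"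
  by (rule card_sends) (use DP in \<open>auto simp: tr1_def A_def split: if_splits\<close>)

lemma msgs2: "card {(x, y). tr2 x y \<noteq> None} \<le> (\<Sum>x\<in>{u, v}. if x \<in> D then card (N x) else 0)"
proof -
  have "card {(x, y). tr2 x y \<noteq> None} \<le> card ((\<lambda>(y, x). (x, y)) ` (SIGMA y:D. N y))"
    by (rule card_mono) (auto simp: tr2_def D_def split: if_splits)
  also have "\<dots> \<le> card (SIGMA y:D. N y)" by (rule card_image_le) (auto simp: D_def)
  also have "\<dots> = (\<Sum>x\<in>D. card (N x))" by (rule card_SigmaI) (auto simp: D_def)
  also have "\<dots> = (\<Sum>x\<in>{u, v}. if x \<in> D then card (N x) else 0)"
    by (rule sum.mono_neutral_cong_left) (auto simp: D_def)
  finally show ?thesis .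
qed

lemma round2: "rch (s1, tr1) (s2, tr2) 1 (\<Sum>x\<in>{u, v}. if x \<in> D then card (N x) else 0)"
proof (rule rch1)
  fix y
  show "step c n y (N y) (\<lambda>x. tr1 x y) (s1 y) = (s2 y, reply (\<lambda>x. tr1 x y) (absorb (\<lambda>x. tr1 x y) (s1 y)))"
    using idle_stats[of "\<lambda>x. tr1 x y", OF stats1] s1_sel(7)[of y] by (auto simp: step_def Let_def s2_def)
next
  fix x w
  have "x \<in> A w \<and> w \<in> D \<longleftrightarrow> w \<in> D \<and> x \<in> N w" using DP by (auto simp: A_def)
  then show "tr2 x w = (if w \<in> N x then reply (\<lambda>z. tr1 z x) (absorb (\<lambda>z. tr1 z x) (s1 x)) w else None)"
    using Nsym[of x w] by (auto simp: tr2_def reply_def tr1_def s2_def)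
qed (use tr2_mok msgs2 in \<open>auto intro!: exI[of _ u] simp: s1_sel\<close>)

lemma round3: "rch (s2, tr2) (s3, many u {v} Start) 1 1"
proof (rule rch1)
  fix y
  show "step c n y (N y) (\<lambda>x. tr2 x y) (s2 y) = (s3 y, if y = u then to_set {v} Start else (\<lambda>_. None))"
  proof (cases "y = u")
    case True
    have "ctl (s2 u) = InsW True v" "dem (s2 u) = (u \<in> D)" by (simp_all add: s2_def s1_sel)
    then show ?thesis using True by (simp add: step_def Let_def s3_def)
  next
    case False
    have st: "\<And>x m. tr2 x y = Some m \<Longrightarrow> \<exists>h i p r. m = Stat h i p r" using stats2 by blast
    have "ctl (s2 y) = Idle" using False by (simp add: s2_def)
    then show ?thesis using False idle_stats[of "\<lambda>x. tr2 x y", OF st] reply_stats[of "\<lambda>x. tr2 x y", OF stats2]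
      by (simp add: step_def Let_def s3_def)
  qed
next
  show "many u {v} Start x w = (if w \<in> N x then (if x = u then to_set {v} Start else (\<lambda>_. None)) w else None)" for x w
    by (auto simp: many_def to_set_def N_cases)
  show "(\<exists>y. ctl (s2 y) \<noteq> Idle) \<or> (\<exists>u w. tr2 u w \<noteq> None)" by (intro disjI1 exI[of _ u]) (simp add: s2_def)
  show "many u {v} Start x w = Some m \<Longrightarrow> mok t m" for x w m using mok_Start by (auto simp: many_def split: if_splits)
  show "card {(x, w). many u {v} Start x w \<noteq> None} \<le> 1" using card_many[of "{v}" u Start] by simp
qed

lemma round4: "rch (s3, many u {v} Start) (s4, none) 1 0"
proof -
  have st: "idle_step q v (N v) (to_set {u} Start) (s3 v) = ((s3 v)\<lparr>stk := [Hub (Some u) 0 (v \<in> D)], ctl := Pre\<rparr>, to_set {} Start)"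
    using uv(1) by (simp add: idle_Start s3_sel)
  have "rch (s3, many u {v} Start) (s4, many v {} Start) 1 (card ({} :: nat set))"
    unfolding s4_def by (rule deliver[where x = u and y = v and m = Start and A = "{}" and \<sigma> = s3, OF _ _ st]) (auto simp: quiet_def s3_sel)
  then show ?thesis by simp
qed

text \<open>A vertex turning heavy tells at most \<open>2 * W + 1\<close> neighbours and gets as
  many answers. A vertex that was heavy tells all neighbours only if its degree is twice the
  published one; up to one, its drift was then at least half of the degree, and it drops to
  zero.\<close>

lemma push_cost:
  assumes x: "x \<in> {u, v}"
  shows "card (A x) + (if x \<in> D then card (N x) else 0) + 2 * drift s4 x \<le> 2 * old.drift \<sigma> x + (4 * W + 3)"
proof -
  have h: "heavy (s4 x)" using x by (simp add: s4_sel)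
  consider "x \<in> D" | "x \<in> P" "x \<notin> D" | "x \<notin> P" using DP by blast
  then show ?thesis
  proof cases
    case 1
    then show ?thesis using DP small_N[OF 1] h by (auto simp: A_def drift_def s4_sel s1_sel)
  next
    case 2
    then have "heavy (\<sigma> x)" "2 * pd (\<sigma> x) \<le> card (N x)" using x by (auto simp: P_def D_def)
    then show ?thesis using 2 h x card_N[of x] by (auto simp: A_def drift_def old.drift_def s4_sel s1_sel)
  next
    case 3
    then have "heavy (\<sigma> x)" using x by (auto simp: P_def)
    moreover have "card ({u, v} - {x}) = 1" using x uv(1) by auto
    ultimately show ?thesis using 3 DP h x card_N[of x] W1(1) by (auto simp: A_def drift_def old.drift_def s4_sel s1_sel)
  qed
qed

lemma Psi4: "(\<Sum>x\<in>{u, v}. card (A x)) + (\<Sum>x\<in>{u, v}. if x \<in> D then card (N x) else 0) + 2 * Psi s4 \<le> 2 * old.Psi \<sigma> + (8 * W + 6)"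
proof -
  have uvV: "{u, v} \<subseteq> V" using uv by simp
  have o: "drift s4 x = old.drift \<sigma> x" if "x \<in> V - {u, v}" for x
    using that DP by (auto simp: drift_def old.drift_def s4_sel s1_sel card_N)
  have s: "Psi s4 = (\<Sum>x\<in>V - {u, v}. drift s4 x) + (\<Sum>x\<in>{u, v}. drift s4 x)"
    "old.Psi \<sigma> = (\<Sum>x\<in>V - {u, v}. old.drift \<sigma> x) + (\<Sum>x\<in>{u, v}. old.drift \<sigma> x)"
    unfolding Psi_def old.Psi_def using sum.subset_diff[OF uvV finV] by auto
  have "(\<Sum>x\<in>V - {u, v}. drift s4 x) = (\<Sum>x\<in>V - {u, v}. old.drift \<sigma> x)" using o by (rule sum.cong[OF refl])
  then show ?thesis unfolding s using push_cost[of u] push_cost[of v] uv(1) by simp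
qed

lemma insert_handled: "handled (Insert u v)"
proof -
  obtain s5 r1 m1 where a: "rb (s4, none) (s5, many v (set_option (Some u)) Ret) r1 m1"
    "Inv {} s5 [(u, Hub None 0 (u \<in> D))]" "quiet s5" "Psi s5 \<le> Psi s4"
    "r1 + Ar * Phi s5 \<le> Ar * Phi s4 + Ar" "m1 + Am * Phi s5 \<le> Am * Phi s4 + Am"
    by (rule run_hub[OF Inv4[unfolded gs4_def] solo4])
  have a1: "rb (s4, none) (s5, many v {u} Ret) r1 m1" using a(1) by simp
  define s6 where "s6 = s5(u := (s5 u)\<lparr>ctl := Pre\<rparr>)"
  note f = ret_hub[OF a(3,2), folded s6_def]
  note sm = same_sets(8,9)[OF f(4)]
  obtain s7 r2 m2 where b: "rb (s6, none) (s7, many u (set_option None) Ret) r2 m2"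
    "Inv {} s7 []" "quiet s7" "Psi s7 \<le> Psi s6"
    "r2 + Ar * Phi s7 \<le> Ar * Phi s6 + Ar" "m2 + Am * Phi s7 \<le> Am * Phi s6 + Am"
    by (rule run_hub[OF f(2,3)])
  have b1: "rb (s6, none) (s7, none) r2 m2" using b(1) by simp
  have "rb (s1, tr1) (s7, none) (1 + 1 + 1 + r1 + 1 + r2) ((\<Sum>x\<in>{u, v}. if x \<in> D then card (N x) else 0) + 1 + 0 + m1 + 0 + m2)"
    by (rule rb_trans[OF rb_trans[OF rb_trans[OF rb_trans[OF rb_trans[OF rbI[OF round2] rbI[OF round3]] rbI[OF round4]] a1] rbI[OF f(1)]] b1]) auto
  moreover have "rest s7" by (rule rest_Inv[OF b(2,3)])
  moreover have "mis.small (5 * (2 * t + 1)) (s1, tr1)" using tr1_mok length_enc_msg by (auto simp: mis.small_def)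
  moreover have "mis.msgs (s1, tr1) \<le> (\<Sum>x\<in>{u, v}. card (A x))" using msgs1 by (simp add: mis.msgs_def)
  moreover have "Ar * Phi s4 \<le> Ar * Phi \<sigma> + 4 * Ar" "Am * Phi s4 \<le> Am * Phi \<sigma> + 4 * Am"
    using mult_le_mono2[OF Phi4, of Ar] mult_le_mono2[OF Phi4, of Am] by (simp_all add: algebra_simps)
  moreover have "Psi s7 \<le> Psi s4"
    using Psi_shrinks[OF sm(2)] a(4) b(4) by simp
  moreover have "1 + 1 + 1 + r1 + 1 + r2 + Ar * Phi s7 \<le> Ar * Phi \<sigma> + (6 * Ar + 4)"
    using a(5) b(5) calculation(5) sm(1) by simp
  moreover have "(\<Sum>x\<in>{u, v}. card (A x)) + ((\<Sum>x\<in>{u, v}. if x \<in> D then card (N x) else 0) + 1 + 0 + m1 + 0 + m2) + Am * Phi s7 + 2 * Psi s7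
      \<le> Am * Phi \<sigma> + 2 * old.Psi \<sigma> + (6 * Am + 8 * W + 8)"
    using a(6) b(6)[unfolded sm(1)] calculation(6,7) Psi4 by linarith
  ultimately show ?thesis unfolding handled_def first by blast
qed

end

section \<open>Deletion of an edge\<close>

locale deletion = change c n t E V kap E0 \<sigma> for c n t E V kap E0 \<sigma> +
  fixes a b :: vertex
  assumes ab: "{a, b} \<in> E0" and EE: "E = E0 - {{a, b}}"
begin

abbreviation "N0 \<equiv> nbrs E0"

lemma ab': "a \<noteq> b" "a \<in> V" "b \<in> V"
  using old.edge[of b a] ab by (auto simp: nbrs_def)

lemma N_cases: "N y = (if y = a then N0 a - {b} else if y = b then N0 b - {a} else N0 y)"
  using ab'(1) by (auto simp: EE nbrs_def doubleton_eq_iff)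

lemma N_old: "x \<in> N y \<Longrightarrow> x \<in> N0 y" by (auto simp: N_cases split: if_splits)

lemma card_N: "card (N0 y) = card (N y) + of_bool (y \<in> {a, b})"
proof -
  have "b \<in> N0 a" "a \<in> N0 b" using ab by (auto simp: nbrs_def insert_commute)
  then have "card (N0 a) = card (N0 a - {b}) + 1" "card (N0 b) = card (N0 b - {a}) + 1"
    using card_Suc_Diff1[of "N0 a" b] card_Suc_Diff1[of "N0 b" a] by auto
  then show ?thesis by (simp add: N_cases)
qed

definition "P = {x \<in> {a, b}. heavy (\<sigma> x) \<and> 2 * card (N x) \<le> pd (\<sigma> x)}"
definition "X = {x \<in> {a, b}. unc (N x) (\<sigma> x) \<or> lunc (N x) (\<sigma> x)}"
definition "box y = (\<lambda>x. if x \<in> P \<and> y \<in> N x then Some (Stat True (inm (\<sigma> x)) (card (N x)) False) else None)"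
definition "s1 y = (\<sigma> y)\<lparr>pd := if y \<in> P then card (N y) else pd (\<sigma> y)\<rparr>"
definition "s2 y = absorb (box y) (s1 y)"

lemma box_stats: "box y x = Some m \<Longrightarrow> \<exists>h i p. m = Stat h i p False" by (auto simp: box_def split: if_splits)

lemma s2_sel: "heavy (s2 y) = heavy (\<sigma> y)" "inm (s2 y) = inm (\<sigma> y)"
  "pd (s2 y) = (if y \<in> P then card (N y) else pd (\<sigma> y))" "stk (s2 y) = []" "ctl (s2 y) = Idle"
  "hv (s2 y) x = (if x \<in> P \<and> y \<in> N x then Some (card (N x)) else hv (\<sigma> y) x)"
  "x \<in> mv (s2 y) \<longleftrightarrow> (if x \<in> P \<and> y \<in> N x then inm (\<sigma> x) else x \<in> mv (\<sigma> y))"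
proof -
  have "inm (s2 y) = (inm (\<sigma> y) \<and> \<not> (\<exists>x. x \<in> P \<and> y \<in> N x \<and> inm (\<sigma> x)))"
    by (auto simp: s2_def s1_def absorb_def box_def)
  then show "inm (s2 y) = inm (\<sigma> y)" using old_rest(5) N_old by blast
qed (auto simp: s2_def s1_def absorb_def box_def old_rest(1,2))

lemma exact:
  assumes "x \<in> N y" "heavy (\<sigma> y) \<or> \<not> heavy (\<sigma> x)"
  shows "x \<in> mv (s2 y) \<longleftrightarrow> inm (\<sigma> x)"
  using old_rest(4)[OF N_old[OF assms(1)] assms(2)] by (simp add: s2_sel)

text \<open>In the old graph \<open>x\<close> had a cover, and all its neighbours but one are still
  there; so the lost cover was the other endpoint, which is a member of the set and lacks nothing
  itself.\<close>

lemma other: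
  assumes x: "x \<in> X" and y: "{x, y} = {a, b}"
  shows "y \<notin> X" "inm (\<sigma> y)" "heavy (\<sigma> x) \<or> \<not> heavy (\<sigma> y)" "\<not> inm (\<sigma> x)"
proof -
  have xV: "x \<in> V" using x ab' by (auto simp: X_def)
  show nx: "\<not> inm (\<sigma> x)" using x by (auto simp: X_def unc_def lunc_def)
  obtain z where z: "z \<in> N0 x" "inm (\<sigma> z)" "heavy (\<sigma> x) \<or> \<not> heavy (\<sigma> z)" using old_rest(6)[OF xV nx] by blast
  have m: "z \<in> mv (\<sigma> x)" using old_rest(4)[OF z(1,3)] z(2) by simp
  have "z \<notin> N x"
  proof
    assume "z \<in> N x"
    then show False using x m z(3) old_rest(3)[OF z(1)] by (auto simp: X_def unc_def lunc_def lcov_def)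
  qed
  then have "z = y" using z(1) y by (auto simp: N_cases doubleton_eq_iff split: if_splits)
  then show "inm (\<sigma> y)" "heavy (\<sigma> x) \<or> \<not> heavy (\<sigma> y)" using z by auto
  then show "y \<notin> X" by (auto simp: X_def unc_def lunc_def)
qed

lemma X_one: "X = {} \<or> (\<exists>x\<in>{a, b}. X = {x})"
proof -
  have "a \<in> X \<Longrightarrow> b \<notin> X" using other(1)[of a b] by simp
  then show ?thesis by (auto simp: X_def)
qed

lemma InvX: "Inv X s2 []"
proof -
  have 1: "hv_exact s2" using old_rest(3)[OF N_old] Nsym by (auto simp: hv_exact_def s2_sel P_def)
  have 2: "mv_light s2" "mv_heavy s2" "stale s2 []" using exact by (auto simp: mv_light_def mv_heavy_def stale_def s2_sel(1,2))
  have 4: "indep s2" using old_rest(5)[OF N_old] by (auto simp: indep_def s2_sel(2))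
  have c: "\<exists>x\<in>N y. inm (\<sigma> x) \<and> (heavy (\<sigma> y) \<or> \<not> heavy (\<sigma> x))" if "y \<in> V" "y \<notin> {a, b}" "\<not> inm (\<sigma> y)" for y
    using old_rest(6)[OF that(1,3)] that(2) by (auto simp: N_cases)
  have lc: "lcov (N y) (s2 y) \<longleftrightarrow> (\<exists>x\<in>N y. \<not> heavy (\<sigma> x) \<and> inm (\<sigma> x))" if "y \<in> V" for y
    using lcov_eq[OF 1 2(1) that] by (simp add: s2_sel(1,2))
  have 5: "light_cov X s2 []" unfolding light_cov_def
  proof (intro ballI impI)
    fix y assume y: "y \<in> V" "lunc (N y) (s2 y)"
    show "y \<in> PL [] \<or> y \<in> X"
    proof (cases "y \<in> {a, b}")
      case True
      have "lcov (N y) (\<sigma> y) \<longrightarrow> lcov (N y) (s2 y)"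
        unfolding lc[OF y(1)] using old_rest(3,4)[OF N_old] by (force simp: lcov_def split: if_splits)
      then show ?thesis using True y by (auto simp: X_def lunc_def s2_sel)
    next
      case False
      then show ?thesis using y c[OF y(1) False] lc[OF y(1)] by (auto simp: lunc_def s2_sel(1,2))
    qed
  qed
  have 6: "heavy_cov X s2 []" unfolding heavy_cov_def
  proof (intro ballI impI)
    fix y assume y: "y \<in> V" "unc (N y) (s2 y)"
    then have n: "heavy (\<sigma> y)" "\<not> inm (\<sigma> y)" "\<And>x. x \<in> N y \<Longrightarrow> \<not> inm (\<sigma> x)"
      using exact[of _ y] by (auto simp: unc_def s2_sel(1,2))
    show "y \<in> Z2 s2 [] \<or> y \<in> X"
    proof (cases "y \<in> {a, b}")
      case True
      have "mv (\<sigma> y) \<inter> N y = {}" using n old_rest(4)[OF N_old] by blast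
      then show ?thesis using True n by (auto simp: X_def unc_def)
    next
      case False
      then show ?thesis using c[OF y(1) False n(2)] n(3) by blast
    qed
  qed
  have 8: "degrees s2" unfolding degrees_def
  proof
    fix y assume y: "y \<in> V"
    have "pd (\<sigma> y) \<le> 2 * card (N y)" if "y \<notin> P" "y \<in> {a, b}" "heavy (\<sigma> y)" using that by (auto simp: P_def)
    moreover have "heavy (\<sigma> y)" if "y \<in> P" using that by (simp add: P_def)
    ultimately show "if heavy (s2 y) then card (N y) \<le> 2 * pd (s2 y) \<and> pd (s2 y) \<le> 2 * card (N y) else card (N y) \<le> 2 * W"
      using old_rest(7,8)[OF y] unfolding card_N by (cases "y \<in> P"; cases "y \<in> {a, b}") (auto simp: s2_sel)
  qed
  have "stacks s2 []" "bounded []" "linked []" by (auto simp: stacks_def s2_sel bounded_def)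
  then show ?thesis using 1 2 4 5 6 8 by (simp add: Inv_def)
qed

text \<open>A published degree of at least twice the present one means that, up to one, the drift
  was at least the present degree, and publication resets it to zero.\<close>

lemma Psi2: "(\<Sum>x\<in>{a, b}. if x \<in> P then card (N x) else 0) + 2 * Psi s2 \<le> 2 * old.Psi \<sigma> + 4"
proof -
  have abV: "{a, b} \<subseteq> V" using ab' by simp
  have c: "(if x \<in> P then card (N x) else 0) + 2 * drift s2 x \<le> 2 * old.drift \<sigma> x + 2" if "x \<in> {a, b}" for x
    using card_N[of x] that by (cases "x \<in> P") (auto simp: drift_def old.drift_def s2_sel P_def)
  have o: "drift s2 x = old.drift \<sigma> x" if "x \<in> V - {a, b}" for x
    using that card_N[of x] by (auto simp: drift_def old.drift_def s2_sel P_def)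
  have s: "Psi s2 = (\<Sum>x\<in>V - {a, b}. drift s2 x) + (\<Sum>x\<in>{a, b}. drift s2 x)"
    "old.Psi \<sigma> = (\<Sum>x\<in>V - {a, b}. old.drift \<sigma> x) + (\<Sum>x\<in>{a, b}. old.drift \<sigma> x)"
    unfolding Psi_def old.Psi_def using sum.subset_diff[OF abV finV] by auto
  have "(\<Sum>x\<in>V - {a, b}. drift s2 x) = (\<Sum>x\<in>V - {a, b}. old.drift \<sigma> x)" using o by (rule sum.cong[OF refl])
  then show ?thesis unfolding s using c[of a] c[of b] ab'(1) by simp
qed

lemma upd_Lost:
  assumes x: "x \<in> {a, b}"
  shows "x \<in> X \<Longrightarrow> \<not> heavy (\<sigma> x) \<Longrightarrow> upd n x (N x) (Lost w) (\<sigma> x) =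
      (become None (N x) (\<sigma> x), to_set (N x) (own_stat (become None (N x) (\<sigma> x)) False))"
    "x \<in> X \<Longrightarrow> heavy (\<sigma> x) \<Longrightarrow> upd n x (N x) (Lost w) (\<sigma> x) =
      ((s1 x)\<lparr>stk := [Hub None 0 False], ctl := Wait\<rparr>, \<lambda>y. box y x)"
    "x \<notin> X \<Longrightarrow> upd n x (N x) (Lost w) (\<sigma> x) = (s1 x, \<lambda>y. box y x)"
  using x old_rest(2)[of x]
  by (auto simp: upd_def Let_def X_def P_def box_def s1_def to_set_def own_stat_def fun_eq_iff unc_def lunc_def)

lemma phi_le: "Phi s2 = Phi \<sigma>" by (simp add: Phi_def s2_sel)

lemma shape:
  assumes "\<And>x. x \<in> {a, b} \<Longrightarrow> upd n x (N x) (Lost (if x = a then b else a)) (\<sigma> x) = (f x, h x)"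
    and "\<And>x. x \<notin> {a, b} \<Longrightarrow> f x = \<sigma> x \<and> h x = (\<lambda>_. None)" and "\<And>x y. h x y \<noteq> None \<Longrightarrow> y \<in> N x"
  shows "mis.a_first n E (Delete a b) \<sigma> = (f, h)"
proof -
  have e: "x \<in> {a, b} \<Longrightarrow> event_at x (Delete a b) = Lost (if x = a then b else a)" for x by auto
  have "(if x \<in> endpoints (Delete a b) then fst (upd n x (N x) (event_at x (Delete a b)) (\<sigma> x)) else \<sigma> x) = f x" for x
    using assms(1)[of x] assms(2)[of x] e[of x] by (cases "x \<in> {a, b}") simp_all
  moreover have "(if x \<in> endpoints (Delete a b) \<and> w \<in> N x then snd (upd n x (N x) (event_at x (Delete a b)) (\<sigma> x)) w else None) = h x w" for x w
  proof (cases "x \<in> {a, b}")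
    case True
    then have "snd (upd n x (N x) (event_at x (Delete a b)) (\<sigma> x)) = h x" using assms(1)[OF True] e[OF True] by simp
    then show ?thesis using True assms(3)[of x w] by (cases "h x w") auto
  next
    case False
    then show ?thesis using assms(2)[OF False] by simp
  qed
  ultimately show ?thesis unfolding mis.a_first_def by simp
qed

lemma light_case:
  assumes X: "X = {x}" "\<not> heavy (\<sigma> x)"
  shows "handled (Delete a b)"
proof -
  have "x \<in> X" using X(1) by simp
  then have x: "x \<in> {a, b}" by (simp add: X_def)
  define y where "y = (if x = a then b else a)"
  have y: "{x, y} = {a, b}" "x \<in> {a, b}" "y \<noteq> x" using x ab'(1) by (auto simp: y_def)
  note oth = other[OF _ y(1)]
  \<comment> \<open>The lost cover of a light vertex was light as well. Hence neither endpoint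
    publishes a degree, and \<open>x\<close> is the only one to act.\<close>
  have hy: "\<not> heavy (\<sigma> y)" using oth(3)[OF \<open>x \<in> X\<close>] X(2) by simp
  have P: "P = {}" using X hy y(1) by (auto simp: P_def doubleton_eq_iff)
  have s2: "s2 = \<sigma>"
  proof
    fix z
    have "box z = (\<lambda>_. None)" using P by (simp add: box_def)
    then show "s2 z = \<sigma> z" using P by (simp add: s2_def s1_def)
  qed
  have xV: "x \<in> V" using y ab' by auto
  have lu: "lunc (N x) (\<sigma> x)" using X by (auto simp: X_def unc_def)
  have i0: "Inv {x} \<sigma> []" using InvX X s2 by simp
  have d: "card (N x) \<le> 2 * W" using old_rest(8)[OF xV X(2)] card_N[of x] by simp
  define s where "s = \<sigma>(x := become None (N x) (\<sigma> x))"
  have fst: "mis.a_first n E (Delete a b) \<sigma> = (s, many x (N x) (own_stat (s x) False))"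
  proof (rule shape)
    fix z assume z: "z \<in> {a, b}"
    have "z \<noteq> x \<Longrightarrow> (s1 z, \<lambda>y. box y z) = (\<sigma> z, \<lambda>_. None)" using P by (simp add: s1_def box_def)
    moreover have "z \<noteq> x \<Longrightarrow> z \<notin> X" using X by simp
    ultimately show "upd n z (N z) (Lost (if z = a then b else a)) (\<sigma> z) = (s z, many x (N x) (own_stat (s x) False) z)"
      using upd_Lost(1,3)[OF z] X by (cases "z = x") (auto simp: s_def many_def to_set_def fun_eq_iff)
  qed (use y in \<open>auto simp: s_def many_def split: if_splits\<close>)
  have so: "solo s x Wait" using old_rest(1) by (simp add: solo_def s_def become_def)
  have be: "tell (s(x := (s x)\<lparr>ctl := Pre\<rparr>)) x = bec \<sigma> x None" by (simp add: bec_def s_def)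
  have r1: "rch (s, many x (N x) (own_stat (s x) False)) (bec \<sigma> x None, none) 1 0"
    using tell_round[OF so xV] unfolding be .
  have i1: "Inv {} (bec \<sigma> x None) [(x, Hub None 0 False)]"
    using bec_Inv[OF i0 xV d, of None] lu by simp
  note bp = bec_Phi[OF i0 xV, of None]
  have so1: "solo (bec \<sigma> x None) x Pre" using old_rest(1) by (simp add: solo_def bec_sel)
  obtain s7 r m where h: "rb (bec \<sigma> x None, none) (s7, many x (set_option None) Ret) r m" "Inv {} s7 []" "quiet s7" "Psi s7 \<le> Psi (bec \<sigma> x None)"
    "r + Ar * Phi s7 \<le> Ar * Phi (bec \<sigma> x None) + Ar" "m + Am * Phi s7 \<le> Am * Phi (bec \<sigma> x None) + Am"
    by (rule run_hub[OF i1 so1])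
  have "rb (s, many x (N x) (own_stat (s x) False)) (s7, none) (1 + r) (0 + m)"
    by (rule rb_trans[OF rbI[OF r1]]) (use h(1) in auto)
  moreover have "rest s7" by (rule rest_Inv[OF h(2,3)])
  moreover have "mis.small (5 * (2 * t + 1)) (s, many x (N x) (own_stat (s x) False))"
  proof -
    have "mok t (own_stat (s x) False)" by (simp add: own_stat_def s_def become_def mok_Stat)
    then show ?thesis using length_enc_msg by (auto simp: mis.small_def many_def split: if_splits)
  qed
  moreover have "mis.msgs (s, many x (N x) (own_stat (s x) False)) \<le> 2 * W"
    using card_many[of "N x" x] d order_trans by (fastforce simp: mis.msgs_def)
  moreover have "Phi (bec \<sigma> x None) \<le> Phi \<sigma>" "shrinks \<sigma> (bec \<sigma> x None)" using bp lu by auto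
  note ph = this
  have "Ar * Phi (bec \<sigma> x None) \<le> Ar * Phi \<sigma>" "Am * Phi (bec \<sigma> x None) \<le> Am * Phi \<sigma>"
    using mult_le_mono2[OF ph(1)] by auto
  note ps = this
  moreover have "1 + r + Ar * Phi s7 \<le> Ar * Phi \<sigma> + (6 * Ar + 4)" using h(5) ps by linarith
  moreover have "2 * W + (0 + m) + Am * Phi s7 + 2 * Psi s7 \<le> Am * Phi \<sigma> + 2 * old.Psi \<sigma> + (6 * Am + 8 * W + 8)"
    using h(4,6) ps Psi2 Psi_shrinks[OF ph(2)] unfolding s2 by linarith
  ultimately show ?thesis unfolding handled_def fst by blast
qed

lemma heavy_case:
  assumes X: "\<And>x. x \<in> X \<Longrightarrow> heavy (\<sigma> x)"
  shows "handled (Delete a b)"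
proof -
  define f1 where "f1 y = (if y \<in> X then (s1 y)\<lparr>stk := [Hub None 0 False], ctl := Wait\<rparr> else s1 y)" for y
  define f2 where "f2 y = (if y \<in> X then (s2 y)\<lparr>stk := [Hub None 0 False], ctl := Pre\<rparr> else s2 y)" for y
  define tr where "tr x y = box y x" for x y
  have Pn: "x \<notin> {a, b} \<Longrightarrow> s1 x = \<sigma> x \<and> tr x = (\<lambda>_. None)" for x
    by (auto simp: s1_def tr_def box_def P_def fun_eq_iff)
  have fst: "mis.a_first n E (Delete a b) \<sigma> = (f1, tr)"
  proof (rule shape)
    fix z assume z: "z \<in> {a, b}"
    show "upd n z (N z) (Lost (if z = a then b else a)) (\<sigma> z) = (f1 z, tr z)"
      using upd_Lost(2,3)[OF z] X by (cases "z \<in> X") (auto simp: f1_def tr_def)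
  qed (use Pn in \<open>auto simp: f1_def tr_def box_def X_def split: if_splits\<close>)
  have mo: "tr x y = Some m \<Longrightarrow> mok t m" for x y m
    using degn[of x] by (auto simp: tr_def box_def split: if_splits intro!: mok_Stat)
  have k: "card {(x, y). tr x y \<noteq> None} \<le> (\<Sum>x\<in>{a, b}. card (if x \<in> P then N x else {}))"
    by (rule card_sends) (auto simp: tr_def box_def P_def split: if_splits)
  have kk: "(\<Sum>x\<in>{a, b}. card (if x \<in> P then N x else {})) = (\<Sum>x\<in>{a, b}. if x \<in> P then card (N x) else 0)"
    by (rule sum.cong) auto
  have r1: "rb (f1, tr) (f2, none) 1 0"
  \<comment> \<open>If nothing is awake or in transit, the recovery is already over; a further round
    may be counted only in a live configuration.\<close>
  proof (cases "(\<exists>v. ctl (f1 v) \<noteq> Idle) \<or> (\<exists>u w. tr u w \<noteq> None)")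
    case True
    have "rch (f1, tr) (f2, none) 1 0"
    proof (rule rch1[where ob = "\<lambda>_ _. None"])
      fix y
      have st: "\<And>x m. box y x = Some m \<Longrightarrow> \<exists>h i p r. m = Stat h i p r" using box_stats by blast
      have ctl: "ctl (f1 y) = (if y \<in> X then Wait else Idle)" by (simp add: f1_def s1_def old_rest(1))
      have ab: "absorb (box y) (s\<lparr>stk := z\<rparr>) = (absorb (box y) s)\<lparr>stk := z\<rparr>" for s z by (simp add: absorb_def)
      show "step c n y (N y) (\<lambda>x. tr x y) (f1 y) = (f2 y, \<lambda>_. None)"
        using ctl idle_stats[of "box y", OF st] reply_stats[of "box y", OF box_stats]
        by (cases "y \<in> X") (simp_all add: step_def Let_def tr_def f1_def f2_def s2_def ab)
    qed (use True in \<open>auto simp: none_def\<close>)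
    then show ?thesis by (rule rbI) auto
  next
    case False
    have b: "box y = (\<lambda>_. None)" for y using False by (auto simp: tr_def fun_eq_iff)
    have "y \<notin> X" for y using False by (auto simp: f1_def split: if_splits)
    then have "f2 = f1" by (simp add: f1_def f2_def s2_def b fun_eq_iff)
    moreover have "tr = none" using False by (auto simp: none_def fun_eq_iff)
    ultimately show ?thesis using rch_refl by (auto simp: rb_def)
  qed
  have sm: "same s2 f2" by (auto simp: same_def f2_def)
  note sme = same_sets(8,9)[OF sm]
  have "\<exists>s7 r m. rb (f2, none) (s7, none) r m \<and> rest s7 \<and> Psi s7 \<le> Psi s2 \<and>
    r + Ar * Phi s7 \<le> Ar * Phi s2 + Ar \<and> m + Am * Phi s7 \<le> Am * Phi s2 + Am"
  proof (cases "X = {}")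
    case True
    then have "f2 = s2" by (simp add: f2_def fun_eq_iff)
    moreover have "rest s2" by (rule rest_Inv) (use InvX True in \<open>auto simp: quiet_def s2_sel\<close>)
    moreover have "rb (s2, none) (s2, none) 0 0" by (rule rbI[OF rch_refl]) auto
    ultimately show ?thesis by fastforce
  next
    case False
    then obtain x where x: "X = {x}" "x \<in> {a, b}" using X_one by blast
    have xV: "x \<in> V" using x ab' by auto
    have hx: "heavy (f2 x)" using X x by (simp add: same_sel[OF sm] s2_sel)
    let ?gs = "[(x, Hub None 0 False)]"
    have "Inv X f2 ?gs"
      by (rule same_Inv[OF sm InvX]) (use x xV in \<open>auto simp: Z1_def PL_def stacks_def bounded_def f2_def s2_sel\<close>)
    \<comment> \<open>The exception \<open>x\<close> is heavy and now lies in \<open>Z1\<close> of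
      its own frame, so the frame takes over what \<open>X\<close> allowed.\<close>
    then have "Inv {} f2 ?gs" using hx x(1) unfolding Inv_def light_cov_def heavy_cov_def
      by (auto simp: lunc_def Z2_def Z1_Hub)
    moreover have "solo f2 x Pre" using x(1) by (simp add: solo_def f2_def s2_sel)
    ultimately obtain s7 r m where h: "rb (f2, none) (s7, many x (set_option None) Ret) r m" "Inv {} s7 []" "quiet s7" "Psi s7 \<le> Psi f2"
      "r + Ar * Phi s7 \<le> Ar * Phi f2 + Ar" "m + Am * Phi s7 \<le> Am * Phi f2 + Am"
      by (rule run_hub)
    have "rest s7" by (rule rest_Inv[OF h(2,3)])
    moreover have "Psi s7 \<le> Psi s2" using h(4) Psi_shrinks[OF sme(2)] by simp
    ultimately show ?thesis using h(1,5,6) sme(1) by auto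
  qed
  then obtain s7 r m where h: "rb (f2, none) (s7, none) r m" "rest s7" "Psi s7 \<le> Psi s2"
    "r + Ar * Phi s7 \<le> Ar * Phi s2 + Ar" "m + Am * Phi s7 \<le> Am * Phi s2 + Am" by blast
  have "rb (f1, tr) (s7, none) (1 + r) (0 + m)" by (rule rb_trans[OF r1 h(1)])
  moreover have "mis.small (5 * (2 * t + 1)) (f1, tr)" using mo length_enc_msg by (auto simp: mis.small_def)
  moreover have "mis.msgs (f1, tr) \<le> (\<Sum>x\<in>{a, b}. if x \<in> P then card (N x) else 0)" using k kk by (simp add: mis.msgs_def)
  moreover have "1 + r + Ar * Phi s7 \<le> Ar * Phi \<sigma> + (6 * Ar + 4)" using h(4) phi_le by simp
  moreover have "(\<Sum>x\<in>{a, b}. if x \<in> P then card (N x) else 0) + (0 + m) + Am * Phi s7 + 2 * Psi s7 \<le> Am * Phi \<sigma> + 2 * old.Psi \<sigma> + (6 * Am + 8 * W + 8)"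
    using h(3,5) Psi2 unfolding phi_le by linarith
  ultimately show ?thesis unfolding handled_def fst using h(2) by blast
qed

lemma delete_handled: "handled (Delete a b)"
proof (cases "\<exists>x\<in>X. \<not> heavy (\<sigma> x)")
  case True
  then show ?thesis using X_one light_case by auto
next
  case False
  then show ?thesis using heavy_case by blast
qed

end

context change
begin

text \<open>The additional round compared with \<open>handled\<close> is the first one after the
  update, which precedes the run described there.\<close>

lemma handled_recovery:
  assumes h: "handled x" and ms: "mis.codes c n ms \<sigma>"
  shows "recovers (mis.alg c) n E x ms"
    "transit (config_at (mis.alg c) n E x ms i) y w = Some msg \<Longrightarrow> length msg \<le> 5 * (2 * t + 1)"
    "\<exists>\<sigma>'. mis.codes c n (memories (config_at (mis.alg c) n E x ms (last_index (mis.alg c) n E x ms))) \<sigma>' \<and> rest \<sigma>' \<and>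
      rounds (mis.alg c) n E x ms + Ar * Phi \<sigma>' \<le> Ar * Phi \<sigma> + (6 * Ar + 5) \<and>
      messages (mis.alg c) n E x ms + Am * Phi \<sigma>' + 2 * Psi \<sigma>' \<le> Am * Phi \<sigma> + 2 * old.Psi \<sigma> + (6 * Am + 8 * W + 8)"
proof -
  obtain \<sigma>' r m k where a: "mis.small (5 * (2 * t + 1)) (mis.a_first n E x \<sigma>)" "mis.msgs (mis.a_first n E x \<sigma>) \<le> k"
    "rb (mis.a_first n E x \<sigma>) (\<sigma>', none) r m" "rest \<sigma>'" "r + Ar * Phi \<sigma>' \<le> Ar * Phi \<sigma> + (6 * Ar + 4)"
    "k + m + Am * Phi \<sigma>' + 2 * Psi \<sigma>' \<le> Am * Phi \<sigma> + 2 * old.Psi \<sigma> + (6 * Am + 8 * W + 8)"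
    using h unfolding handled_def by blast
  obtain r' where r': "r' \<le> r" "rch (mis.a_first n E x \<sigma>) (\<sigma>', none) r' m" using a(3) by (auto simp: rb_def)
  have slp: "\<not> awk (\<sigma> v)" for v using old_rest(1) by (simp add: awk_def)
  have nl: "\<not> mis.live (\<sigma>', none)" using a(4) by (simp add: mis.live_def awk_def none_def rest_def)
  note rec = mis.recovery[OF ms finN slp a(1,2) r'(2) nl]
  show "recovers (mis.alg c) n E x ms" by (rule rec(1))
  show "transit (config_at (mis.alg c) n E x ms i) y w = Some msg \<Longrightarrow> length msg \<le> 5 * (2 * t + 1)" by (rule rec(5))
  show "\<exists>\<sigma>'. mis.codes c n (memories (config_at (mis.alg c) n E x ms (last_index (mis.alg c) n E x ms))) \<sigma>' \<and> rest \<sigma>' \<and>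
      rounds (mis.alg c) n E x ms + Ar * Phi \<sigma>' \<le> Ar * Phi \<sigma> + (6 * Ar + 5) \<and>
      messages (mis.alg c) n E x ms + Am * Phi \<sigma>' + 2 * Psi \<sigma>' \<le> Am * Phi \<sigma> + 2 * old.Psi \<sigma> + (6 * Am + 8 * W + 8)"
    by (rule exI[of _ \<sigma>']) (use rec(2-4) a(4-6) r'(1) in auto)
qed

end

section \<open>Edge counts and whole update sequences\<close>

lemma handshake:
  assumes V: "finite V" and E: "\<And>e. e \<in> E \<Longrightarrow> \<exists>a b. e = {a, b} \<and> a \<noteq> b \<and> a \<in> V \<and> b \<in> V"
  shows "finite E" "(\<Sum>v\<in>V. card (nbrs E v)) \<le> 2 * card E"
proof -
  have "E \<subseteq> Pow V" using E by blast
  then show fE: "finite E" using V finite_subset by blast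
  have e2: "card e = 2" if "e \<in> E" for e using E[OF that] by auto
  have fN: "finite (nbrs E v)" for v
    by (rule finite_subset[OF _ V]) (use E in \<open>fastforce simp: nbrs_def doubleton_eq_iff\<close>)
  have "(\<Sum>v\<in>V. card (nbrs E v)) = card (SIGMA v:V. nbrs E v)" using V fN by (simp add: card_SigmaI)
  also have "\<dots> \<le> card (SIGMA e:E. e)"
  proof (rule card_inj_on_le[of "\<lambda>(v, w). ({v, w}, v)"])
    show "inj_on (\<lambda>(v, w). ({v, w}, v)) (SIGMA v:V. nbrs E v)" by (auto simp: inj_on_def doubleton_eq_iff)
    show "(\<lambda>(v, w). ({v, w}, v)) ` (SIGMA v:V. nbrs E v) \<subseteq> (SIGMA e:E. e)" by (auto simp: nbrs_def)
    show "finite (SIGMA e:E. e)"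
    proof (rule finite_SigmaI[OF fE])
      show "finite e" if "e \<in> E" for e using e2[OF that] card.infinite by fastforce
    qed
  qed
  also have "card (SIGMA e:E. e) = (\<Sum>e\<in>E. card e)" by (rule card_SigmaI) (use fE e2 card.infinite in \<open>fastforce+\<close>)
  also have "\<dots> = 2 * card E" using e2 by simp
  finally show "(\<Sum>v\<in>V. card (nbrs E v)) \<le> 2 * card E" .
qed

lemma graph_edges:
  assumes "valid_updates V us" "i \<le> length us" "e \<in> graph_after us i"
  shows "\<exists>a b. e = {a, b} \<and> a \<noteq> b \<and> a \<in> V \<and> b \<in> V"
  using assms(2,3)
proof (induction i)
  case 0
  then show ?case by (simp add: graph_after_def)
next
  case (Suc i)
  have g: "graph_after us (Suc i) = apply_update (us ! i) (graph_after us i)"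
    using Suc.prems(1) by (simp add: graph_after_def take_Suc_conv_app_nth)
  have v: "valid_update V (graph_after us i) (us ! i)" using assms(1) Suc.prems(1) by (simp add: valid_updates_def)
  show ?case
  proof (cases "e \<in> graph_after us i")
    case True
    then show ?thesis using Suc by simp
  next
    case False
    then show ?thesis using Suc.prems(2) v unfolding g by (cases "us ! i") auto
  qed
qed

lemma graph_Suc: "i < length us \<Longrightarrow> graph_after us (Suc i) = apply_update (us ! i) (graph_after us i)"
  by (simp add: graph_after_def take_Suc_conv_app_nth)

locale history =
  fixes c n :: nat and V :: "vertex set" and us :: "edge_update list"
  assumes finV: "finite V" and cardV: "card V = n" and idsV: "V \<subseteq> {..<n ^ c}" and val: "valid_updates V us"
    and ne: "us \<noteq> []"
begin

abbreviation "G \<equiv> graph_after us"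
definition "lgn = (LEAST k. n \<le> 2 ^ k)"
text \<open>A level is raised only if \<open>2 ^ K\<close> vertices have degree about \<open>4 ^ K\<close>, hence \<open>8 ^ K\<close> is at most of the
  order of the number of edges; this is where the exponent \<open>2 / 3\<close> of \<open>4 ^ kap\<close> comes from.\<close>

definition "kap = (LEAST k. 4 * max_edges us < 8 ^ k)"
text \<open>Large enough for \<open>4 * n ^ 4 * 2 ^ (2 * q)\<close>, which is at most two to the
  power \<open>14 + (2 * c + 8) * lgn\<close>.\<close>

definition "t = 15 + (2 * c + 8) * lgn"

lemma card_G: "i \<le> length us \<Longrightarrow> card (G i) \<le> max_edges us"
  unfolding max_edges_def by (rule Max_ge) auto

lemma edges_G: "i \<le> length us \<Longrightarrow> e \<in> G i \<Longrightarrow> \<exists>a b. e = {a, b} \<and> a \<noteq> b \<and> a \<in> V \<and> b \<in> V"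
  using graph_edges[OF val] .

lemma first_insert: "\<exists>u v. G 1 = {{u, v}} \<and> u \<noteq> v \<and> u \<in> V \<and> v \<in> V"
proof -
  have "valid_update V (G 0) (us ! 0)" "0 < length us" using val ne by (auto simp: valid_updates_def)
  moreover have "G 0 = {}" by (simp add: graph_after_def)
  ultimately show ?thesis using graph_Suc[of 0 us] by (cases "us ! 0") auto
qed

lemma n2: "2 \<le> n"
proof -
  obtain u v where "u \<noteq> v" "u \<in> V" "v \<in> V" using first_insert by blast
  then have "card {u, v} = 2" by simp
  moreover have "card {u, v} \<le> card V" by (rule card_mono[OF finV]) (use \<open>u \<in> V\<close> \<open>v \<in> V\<close> in simp)
  ultimately show ?thesis using cardV by simp
qed

lemma max1: "1 \<le> max_edges us"
proof -
  have "card (G 1) = 1" using first_insert by auto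
  then show ?thesis using card_G[of 1] ne by (cases us) auto
qed

lemma max_n: "max_edges us \<le> n * n"
proof -
  have "card (G i) \<le> n * n" if i: "i \<le> length us" for i
  proof -
    have "card (G i) \<le> card ((\<lambda>(a, b). {a, b}) ` (V \<times> V))"
    proof (rule card_mono)
      show "G i \<subseteq> (\<lambda>(a, b). {a, b}) ` (V \<times> V)"
      proof
        fix e assume "e \<in> G i"
        then obtain a b where "e = {a, b}" "a \<in> V" "b \<in> V" using edges_G[OF i] by blast
        then show "e \<in> (\<lambda>(a, b). {a, b}) ` (V \<times> V)" by (intro image_eqI[of _ _ "(a, b)"]) auto
      qed
    qed (use finV in simp)
    also have "\<dots> \<le> card (V \<times> V)" by (rule card_image_le) (use finV in auto)
    also have "\<dots> = n * n" using cardV by (simp add: card_cartesian_product)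
    finally show ?thesis .
  qed
  then show ?thesis unfolding max_edges_def by simp
qed

lemma lgn: "n \<le> 2 ^ lgn" "1 \<le> lgn" "2 ^ (lgn - 1) < n"
proof -
  have "n \<le> 2 ^ n" using less_exp[of n] by simp
  then show a: "n \<le> 2 ^ lgn" unfolding lgn_def by (rule LeastI)
  show b: "1 \<le> lgn" using a n2 by (cases lgn) auto
  have "\<not> n \<le> 2 ^ (lgn - 1)" using not_less_Least[of "lgn - 1" "\<lambda>k. n \<le> 2 ^ k"] b by (simp add: lgn_def)
  then show "2 ^ (lgn - 1) < n" by simp
qed

lemma kap: "4 * max_edges us < 8 ^ kap" "1 \<le> kap" "8 ^ (kap - 1) \<le> 4 * max_edges us" "kap \<le> 5 * lgn"
proof -
  have "k < 8 ^ k" for k :: nat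
  proof -
    have "(2::nat) ^ k \<le> 8 ^ k" by (rule power_mono) auto
    then show ?thesis using less_exp[of k] by linarith
  qed
  then show a: "4 * max_edges us < 8 ^ kap" unfolding kap_def by (rule LeastI)
  show b: "1 \<le> kap" using a max1 by (cases kap) auto
  have "\<not> 4 * max_edges us < 8 ^ (kap - 1)"
    using not_less_Least[of "kap - 1" "\<lambda>k. 4 * max_edges us < 8 ^ k"] b by (simp add: kap_def)
  then show d: "8 ^ (kap - 1) \<le> 4 * max_edges us" by simp
  \<comment> \<open>A crude estimate suffices: four times the number of edges is at most
    \<open>n ^ 4\<close>, which makes the number of levels logarithmic.\<close>
  have "2 * 2 \<le> n * n" by (rule mult_mono) (use n2 in auto)
  then have "4 * max_edges us \<le> (n * n) * (n * n)" using max_n by (intro mult_mono) auto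
  also have "\<dots> \<le> (2 ^ lgn * 2 ^ lgn) * (2 ^ lgn * 2 ^ lgn)" by (intro mult_mono) (use lgn in auto)
  also have "\<dots> = 2 ^ (4 * lgn)" by (simp add: power_add[symmetric])
  finally have "8 ^ (kap - 1) \<le> (2::nat) ^ (4 * lgn)" using d by linarith
  moreover have "(2::nat) ^ (kap - 1) \<le> 8 ^ (kap - 1)" by (rule power_mono) auto
  ultimately have "(2::nat) ^ (kap - 1) \<le> 2 ^ (4 * lgn)" by linarith
  then have "kap - 1 \<le> 4 * lgn" by (rule power_le_imp_le_exp[rotated]) simp
  then show "kap \<le> 5 * lgn" using lgn(2) by linarith
qed

lemma qb: "qbits c n = (c + 2) * lgn + 6" by (simp add: qbits_def lgn_def)

lemma arena_G:
  assumes i: "i \<le> length us"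
  shows "arena c n t (G i) V kap"
proof
  have hs: "(\<Sum>v\<in>V. card (nbrs (G i) v)) \<le> 2 * card (G i)" by (rule handshake(2)[OF finV edges_G[OF i]])
  show "finite V" by (rule finV)
  show "w \<in> nbrs (G i) u \<Longrightarrow> u \<in> V \<and> w \<in> V \<and> u \<noteq> w" for u w
    using edges_G[OF i, of "{u, w}"] by (auto simp: nbrs_def doubleton_eq_iff)
  show "card V = n" by (rule cardV)
  show "v \<in> V \<Longrightarrow> v < n ^ c" for v using idsV by auto
  show "K < kap" if H: "H \<subseteq> V" "2 ^ K \<le> card H" "\<And>v. v \<in> H \<Longrightarrow> 4 ^ K < 2 * card (nbrs (G i) v)" for H K
  proof -
    have fH: "finite H" by (rule finite_subset[OF H(1) finV])
    have "(8::nat) ^ K = 2 ^ K * 4 ^ K" by (simp add: power_mult_distrib[symmetric])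
    also have "\<dots> \<le> card H * 4 ^ K" using H(2) by (rule mult_right_mono) simp
    also have "\<dots> \<le> (\<Sum>v\<in>H. 2 * card (nbrs (G i) v))"
      using sum_bounded_below[of H "4 ^ K" "\<lambda>v. 2 * card (nbrs (G i) v)"] H(3) less_imp_le by auto
    also have "\<dots> \<le> (\<Sum>v\<in>V. 2 * card (nbrs (G i) v))" by (rule sum_mono2[OF finV H(1)]) simp
    also have "\<dots> = 2 * (\<Sum>v\<in>V. card (nbrs (G i) v))" by (simp add: sum_distrib_left)
    also have "\<dots> \<le> 4 * max_edges us" using hs card_G[OF i] by linarith
    also have "\<dots> < 8 ^ kap" by (rule kap(1))
    finally show ?thesis by (rule power_less_imp_less_exp[rotated]) simp
  qed
  have "n ^ 4 \<le> (2 ^ lgn) ^ 4" by (rule power_mono) (use lgn in auto)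
  then have "4 * n ^ 4 * 2 ^ (2 * qbits c n) \<le> 4 * (2 ^ lgn) ^ 4 * 2 ^ (2 * qbits c n)" by (intro mult_right_mono mult_left_mono) auto
  also have "\<dots> = 2 ^ (2 + lgn * 4 + 2 * qbits c n)" by (simp add: power_add power_mult)
  also have "\<dots> < 2 ^ t" by (rule power_strict_increasing) (simp_all add: t_def qb algebra_simps)
  finally show "4 * n ^ 4 * 2 ^ (2 * qbits c n) < 2 ^ t" .
  have "kap < 2 ^ kap" by (rule less_exp)
  also have "(2::nat) ^ kap \<le> 2 ^ t" by (rule power_increasing) (use kap(4) in \<open>simp_all add: t_def algebra_simps\<close>)
  finally show "kap < 2 ^ t" .
  show "3 \<le> t" by (simp add: t_def)
qed

abbreviation "A \<equiv> mis.alg c"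
abbreviation "ms \<equiv> memories_after A n us"
abbreviation "cr \<equiv> 6 * arena.Ar c n kap + 5"
abbreviation "cm \<equiv> 6 * arena.Am c n kap + 8 * proto.W kap + 8"

lemma step_G:
  assumes i: "i < length us" and ms: "mis.codes c n (ms i) \<sigma>" and r: "proto.rest (G i) V kap \<sigma>"
  shows "recovers A n (G (Suc i)) (us ! i) (ms i)"
    "transit (config_at A n (G (Suc i)) (us ! i) (ms i) k) y w = Some msg \<Longrightarrow> length msg \<le> 5 * (2 * t + 1)"
    "\<exists>\<sigma>'. mis.codes c n (ms (Suc i)) \<sigma>' \<and> proto.rest (G (Suc i)) V kap \<sigma>' \<and>
      rounds A n (G (Suc i)) (us ! i) (ms i) + arena.Ar c n kap * proto.Phi V \<sigma>' \<le> arena.Ar c n kap * proto.Phi V \<sigma> + cr \<and>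
      messages A n (G (Suc i)) (us ! i) (ms i) + arena.Am c n kap * proto.Phi V \<sigma>' + 2 * proto.Psi (G (Suc i)) V \<sigma>'
        \<le> arena.Am c n kap * proto.Phi V \<sigma> + 2 * proto.Psi (G i) V \<sigma> + cm"
proof -
  interpret old: arena c n t "G i" V kap by (rule arena_G) (use i in simp)
  interpret new: arena c n t "G (Suc i)" V kap by (rule arena_G) (use i in simp)
  interpret ch: change c n t "G (Suc i)" V kap "G i" \<sigma> by unfold_locales (rule r)
  have v: "valid_update V (G i) (us ! i)" using val i by (simp add: valid_updates_def)
  note g = graph_Suc[OF i]
  have h: "ch.handled (us ! i)"
  proof (cases "us ! i")
    case (Insert a b)
    define u w where "u = min a b" and "w = max a b"
    have ab: "a \<noteq> b" "a \<in> V" "b \<in> V" "{a, b} \<notin> G i" using v Insert by auto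
    have uw: "{u, w} = {a, b}" by (auto simp: u_def w_def min_def max_def)
    interpret ins: insertion c n t "G (Suc i)" V kap "G i" \<sigma> u w
    proof
      show "u < w" using ab by (auto simp: u_def w_def)
      show "u \<in> V" "w \<in> V" using ab by (auto simp: u_def w_def min_def max_def)
      show "{u, w} \<notin> G i" "G (Suc i) = insert {u, w} (G i)" using ab g Insert uw by auto
    qed
    \<comment> \<open>Both ways of writing the inserted edge lead to the same first round, so the
      endpoints may be taken in increasing order.\<close>
    have "mis.a_first n (G (Suc i)) (Insert a b) \<sigma> = mis.a_first n (G (Suc i)) (Insert u w) \<sigma>"
    proof (cases "a < b")
      case False
      then have "u = b" "w = a" by (simp_all add: u_def w_def)
      then show ?thesis using ab(1) by (auto simp: mis.a_first_def fun_eq_iff)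
    qed (simp add: u_def w_def)
    then show ?thesis using ins.insert_handled Insert by (simp add: ch.handled_def)
  next
    case (Delete a b)
    interpret del: deletion c n t "G (Suc i)" V kap "G i" \<sigma> a b
      by unfold_locales (use v g Delete in auto)
    show ?thesis using del.delete_handled Delete by simp
  qed
  note hr = ch.handled_recovery[OF h ms]
  show "recovers A n (G (Suc i)) (us ! i) (ms i)" by (rule hr(1))
  show "transit (config_at A n (G (Suc i)) (us ! i) (ms i) k) y w = Some msg \<Longrightarrow> length msg \<le> 5 * (2 * t + 1)" by (rule hr(2))
  show "\<exists>\<sigma>'. mis.codes c n (ms (Suc i)) \<sigma>' \<and> proto.rest (G (Suc i)) V kap \<sigma>' \<and>
      rounds A n (G (Suc i)) (us ! i) (ms i) + arena.Ar c n kap * proto.Phi V \<sigma>' \<le> arena.Ar c n kap * proto.Phi V \<sigma> + cr \<and>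
      messages A n (G (Suc i)) (us ! i) (ms i) + arena.Am c n kap * proto.Phi V \<sigma>' + 2 * proto.Psi (G (Suc i)) V \<sigma>'
        \<le> arena.Am c n kap * proto.Phi V \<sigma> + 2 * proto.Psi (G i) V \<sigma> + cm"
    using hr(3) by (simp add: Let_def)
qed

text \<open>Both potentials vanish in the initial state, so adding up the amortised costs
  telescopes.\<close>

lemma history_state:
  "i \<le> length us \<Longrightarrow> \<exists>\<sigma>. mis.codes c n (ms i) \<sigma> \<and> proto.rest (G i) V kap \<sigma> \<and>
    (\<Sum>j<i. rounds A n (G (Suc j)) (us ! j) (ms j)) + arena.Ar c n kap * proto.Phi V \<sigma> \<le> i * cr \<and>
    (\<Sum>j<i. messages A n (G (Suc j)) (us ! j) (ms j)) + arena.Am c n kap * proto.Phi V \<sigma> + 2 * proto.Psi (G i) V \<sigma> \<le> i * cm"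
proof (induction i)
  case 0
  interpret arena c n t "G 0" V kap by (rule arena_G) simp
  have "nbrs (G 0) v = {}" for v by (simp add: graph_after_def nbrs_def)
  then have "rest (\<lambda>_. ini)" by (simp add: rest_def hv_exact_def indep_def degrees_def ini_def)
  moreover have "Phi (\<lambda>_. ini) = 0" "Psi (\<lambda>_. ini) = 0" by (simp_all add: Phi_def Psi_def drift_def ini_def)
  ultimately show ?case using mis.codes_start by (intro exI[of _ "\<lambda>_. ini"]) simp
next
  case (Suc i)
  obtain \<sigma> where s: "mis.codes c n (ms i) \<sigma>" "proto.rest (G i) V kap \<sigma>"
    "(\<Sum>j<i. rounds A n (G (Suc j)) (us ! j) (ms j)) + arena.Ar c n kap * proto.Phi V \<sigma> \<le> i * cr"
    "(\<Sum>j<i. messages A n (G (Suc j)) (us ! j) (ms j)) + arena.Am c n kap * proto.Phi V \<sigma> + 2 * proto.Psi (G i) V \<sigma> \<le> i * cm"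
    using Suc by auto
  have i: "i < length us" using Suc.prems by simp
  obtain \<sigma>' where s': "mis.codes c n (ms (Suc i)) \<sigma>'" "proto.rest (G (Suc i)) V kap \<sigma>'"
    "rounds A n (G (Suc i)) (us ! i) (ms i) + arena.Ar c n kap * proto.Phi V \<sigma>' \<le> arena.Ar c n kap * proto.Phi V \<sigma> + cr"
    "messages A n (G (Suc i)) (us ! i) (ms i) + arena.Am c n kap * proto.Phi V \<sigma>' + 2 * proto.Psi (G (Suc i)) V \<sigma>'
        \<le> arena.Am c n kap * proto.Phi V \<sigma> + 2 * proto.Psi (G i) V \<sigma> + cm"
    using step_G(3)[OF i s(1,2)] by blast
  have m: "Suc i * x = i * x + x" for x by simp
  have S: "(\<Sum>j<Suc i. f j) = (\<Sum>j<i. f j) + f i" for f :: "nat \<Rightarrow> nat" by simp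
  show ?case
    by (intro exI[of _ \<sigma>'] conjI s'(1,2); unfold S m) (use s(3,4) s'(3,4) in linarith)+
qed

lemma maintains: "maintains_MIS A n V us"
  unfolding maintains_MIS_def
proof (intro conjI allI impI)
  show "recovers A n (G (Suc i)) (us ! i) (ms i)" if "i < length us" for i
    using history_state[of i] step_G(1)[OF that] that by auto
  show "is_MIS V (G i) {v \<in> V. in_MIS A (ms i v)}" if i: "i \<le> length us" for i
  proof -
    interpret arena c n t "G i" V kap by (rule arena_G[OF i])
    obtain \<sigma> where s: "mis.codes c n (ms i) \<sigma>" "rest \<sigma>" using history_state[OF i] by blast
    have "in_MIS A (ms i v) = inm (\<sigma> v)" for v using s(1) by (simp add: mis.codes_def mis.alg_def)
    then show ?thesis using rest_MIS[OF s(2)] by simp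
  qed
qed

lemma message_length:
  assumes i: "i < length us" and m: "transit (config_at A n (G (Suc i)) (us ! i) (ms i) k) y w = Some msg"
  shows "length msg \<le> (235 + 20 * c) * lgn"
proof -
  have "length msg \<le> 5 * (2 * t + 1)" using history_state[of i] step_G(2)[OF i _ _ m] i by auto
  also have "\<dots> = 155 + (80 + 20 * c) * lgn" by (simp add: t_def algebra_simps)
  also have "\<dots> \<le> 155 * lgn + (80 + 20 * c) * lgn" using lgn(2) by simp
  finally show ?thesis by (simp add: algebra_simps)
qed

abbreviation "Cr \<equiv> 6 * (190 * (141 + 14 * c) + 64) + 5"
abbreviation "Cm \<equiv> 6 * (2280 * (20 + 2 * c) + 98) + 16"

text \<open>Since \<open>lgn\<close> is at least one, additive constants can be absorbed into the
  coefficients of \<open>lgn\<close>; one factor comes from the number of Luby phases, the other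
  from the bits of the seed.\<close>

lemma cr_bound: "cr \<le> Cr * (lgn * lgn)" and cm_bound: "cm \<le> Cm * (proto.W kap * (lgn * lgn))"
proof -
  interpret arena c n t "G 0" V kap by (rule arena_G) simp
  define s where "s = lgn * lgn"
  have l: "lg = lgn" by (simp add: lg_def lgn_def)
  have s: "lgn \<le> s" "1 \<le> s" using lgn(2) by (auto simp: s_def)
  have k: "kap \<le> 5 * lgn" by (rule kap(4))
  have j: "jm \<le> 190 * lgn" using lgn(2) by (simp add: jm_def l)
  have r: "lr \<le> (141 + 14 * c) * lgn" using lgn(2) by (simp add: lr_def qb algebra_simps)
  have "jm * lr \<le> (190 * lgn) * ((141 + 14 * c) * lgn)" by (rule mult_mono[OF j r]) auto
  also have "\<dots> = 190 * (141 + 14 * c) * s" by (simp add: algebra_simps s_def)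
  finally have jr: "jm * lr \<le> 190 * (141 + 14 * c) * s" .
  define X where "X = 190 * (141 + 14 * c) * s"
  have "6 * (8 * kap + (Y + 1) + 23) + 5 \<le> 6 * X + 389 * s" if "Y \<le> X" for Y
  proof -
    have "6 * (8 * kap + (Y + 1) + 23) + 5 = 48 * kap + 6 * Y + 149" by simp
    then show ?thesis using that k s by linarith
  qed
  from this[OF jr[folded X_def]] have "cr \<le> 6 * X + 389 * s" unfolding Ar_def Lr_def .
  also have "\<dots> = Cr * s" by (simp add: X_def algebra_simps)
  finally show "cr \<le> Cr * (lgn * lgn)" unfolding s_def .
  have q4: "4 + 2 * q \<le> (20 + 2 * c) * lgn" using lgn(2) by (simp add: qb algebra_simps)
  have "jm * lm \<le> (190 * lgn) * (12 * W * ((20 + 2 * c) * lgn))"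
    unfolding lm_def by (rule mult_mono[OF j mult_left_mono[OF q4]]) auto
  also have "\<dots> = 2280 * (20 + 2 * c) * (W * s)" by (simp add: algebra_simps s_def)
  finally have jl: "jm * lm \<le> 2280 * (20 + 2 * c) * (W * s)" .
  have w: "W \<le> W * s" using mult_le_mono2[OF s(2), of W] by simp
  have "(12 * W + 1) * (kap + 2) \<le> (13 * W) * (7 * lgn)" by (rule mult_mono) (use W1(1) k lgn(2) in auto)
  also have "\<dots> = 91 * (W * lgn)" by simp
  also have "W * lgn \<le> W * s" by (rule mult_le_mono2[OF s(1)])
  finally have wk: "(12 * W + 1) * (kap + 2) \<le> 91 * (W * s)" by simp
  define Y where "Y = 2280 * (20 + 2 * c) * (W * s)"
  have "6 * (a + (b + 1) + 2 * W + 4) + 8 * W + 8 \<le> 6 * Y + 604 * (W * s)" if "a \<le> 91 * (W * s)" "b \<le> Y" for a b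
  proof -
    have "6 * (a + (b + 1) + 2 * W + 4) + 8 * W + 8 = 6 * a + 6 * b + 20 * W + 38" by simp
    then show ?thesis using that w W1(1) by linarith
  qed
  from this[OF wk jl[folded Y_def]] have "cm \<le> 6 * Y + 604 * (W * s)" unfolding Am_def Lm_def .
  also have "\<dots> = Cm * (W * s)" by (simp add: Y_def algebra_simps)
  finally show "cm \<le> Cm * (W * (lgn * lgn))" unfolding s_def .
qed

text \<open>Rounding the logarithm up adds less than one, and the logarithm is at least one because
  an update involves two vertices.\<close>

lemma log_lgn: "real lgn \<le> 2 * log 2 (real n)" "1 \<le> log 2 (real n)"
proof -
  show l: "1 \<le> log 2 (real n)" using n2 by (simp add: le_log_iff)
  have "real (lgn - 1) \<le> log 2 (real n)"
    using lgn(3) n2 by (subst le_log_iff) (auto simp: powr_realpow simp flip: of_nat_power)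
  then show "real lgn \<le> 2 * log 2 (real n)" using l lgn(2) by linarith
qed

text \<open>By minimality of \<open>kap\<close>, \<open>8 ^ (kap - 1)\<close> is at most four times
  the number of edges, and the power \<open>2 / 3\<close> turns eights into fours. The constant is
  four for the last level times four as a bound for \<open>4 powr (2 / 3)\<close>.\<close>

lemma W_bound: "real (proto.W kap) \<le> 16 * real (max_edges us) powr (2 / 3)"
proof -
  interpret arena c n t "G 0" V kap by (rule arena_G) simp
  have p: "(8 ^ k) powr (2 / 3) = (4::real) ^ k" for k :: nat
  proof -
    have "(8::real) ^ k = (2 ^ 3) ^ k" by simp
    also have "\<dots> = 2 ^ (3 * k)" by (simp only: power_mult)
    also have "\<dots> = 2 powr real (3 * k)" by (simp only: powr_realpow zero_less_numeral)
    finally have "(8 ^ k) powr (2 / 3) = (2::real) powr (real (3 * k) * (2 / 3))" by (simp add: powr_powr)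
    also have "real (3 * k) * (2 / 3) = real (2 * k)" by simp
    also have "(2::real) powr real (2 * k) = 2 ^ (2 * k)" by (simp only: powr_realpow zero_less_numeral)
    also have "\<dots> = 4 ^ k" by (simp add: power_mult)
    finally show ?thesis .
  qed
  have "(8::real) ^ (kap - 1) \<le> 4 * real (max_edges us)" 
  proof -
    have "real (8 ^ (kap - 1)) \<le> real (4 * max_edges us)" using kap(3) by (simp only: of_nat_le_iff)
    then show ?thesis by simp
  qed
  then have "(4::real) ^ (kap - 1) \<le> (4 * real (max_edges us)) powr (2 / 3)" unfolding p[symmetric] by - (rule powr_mono2, simp_all)
  also have "\<dots> = 4 powr (2 / 3) * real (max_edges us) powr (2 / 3)" by (rule powr_mult)
  also have "\<dots> \<le> 4 powr 1 * real (max_edges us) powr (2 / 3)" by (intro mult_right_mono powr_mono) auto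
  finally have "4 * (4::real) ^ (kap - 1) \<le> 16 * real (max_edges us) powr (2 / 3)" by simp
  moreover have "real W = 4 * 4 ^ (kap - 1)" using power_minus_mult[of kap "4::real"] kap(2) by (simp add: W_def)
  ultimately show ?thesis by simp
qed

lemma lgn_sq: "real (lgn * lgn) \<le> 4 * (log 2 (real n))\<^sup>2"
proof -
  have "real lgn * real lgn \<le> (2 * log 2 (real n)) * (2 * log 2 (real n))" by (rule mult_mono) (use log_lgn in auto)
  then show ?thesis by (simp add: power2_eq_square)
qed

lemma rounds_bound: "amortized_rounds A n us \<le> real (4 * Cr) * (log 2 (real n))\<^sup>2"
proof -
  let ?r = "\<lambda>j. rounds A n (G (Suc j)) (us ! j) (ms j)"
  have "(\<Sum>j<length us. ?r j) \<le> length us * cr" using history_state[of "length us"] by auto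
  then have "real (\<Sum>j<length us. ?r j) \<le> real (length us * cr)" by (simp only: of_nat_le_iff)
  then have "amortized_rounds A n us \<le> real cr" using ne by (simp add: amortized_rounds_def field_simps)
  also have "\<dots> \<le> real (Cr * (lgn * lgn))" using cr_bound by (simp only: of_nat_le_iff)
  also have "\<dots> = real Cr * real (lgn * lgn)" by (rule of_nat_mult)
  also have "\<dots> \<le> real Cr * (4 * (log 2 (real n))\<^sup>2)" by (rule mult_left_mono[OF lgn_sq]) simp
  finally show ?thesis by (simp add: algebra_simps)
qed

lemma messages_bound:
  "amortized_messages A n us \<le> real (64 * Cm) * real (max_edges us) powr (2 / 3) * (log 2 (real n))\<^sup>2"
proof -
  let ?r = "\<lambda>j. messages A n (G (Suc j)) (us ! j) (ms j)"
  have "(\<Sum>j<length us. ?r j) \<le> length us * cm" using history_state[of "length us"] by auto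
  then have "real (\<Sum>j<length us. ?r j) \<le> real (length us * cm)" by (simp only: of_nat_le_iff)
  then have "amortized_messages A n us \<le> real cm" using ne by (simp add: amortized_messages_def field_simps)
  also have "\<dots> \<le> real (Cm * (proto.W kap * (lgn * lgn)))" using cm_bound by (simp only: of_nat_le_iff)
  also have "\<dots> = real Cm * (real (proto.W kap) * real (lgn * lgn))" by (simp only: of_nat_mult)
  also have "\<dots> \<le> real Cm * ((16 * real (max_edges us) powr (2 / 3)) * (4 * (log 2 (real n))\<^sup>2))"
    by (intro mult_left_mono mult_mono W_bound lgn_sq) auto
  finally show ?thesis by (simp add: algebra_simps)
qed

lemma size_bound: "message_size_bounded A n us (real (470 + 40 * c) * log 2 (real n))"
  unfolding message_size_bounded_def
proof (intro allI impI)
  fix i k y w msg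
  assume "i < length us" "transit (config_at A n (G (Suc i)) (us ! i) (ms i) k) y w = Some msg"
  then have "real (length msg) \<le> real ((235 + 20 * c) * lgn)" using message_length by (simp only: of_nat_le_iff)
  also have "\<dots> = real (235 + 20 * c) * real lgn" by (rule of_nat_mult)
  also have "\<dots> \<le> real (235 + 20 * c) * (2 * log 2 (real n))" by (rule mult_left_mono[OF log_lgn(1)]) simp
  finally show "real (length msg) \<le> real (470 + 40 * c) * log 2 (real n)" by (simp add: algebra_simps)
qed

end

theorem theorem4:
  fixes c :: nat
  shows "\<exists>(A :: algorithm) (B :: real) (R :: real) (M :: real).
    \<forall>(n :: nat) (V :: vertex set) (us :: edge_update list).
      finite V \<longrightarrow> card V = n \<longrightarrow> V \<subseteq> {..<n ^ c} \<longrightarrow> valid_updates V us \<longrightarrow>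
        maintains_MIS A n V us \<and>
        message_size_bounded A n us (B * log 2 (real n)) \<and>
        amortized_rounds A n us \<le> R * (log 2 (real n))\<^sup>2 \<and>
        amortized_messages A n us
          \<le> M * real (max_edges us) powr (2 / 3) * (log 2 (real n))\<^sup>2"
proof -
  let ?B = "real (470 + 40 * c)" and ?R = "real (4 * (6 * (190 * (141 + 14 * c) + 64) + 5))"
    and ?M = "real (64 * (6 * (2280 * (20 + 2 * c) + 98) + 16))"
  have "maintains_MIS (mis.alg c) n V us \<and>
        message_size_bounded (mis.alg c) n us (?B * log 2 (real n)) \<and>
        amortized_rounds (mis.alg c) n us \<le> ?R * (log 2 (real n))\<^sup>2 \<and>
        amortized_messages (mis.alg c) n us \<le> ?M * real (max_edges us) powr (2 / 3) * (log 2 (real n))\<^sup>2"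
    if a: "finite V" "card V = n" "V \<subseteq> {..<n ^ c}" "valid_updates V us" for n V us
  \<comment> \<open>Without updates there may be fewer than two vertices, and the estimates of
    \<open>history\<close> do not apply. Then the averages are zero, and it only matters that the
    initial set is maximal independent in the empty graph.\<close>
  proof (cases "us = []")
    case True
    have "inm ini" by (simp add: ini_def)
    then have "in_MIS (mis.alg c) (start_memory (mis.alg c) n v)" for v
      using mis.codes_start[of c n] by (simp add: mis.codes_def mis.alg_def)
    then have "is_MIS V {} {v \<in> V. in_MIS (mis.alg c) (start_memory (mis.alg c) n v)}"
      by (auto simp: is_MIS_def independent_def)
    then show ?thesis
      using True by (simp add: maintains_MIS_def message_size_bounded_def amortized_rounds_def amortized_messages_def graph_after_def)
  next
    case False
    interpret history c n V us by unfold_locales (use a False in auto)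
    show ?thesis using maintains size_bound rounds_bound messages_bound by blast
  qed
  then show ?thesis by blast
qed

end
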